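(* Let $\mathcal{C}$ be a non-unital topological category. If $\mathcal{C}$ has weak left units and is right fibrant, then $\mathcal{C}$ has soft left units. Dually, if $\mathcal{C}$ has weak right units and is left fibrant, then $\mathcal{C}$ has soft right units.
   Context: All spaces are compactly generated (no Hausdorff condition). "Fibration" means Serre fibration. A non-unital topological category $\mathcal{C}$ consists of spaces $\mathcal{C}_0$ (objects), $\mathcal{C}_1$ (morphisms), continuous source and target maps $s=d_1,\ t=d_0:\mathcal{C}_1\to\mathcal{C}_0$ and a continuous associative composition $(f,g)\mapsto g\circ f$ defined on $\mathcal{C}_1\times_{\mathcal{C}_0}\mathcal{C}_1=\{(f,g): t(f)=s(g)\}$ with $s(g\circ f)=s(f)$, $t(g\circ f)=t(g)$; identities are not required. Its nerve $N_\bullet\mathcal{C}$ is the semi-simplicial space whose $p$-simplices are composable sequences $c_0\to\cdots\to c_p$ (topologised as an iterated fibre product of copies of $\mathcal{C}_1$ over $\mathcal{C}_0$), with $d_i$ forgetting $c_i$; $B\mathcal{C}=\|N_\bullet\mathcal{C}\|$ where $\|X_\bullet\| = (\coprod_p X_p\times\Delta^p)/((x,d^it)\sim(d_ix,t))$. For $c\in\mathcal{C}_0$ the over-category $\mathcal{C}/c$ has objects the morphisms $b\to c$ of $\mathcal{C}$ and morphisms $(g:a\to c)\to(f:b\to c)$ the $h:a\to b$ with $f\circ h=g$; its nerve has $N_p(\mathcal{C}/c)=\{(c_0\to\cdots\to c_p\to c)\}\subset N_{p+1}\mathcal{C}$ with the subspace topology. Dually the under-category $c\backslash\mathcal{C}$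 has $N_p(c\backslash\mathcal{C})=\{(c\to c_0\to\cdots\to c_p)\}\subset N_{p+1}\mathcal{C}$. $\mathcal{C}$ is left fibrant if $s:\mathcal{C}_1\to\mathcal{C}_0$ is a fibration and right fibrant if $t:\mathcal{C}_1\to\mathcal{C}_0$ is a fibration. $\mathcal{C}$ has soft left units if $B(\mathcal{C}/c)\simeq *$ for every $c\in\mathcal{C}_0$, and soft right units if $B(c\backslash\mathcal{C})\simeq *$ for every $c\in\mathcal{C}_0$; here $\simeq *$ means weakly contractible. $\mathcal{C}$ has weak left units if for each $b\in\mathcal{C}_0$ there is a morphism $u:b\to b'$ in $\mathcal{C}$ such that $u\circ - : t^{-1}(b)\to t^{-1}(b')$ is a weak homotopy equivalence. $\mathcal{C}$ has weak right units if for each $b\in\mathcal{C}_0$ there is a morphism $u:b'\to b$ in $\mathcal{C}$ such that $-\circ u : s^{-1}(b)\to s^{-1}(b')$ is a weak homotopy equivalence. *)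

theory Defs
  imports "HOL-Analysis.Analysis" "HOL-Homology.Simplices"
begin

section \<open>Compactly generated spaces, without a separation axiom\<close>

text \<open>
  A set is k-open if its preimage under every continuous map from a compact Hausdorff space is
  open.  (Without a Hausdorff condition this is not the library's \<^const>\<open>kification\<close>, which tests
  on compact subspaces.)  A definition cannot quantify over all types of test spaces, so the test
  spaces below live on one large enough type; theorem \<open>openin_cg_topology\<close>
  shows that this loses nothing: k-open sets are detected by compact Hausdorff spaces on
  arbitrary types.
\<close>

type_synonym 'a test_point = "('a + real) list set \<Rightarrow> real"

definition cg_open :: "'a topology \<Rightarrow> 'a set \<Rightarrow> bool" where
  "cg_open X U \<longleftrightarrow> U \<subseteq> topspace X \<and>
     (\<forall>(K :: 'a test_point topology) f.
        compact_space K \<and> Hausdorff_space K \<and> continuous_map K X f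
          \<longrightarrow> openin K {z \<in> topspace K. f z \<in> U})"

definition cg_topology :: "'a topology \<Rightarrow> 'a topology" where
  "cg_topology X = topology (cg_open X)"

definition cg_space :: "'a topology \<Rightarrow> bool" where
  "cg_space X \<longleftrightarrow> cg_topology X = X"

definition cg_prod :: "'a topology \<Rightarrow> 'b topology \<Rightarrow> ('a \<times> 'b) topology" where
  "cg_prod X Y = cg_topology (prod_topology X Y)"

definition cg_subspace :: "'a topology \<Rightarrow> 'a set \<Rightarrow> 'a topology" where
  "cg_subspace X S = cg_topology (subtopology X S)"

lemma istopology_cg_open: "istopology (cg_open X)"
  unfolding istopology_def
proof (intro conjI strip)
  fix S T assume ST: "cg_open X S" "cg_open X T"
  have "{z \<in> topspace K. f z \<in> S \<inter> T} = {z \<in> topspace K. f z \<in> S} \<inter> {z \<in> topspace K. f z \<in> T}"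
    for K :: "'a test_point topology" and f by auto
  then show "cg_open X (S \<inter> T)"
    using ST unfolding cg_open_def by (metis (no_types, lifting) le_infI1 openin_Int)
next
  fix \<K> assume *: "\<forall>S\<in>\<K>. cg_open X S"
  have "{z \<in> topspace K. f z \<in> \<Union>\<K>} = \<Union>((\<lambda>S. {z \<in> topspace K. f z \<in> S}) ` \<K>)"
    for K :: "'a test_point topology" and f by auto
  then show "cg_open X (\<Union>\<K>)"
    using * unfolding cg_open_def by (auto intro!: openin_Union)
qed

lemma openin_cg_topology_iff: "openin (cg_topology X) U \<longleftrightarrow> cg_open X U"
  by (simp add: cg_topology_def istopology_cg_open topology_inverse')

text \<open>
  Given a test map \<open>f\<close> on a compact Hausdorff space \<open>K\<close> of any size, the proof of
  \<open>openin_cg_topology\<close> builds a small Hausdorff quotient of \<open>K\<close>.  Its points are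
  separated by a family of continuous functions closed under enough applications of Urysohn's
  lemma; this datatype indexes the family.
\<close>

datatype 'a probe = Base "'a set" | Zero | Dist "'a probe" real real "'a probe"
  | Sep "'a set" "'a set" "'a probe"

primrec probe_code :: "'a probe \<Rightarrow> ('a + real) list set" where
  "probe_code (Base V) = insert [Inr 0] ((\<lambda>a. [Inr 0, Inl a]) ` V)"
| "probe_code Zero = {[Inr 1]}"
| "probe_code (Dist i r c j) =
     insert [Inr 2, Inr r, Inr c] ((#) (Inr 3) ` probe_code i \<union> (#) (Inr 4) ` probe_code j)"
| "probe_code (Sep C D j) =
     insert [Inr 5] ((\<lambda>a. [Inr 6, Inl a]) ` C \<union> (\<lambda>a. [Inr 7, Inl a]) ` D \<union> (#) (Inr 8) ` probe_code j)"

lemma inj_probe_code: "inj probe_code"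
proof (rule injI)
  fix x y :: "'a probe"
  show "probe_code x = probe_code y \<Longrightarrow> x = y"
  proof (induction x arbitrary: y)
    case (Base V)
    have "[Inr 0] \<in> probe_code y" using Base by auto
    then obtain W where y: "y = Base W" by (cases y) auto
    have "V = {a. [Inr 0, Inl a] \<in> probe_code (Base V)}"
         "W = {a. [Inr 0, Inl a] \<in> probe_code y}" using y by auto
    then show ?case using Base y by metis
  next
    case Zero
    then have "[Inr 1] \<in> probe_code y" by auto
    then show ?case by (cases y) auto
  next
    case (Dist i r c j)
    have "[Inr 2, Inr r, Inr c] \<in> probe_code y" by (simp flip: Dist.prems)
    then obtain i' j' where y: "y = Dist i' r c j'" by (cases y) auto
    have "probe_code i = {w. Inr 3 # w \<in> probe_code (Dist i r c j)}"
         "probe_code j = {w. Inr 4 # w \<in> probe_code (Dist i r c j)}"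
         "probe_code i' = {w. Inr 3 # w \<in> probe_code y}"
         "probe_code j' = {w. Inr 4 # w \<in> probe_code y}" using y by auto
    then have "probe_code i = probe_code i'" "probe_code j = probe_code j'"
      by (simp_all only: Dist.prems)
    then show ?case using Dist.IH y by blast
  next
    case (Sep C D j)
    have "[Inr 5] \<in> probe_code y" by (simp flip: Sep.prems)
    then obtain C' D' j' where y: "y = Sep C' D' j'" by (cases y) auto
    have "C = {a. [Inr 6, Inl a] \<in> probe_code (Sep C D j)}"
         "D = {a. [Inr 7, Inl a] \<in> probe_code (Sep C D j)}"
         "probe_code j = {w. Inr 8 # w \<in> probe_code (Sep C D j)}"
         "C' = {a. [Inr 6, Inl a] \<in> probe_code y}"
         "D' = {a. [Inr 7, Inl a] \<in> probe_code y}"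
         "probe_code j' = {w. Inr 8 # w \<in> probe_code y}" using y by auto
    note eqs = this[folded Sep.prems]
    have "C = C'" by (rule trans[OF eqs(1) eqs(4)[symmetric]])
    moreover have "D = D'" by (rule trans[OF eqs(2) eqs(5)[symmetric]])
    moreover have "probe_code j = probe_code j'" by (rule trans[OF eqs(3) eqs(6)[symmetric]])
    ultimately show ?case using Sep.IH y by blast
  qed
qed

lemma cg_open_test:
  fixes X :: "'a topology" and K :: "'k topology" and \<phi> :: "'a probe \<Rightarrow> 'k \<Rightarrow> real"
  assumes U: "cg_open X U" and K: "compact_space K" and f: "continuous_map K X f"
    and \<phi>: "\<And>i. continuous_map K euclideanreal (\<phi> i)"
    and sep: "\<And>x y. \<lbrakk>x \<in> topspace K; y \<in> topspace K; \<And>i. \<phi> i x = \<phi> i y\<rbrakk> \<Longrightarrow> f x = f y"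
  shows "openin K {x \<in> topspace K. f x \<in> U}"
proof -
  define \<pi> where "\<pi> = (\<lambda>x w. if w \<in> range probe_code then \<phi> (inv_into UNIV probe_code w) x else 0)"
  define K' :: "'a test_point topology" where
    "K' = subtopology (powertop_real UNIV) (\<pi> ` topspace K)"
  have \<pi>: "continuous_map K K' \<pi>"
    unfolding K'_def continuous_map_in_subtopology continuous_map_componentwise_UNIV
    using \<phi> by (auto simp: \<pi>_def)
  have top: "\<pi> ` topspace K = topspace K'"
    by (auto simp: K'_def)
  have H: "Hausdorff_space K'"
    unfolding K'_def
    by (intro Hausdorff_space_subtopology) (simp add: Hausdorff_space_product_topology)
  have C: "compact_space K'"
    using K \<pi> top by (metis compact_space_def image_compactin)
  have q: "quotient_map K K' \<pi>"
    using continuous_imp_quotient_map \<pi> K H top by blast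
  have sep': "f x = f y" if "x \<in> topspace K" "y \<in> topspace K" "\<pi> x = \<pi> y" for x y
  proof (rule sep[OF that(1,2)])
    fix i
    show "\<phi> i x = \<phi> i y"
      using fun_cong[OF that(3), of "probe_code i"] by (simp add: \<pi>_def inv_f_f[OF inj_probe_code])
  qed
  obtain g where g: "continuous_map K' X g" "\<And>x. x \<in> topspace K \<Longrightarrow> g (\<pi> x) = f x"
    using quotient_map_lift_exists[OF q f] sep' by metis
  have "openin K' {z \<in> topspace K'. g z \<in> U}"
    using U C H g(1) unfolding cg_open_def by blast
  then have "openin K {x \<in> topspace K. \<pi> x \<in> {z \<in> topspace K'. g z \<in> U}}"
    using \<pi> by (rule openin_continuous_map_preimage[rotated])
  moreover have "{x \<in> topspace K. \<pi> x \<in> {z \<in> topspace K'. g z \<in> U}} = {x \<in> topspace K. f x \<in> U}"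
    using g(2) top by auto
  ultimately show ?thesis by simp
qed

lemma cg_open_generization:
  assumes U: "cg_open X U" and "u \<in> U" "a \<in> topspace X"
    and spec: "\<And>V. openin X V \<Longrightarrow> u \<in> V \<Longrightarrow> a \<in> V"
  shows "a \<in> U"
proof -
  let ?I = "top_of_set {0..1::real}"
  define f where "f r = (if r = 0 then u else a)" for r :: real
  have u: "u \<in> topspace X" using U \<open>u \<in> U\<close> by (auto simp: cg_open_def)
  have cont: "continuous_map ?I X f"
    unfolding continuous_map_def
  proof (intro conjI strip)
    show "f \<in> topspace ?I \<rightarrow> topspace X" using u assms by (auto simp: f_def)
    fix V assume V: "openin X V"
    consider "u \<in> V" "a \<in> V" | "u \<notin> V" "a \<in> V" | "u \<notin> V" "a \<notin> V" using spec[OF V] by blast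
    then show "openin ?I {x \<in> topspace ?I. f x \<in> V}"
    proof cases
      case 1 then have "{x \<in> topspace ?I. f x \<in> V} = topspace ?I" by (auto simp: f_def)
      then show ?thesis by (metis openin_topspace)
    next
      case 2 then have "{x \<in> topspace ?I. f x \<in> V} = {0..1} \<inter> - {0}" by (auto simp: f_def)
      then show ?thesis by (metis openin_open_Int open_Compl closed_singleton)
    next
      case 3 then have "{x \<in> topspace ?I. f x \<in> V} = {}" by (auto simp: f_def)
      then show ?thesis by (metis openin_empty)
    qed
  qed
  have "openin ?I {x \<in> topspace ?I. f x \<in> U}"
    by (rule cg_open_test[OF U _ cont, where \<phi> = "\<lambda>_ r. r"])
       (auto simp: compact_space_subtopology continuous_map_id[unfolded id_def] continuous_map_from_subtopology)
  then obtain T where T: "open T" "{x \<in> topspace ?I. f x \<in> U} = {0..1} \<inter> T"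
    unfolding openin_open by blast
  have "0 \<in> {x \<in> topspace ?I. f x \<in> U}" using \<open>u \<in> U\<close> by (simp add: f_def)
  then have "0 \<in> T" unfolding T(2) by blast
  then obtain e where e: "e > 0" "ball 0 e \<subseteq> T" using T(1) open_contains_ball by blast
  define r where "r = min 1 (e/2)"
  have r: "0 < r" "r \<le> 1" "r < e" using e by (auto simp: r_def)
  then have "r \<in> ball 0 e" by simp
  then have "r \<in> {0..1} \<inter> T" using e(2) r by auto
  then have "r \<in> {x \<in> topspace ?I. f x \<in> U}" unfolding T(2) .
  then have "f r \<in> U" by blast
  then show ?thesis using r by (simp add: f_def)
qed

theorem openin_cg_topology:
  fixes X :: "'a topology" and K :: "'k topology"
  assumes U: "openin (cg_topology X) U"
    and K: "compact_space K" "Hausdorff_space K" and f: "continuous_map K X f"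
  shows "openin K {x \<in> topspace K. f x \<in> U}"
proof (rule ccontr)
  assume no: "\<not> openin K {x \<in> topspace K. f x \<in> U}"
  have U: "cg_open X U" using U by (simp add: openin_cg_topology_iff)
  have fX: "f x \<in> topspace X" if "x \<in> topspace K" for x
    using f that by (auto simp: continuous_map_def)
  have nK: "normal_space K" using K compact_Hausdorff_or_regular_imp_normal_space by blast
  obtain q0 where q0: "q0 \<in> topspace K" "f q0 \<in> U"
    and bad: "\<And>W. \<lbrakk>openin K W; q0 \<in> W\<rbrakk> \<Longrightarrow> \<exists>q\<in>W. f q \<notin> U"
  proof -
    have "\<exists>x\<in>{x \<in> topspace K. f x \<in> U}. \<nexists>T. openin K T \<and> x \<in> T \<and> T \<subseteq> {x \<in> topspace K. f x \<in> U}"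
      using no by (subst (asm) openin_subopen) blast
    then obtain x where "x \<in> topspace K" "f x \<in> U"
      and x: "\<nexists>T. openin K T \<and> x \<in> T \<and> T \<subseteq> {x \<in> topspace K. f x \<in> U}" by blast
    moreover have "\<exists>q\<in>W. f q \<notin> U" if "openin K W" "x \<in> W" for W
      using x that openin_subset[of K W] by blast
    ultimately show ?thesis using that by blast
  qed
  have "\<exists>g. continuous_map K euclideanreal g \<and>
      (closedin K S \<and> closedin K T \<and> disjnt S T \<longrightarrow> g ` S \<subseteq> {0} \<and> g ` T \<subseteq> {1})" for S T
  proof (cases "closedin K S \<and> closedin K T \<and> disjnt S T")
    case True
    then show ?thesis using Urysohn_lemma_alt[OF nK, of S T 0 1] by metis
  next
    case False
    then show ?thesis by (intro exI[of _ "\<lambda>_. 0"]) auto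
  qed
  then obtain urysohn where urysohn: "continuous_map K euclideanreal (urysohn S T) \<and>
      (closedin K S \<and> closedin K T \<and> disjnt S T \<longrightarrow> urysohn S T ` S \<subseteq> {0} \<and> urysohn S T ` T \<subseteq> {1})" for S T
    by metis
  have ury: "urysohn S T ` S \<subseteq> {0}" "urysohn S T ` T \<subseteq> {1}"
    if "closedin K S" "closedin K T" "disjnt S T" for S T
    using urysohn[of S T] that by blast+
  define pre where "pre C = {x \<in> topspace K. f x \<in> C}" for C
  have pre_closed: "closedin K (pre C)" if "closedin X C" for C
    using f that unfolding pre_def by (simp add: closedin_continuous_map_preimage)
  have pre_open: "openin K (pre V)" if "openin X V" for V
    using f that unfolding pre_def by (simp add: openin_continuous_map_preimage)
  define \<phi> :: "'a probe \<Rightarrow> 'k \<Rightarrow> real" where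
    "\<phi> = rec_probe (\<lambda>V. urysohn {q0} (topspace K - pre V)) (\<lambda>_. 0)
       (\<lambda>_ r c _ g h x. c * \<bar>g x - r\<bar> + h x)
       (\<lambda>C D _ g. urysohn (pre C \<inter> {x \<in> topspace K. g x \<le> 1/2}) (pre D \<inter> {x \<in> topspace K. g x \<le> 1/2}))"
  have \<phi>_simps: "\<phi> (Base V) = urysohn {q0} (topspace K - pre V)" "\<phi> Zero = (\<lambda>_. 0)"
    "\<phi> (Dist i r c j) = (\<lambda>x. c * \<bar>\<phi> i x - r\<bar> + \<phi> j x)"
    "\<phi> (Sep C D j) = urysohn (pre C \<inter> {x \<in> topspace K. \<phi> j x \<le> 1/2}) (pre D \<inter> {x \<in> topspace K. \<phi> j x \<le> 1/2})"
    for V i r c j C D by (simp_all add: \<phi>_def)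
  have \<phi>: "continuous_map K euclideanreal (\<phi> i)" for i
    by (induction i) (auto simp: \<phi>_simps urysohn intro!: continuous_intros)
  have half: "closedin K {x \<in> topspace K. \<phi> j x \<le> 1/2}" for j
    using closedin_continuous_map_preimage[OF \<phi>, of "{..1/2}" j] by simp

  define same where "same x y \<longleftrightarrow> x \<in> topspace K \<and> y \<in> topspace K \<and> (\<forall>i. \<phi> i x = \<phi> i y)" for x y
  define fibre where "fibre x = {y. same x y}" for x
  have fibre_closed: "closedin K (fibre x)" if "x \<in> topspace K" for x
  proof -
    have "fibre x = (\<Inter>i. {y \<in> topspace K. \<phi> i y \<in> {\<phi> i x}})"
      using that by (auto simp: fibre_def same_def)
    moreover have "closedin K {y \<in> topspace K. \<phi> i y \<in> {\<phi> i x}}" for i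
      by (rule closedin_continuous_map_preimage[OF \<phi>]) simp
    ultimately show ?thesis by (metis (no_types, lifting) closedin_Inter empty_is_image imageE UNIV_not_empty)
  qed

  have meet: "\<exists>y. same x y \<and> f y \<in> C \<inter> D"
    if C: "closedin X C" and D: "closedin X D" and c: "same x c" "f c \<in> C" and d: "same x d" "f d \<in> D"
    for x c d C D
  proof (rule ccontr)
    assume none: "\<nexists>y. same x y \<and> f y \<in> C \<inter> D"
    have x: "x \<in> topspace K" using c by (simp add: same_def)
    define L where "L = pre (C \<inter> D)"
    have L: "compactin K L"
      using pre_closed[of "C \<inter> D"] C D K(1) by (simp add: L_def closedin_compact_space closedin_Int)
    define null where "null = {j. \<phi> j x = 0 \<and> (\<forall>y\<in>topspace K. \<phi> j y \<ge> 0)}"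
    define O' where "O' j = {y \<in> topspace K. \<phi> j y \<in> {1/2<..}}" for j
    have O: "openin K (O' j)" for j
      unfolding O'_def by (rule openin_continuous_map_preimage[OF \<phi>]) simp
    have "L \<subseteq> \<Union>(O' ` null)"
    proof
      fix l assume l: "l \<in> L"
      then have lK: "l \<in> topspace K" and lCD: "f l \<in> C \<inter> D" by (auto simp: L_def pre_def)
      then have "\<not> same x l" using none by blast
      then obtain i where i: "\<phi> i x \<noteq> \<phi> i l" using x lK by (auto simp: same_def)
      let ?j = "Dist i (\<phi> i x) (1 / \<bar>\<phi> i l - \<phi> i x\<bar>) Zero"
      have "?j \<in> null" by (auto simp: null_def \<phi>_simps)
      moreover have "l \<in> O' ?j" using i lK by (simp add: O'_def \<phi>_simps)
      ultimately show "l \<in> \<Union>(O' ` null)" by blast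
    qed
    then obtain \<F> where "finite \<F>" "\<F> \<subseteq> O' ` null" "L \<subseteq> \<Union>\<F>"
      using compactinD[OF L, of "O' ` null"] O by (metis imageE)
    then obtain J where J: "finite J" "J \<subseteq> null" "L \<subseteq> \<Union>(O' ` J)"
      by (metis finite_subset_image)
    have "\<exists>j\<in>null. \<Union>(O' ` J) \<subseteq> O' j" using J(1,2)
    proof (induction J)
      case empty
      have "Zero \<in> null" by (simp add: null_def \<phi>_simps)
      then show ?case by auto
    next
      case (insert i J)
      then obtain j where j: "j \<in> null" "\<Union>(O' ` J) \<subseteq> O' j" by auto
      have i: "i \<in> null" using insert by auto
      have "Dist i 0 1 j \<in> null" using i j by (simp add: null_def \<phi>_simps)
      moreover have "O' i \<subseteq> O' (Dist i 0 1 j)" "O' j \<subseteq> O' (Dist i 0 1 j)"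
        using i j(1) by (fastforce simp: O'_def null_def \<phi>_simps)+
      ultimately show ?case using j(2) by blast
    qed
    then obtain j where j: "j \<in> null" "L \<subseteq> O' j" using J(3) by blast
    let ?N = "{x \<in> topspace K. \<phi> j x \<le> 1/2}"
    have "disjnt (pre C \<inter> ?N) (pre D \<inter> ?N)"
      unfolding disjnt_iff
    proof (intro allI notI)
      fix y assume y: "y \<in> pre C \<inter> ?N \<and> y \<in> pre D \<inter> ?N"
      then have "y \<in> O' j" using j(2) by (auto simp: L_def pre_def)
      then show False using y by (simp add: O'_def)
    qed
    moreover have "closedin K (pre C \<inter> ?N)" "closedin K (pre D \<inter> ?N)"
      by (rule closedin_Int[OF pre_closed[OF C] half], rule closedin_Int[OF pre_closed[OF D] half])
    ultimately have "\<phi> (Sep C D j) ` (pre C \<inter> ?N) \<subseteq> {0} \<and> \<phi> (Sep C D j) ` (pre D \<inter> ?N) \<subseteq> {1}"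
      using ury[of "pre C \<inter> ?N" "pre D \<inter> ?N"] by (simp only: \<phi>_simps(4) simp_thms)
    moreover have "c \<in> pre C \<inter> ?N" "d \<in> pre D \<inter> ?N"
    proof -
      have "\<phi> j c = 0" "\<phi> j d = 0" using c(1) d(1) j(1) by (simp_all add: same_def null_def)
      then show "c \<in> pre C \<inter> ?N" "d \<in> pre D \<inter> ?N"
        using c d by (simp_all add: pre_def same_def)
    qed
    ultimately have "\<phi> (Sep C D j) c = 0" "\<phi> (Sep C D j) d = 1" by blast+
    then show False using c(1) d(1) unfolding same_def by (metis zero_neq_one)
  qed

  define cl where "cl y = X closure_of {f y}" for y
  have cl: "closedin X (cl y)" "z \<in> cl y \<longleftrightarrow> z \<in> topspace X \<and> (\<forall>T. z \<in> T \<and> openin X T \<longrightarrow> f y \<in> T)" for y z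
    by (auto simp: cl_def in_closure_of)
  have special: "\<exists>m. same x m \<and> (\<forall>y. same x y \<longrightarrow> f m \<in> cl y)" if x: "x \<in> topspace K" for x
  proof -
    define G where "G y = fibre x \<inter> pre (cl y)" for y
    have fin: "\<exists>C. closedin X C \<and> (\<exists>m. same x m \<and> f m \<in> C) \<and> (\<forall>y\<in>Q. C \<subseteq> cl y)"
      if "finite Q" "Q \<subseteq> fibre x" for Q
      using that
    proof (induction Q)
      case empty
      then show ?case using x fX by (intro exI[of _ "topspace X"]) (auto simp: same_def)
    next
      case (insert y Q)
      then obtain C where C: "closedin X C" "\<exists>m. same x m \<and> f m \<in> C" "\<forall>y\<in>Q. C \<subseteq> cl y" by auto
      have y: "same x y" using insert by (simp add: fibre_def)
      then have "f y \<in> cl y" using fX by (auto simp: cl(2) same_def)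
      then have "\<exists>m. same x m \<and> f m \<in> C \<inter> cl y"
        using meet[OF C(1), of "cl y"] C(2) y by (metis cl(1))
      then show ?case using C by (intro exI[of _ "C \<inter> cl y"]) (auto intro: closedin_Int cl(1))
    qed
    have "\<Inter>(G ` fibre x) \<noteq> {}"
    proof (rule K(1)[unfolded compact_space_fip, rule_format], intro conjI ballI allI impI)
      show "closedin K C" if "C \<in> G ` fibre x" for C
        using that by (auto simp: G_def intro!: closedin_Int fibre_closed[OF x] pre_closed cl(1))
      fix \<F> assume "finite \<F> \<and> \<F> \<subseteq> G ` fibre x"
      then obtain Q where Q: "finite Q" "Q \<subseteq> fibre x" "\<F> = G ` Q"
        by (metis finite_subset_image)
      obtain C m where m: "same x m" "f m \<in> C" "\<forall>y\<in>Q. C \<subseteq> cl y"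
        using fin[OF Q(1,2)] by blast
      then have "m \<in> \<Inter>\<F>" by (auto simp: Q(3) G_def fibre_def pre_def same_def)
      then show "\<Inter>\<F> \<noteq> {}" by blast
    qed
    then obtain m where m: "m \<in> \<Inter>(G ` fibre x)" by blast
    have "x \<in> fibre x" using x by (simp add: fibre_def same_def)
    then have "m \<in> G x" using m by blast
    then have "same x m" by (simp add: G_def fibre_def)
    moreover have "f m \<in> cl y" if "same x y" for y
    proof -
      have "m \<in> G y" using m that by (auto simp: fibre_def)
      then show ?thesis by (simp add: G_def pre_def)
    qed
    ultimately show ?thesis by blast
  qed

  define h where "h x = (if same x q0 then f q0
     else f (SOME m. same x m \<and> (\<forall>y. same x y \<longrightarrow> f m \<in> cl y)))" for x
  have h: "\<exists>m. same x m \<and> h x = f m \<and> (\<not> same x q0 \<longrightarrow> (\<forall>y. same x y \<longrightarrow> f m \<in> cl y))"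
    if "x \<in> topspace K" for x
    using someI_ex[OF special[OF that]] unfolding h_def by auto
  have same_cong: "same x = same y" if "same x y" for x y
    using that by (auto simp: same_def fun_eq_iff)
  have hV: "f y \<in> V" if V: "openin X V" "h x \<in> V" and xy: "same x y" for x y V
  proof (cases "same x q0")
    case True
    then have "f q0 \<in> V" using V by (simp add: h_def)
    then have "q0 \<in> pre V" using q0(1) by (simp add: pre_def)
    then have "disjnt {q0} (topspace K - pre V)" by simp
    moreover have "closedin K {q0}" using closedin_Hausdorff_singleton[OF K(2) q0(1)] .
    moreover have "closedin K (topspace K - pre V)" using pre_open[OF V(1)] by blast
    ultimately have *: "\<phi> (Base V) ` {q0} \<subseteq> {0} \<and> \<phi> (Base V) ` (topspace K - pre V) \<subseteq> {1}"
      using ury[of "{q0}" "topspace K - pre V"] by (simp only: \<phi>_simps(1) simp_thms)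
    have "\<phi> (Base V) y = \<phi> (Base V) q0" using xy True by (simp add: same_def)
    with * have "y \<notin> topspace K - pre V" by force
    then show ?thesis using xy by (auto simp: same_def pre_def)
  next
    case False
    obtain m where "h x = f m" "f m \<in> cl y"
      using h[of x] False xy by (auto simp: same_def)
    then show ?thesis using V by (auto simp: cl(2))
  qed
  have tube: "\<exists>W. openin K W \<and> x \<in> W \<and> W \<subseteq> pre V \<and> (\<forall>y z. y \<in> W \<and> same y z \<longrightarrow> z \<in> W)"
    if V: "openin X V" and x: "x \<in> topspace K" and xV: "\<And>y. same x y \<Longrightarrow> f y \<in> V" for x V
  proof -
    let ?P = "powertop_real (UNIV :: 'a probe set)"
    define \<pi> where "\<pi> = (\<lambda>x i. \<phi> i x)"
    have \<pi>: "continuous_map K ?P \<pi>" by (simp add: \<pi>_def continuous_map_componentwise_UNIV \<phi>)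
    have H: "Hausdorff_space ?P" by (simp add: Hausdorff_space_product_topology)
    define W where "W = {y \<in> topspace K. \<pi> y \<in> topspace ?P - \<pi> ` (topspace K - pre V)}"
    have "closedin K (topspace K - pre V)" using pre_open[OF V] by blast
    then have "closedin ?P (\<pi> ` (topspace K - pre V))"
      using continuous_imp_closed_map[OF \<pi> K(1) H] by (simp add: closed_map_def)
    then have "openin K W"
      unfolding W_def by (intro openin_continuous_map_preimage[OF \<pi>]) blast
    moreover have "same y z \<longleftrightarrow> y \<in> topspace K \<and> z \<in> topspace K \<and> \<pi> y = \<pi> z" for y z
      by (auto simp: same_def \<pi>_def fun_eq_iff)
    ultimately show ?thesis using x xV
      by (intro exI[of _ W]) (auto simp: W_def pre_def image_iff)
  qed
  have hc: "continuous_map K X h"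
    unfolding continuous_map_def
  proof (intro conjI strip)
    show "h \<in> topspace K \<rightarrow> topspace X" using h fX by (fastforce simp: same_def)
    fix V assume V: "openin X V"
    show "openin K {x \<in> topspace K. h x \<in> V}"
    proof (rule openin_subopen[THEN iffD2], intro ballI)
      fix x assume "x \<in> {x \<in> topspace K. h x \<in> V}"
      then have x: "x \<in> topspace K" "h x \<in> V" by auto
      obtain W where W: "openin K W" "x \<in> W" "W \<subseteq> pre V" "\<And>y z. y \<in> W \<Longrightarrow> same y z \<Longrightarrow> z \<in> W"
        using tube[OF V x(1) hV[OF V x(2)]] by blast
      have "h y \<in> V" if "y \<in> W" for y
      proof -
        have "y \<in> topspace K" using that W(1) openin_subset by blast
        then obtain m where "same y m" "h y = f m" using h by blast
        then show ?thesis using W(3,4) that by (auto simp: pre_def)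
      qed
      then show "\<exists>T. openin K T \<and> x \<in> T \<and> T \<subseteq> {x \<in> topspace K. h x \<in> V}"
        using W(1,2) openin_subset[OF W(1)] by (intro exI[of _ W]) auto
    qed
  qed
  have "openin K {x \<in> topspace K. h x \<in> U}"
  proof (rule cg_open_test[OF U K(1) hc \<phi>])
    fix x y assume "x \<in> topspace K" "y \<in> topspace K" "\<And>i. \<phi> i x = \<phi> i y"
    then have "same x = same y" using same_cong by (simp add: same_def)
    then show "h x = h y" by (simp add: h_def)
  qed
  moreover have "h q0 = f q0" using q0 by (simp add: h_def same_def)
  ultimately obtain q where q: "q \<in> topspace K" "h q \<in> U" "f q \<notin> U"
    using bad[of "{x \<in> topspace K. h x \<in> U}"] q0 by auto
  have "f q \<in> V" if "openin X V" "h q \<in> V" for V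
    using hV[OF that] q(1) by (simp add: same_def)
  then show False using cg_open_generization[OF U q(2) fX[OF q(1)]] q(3) by blast
qed


section \<open>Serre fibrations and weak homotopy equivalences\<close>

definition cube :: "nat \<Rightarrow> (nat \<Rightarrow> real) topology" where
  "cube n = product_topology (\<lambda>_. top_of_set {0..1}) {..<n}"

definition cube_boundary :: "nat \<Rightarrow> (nat \<Rightarrow> real) set" where
  "cube_boundary n = {t \<in> topspace (cube n). \<exists>i<n. t i = 0 \<or> t i = 1}"

definition serre_fibration :: "'e topology \<Rightarrow> 'b topology \<Rightarrow> ('e \<Rightarrow> 'b) \<Rightarrow> bool" where
  "serre_fibration E B p \<longleftrightarrow> continuous_map E B p \<and>
     (\<forall>n h g. continuous_map (prod_topology (cube n) (top_of_set {0..1::real})) B h \<and>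
        continuous_map (cube n) E g \<and> (\<forall>t\<in>topspace (cube n). p (g t) = h (t, 0)) \<longrightarrow>
        (\<exists>H. continuous_map (prod_topology (cube n) (top_of_set {0..1::real})) E H \<and>
           (\<forall>t\<in>topspace (cube n). H (t, 0) = g t) \<and>
           (\<forall>t\<in>topspace (cube n). \<forall>r\<in>{0..1}. p (H (t, r)) = h (t, r))))"

definition cube_loops :: "nat \<Rightarrow> 'a topology \<Rightarrow> 'a \<Rightarrow> ((nat \<Rightarrow> real) \<Rightarrow> 'a) set" where
  "cube_loops n X x = {g. continuous_map (cube n) X g \<and> (\<forall>t\<in>cube_boundary n. g t = x)}"

definition cube_homotopic :: "nat \<Rightarrow> 'a topology \<Rightarrow> 'a \<Rightarrow>
    ((nat \<Rightarrow> real) \<Rightarrow> 'a) \<Rightarrow> ((nat \<Rightarrow> real) \<Rightarrow> 'a) \<Rightarrow> bool" where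
  "cube_homotopic n X x = homotopic_with (\<lambda>g. \<forall>t\<in>cube_boundary n. g t = x) (cube n) X"

text \<open>
  The underlying set of the \<open>n\<close>-th homotopy group.  The group structure is not needed: induced
  maps are homomorphisms, so they are isomorphisms iff they are bijective.
\<close>

definition homotopy_classes :: "nat \<Rightarrow> 'a topology \<Rightarrow> 'a \<Rightarrow> ((nat \<Rightarrow> real) \<Rightarrow> 'a) set set" where
  "homotopy_classes n X x = cube_loops n X x // {(g, h). cube_homotopic n X x g h}"

definition homotopy_classes_map :: "nat \<Rightarrow> 'b topology \<Rightarrow> ('a \<Rightarrow> 'b) \<Rightarrow> 'a \<Rightarrow>
    ((nat \<Rightarrow> real) \<Rightarrow> 'a) set \<Rightarrow> ((nat \<Rightarrow> real) \<Rightarrow> 'b) set" where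
  "homotopy_classes_map n Y f x c = {h. \<exists>g\<in>c. cube_homotopic n Y (f x) (f \<circ> g) h}"

definition weak_homotopy_equivalence :: "'a topology \<Rightarrow> 'b topology \<Rightarrow> ('a \<Rightarrow> 'b) \<Rightarrow> bool" where
  "weak_homotopy_equivalence X Y f \<longleftrightarrow> continuous_map X Y f \<and>
     bij_betw (\<lambda>C. {y. \<exists>x\<in>C. path_component_of Y (f x) y})
       (path_components_of X) (path_components_of Y) \<and>
     (\<forall>n\<ge>1. \<forall>x\<in>topspace X. bij_betw (homotopy_classes_map n Y f x)
       (homotopy_classes n X x) (homotopy_classes n Y (f x)))"

definition weakly_contractible :: "'a topology \<Rightarrow> bool" where
  "weakly_contractible X \<longleftrightarrow> weak_homotopy_equivalence X (discrete_topology {()}) (\<lambda>_. ())"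


section \<open>Geometric realisation of semi-simplicial spaces\<close>

text \<open>
  A semi-simplicial space is given by the spaces \<open>X p\<close> of \<open>p\<close>-simplices and the face maps
  \<open>d p i\<close> from \<open>X p\<close> to \<open>X (p - 1)\<close>, for \<open>i \<le> p\<close> and \<open>p \<ge> 1\<close>.
\<close>

definition simplex_topology :: "nat \<Rightarrow> (nat \<Rightarrow> real) topology" where
  "simplex_topology p = subtopology (powertop_real UNIV) (standard_simplex p)"

definition face_glue :: "(nat \<Rightarrow> 'x topology) \<Rightarrow> (nat \<Rightarrow> nat \<Rightarrow> 'x \<Rightarrow> 'x) \<Rightarrow>
    nat \<times> 'x \<times> (nat \<Rightarrow> real) \<Rightarrow> nat \<times> 'x \<times> (nat \<Rightarrow> real) \<Rightarrow> bool" where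
  "face_glue X d a b \<longleftrightarrow> (\<exists>p x i t. x \<in> topspace (X (Suc p)) \<and> i \<le> Suc p \<and> t \<in> standard_simplex p \<and>
     a = (Suc p, x, simplical_face i t) \<and> b = (p, d (Suc p) i x, t))"

definition quotient_topology :: "'a topology \<Rightarrow> ('a \<Rightarrow> 'b) \<Rightarrow> 'b topology" where
  "quotient_topology X q =
     topology (\<lambda>U. U \<subseteq> q ` topspace X \<and> openin X {x \<in> topspace X. q x \<in> U})"

definition realisation :: "(nat \<Rightarrow> 'x topology) \<Rightarrow> (nat \<Rightarrow> nat \<Rightarrow> 'x \<Rightarrow> 'x) \<Rightarrow>
    (nat \<times> 'x \<times> (nat \<Rightarrow> real)) set topology" where
  "realisation X d =
     quotient_topology (sum_topology (\<lambda>p. cg_prod (X p) (simplex_topology p)) UNIV)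
       (\<lambda>a. {b. equivclp (face_glue X d) a b})"

lemma openin_quotient_topology:
  "openin (quotient_topology X q) U \<longleftrightarrow> U \<subseteq> q ` topspace X \<and> openin X {x \<in> topspace X. q x \<in> U}"
proof -
  have "istopology (\<lambda>U. U \<subseteq> q ` topspace X \<and> openin X {x \<in> topspace X. q x \<in> U})"
    unfolding istopology_def
  proof (intro conjI allI impI)
    fix S T assume ST: "S \<subseteq> q ` topspace X \<and> openin X {x \<in> topspace X. q x \<in> S}"
      "T \<subseteq> q ` topspace X \<and> openin X {x \<in> topspace X. q x \<in> T}"
    have "{x \<in> topspace X. q x \<in> S \<inter> T} = {x \<in> topspace X. q x \<in> S} \<inter> {x \<in> topspace X. q x \<in> T}"
      by auto
    moreover have "openin X ({x \<in> topspace X. q x \<in> S} \<inter> {x \<in> topspace X. q x \<in> T})"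
      using ST by (intro openin_Int) blast+
    ultimately show "openin X {x \<in> topspace X. q x \<in> S \<inter> T}" by (simp only:)
    show "S \<inter> T \<subseteq> q ` topspace X" using ST by blast
  next
    fix \<K> assume *: "\<forall>S\<in>\<K>. S \<subseteq> q ` topspace X \<and> openin X {x \<in> topspace X. q x \<in> S}"
    have "{x \<in> topspace X. q x \<in> \<Union>\<K>} = \<Union>((\<lambda>S. {x \<in> topspace X. q x \<in> S}) ` \<K>)" by auto
    moreover have "openin X (\<Union>((\<lambda>S. {x \<in> topspace X. q x \<in> S}) ` \<K>))"
      using * by (intro openin_Union) blast
    ultimately show "openin X {x \<in> topspace X. q x \<in> \<Union>\<K>}" by (simp only:)
    show "\<Union>\<K> \<subseteq> q ` topspace X" using * by blast
  qed
  then show ?thesis by (simp add: quotient_topology_def topology_inverse')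
qed


section \<open>Non-unital topological categories\<close>

text \<open>\<open>cmp C g f\<close> is the composite of \<open>f\<close> followed by \<open>g\<close>.\<close>

record ('o, 'm) top_cat =
  Obj :: "'o topology"
  Mor :: "'m topology"
  src :: "'m \<Rightarrow> 'o"
  tgt :: "'m \<Rightarrow> 'o"
  cmp :: "'m \<Rightarrow> 'm \<Rightarrow> 'm"

definition nonunital_top_cat :: "('o, 'm) top_cat \<Rightarrow> bool" where
  "nonunital_top_cat C \<longleftrightarrow> cg_space (Obj C) \<and> cg_space (Mor C) \<and>
     continuous_map (Mor C) (Obj C) (src C) \<and> continuous_map (Mor C) (Obj C) (tgt C) \<and>
     continuous_map (cg_subspace (cg_prod (Mor C) (Mor C)) {(f, g). tgt C f = src C g}) (Mor C)
       (\<lambda>(f, g). cmp C g f) \<and>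
     (\<forall>f\<in>topspace (Mor C). \<forall>g\<in>topspace (Mor C). tgt C f = src C g \<longrightarrow>
        src C (cmp C g f) = src C f \<and> tgt C (cmp C g f) = tgt C g) \<and>
     (\<forall>f\<in>topspace (Mor C). \<forall>g\<in>topspace (Mor C). \<forall>h\<in>topspace (Mor C).
        tgt C f = src C g \<and> tgt C g = src C h \<longrightarrow> cmp C h (cmp C g f) = cmp C (cmp C h g) f)"

text \<open>
  A \<open>p\<close>-simplex of the nerve is a pair \<open>(c, f)\<close> of the objects \<open>c 0, \<dots>, c p\<close> and the morphisms
  \<open>f i\<close> from \<open>c i\<close> to \<open>c (Suc i)\<close> for \<open>i < p\<close>.  Recording the objects as well treats \<open>p = 0\<close>
  uniformly: the space below is the limit of the zigzag of the \<open>p\<close> copies of \<open>Mor C\<close> over the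
  \<open>p + 1\<close> copies of \<open>Obj C\<close>, i.e. the iterated fibre product.
\<close>

definition nerve :: "('o, 'm) top_cat \<Rightarrow> nat \<Rightarrow> ((nat \<Rightarrow> 'o) \<times> (nat \<Rightarrow> 'm)) topology" where
  "nerve C p = cg_subspace
     (prod_topology (product_topology (\<lambda>_. Obj C) {..p}) (product_topology (\<lambda>_. Mor C) {..<p}))
     {(c, f). \<forall>i<p. src C (f i) = c i \<and> tgt C (f i) = c (Suc i)}"

definition nerve_face :: "('o, 'm) top_cat \<Rightarrow> nat \<Rightarrow> nat \<Rightarrow>
    (nat \<Rightarrow> 'o) \<times> (nat \<Rightarrow> 'm) \<Rightarrow> (nat \<Rightarrow> 'o) \<times> (nat \<Rightarrow> 'm)" where
  "nerve_face C p i = (\<lambda>(c, f).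
     (\<lambda>j\<in>{..p - 1}. if j < i then c j else c (Suc j),
      \<lambda>j\<in>{..<p - 1}. if Suc j < i then f j
                     else if Suc j = i then cmp C (f (Suc j)) (f j)
                     else f (Suc j)))"

text \<open>
  In the nerve of the over-category (under-category) of \<open>c\<close>, the last (first) vertex of a
  \<open>Suc p\<close>-simplex of the nerve of \<open>C\<close> is fixed to be \<open>c\<close> and is never forgotten by a face map.
\<close>

definition over_nerve :: "('o, 'm) top_cat \<Rightarrow> 'o \<Rightarrow> nat \<Rightarrow> ((nat \<Rightarrow> 'o) \<times> (nat \<Rightarrow> 'm)) topology" where
  "over_nerve C c p = cg_subspace (nerve C (Suc p)) {x. fst x (Suc p) = c}"

definition under_nerve :: "('o, 'm) top_cat \<Rightarrow> 'o \<Rightarrow> nat \<Rightarrow> ((nat \<Rightarrow> 'o) \<times> (nat \<Rightarrow> 'm)) topology" where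
  "under_nerve C c p = cg_subspace (nerve C (Suc p)) {x. fst x 0 = c}"

definition B_over :: "('o, 'm) top_cat \<Rightarrow> 'o \<Rightarrow>
    (nat \<times> ((nat \<Rightarrow> 'o) \<times> (nat \<Rightarrow> 'm)) \<times> (nat \<Rightarrow> real)) set topology" where
  "B_over C c = realisation (over_nerve C c) (\<lambda>p i. nerve_face C (Suc p) i)"

definition B_under :: "('o, 'm) top_cat \<Rightarrow> 'o \<Rightarrow>
    (nat \<times> ((nat \<Rightarrow> 'o) \<times> (nat \<Rightarrow> 'm)) \<times> (nat \<Rightarrow> real)) set topology" where
  "B_under C c = realisation (under_nerve C c) (\<lambda>p i. nerve_face C (Suc p) (Suc i))"

definition left_fibrant :: "('o, 'm) top_cat \<Rightarrow> bool" where
  "left_fibrant C \<longleftrightarrow> serre_fibration (Mor C) (Obj C) (src C)"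

definition right_fibrant :: "('o, 'm) top_cat \<Rightarrow> bool" where
  "right_fibrant C \<longleftrightarrow> serre_fibration (Mor C) (Obj C) (tgt C)"

definition soft_left_units :: "('o, 'm) top_cat \<Rightarrow> bool" where
  "soft_left_units C \<longleftrightarrow> (\<forall>c\<in>topspace (Obj C). weakly_contractible (B_over C c))"

definition soft_right_units :: "('o, 'm) top_cat \<Rightarrow> bool" where
  "soft_right_units C \<longleftrightarrow> (\<forall>c\<in>topspace (Obj C). weakly_contractible (B_under C c))"

definition src_fibre :: "('o, 'm) top_cat \<Rightarrow> 'o \<Rightarrow> 'm topology" where
  "src_fibre C b = cg_subspace (Mor C) {f. src C f = b}"

definition tgt_fibre :: "('o, 'm) top_cat \<Rightarrow> 'o \<Rightarrow> 'm topology" where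
  "tgt_fibre C b = cg_subspace (Mor C) {f. tgt C f = b}"

definition weak_left_units :: "('o, 'm) top_cat \<Rightarrow> bool" where
  "weak_left_units C \<longleftrightarrow> (\<forall>b\<in>topspace (Obj C). \<exists>u\<in>topspace (Mor C). src C u = b \<and>
     weak_homotopy_equivalence (tgt_fibre C b) (tgt_fibre C (tgt C u)) (\<lambda>f. cmp C u f))"

definition weak_right_units :: "('o, 'm) top_cat \<Rightarrow> bool" where
  "weak_right_units C \<longleftrightarrow> (\<forall>b\<in>topspace (Obj C). \<exists>u\<in>topspace (Mor C). tgt C u = b \<and>
     weak_homotopy_equivalence (src_fibre C b) (src_fibre C (src C u)) (\<lambda>f. cmp C f u))"

end

theory Submission
  imports Defs
begin

text \<open>
  A weak left unit \<open>u\<close> from \<open>c\<close> to \<open>c'\<close> induces a map from the realisation of the over-category of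
  \<open>c\<close> to that of \<open>c'\<close>.  It extends over the cone, because \<open>u\<close> can be appended to every simplex as a
  new last vertex, so it is null-homotopic.  It is also a weak equivalence: on nerves it is a
  levelwise weak equivalence, since the target map is a fibration, and realisation of
  semi-simplicial spaces preserves these.  A null-homotopic weak equivalence has a weakly
  contractible source.

  For the realisation, weak equivalences are replaced by the compression property: a square
  from a cube and its boundary has a lift up to homotopy relative to the boundary.  This
  property is local on the target (subdivide the cube and lift cell by cell).  The realisation is
  covered by the open stars in which the \<open>m + 1\<close> largest weights are separated from the others;
  pushing the other weights to zero deforms a finite intersection of stars to a space of the form
  \<open>X m \<times> W\<close>, where the levelwise property applies.
\<close>

section \<open>Homotopy extension and lifting up to homotopy\<close>

text \<open>Homotopy groups of the pieces of a cover do not determine those of the whole in any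
  direct way, whereas a lift up to homotopy relative to a boundary can be extended from one cell to
  the next; hence the compression property. An open cover suits it because a cube can be subdivided
  subordinate to the cover by compactness of the cube alone, without a separation condition on the
  spaces of simplices. Maps out of a realisation descend from its cells; maps into it are built on
  compact Hausdorff sources, here cubes, and weak homotopy theory asks for no others. The fibration
  hypothesis serves one purpose: a unit compresses only the last morphism of a chain, the
  compressing homotopy moves its source, and the earlier morphisms must follow. Weak contractibility
  is handled as extendability of maps from the boundaries of cubes; dimension 0 supplies a point.
  The second half is the first for the opposite category. Reversing the vertices reverses the
  numbering of the faces, so the weights have to be reversed too.\<close>

abbreviation cont_from :: "'k::topological_space set \<Rightarrow> 'a topology \<Rightarrow> ('k \<Rightarrow> 'a) \<Rightarrow> bool" where
  "cont_from S X f \<equiv> continuous_map (top_of_set S) X f"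

abbreviation unit_I :: "real set" where "unit_I \<equiv> {0..1}"

lemma cont_from_compose:
  assumes "continuous_on S f" "\<And>x. x \<in> S \<Longrightarrow> f x \<in> T" "cont_from T Z g"
  shows "cont_from S Z (\<lambda>x. g (f x))"
  using continuous_map_compose[of "top_of_set S" "top_of_set T" f Z g] assms
  by (force simp: continuous_map_in_subtopology o_def)

lemma cont_from_cong:
  assumes "cont_from S Z f" "\<And>x. x \<in> S \<Longrightarrow> f x = g x"
  shows "cont_from S Z g"
  using assms by (auto intro: continuous_map_eq)

lemma cont_from_subset: "cont_from S Z f \<Longrightarrow> T \<subseteq> S \<Longrightarrow> cont_from T Z f"
  using cont_from_compose[of T "\<lambda>x. x" S Z f] by (auto simp: continuous_on_id)

lemma cont_from_in: "cont_from S Z f \<Longrightarrow> x \<in> S \<Longrightarrow> f x \<in> topspace Z"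
  by (auto simp: continuous_map_def)

lemma cont_from_glue:
  assumes A: "closedin (top_of_set S) A" and B: "closedin (top_of_set S) B" and S: "S \<subseteq> A \<union> B"
    and f: "cont_from A Z f" and g: "cont_from B Z g" and eq: "\<And>x. x \<in> A \<Longrightarrow> x \<in> B \<Longrightarrow> f x = g x"
  shows "cont_from S Z (\<lambda>x. if x \<in> A then f x else g x)"
proof (rule pasting_lemma_closed[where I = UNIV and T = "\<lambda>b. if b then A else B" and f = "\<lambda>b. if b then f else g"])
  have sub: "A \<subseteq> S" "B \<subseteq> S" using A B closedin_imp_subset by blast+
  show "continuous_map (subtopology (top_of_set S) (if b then A else B)) Z (if b then f else g)" for b
    using sub f g by (auto simp: subtopology_subtopology Int_absorb1)
qed (use A B S eq in \<open>auto split: if_splits\<close>)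

text \<open>The homotopy extension property, in the form of a retraction of the cylinder onto its
  bottom and the part over \<open>A\<close>. This form mentions no target space, so it serves
  targets of every type, and it is carried along homeomorphisms by conjugation.\<close>

definition hep :: "'k::topological_space set \<Rightarrow> 'k set \<Rightarrow> bool" where
  "hep S A \<longleftrightarrow> closedin (top_of_set S) A \<and>
     (\<exists>r. continuous_on (S \<times> unit_I) r \<and> (\<forall>y\<in>S \<times> unit_I. r y \<in> S \<times> {0} \<union> A \<times> unit_I) \<and>
          (\<forall>y\<in>S \<times> {0} \<union> A \<times> unit_I. r y = y))"

lemma closedin_Times_top_of_set:
  "closedin (top_of_set S) A \<Longrightarrow> closedin (top_of_set T) B \<Longrightarrow> closedin (top_of_set (S \<times> T)) (A \<times> B)"
  by (metis closedin_prod_Times_iff prod_topology_subtopology_eu)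

lemma hep_subset: "hep S A \<Longrightarrow> A \<subseteq> S"
  by (auto simp: hep_def closedin_def)

lemma closedin_top_of_set_subset:
  "closedin (top_of_set S) A \<Longrightarrow> A \<subseteq> T \<Longrightarrow> T \<subseteq> S \<Longrightarrow> closedin (top_of_set T) A"
  using closedin_subset_trans by blast

lemma hep_extend:
  assumes hep: "hep S A" and F: "cont_from S Z F" and h: "cont_from (A \<times> unit_I) Z h"
    and eq: "\<And>a. a \<in> A \<Longrightarrow> h (a, 0) = F a"
  obtains G where "cont_from (S \<times> unit_I) Z G" "\<And>x. x \<in> S \<Longrightarrow> G (x, 0) = F x"
    "\<And>a s. a \<in> A \<Longrightarrow> s \<in> unit_I \<Longrightarrow> G (a, s) = h (a, s)"
proof -
  obtain r where cA: "closedin (top_of_set S) A" and r: "continuous_on (S \<times> unit_I) r"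
    "\<And>y. y \<in> S \<times> unit_I \<Longrightarrow> r y \<in> S \<times> {0} \<union> A \<times> unit_I"
    "\<And>y. y \<in> S \<times> {0} \<union> A \<times> unit_I \<Longrightarrow> r y = y"
    using hep unfolding hep_def by blast
  have AS: "A \<subseteq> S" using hep_subset[OF hep] .
  let ?J = "S \<times> {0} \<union> A \<times> unit_I"
  let ?k = "\<lambda>y. if y \<in> S \<times> {0} then F (fst y) else h y"
  have "closedin (top_of_set unit_I) {0}" by auto
  then have c1: "closedin (top_of_set (S \<times> unit_I)) (S \<times> {0})"
    by (intro closedin_Times_top_of_set) auto
  have c2: "closedin (top_of_set (S \<times> unit_I)) (A \<times> unit_I)"
    using cA by (intro closedin_Times_top_of_set) auto
  have J: "?J \<subseteq> S \<times> unit_I" using AS by auto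
  have k: "cont_from ?J Z ?k"
  proof (rule cont_from_glue[OF closedin_top_of_set_subset[OF c1 _ J] closedin_top_of_set_subset[OF c2 _ J] _ _ h])
    show "cont_from (S \<times> {0::real}) Z (\<lambda>y. F (fst y))"
      by (rule cont_from_compose[OF _ _ F]) (auto intro!: continuous_intros)
  qed (use eq in auto)
  have "cont_from (S \<times> unit_I) Z (\<lambda>y. ?k (r y))"
    by (rule cont_from_compose[OF r(1,2) k])
  then show ?thesis
  proof (rule that)
    fix x assume "x \<in> S" then show "?k (r (x, 0)) = F x" using r(3)[of "(x, 0)"] by auto
  next
    fix a s assume as: "a \<in> A" "s \<in> unit_I"
    then show "?k (r (a, s)) = h (a, s)" using r(3)[of "(a, s)"] eq by auto
  qed
qed

lemma continuous_on_reverse_time: "continuous_on (S \<times> unit_I) (\<lambda>y. (fst y, 1 - snd y))"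
  by (intro continuous_intros)

lemma cont_from_reverse_time:
  assumes "cont_from (A \<times> unit_I) Z h"
  shows "cont_from (A \<times> unit_I) Z (\<lambda>y. h (fst y, 1 - snd y))"
  by (rule cont_from_compose[OF continuous_on_reverse_time _ assms]) auto

lemma hep_extend_reverse:
  assumes hep: "hep S A" and F: "cont_from S Z F" and h: "cont_from (A \<times> unit_I) Z h"
    and eq: "\<And>a. a \<in> A \<Longrightarrow> h (a, 1) = F a"
  obtains G where "cont_from (S \<times> unit_I) Z G" "\<And>x. x \<in> S \<Longrightarrow> G (x, 1) = F x"
    "\<And>a s. a \<in> A \<Longrightarrow> s \<in> unit_I \<Longrightarrow> G (a, s) = h (a, s)"
proof -
  obtain G where "cont_from (S \<times> unit_I) Z G" "\<And>x. x \<in> S \<Longrightarrow> G (x, 0) = F x"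
    "\<And>a s. a \<in> A \<Longrightarrow> s \<in> unit_I \<Longrightarrow> G (a, s) = h (a, 1 - s)"
    using hep_extend[OF hep F cont_from_reverse_time[OF h]] eq by auto
  then show ?thesis
    using that[OF cont_from_reverse_time, of G] by auto
qed

lemma cont_from_slice:
  assumes "cont_from (S \<times> T) Z G" "s \<in> T"
  shows "cont_from S Z (\<lambda>x. G (x, s))"
  by (rule cont_from_compose[OF _ _ assms(1)]) (use assms in \<open>auto intro!: continuous_intros\<close>)

text \<open>The second clause is homotopy extension for the prism over \<open>S\<close> relative to
  its sides, bottom and top. It makes it possible to modify a homotopy on \<open>S\<close> while
  prescribing what happens on \<open>A\<close> and at both ends.\<close>

definition cell_pair :: "'k::topological_space set \<Rightarrow> 'k set \<Rightarrow> bool" where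
  "cell_pair S A \<longleftrightarrow> hep S A \<and> hep (S \<times> unit_I) (A \<times> unit_I \<union> S \<times> {0, 1})"

text \<open>\<open>L\<close> fills the square of \<open>f\<close> and \<open>g\<close> up to the
  homotopy \<open>H\<close>, which is stationary on \<open>A\<close>. For \<open>A\<close> contained
  in \<open>S\<close>, commutativity of the square on \<open>A\<close> is implied:
  \<open>H (a, 0)\<close> is both \<open>u (f a)\<close> and \<open>g a\<close>.\<close>

definition solves :: "'k::topological_space set \<Rightarrow> 'k set \<Rightarrow> 'a topology \<Rightarrow> 'b topology \<Rightarrow> ('a \<Rightarrow> 'b) \<Rightarrow>
    ('k \<Rightarrow> 'a) \<Rightarrow> ('k \<Rightarrow> 'b) \<Rightarrow> bool" where
  "solves S A X Y u f g \<longleftrightarrow> (\<exists>L H. cont_from S X L \<and> (\<forall>a\<in>A. L a = f a) \<and> cont_from (S \<times> unit_I) Y H \<and>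
     (\<forall>x\<in>S. H (x, 0) = u (L x) \<and> H (x, 1) = g x) \<and> (\<forall>a\<in>A. \<forall>s\<in>unit_I. H (a, s) = g a))"

text \<open>Homotopies on the boundary of the prism over \<open>S\<close> come from two sources
  below: one formula on the bottom, another on the sides and the top. Both parts are closed and meet
  over \<open>A \<times> {0}\<close>, where the formulas must agree.\<close>

lemma cell_boundary_glue:
  assumes cp: "cell_pair S A"
    and p: "cont_from (S \<times> unit_I) Z p"
    and q: "cont_from ((A \<times> unit_I \<union> S \<times> {1}) \<times> unit_I) Z q"
    and eq: "\<And>a s. a \<in> A \<Longrightarrow> s \<in> unit_I \<Longrightarrow> p (a, s) = q ((a, 0), s)"
  shows "cont_from ((A \<times> unit_I \<union> S \<times> {0, 1}) \<times> unit_I) Z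
     (\<lambda>y. if snd (fst y) = 0 then p (fst (fst y), snd y) else q y)"
proof -
  let ?B = "(A \<times> unit_I \<union> S \<times> {0, 1}) \<times> unit_I" and ?P = "(S \<times> {0::real}) \<times> unit_I"
    and ?Q = "(A \<times> unit_I \<union> S \<times> {1}) \<times> unit_I"
  have AS: "A \<subseteq> S" using cp hep_subset by (auto simp: cell_pair_def)
  have A: "closedin (top_of_set S) A" using cp by (auto simp: cell_pair_def hep_def)
  have I: "closedin (top_of_set unit_I) {0}" "closedin (top_of_set unit_I) {1}" by auto
  have c: "closedin (top_of_set (S \<times> unit_I)) (S \<times> {0})" "closedin (top_of_set (S \<times> unit_I)) (A \<times> unit_I \<union> S \<times> {1})"
    using I A by (auto intro!: closedin_Times_top_of_set closedin_Un)
  have "closedin (top_of_set ((S \<times> unit_I) \<times> unit_I)) ?P"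
       "closedin (top_of_set ((S \<times> unit_I) \<times> unit_I)) ?Q"
    by (rule closedin_Times_top_of_set[OF c(1)], simp) (rule closedin_Times_top_of_set[OF c(2)], simp)
  note cs = this
  have cl: "closedin (top_of_set ?B) ?P" "closedin (top_of_set ?B) ?Q"
    by (rule closedin_top_of_set_subset[OF cs(1)]; use AS in force)
       (rule closedin_top_of_set_subset[OF cs(2)]; use AS in force)
  have pc: "cont_from ?P Z (\<lambda>y. p (fst (fst y), snd y))"
    by (rule cont_from_compose[OF _ _ p]) (auto intro!: continuous_intros)
  have "cont_from ?B Z (\<lambda>x. if x \<in> ?P then p (fst (fst x), snd x) else q x)"
    by (rule cont_from_glue[OF cl _ pc q]) (use eq in auto)
  then show ?thesis
    by (rule cont_from_cong) (use AS in auto)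
qed

text \<open>The lift at time 1 is carried back along \<open>F\<close> by homotopy extension, which
  gives \<open>M\<close>. The solving homotopy is then carried back by homotopy extension on the
  prism, with \<open>u\<close> of \<open>M\<close> prescribed on the bottom and \<open>G\<close> on
  the sides and the top.\<close>

lemma solves_homotopy:
  assumes cp: "cell_pair S A" and u: "continuous_map X Y u"
    and F: "cont_from (A \<times> unit_I) X F" and G: "cont_from (S \<times> unit_I) Y G"
    and eq: "\<And>a s. a \<in> A \<Longrightarrow> s \<in> unit_I \<Longrightarrow> u (F (a, s)) = G (a, s)"
    and sol: "solves S A X Y u (\<lambda>a. F (a, 1)) (\<lambda>x. G (x, 1))"
  shows "solves S A X Y u (\<lambda>a. F (a, 0)) (\<lambda>x. G (x, 0))"
proof -
  have AS: "A \<subseteq> S" using cp hep_subset by (auto simp: cell_pair_def)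
  obtain L1 H1 where L1: "cont_from S X L1" "\<And>a. a \<in> A \<Longrightarrow> L1 a = F (a, 1)"
    and H1: "cont_from (S \<times> unit_I) Y H1" "\<And>x. x \<in> S \<Longrightarrow> H1 (x, 0) = u (L1 x)" "\<And>x. x \<in> S \<Longrightarrow> H1 (x, 1) = G (x, 1)"
      "\<And>a s. a \<in> A \<Longrightarrow> s \<in> unit_I \<Longrightarrow> H1 (a, s) = G (a, 1)"
    using sol unfolding solves_def by auto
  obtain M where M: "cont_from (S \<times> unit_I) X M" "\<And>x. x \<in> S \<Longrightarrow> M (x, 1) = L1 x"
    "\<And>a s. a \<in> A \<Longrightarrow> s \<in> unit_I \<Longrightarrow> M (a, s) = F (a, s)"
    using hep_extend_reverse[of S A, OF _ L1(1) F] cp L1(2) by (auto simp: cell_pair_def)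
  let ?T = "\<lambda>y. if snd (fst y) = 0 then u (M (fst (fst y), snd y)) else G (fst (fst y), snd y)"
  have "cont_from ((A \<times> unit_I \<union> S \<times> {0, 1}) \<times> unit_I) Y ?T"
  proof (rule cell_boundary_glue[OF cp, where p = "\<lambda>y. u (M y)" and q = "\<lambda>y. G (fst (fst y), snd y)"])
    show "cont_from (S \<times> unit_I) Y (\<lambda>y. u (M y))"
      using continuous_map_compose[OF M(1) u] by (simp add: o_def)
    show "cont_from ((A \<times> unit_I \<union> S \<times> {1}) \<times> unit_I) Y (\<lambda>y. G (fst (fst y), snd y))"
      by (rule cont_from_compose[OF _ _ G]) (use AS in \<open>auto intro!: continuous_intros\<close>)
  qed (use eq M in auto)
  then have T: "cont_from ((A \<times> unit_I \<union> S \<times> {0, 1}) \<times> unit_I) Y ?T" by simp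
  have hp: "hep (S \<times> unit_I) (A \<times> unit_I \<union> S \<times> {0, 1})" using cp by (simp add: cell_pair_def)
  obtain H where H: "cont_from ((S \<times> unit_I) \<times> unit_I) Y H" 
     "\<And>a s. a \<in> A \<times> unit_I \<union> S \<times> {0, 1} \<Longrightarrow> s \<in> unit_I \<Longrightarrow> H (a, s) = ?T (a, s)"
  proof (rule hep_extend_reverse[OF hp H1(1) T])
    fix a assume "a \<in> A \<times> unit_I \<union> S \<times> {0, 1::real}"
    then show "?T (a, 1) = H1 a" using H1 M AS eq by (cases a) auto
  qed blast
  have "cont_from (S \<times> unit_I) Y (\<lambda>y. H (y, 0))"
    by (rule cont_from_slice[OF H(1)]) auto
  moreover have "cont_from S X (\<lambda>x. M (x, 0))"
    by (rule cont_from_slice[OF M(1)]) auto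
  ultimately show ?thesis
    unfolding solves_def
    using AS M H(2) eq
    by (intro exI[of _ "\<lambda>x. M (x, 0)"] exI[of _ "\<lambda>y. H (y, 0)"]) auto
qed

text \<open>Solutions on neighbouring cells have to match, so the homotopy on \<open>A\<close> is
  prescribed as \<open>h\<close> instead of being stationary. Running \<open>g\<close> backwards
  along \<open>h\<close> gives a strictly commuting square; its solution is stationary on
  \<open>A\<close>, and a second extension turns the stationary part into \<open>h\<close>.\<close>

lemma solves_relative:
  assumes cp: "cell_pair S A" and u: "continuous_map X Y u"
    and f: "cont_from A X f" and h: "cont_from (A \<times> unit_I) Y h" and g: "cont_from S Y g"
    and hf: "\<And>a. a \<in> A \<Longrightarrow> h (a, 0) = u (f a)" and hg: "\<And>a. a \<in> A \<Longrightarrow> h (a, 1) = g a"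
    and sol: "\<And>g. cont_from S Y g \<Longrightarrow> (\<And>a. a \<in> A \<Longrightarrow> u (f a) = g a) \<Longrightarrow> solves S A X Y u f g"
  obtains L H where "cont_from S X L" "\<And>a. a \<in> A \<Longrightarrow> L a = f a" "cont_from (S \<times> unit_I) Y H"
     "\<And>x. x \<in> S \<Longrightarrow> H (x, 0) = u (L x)" "\<And>x. x \<in> S \<Longrightarrow> H (x, 1) = g x"
     "\<And>a s. a \<in> A \<Longrightarrow> s \<in> unit_I \<Longrightarrow> H (a, s) = h (a, s)"
proof -
  have AS: "A \<subseteq> S" using cp hep_subset by (auto simp: cell_pair_def)
  obtain G where G: "cont_from (S \<times> unit_I) Y G" "\<And>x. x \<in> S \<Longrightarrow> G (x, 1) = g x"
    "\<And>a s. a \<in> A \<Longrightarrow> s \<in> unit_I \<Longrightarrow> G (a, s) = h (a, s)"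
    using hep_extend_reverse[of S A, OF _ g h hg] cp by (auto simp: cell_pair_def)
  have "solves S A X Y u f (\<lambda>x. G (x, 0))"
    by (rule sol) (use G hf in \<open>auto intro: cont_from_slice\<close>)
  then obtain L H1 where L: "cont_from S X L" "\<And>a. a \<in> A \<Longrightarrow> L a = f a"
    and H1: "cont_from (S \<times> unit_I) Y H1" "\<And>x. x \<in> S \<Longrightarrow> H1 (x, 0) = u (L x)" "\<And>x. x \<in> S \<Longrightarrow> H1 (x, 1) = G (x, 0)"
      "\<And>a s. a \<in> A \<Longrightarrow> s \<in> unit_I \<Longrightarrow> H1 (a, s) = G (a, 0)"
    unfolding solves_def by auto
  \<comment> \<open>With prism height \<open>t\<close> and deformation time \<open>s\<close>, the
    side carries \<open>G (a, t * s)\<close>: stationary at \<open>s = 0\<close>, where it agrees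
    with \<open>H1\<close>, and equal to \<open>h\<close> at \<open>s = 1\<close>. On the top, where
    \<open>t = 1\<close>, it moves \<open>G (x, 0)\<close> to \<open>g x\<close>.\<close>
  let ?T = "\<lambda>y. if snd (fst y) = 0 then u (L (fst (fst y))) else G (fst (fst y), snd (fst y) * snd y)"
  have "cont_from ((A \<times> unit_I \<union> S \<times> {0, 1}) \<times> unit_I) Y
      (\<lambda>y. if snd (fst y) = 0 then u (L (fst (fst (fst y), snd y))) else G (fst (fst y), snd (fst y) * snd y))"
  proof (rule cell_boundary_glue[OF cp, where p = "\<lambda>z. u (L (fst z))"])
    have "cont_from S Y (\<lambda>x. u (L x))"
      using continuous_map_compose[OF L(1) u] by (simp add: o_def)
    then show "cont_from (S \<times> unit_I) Y (\<lambda>z::'a \<times> real. u (L (fst z)))"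
      by (rule cont_from_compose[rotated 2]) (auto intro!: continuous_intros)
    show "cont_from ((A \<times> unit_I \<union> S \<times> {1}) \<times> unit_I) Y (\<lambda>y. G (fst (fst y), snd (fst y) * snd y))"
      by (rule cont_from_compose[OF _ _ G(1)]) (use AS in \<open>auto intro!: continuous_intros mult_le_one\<close>)
  qed (use G hf L in auto)
  then have T: "cont_from ((A \<times> unit_I \<union> S \<times> {0, 1}) \<times> unit_I) Y ?T" by (simp only: fst_conv)
  have hp: "hep (S \<times> unit_I) (A \<times> unit_I \<union> S \<times> {0, 1})" using cp by (simp add: cell_pair_def)
  obtain H where H: "cont_from ((S \<times> unit_I) \<times> unit_I) Y H" 
     "\<And>a s. a \<in> A \<times> unit_I \<union> S \<times> {0, 1} \<Longrightarrow> s \<in> unit_I \<Longrightarrow> H (a, s) = ?T (a, s)"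
  proof (rule hep_extend[OF hp H1(1) T])
    fix a assume "a \<in> A \<times> unit_I \<union> S \<times> {0, 1::real}"
    then show "?T (a, 0) = H1 a" using H1 AS G(3) hf L(2) by (cases a) auto
  qed blast
  have "cont_from (S \<times> unit_I) Y (\<lambda>y. H (y, 1))"
    by (rule cont_from_slice[OF H(1)]) auto
  with L show ?thesis
  proof (rule that)
    fix a :: 'a and s :: real assume "a \<in> A" "s \<in> unit_I"
    then show "H ((a, s), 1) = h (a, s)" using G(3)[of a s] hf L by (auto simp: H(2))
  qed (use G in \<open>auto simp: H(2)\<close>)
qed

section \<open>Cubes\<close>

definition unit_cube :: "nat \<Rightarrow> (nat \<Rightarrow> real) set" where
  "unit_cube n = (\<Pi>\<^sub>E i\<in>{..<n}. {0..1})"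

text \<open>The product topology on functions extensional on the first \<open>n\<close> indices is
  induced from the function space, the remaining coordinates being constant. Cubes thus become
  subsets of a metric space, with \<open>continuous_on\<close> and Lebesgue numbers
  available.\<close>

lemma cube_eq_top_of_set: "cube n = top_of_set (unit_cube n)"
proof -
  have "continuous_map (cube n) (top_of_set (unit_cube n)) id"
    unfolding continuous_map_in_subtopology
  proof (intro conjI)
    show "id \<in> topspace (cube n) \<rightarrow> unit_cube n" by (auto simp: cube_def unit_cube_def)
    have "continuous_map (cube n) euclideanreal (\<lambda>x. x i)" for i
    proof (cases "i < n")
      case True
      then have "continuous_map (cube n) (top_of_set {0..1}) (\<lambda>x. x i)"
        unfolding cube_def by (intro continuous_map_product_projection) auto
      then show ?thesis by (simp add: continuous_map_in_subtopology)
    next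
      case False
      then have "x i = undefined" if "x \<in> topspace (cube n)" for x
        using that by (auto simp: cube_def PiE_def extensional_def)
      moreover have "continuous_map (cube n) euclideanreal (\<lambda>x. undefined)" by simp
      ultimately show ?thesis using continuous_map_eq by (metis (mono_tags, lifting))
    qed
    then show "continuous_map (cube n) euclidean id"
      unfolding euclidean_product_topology[symmetric] continuous_map_componentwise_UNIV by simp
  qed
  moreover have "continuous_map (top_of_set (unit_cube n)) (cube n) id"
  proof -
    have "continuous_map (top_of_set (unit_cube n)) (top_of_set {0..1}) (\<lambda>x. x i)" if "i < n" for i
    proof -
      have "x i \<in> {0..1}" if "x \<in> unit_cube n" for x
        using that \<open>i < n\<close> by (auto simp: unit_cube_def PiE_def Pi_def)
      moreover have "continuous_on (unit_cube n) (\<lambda>x. x i)"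
        by (rule continuous_on_subset[OF continuous_on_product_coordinates]) simp
      ultimately show ?thesis
        unfolding continuous_map_in_subtopology by force
    qed
    moreover have "unit_cube n \<subseteq> extensional {..<n}" by (auto simp: unit_cube_def PiE_def)
    ultimately show ?thesis
      unfolding cube_def continuous_map_componentwise by force
  qed
  ultimately have "homeomorphic_maps (cube n) (top_of_set (unit_cube n)) id id"
    by (simp add: homeomorphic_maps_def)
  then show ?thesis
    using homeomorphic_maps_imp_map homeomorphic_map_id by metis
qed

lemma topspace_cube: "topspace (cube n) = unit_cube n"
  by (simp add: cube_eq_top_of_set)

lemma cube_boundary_subset: "cube_boundary n \<subseteq> unit_cube n"
  by (auto simp: cube_boundary_def topspace_cube)

lemma compact_unit_cube: "compact (unit_cube n)"
proof -
  have "compact_space (cube n)"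
    unfolding cube_def by (intro compact_space_product_topology[THEN iffD2] disjI2 ballI)
      (simp add: compact_space_subtopology)
  then show ?thesis by (simp add: cube_eq_top_of_set compact_space_subtopology compact_space_def compactin_subtopology)
qed

lemma unit_cube_ext: "x \<in> unit_cube n \<Longrightarrow> y \<in> unit_cube n \<Longrightarrow> (\<And>i. i < n \<Longrightarrow> x i = y i) \<Longrightarrow> x = y"
  unfolding unit_cube_def by (rule PiE_ext) auto

lemma continuous_on_restrict_lessThan:
  fixes f :: "'k::topological_space \<Rightarrow> nat \<Rightarrow> real"
  assumes "\<And>i. i < n \<Longrightarrow> continuous_on S (\<lambda>x. f x i)"
  shows "continuous_on S (\<lambda>x. restrict (f x) {..<n})"
proof (rule continuous_on_coordinatewise_then_product)
  fix i show "continuous_on S (\<lambda>x. restrict (f x) {..<n} i)"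
    by (cases "i < n") (auto intro: assms)
qed

lemma continuous_on_coordinate:
  fixes f :: "'k::topological_space \<Rightarrow> nat \<Rightarrow> real"
  assumes "continuous_on S f" shows "continuous_on S (\<lambda>x. f x i)"
  using continuous_on_compose2[OF continuous_on_product_coordinates[of i] assms] by auto

section \<open>The cube as unit ball of a maximum norm about its centre, and radial projection in
  the prism over it\<close>

primrec cube_norm :: "nat \<Rightarrow> (nat \<Rightarrow> real) \<Rightarrow> real" where
  "cube_norm 0 x = 0"
| "cube_norm (Suc n) x = max (cube_norm n x) \<bar>2 * x n - 1\<bar>"

lemma cube_norm_le_iff: "cube_norm n x \<le> c \<longleftrightarrow> 0 \<le> c \<and> (\<forall>i<n. \<bar>2 * x i - 1\<bar> \<le> c)"
  by (induction n) (auto simp: less_Suc_eq)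

lemma cube_norm_ge: "i < n \<Longrightarrow> \<bar>2 * x i - 1\<bar> \<le> cube_norm n x"
  using cube_norm_le_iff[of n x "cube_norm n x"] by auto

lemma cube_norm_attained: "0 < cube_norm n x \<Longrightarrow> \<exists>i<n. \<bar>2 * x i - 1\<bar> = cube_norm n x"
  by (induction n) (auto simp: max_def less_Suc_eq split: if_splits)

lemma continuous_on_cube_norm [continuous_intros]:
  "continuous_on S f \<Longrightarrow> continuous_on S (\<lambda>x. cube_norm n (f x))"
  by (induction n) (auto intro!: continuous_intros intro: continuous_on_coordinate)

lemma unit_cube_iff: "x \<in> unit_cube n \<longleftrightarrow> x \<in> extensional {..<n} \<and> cube_norm n x \<le> 1"
  by (auto simp: unit_cube_def PiE_def Pi_def cube_norm_le_iff abs_le_iff)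

lemma cube_boundary_iff: "x \<in> cube_boundary n \<longleftrightarrow> x \<in> unit_cube n \<and> cube_norm n x = 1"
proof
  assume x: "x \<in> cube_boundary n"
  then obtain i where "x \<in> unit_cube n" "i < n" "x i = 0 \<or> x i = 1"
    by (auto simp: cube_boundary_def topspace_cube)
  then show "x \<in> unit_cube n \<and> cube_norm n x = 1"
    using cube_norm_ge[of i n x] by (auto simp: unit_cube_iff)
next
  assume x: "x \<in> unit_cube n \<and> cube_norm n x = 1"
  then obtain i where "i < n" "\<bar>2 * x i - 1\<bar> = 1" using cube_norm_attained[of n x] by auto
  then have "x i = 0 \<or> x i = 1" by arith
  then show "x \<in> cube_boundary n" using x \<open>i < n\<close> by (auto simp: cube_boundary_def topspace_cube)
qed

text \<open>Straight-line motion in \<open>unit_cube n \<times> unit_I\<close> away from the point at height \<open>2\<close> above the centre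
  of the cube; it ends on the bottom and the sides.  The motion backwards from that end reaches
  \<open>y\<close> at time \<open>1 - cube_dist n y\<close>.\<close>

definition cube_dist :: "nat \<Rightarrow> (nat \<Rightarrow> real) \<times> real \<Rightarrow> real" where
  "cube_dist n y = max (1 - snd y / 2) (cube_norm n (fst y))"

definition cube_push :: "nat \<Rightarrow> ((nat \<Rightarrow> real) \<times> real) \<times> real \<Rightarrow> (nat \<Rightarrow> real) \<times> real" where
  "cube_push n = (\<lambda>(y, s). let c = max (cube_dist n y) (1 - s) / cube_dist n y in
     (restrict (\<lambda>i. 1/2 + c * (fst y i - 1/2)) {..<n}, 2 - c * (2 - snd y)))"

definition cube_sides :: "nat \<Rightarrow> ((nat \<Rightarrow> real) \<times> real) set" where
  "cube_sides n = unit_cube n \<times> {0} \<union> cube_boundary n \<times> unit_I"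

lemma cube_dist_pos: "y \<in> unit_cube n \<times> unit_I \<Longrightarrow> 0 < cube_dist n y"
  by (auto simp: cube_dist_def max_def)

lemma cube_dist_le: "y \<in> unit_cube n \<times> unit_I \<Longrightarrow> cube_dist n y \<le> 1"
  by (auto simp: cube_dist_def unit_cube_iff)

lemma cube_dist_sides: "y \<in> cube_sides n \<Longrightarrow> cube_dist n y = 1"
  by (auto simp: cube_sides_def cube_dist_def cube_boundary_iff unit_cube_iff)

lemma continuous_on_cube_push: "continuous_on ((unit_cube n \<times> unit_I) \<times> unit_I) (cube_push n)"
proof -
  let ?D = "(unit_cube n \<times> unit_I) \<times> unit_I"
  have d: "continuous_on ?D (\<lambda>z. cube_dist n (fst z))"
    unfolding cube_dist_def by (intro continuous_intros) auto
  have ne: "\<forall>z\<in>?D. cube_dist n (fst z) \<noteq> 0"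
    using cube_dist_pos by force
  have c: "continuous_on ?D (\<lambda>z. max (cube_dist n (fst z)) (1 - snd z) / cube_dist n (fst z))"
    by (intro continuous_intros d ne)
  show ?thesis
    unfolding cube_push_def Let_def split_def
    by (intro continuous_on_Pair continuous_on_restrict_lessThan continuous_intros continuous_on_coordinate[of _ "\<lambda>z. fst (fst z)"] d) (use ne in auto)
qed

text \<open>\<open>cube_push\<close> at time \<open>s\<close> is the homothety with factor
  \<open>c\<close> about the point above the cube, and \<open>cube_dist\<close> is the gauge of this
  projection, with value 1 on the bottom and the sides. At time 0 the factor is the inverse of the
  gauge; from time \<open>1 - cube_dist n y\<close> on it is 1.\<close>

lemma cube_push_aux:
  assumes y: "y \<in> unit_cube n \<times> unit_I" and s: "s \<in> unit_I"
  defines "c \<equiv> max (cube_dist n y) (1 - s) / cube_dist n y"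
  shows "1 \<le> c" "c * cube_dist n y \<le> 1" "c * cube_norm n (fst y) \<le> 1" "c * (2 - snd y) \<le> 2"
    "cube_push n (y, s) = (restrict (\<lambda>i. 1/2 + c * (fst y i - 1/2)) {..<n}, 2 - c * (2 - snd y))"
    "cube_norm n (fst (cube_push n (y, s))) = c * cube_norm n (fst y)"
proof -
  let ?d = "cube_dist n y"
  have d: "0 < ?d" "?d \<le> 1" using cube_dist_pos cube_dist_le y by blast+
  show c1: "1 \<le> c" using d by (auto simp: c_def le_divide_eq)
  have cd: "c * ?d = max ?d (1 - s)" using d by (simp add: c_def)
  show c2: "c * ?d \<le> 1" using cd d s by auto
  have "cube_norm n (fst y) \<le> ?d" "1 - snd y / 2 \<le> ?d" by (auto simp: cube_dist_def)
  then have "c * cube_norm n (fst y) \<le> c * ?d" "c * (1 - snd y / 2) \<le> c * ?d" using c1 by (auto intro: mult_left_mono)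
  then show "c * cube_norm n (fst y) \<le> 1" "c * (2 - snd y) \<le> 2" using c2 by (auto simp: algebra_simps)
  show p: "cube_push n (y, s) = (restrict (\<lambda>i. 1/2 + c * (fst y i - 1/2)) {..<n}, 2 - c * (2 - snd y))"
    by (simp add: cube_push_def c_def Let_def)
  have "cube_norm m (fst (cube_push n (y, s))) = c * cube_norm m (fst y)" if "m \<le> n" for m
    using that
  proof (induction m)
    case (Suc m)
    have "\<bar>2 * fst (cube_push n (y, s)) m - 1\<bar> = \<bar>c * (2 * fst y m - 1)\<bar>"
      using Suc.prems by (simp add: p algebra_simps)
    also have "\<dots> = c * \<bar>2 * fst y m - 1\<bar>" using c1 by (simp add: abs_mult)
    finally show ?case using Suc c1 by (simp add: max_mult_distrib_left)
  qed simp
  then show "cube_norm n (fst (cube_push n (y, s))) = c * cube_norm n (fst y)" by blast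
qed

lemma cube_push_in:
  assumes y: "y \<in> unit_cube n \<times> unit_I" and s: "s \<in> unit_I"
  shows "cube_push n (y, s) \<in> unit_cube n \<times> unit_I"
proof -
  have "1 * (2 - snd y) \<le> (max (cube_dist n y) (1 - s) / cube_dist n y) * (2 - snd y)"
    using cube_push_aux(1)[OF y s] y by (intro mult_right_mono) auto
  then show ?thesis
    using cube_push_aux[OF y s] y by (auto simp: mem_Times_iff unit_cube_iff) 
qed

lemma cube_push_0:
  assumes y: "y \<in> unit_cube n \<times> unit_I"
  shows "cube_push n (y, 0) \<in> cube_sides n"
proof -
  have d: "0 < cube_dist n y" "cube_dist n y \<le> 1" using cube_dist_pos cube_dist_le y by blast+
  note aux = cube_push_aux[OF y, of 0, simplified]
  have c: "max (cube_dist n y) 1 / cube_dist n y = 1 / cube_dist n y" using d by (auto simp: max_def)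
  have i: "cube_push n (y, 0) \<in> unit_cube n \<times> unit_I" using cube_push_in[OF y] by simp
  show ?thesis
  \<comment> \<open>The larger term of the gauge tells where the ray leaves the prism: through the
    bottom or through the sides.\<close>
  proof (cases "1 - snd y / 2 \<ge> cube_norm n (fst y)")
    case True
    then have "2 - snd y = 2 * cube_dist n y" by (auto simp: cube_dist_def max_def)
    then have "snd (cube_push n (y, 0)) = 0" using d aux(5) c by simp
    then show ?thesis using i by (auto simp: cube_sides_def mem_Times_iff)
  next
    case False
    then have "cube_dist n y = cube_norm n (fst y)" by (auto simp: cube_dist_def max_def)
    then have "cube_norm n (fst (cube_push n (y, 0))) = 1" using d aux(6) c by simp
    then show ?thesis using i by (auto simp: cube_sides_def mem_Times_iff cube_boundary_iff)
  qed
qed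

lemma cube_push_end:
  assumes y: "y \<in> unit_cube n \<times> unit_I" and s: "1 - cube_dist n y \<le> s" "s \<le> 1"
  shows "cube_push n (y, s) = y"
proof -
  have d: "0 < cube_dist n y" "cube_dist n y \<le> 1" using cube_dist_pos cube_dist_le y by blast+
  have "max (cube_dist n y) (1 - s) / cube_dist n y = 1" using d s by (simp add: max_def)
  then have "cube_push n (y, s) = (restrict (fst y) {..<n}, snd y)"
    by (simp add: cube_push_def Let_def cong: restrict_cong)
  then show ?thesis using y by (auto simp: mem_Times_iff unit_cube_iff extensional_restrict prod_eq_iff)
qed

lemma cube_push_sides:
  "y \<in> cube_sides n \<Longrightarrow> s \<in> unit_I \<Longrightarrow> cube_push n (y, s) = y"
  using cube_push_end[of y n s] cube_dist_sides[of y n] cube_boundary_subset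
  by (auto simp: cube_sides_def)

lemma closed_cube_boundary: "closedin (top_of_set (unit_cube n)) (cube_boundary n)"
proof -
  have "cube_boundary n = {x \<in> topspace (top_of_set (unit_cube n)). cube_norm n x \<in> {1}}"
    by (auto simp: cube_boundary_iff)
  moreover have "closedin (top_of_set (unit_cube n)) {x \<in> topspace (top_of_set (unit_cube n)). cube_norm n x \<in> {1}}"
    by (rule closedin_continuous_map_preimage[of _ euclideanreal]) (auto intro!: continuous_intros)
  ultimately show ?thesis by metis
qed

text \<open>The retraction is radial projection, \<open>cube_push\<close> at time 0, which fixes the
  bottom and the sides.\<close>

lemma hep_cube: "hep (unit_cube n) (cube_boundary n)"
  unfolding hep_def
proof (intro conjI exI[of _ "\<lambda>y. cube_push n (y, 0)"] ballI)
  show "closedin (top_of_set (unit_cube n)) (cube_boundary n)" by (rule closed_cube_boundary)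
  show "continuous_on (unit_cube n \<times> unit_I) (\<lambda>y. cube_push n (y, 0))"
    by (rule continuous_on_compose2[OF continuous_on_cube_push]) (auto intro!: continuous_intros)
qed (use cube_push_0 cube_push_sides in \<open>auto simp: cube_sides_def\<close>)

lemma hep_homeo:
  assumes S: "hep S A" and pq: "homeomorphism T S p q" and B: "B = {y \<in> T. p y \<in> A}"
  shows "hep T B"
proof -
  obtain r where cA: "closedin (top_of_set S) A" and r: "continuous_on (S \<times> unit_I) r"
    "\<And>y. y \<in> S \<times> unit_I \<Longrightarrow> r y \<in> S \<times> {0} \<union> A \<times> unit_I"
    "\<And>y. y \<in> S \<times> {0} \<union> A \<times> unit_I \<Longrightarrow> r y = y"
    using S unfolding hep_def by blast
  have AS: "A \<subseteq> S" using hep_subset[OF S] .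
  have p: "continuous_on T p" "\<And>y. y \<in> T \<Longrightarrow> p y \<in> S" "\<And>y. y \<in> T \<Longrightarrow> q (p y) = y"
    and q: "continuous_on S q" "\<And>x. x \<in> S \<Longrightarrow> q x \<in> T" "\<And>x. x \<in> S \<Longrightarrow> p (q x) = x"
    using pq by (auto simp: homeomorphism_def)
  let ?r = "\<lambda>y. (q (fst (r (p (fst y), snd y))), snd (r (p (fst y), snd y)))"
  have rS: "fst (r (p (fst y), snd y)) \<in> S" if "y \<in> T \<times> unit_I" for y
  proof -
    have "r (p (fst y), snd y) \<in> S \<times> {0} \<union> A \<times> unit_I" using that p(2) by (intro r(2)) auto
    then show ?thesis using AS by auto
  qed
  have c: "continuous_on (T \<times> unit_I) (\<lambda>y. r (p (fst y), snd y))"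
    by (rule continuous_on_compose2[OF r(1)]) 
       (use p(2) in \<open>auto intro!: continuous_intros continuous_on_compose2[OF p(1)]\<close>)
  have "continuous_on (T \<times> unit_I) ?r"
    by (intro continuous_on_Pair continuous_on_compose2[OF q(1)] continuous_on_fst continuous_on_snd c)
       (use rS in auto)
  moreover have "?r y \<in> T \<times> {0} \<union> B \<times> unit_I" if y: "y \<in> T \<times> unit_I" for y
  proof -
    have "r (p (fst y), snd y) \<in> S \<times> {0} \<union> A \<times> unit_I" using y p(2) by (intro r(2)) auto
    then show ?thesis using AS q B by auto
  qed
  moreover have "?r y = y" if "y \<in> T \<times> {0} \<union> B \<times> unit_I" for y
  proof -
    have "r (p (fst y), snd y) = (p (fst y), snd y)" using that p(2) B by (intro r(3)) auto
    then show ?thesis using that p B by auto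
  qed
  moreover have "closedin (top_of_set T) B"
  proof -
    have "continuous_map (top_of_set T) (top_of_set S) p"
      using p by (auto simp: continuous_map_in_subtopology)
    from closedin_continuous_map_preimage[OF this cA] show ?thesis by (simp add: B)
  qed
  ultimately show ?thesis unfolding hep_def by blast
qed

lemma homeomorphism_Times_id:
  assumes "homeomorphism T S p q"
  shows "homeomorphism (T \<times> U) (S \<times> U) (\<lambda>y. (p (fst y), snd y)) (\<lambda>y. (q (fst y), snd y))"
proof -
  have p: "continuous_on T p" "p ` T = S" "\<And>y. y \<in> T \<Longrightarrow> q (p y) = y"
    and q: "continuous_on S q" "q ` S = T" "\<And>x. x \<in> S \<Longrightarrow> p (q x) = x"
    using assms by (auto simp: homeomorphism_def)
  have 1: "continuous_on (T \<times> U) (\<lambda>y. (p (fst y), snd y))"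
    by (intro continuous_intros continuous_on_compose2[OF p(1)]) auto
  have 2: "continuous_on (S \<times> U) (\<lambda>y. (q (fst y), snd y))"
    by (intro continuous_intros continuous_on_compose2[OF q(1)]) auto
  show ?thesis
    by (rule homeomorphismI[OF 1 2]) (use p q in auto)
qed

lemma cell_pair_homeo:
  assumes S: "cell_pair S A" and pq: "homeomorphism T S p q" and B: "B = {y \<in> T. p y \<in> A}"
  shows "cell_pair T B"
  unfolding cell_pair_def
proof
  show "hep T B" using hep_homeo[OF _ pq B] S by (simp add: cell_pair_def)
  have "p y \<in> S" if "y \<in> T" for y using pq that by (auto simp: homeomorphism_def)
  then show "hep (T \<times> unit_I) (B \<times> unit_I \<union> T \<times> {0, 1})"
    by (intro hep_homeo[OF _ homeomorphism_Times_id[OF pq]]) (use S B in \<open>auto simp: cell_pair_def\<close>)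
qed

lemma solves_homeo:
  assumes pq: "homeomorphism T S p q" and B: "B = {y \<in> T. p y \<in> A}" and AS: "A \<subseteq> S"
    and sol: "solves S A X Y u (\<lambda>x. f (q x)) (\<lambda>x. g (q x))"
  shows "solves T B X Y u f g"
proof -
  have p: "continuous_on T p" "\<And>y. y \<in> T \<Longrightarrow> p y \<in> S" "\<And>y. y \<in> T \<Longrightarrow> q (p y) = y"
    using pq by (auto simp: homeomorphism_def)
  obtain L H where L: "cont_from S X L" "\<And>a. a \<in> A \<Longrightarrow> L a = f (q a)"
    and H: "cont_from (S \<times> unit_I) Y H" "\<And>x. x \<in> S \<Longrightarrow> H (x, 0) = u (L x)" "\<And>x. x \<in> S \<Longrightarrow> H (x, 1) = g (q x)"
      "\<And>a s. a \<in> A \<Longrightarrow> s \<in> unit_I \<Longrightarrow> H (a, s) = g (q a)"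
    using sol unfolding solves_def by auto
  have "cont_from T X (\<lambda>y. L (p y))" by (rule cont_from_compose[OF p(1,2) L(1)])
  moreover have "cont_from (T \<times> unit_I) Y (\<lambda>y. H (p (fst y), snd y))"
    by (rule cont_from_compose[OF _ _ H(1)])
       (use p in \<open>auto intro!: continuous_intros continuous_on_compose2[OF p(1)]\<close>)
  ultimately show ?thesis
    unfolding solves_def using L(2) H(2-) p B
    by (intro exI[of _ "\<lambda>y. L (p y)"] exI[of _ "\<lambda>y. H (p (fst y), snd y)"]) auto
qed

text \<open>The relative form of a weak equivalence, free of base points. In dimension 0 the
  boundary is empty, and the condition says that every point of \<open>Y\<close> is joined by a path
  to the image of \<open>u\<close>.\<close>

definition compressible :: "'a topology \<Rightarrow> 'b topology \<Rightarrow> ('a \<Rightarrow> 'b) \<Rightarrow> bool" where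
  "compressible X Y u \<longleftrightarrow> continuous_map X Y u \<and>
     (\<forall>n f g. cont_from (cube_boundary n) X f \<and> cont_from (unit_cube n) Y g \<and>
        (\<forall>a\<in>cube_boundary n. u (f a) = g a) \<longrightarrow> solves (unit_cube n) (cube_boundary n) X Y u f g)"

lemma cube_norm_cong: "(\<And>i. i < n \<Longrightarrow> x i = y i) \<Longrightarrow> cube_norm n x = cube_norm n y"
  by (induction n) auto

lemma homeomorphism_cube_Suc:
  "homeomorphism (unit_cube n \<times> unit_I) (unit_cube (Suc n)) (\<lambda>y. (fst y)(n := snd y)) (\<lambda>x. (restrict x {..<n}, x n))"
proof -
  have c1: "continuous_on (unit_cube n \<times> unit_I) (\<lambda>y. (fst y)(n := snd y))"
  proof (rule continuous_on_coordinatewise_then_product)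
    fix i show "continuous_on (unit_cube n \<times> unit_I) (\<lambda>y. ((fst y)(n := snd y)) i)"
      using continuous_on_coordinate[of "unit_cube n \<times> unit_I" fst i, OF continuous_on_fst[OF continuous_on_id]]
      by (cases "i = n") (auto intro!: continuous_intros)
  qed
  have c2: "continuous_on (unit_cube (Suc n)) (\<lambda>x. (restrict x {..<n}, x n))"
    by (intro continuous_on_Pair continuous_on_restrict_lessThan)
       (auto intro: continuous_on_subset[OF continuous_on_product_coordinates])
  show ?thesis
    by (rule homeomorphismI[OF c1 c2])
       (auto simp: unit_cube_def PiE_def Pi_def extensional_def fun_eq_iff less_Suc_eq)
qed

lemma cube_boundary_Suc:
  "{y \<in> unit_cube n \<times> unit_I. (fst y)(n := snd y) \<in> cube_boundary (Suc n)} = cube_boundary n \<times> unit_I \<union> unit_cube n \<times> {0, 1}"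
proof -
  have "y \<in> unit_cube n \<times> unit_I \<Longrightarrow> (fst y)(n := snd y) \<in> cube_boundary (Suc n) \<longleftrightarrow>
      fst y \<in> cube_boundary n \<or> snd y = 0 \<or> snd y = 1" for y
  proof -
    assume y: "y \<in> unit_cube n \<times> unit_I"
    then have "(fst y)(n := snd y) \<in> unit_cube (Suc n)"
      using homeomorphism_cube_Suc[of n] unfolding homeomorphism_def by blast
    moreover have "cube_norm (Suc n) ((fst y)(n := snd y)) = max (cube_norm n (fst y)) \<bar>2 * snd y - 1\<bar>"
      using cube_norm_cong[of n "(fst y)(n := snd y)" "fst y"] by simp
    moreover have "cube_norm n (fst y) \<le> 1" "\<bar>2 * snd y - 1\<bar> \<le> 1" "fst y \<in> unit_cube n" 
      using y by (auto simp: unit_cube_iff abs_le_iff)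
    moreover have "max a \<bar>2 * s - 1\<bar> = 1 \<longleftrightarrow> a = 1 \<or> s = 0 \<or> s = 1"
      if "a \<le> 1" "\<bar>2 * s - 1\<bar> \<le> 1" for a s :: real
      using that by arith
    ultimately show ?thesis by (simp add: cube_boundary_iff)
  qed
  then show ?thesis using cube_boundary_subset by fastforce
qed

text \<open>The prism over a cube is the cube of the next dimension, with sides, bottom and top as
  its boundary, so both clauses come from \<open>hep_cube\<close>.\<close>

lemma cell_pair_cube: "cell_pair (unit_cube n) (cube_boundary n)"
  unfolding cell_pair_def
  using hep_cube hep_homeo[OF hep_cube homeomorphism_cube_Suc cube_boundary_Suc[symmetric]] by blast

text \<open>A Serre fibration lifts homotopies whose start is lifted; here a lift is given on the
  sides as well. The prism is a cube of the next dimension, and the radial motion, run from the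
  projected point back to \<open>y\<close>, is a homotopy on it that starts in the bottom and sides,
  where \<open>e\<close> lifts it. The lifted motion is read off at the moment when it reaches
  \<open>y\<close>.\<close>

lemma serre_relative_lift:
  assumes p: "serre_fibration E B p" and h: "cont_from (unit_cube n \<times> unit_I) B h"
    and e: "cont_from (cube_sides n) E e" and pe: "\<And>y. y \<in> cube_sides n \<Longrightarrow> p (e y) = h y"
  obtains H where "cont_from (unit_cube n \<times> unit_I) E H"
    "\<And>y. y \<in> unit_cube n \<times> unit_I \<Longrightarrow> p (H y) = h y" "\<And>y. y \<in> cube_sides n \<Longrightarrow> H y = e y"
proof -
  define a where "a = (\<lambda>y::(nat \<Rightarrow> real) \<times> real. (fst y)(n := snd y))"
  define b where "b = (\<lambda>x::nat \<Rightarrow> real. (restrict x {..<n}, x n))"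
  have hom: "homeomorphism (unit_cube n \<times> unit_I) (unit_cube (Suc n)) a b"
    unfolding a_def b_def by (rule homeomorphism_cube_Suc)
  then have a: "continuous_on (unit_cube n \<times> unit_I) a" "\<And>y. y \<in> unit_cube n \<times> unit_I \<Longrightarrow> a y \<in> unit_cube (Suc n)"
    "\<And>y. y \<in> unit_cube n \<times> unit_I \<Longrightarrow> b (a y) = y"
    and b: "continuous_on (unit_cube (Suc n)) b" "\<And>x. x \<in> unit_cube (Suc n) \<Longrightarrow> b x \<in> unit_cube n \<times> unit_I"
    unfolding homeomorphism_def by blast+
  let ?h = "\<lambda>z. h (cube_push n (b (fst z), snd z))" and ?g = "\<lambda>x. e (cube_push n (b x, 0))"
  have c: "continuous_on (unit_cube (Suc n) \<times> unit_I) (\<lambda>z. cube_push n (b (fst z), snd z))"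
  proof (rule continuous_on_compose2[OF continuous_on_cube_push])
    show "continuous_on (unit_cube (Suc n) \<times> unit_I) (\<lambda>z. (b (fst z), snd z))"
      by (intro continuous_on_Pair continuous_on_compose2[OF b(1)] continuous_on_fst continuous_on_snd continuous_on_id) auto
    show "(\<lambda>z. (b (fst z), snd z)) ` (unit_cube (Suc n) \<times> unit_I) \<subseteq> (unit_cube n \<times> unit_I) \<times> unit_I"
      using b(2) by (intro image_subsetI SigmaI) (simp_all add: mem_Times_iff)
  qed
  have 1: "cont_from (unit_cube (Suc n) \<times> unit_I) B ?h"
    by (rule cont_from_compose[OF c _ h], rule cube_push_in) (use b(2) in \<open>simp_all add: mem_Times_iff\<close>)
  have "continuous_on (unit_cube (Suc n)) (\<lambda>x. cube_push n (b x, 0))"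
  proof (rule continuous_on_compose2[OF continuous_on_cube_push])
    show "continuous_on (unit_cube (Suc n)) (\<lambda>x. (b x, 0::real))"
      by (intro continuous_on_Pair b(1) continuous_on_const)
    show "(\<lambda>x. (b x, 0)) ` (unit_cube (Suc n)) \<subseteq> (unit_cube n \<times> unit_I) \<times> unit_I"
      using b(2) by (intro image_subsetI SigmaI) simp_all
  qed
  then have 2: "cont_from (unit_cube (Suc n)) E ?g"
    by (rule cont_from_compose[OF _ _ e]) (use b cube_push_0 in auto)
  have 3: "p (?g x) = ?h (x, 0)" if "x \<in> unit_cube (Suc n)" for x
    using pe[OF cube_push_0[OF b(2)[OF that]]] by simp
  have "\<exists>K. cont_from (unit_cube (Suc n) \<times> unit_I) E K \<and>
     (\<forall>x\<in>unit_cube (Suc n). K (x, 0) = ?g x) \<and> 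
     (\<forall>x\<in>unit_cube (Suc n). \<forall>s\<in>unit_I. p (K (x, s)) = ?h (x, s))"
    using p[unfolded serre_fibration_def, THEN conjunct2, THEN spec, THEN spec, THEN spec, THEN mp, of "Suc n" ?h ?g]
    unfolding cube_eq_top_of_set prod_topology_subtopology_eu topspace_euclidean_subtopology
    using 1 2 3 by (elim meta_mp) simp_all
  then obtain K where K: "cont_from (unit_cube (Suc n) \<times> unit_I) E K"
     "\<And>x. x \<in> unit_cube (Suc n) \<Longrightarrow> K (x, 0) = ?g x" 
     "\<And>x s. x \<in> unit_cube (Suc n) \<Longrightarrow> s \<in> unit_I \<Longrightarrow> p (K (x, s)) = ?h (x, s)"
    by metis
  show ?thesis
  proof
    \<comment> \<open>Time \<open>1 - cube_dist n y\<close> and not 1: the motion has then arrived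
      at \<open>y\<close>, and on the bottom and the sides this time is 0, so the lift takes the
      value \<open>e y\<close> exactly.\<close>
    have "continuous_on (unit_cube n \<times> unit_I) (\<lambda>y. (a y, 1 - cube_dist n y))"
      unfolding cube_dist_def by (intro continuous_intros a(1)) auto
    then show "cont_from (unit_cube n \<times> unit_I) E (\<lambda>y. K (a y, 1 - cube_dist n y))"
      by (rule cont_from_compose[OF _ _ K(1)]) (use a(2) cube_dist_pos cube_dist_le in \<open>simp_all add: mem_Times_iff less_imp_le\<close>)
  next
    fix y assume y: "y \<in> unit_cube n \<times> unit_I"
    then have d: "1 - cube_dist n y \<in> unit_I" using cube_dist_pos[OF y] cube_dist_le[OF y] by auto
    show "p (K (a y, 1 - cube_dist n y)) = h y"
      using K(3)[OF a(2)[OF y] d] a(3)[OF y] cube_push_end[OF y, of "1 - cube_dist n y"] d by auto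
  next
    fix y assume ys: "y \<in> cube_sides n"
    then have y: "y \<in> unit_cube n \<times> unit_I" using cube_boundary_subset by (auto simp: cube_sides_def)
    show "K (a y, 1 - cube_dist n y) = e y"
      using cube_dist_sides[OF ys] K(2)[OF a(2)[OF y]] a(3)[OF y] cube_push_sides[OF ys, of 0] by simp
  qed
qed

section \<open>Weak homotopy equivalences are compressible\<close>

lemma solves_cong:
  assumes "solves S A X Y u f g" "\<And>a. a \<in> A \<Longrightarrow> f a = f' a" "\<And>x. x \<in> S \<Longrightarrow> g x = g' x" "A \<subseteq> S"
  shows "solves S A X Y u f' g'"
proof -
  obtain L H where "cont_from S X L" "\<And>a. a \<in> A \<Longrightarrow> L a = f a" "cont_from (S \<times> unit_I) Y H"
     "\<And>x. x \<in> S \<Longrightarrow> H (x, 0) = u (L x)" "\<And>x. x \<in> S \<Longrightarrow> H (x, 1) = g x"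
     "\<And>a s. a \<in> A \<Longrightarrow> s \<in> unit_I \<Longrightarrow> H (a, s) = g a"
    using assms(1) unfolding solves_def by auto
  then show ?thesis
    unfolding solves_def using assms(2-) by (intro exI[of _ L] exI[of _ H]) auto
qed

text \<open>Boundary data may be deformed in \<open>X\<close> at will: homotopy extension moves
  \<open>g\<close> along with them, and \<open>solves_homotopy\<close> brings a solution over the
  deformed data back to the given square.\<close>

lemma solves_deform:
  assumes cp: "cell_pair S A" and u: "continuous_map X Y u"
    and F: "cont_from (A \<times> unit_I) X F" and g: "cont_from S Y g" and eq: "\<And>a. a \<in> A \<Longrightarrow> u (F (a, 0)) = g a"
    and sol: "\<And>g'. cont_from S Y g' \<Longrightarrow> (\<And>a. a \<in> A \<Longrightarrow> u (F (a, 1)) = g' a) \<Longrightarrow> solves S A X Y u (\<lambda>a. F (a, 1)) g'"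
  shows "solves S A X Y u (\<lambda>a. F (a, 0)) g"
proof -
  have uF: "cont_from (A \<times> unit_I) Y (\<lambda>y. u (F y))"
    using continuous_map_compose[OF F u] by (simp add: o_def)
  obtain G where G: "cont_from (S \<times> unit_I) Y G" "\<And>x. x \<in> S \<Longrightarrow> G (x, 0) = g x"
    "\<And>a s. a \<in> A \<Longrightarrow> s \<in> unit_I \<Longrightarrow> G (a, s) = u (F (a, s))"
    using hep_extend[of S A, OF _ g uF eq] cp by (auto simp: cell_pair_def)
  have AS: "A \<subseteq> S" using cp hep_subset by (auto simp: cell_pair_def)
  have "solves S A X Y u (\<lambda>a. F (a, 0)) (\<lambda>x. G (x, 0))"
    by (rule solves_homotopy[OF cp u F G(1)]) (use G sol[OF cont_from_slice[OF G(1), of 1]] in auto)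
  then show ?thesis by (rule solves_cong) (use G AS in auto)
qed

section \<open>Homotopy classes on cubes, and injectivity and surjectivity of a weak equivalence on
  representatives\<close>

lemma cube_homotopic_iff:
  fixes X :: "'a topology"
  shows
  "cube_homotopic n X x f g \<longleftrightarrow> (\<exists>H. cont_from (unit_cube n \<times> unit_I) X H \<and>
     (\<forall>y\<in>unit_cube n. H (y, 0) = f y \<and> H (y, 1) = g y) \<and> (\<forall>a\<in>cube_boundary n. \<forall>s\<in>unit_I. H (a, s) = x))"
proof -
  \<comment> \<open>\<open>homotopic_with\<close> puts the time in the first factor, the prisms here
    in the second.\<close>
  have sw: "cont_from (A \<times> B) X (\<lambda>y. h (snd y, fst y))" if "cont_from (B \<times> A) X h" for A :: "'k::topological_space set" and B :: "'l::topological_space set" and h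
    by (rule cont_from_compose[OF _ _ that]) (auto intro!: continuous_intros)
  have "cube_homotopic n X x f g \<longleftrightarrow> (\<exists>h. cont_from (unit_I \<times> unit_cube n) X h \<and>
     (\<forall>y\<in>unit_cube n. h (0, y) = f y) \<and> (\<forall>y\<in>unit_cube n. h (1, y) = g y) \<and> (\<forall>s\<in>unit_I. \<forall>a\<in>cube_boundary n. h (s, a) = x))"
    unfolding cube_homotopic_def
  proof (subst homotopic_with)
    fix h k :: "(nat \<Rightarrow> real) \<Rightarrow> 'a" assume "\<And>y. y \<in> topspace (cube n) \<Longrightarrow> h y = k y"
    then have "h a = k a" if "a \<in> cube_boundary n" for a
      using that cube_boundary_subset by (auto simp: cube_eq_top_of_set)
    then show "(\<forall>t\<in>cube_boundary n. h t = x) = (\<forall>t\<in>cube_boundary n. k t = x)" by simp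
  qed (simp add: cube_eq_top_of_set)
  also have "\<dots> \<longleftrightarrow> (\<exists>H. cont_from (unit_cube n \<times> unit_I) X H \<and>
     (\<forall>y\<in>unit_cube n. H (y, 0) = f y \<and> H (y, 1) = g y) \<and> (\<forall>a\<in>cube_boundary n. \<forall>s\<in>unit_I. H (a, s) = x))"
    (is "?l \<longleftrightarrow> ?r")
  proof
    assume ?l then show ?r using sw[of unit_I "unit_cube n"] by (elim exE) (rule exI, force)
  next
    assume ?r then show ?l using sw[of "unit_cube n" unit_I] by (elim exE) (rule exI, force)
  qed
  finally show ?thesis .
qed

lemma cube_loops_iff:
  "g \<in> cube_loops n X x \<longleftrightarrow> cont_from (unit_cube n) X g \<and> (\<forall>a\<in>cube_boundary n. g a = x)"
  by (auto simp: cube_loops_def cube_eq_top_of_set)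

lemma cube_homotopic_refl: "g \<in> cube_loops n X x \<Longrightarrow> cube_homotopic n X x g g"
  by (simp add: cube_homotopic_def cube_loops_def)

lemma cube_homotopic_sym: "cube_homotopic n X x f g \<Longrightarrow> cube_homotopic n X x g f"
  unfolding cube_homotopic_def by (rule homotopic_with_symD)

lemma cube_homotopic_trans: "cube_homotopic n X x f g \<Longrightarrow> cube_homotopic n X x g h \<Longrightarrow> cube_homotopic n X x f h"
  unfolding cube_homotopic_def by (rule homotopic_with_trans)

lemma cube_homotopic_loops:
  assumes "cube_homotopic n X x f g" shows "f \<in> cube_loops n X x" "g \<in> cube_loops n X x"
  using homotopic_with_imp_continuous_maps[OF assms[unfolded cube_homotopic_def]]
    homotopic_with_imp_property[OF assms[unfolded cube_homotopic_def]]
  by (auto simp: cube_loops_def)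

lemma cube_homotopic_compose:
  assumes "cube_homotopic n X x f g" "continuous_map X Y u"
  shows "cube_homotopic n Y (u x) (u \<circ> f) (u \<circ> g)"
  using assms unfolding cube_homotopic_def
  by (rule homotopic_with_compose_continuous_map_left) auto

lemma homotopy_classes_eq: "homotopy_classes n X x = (\<lambda>g. {h. cube_homotopic n X x g h}) ` cube_loops n X x"
  by (auto simp: homotopy_classes_def quotient_def)

lemma weak_homotopy_equivalence_surj:
  assumes w: "weak_homotopy_equivalence X Y u" and n: "1 \<le> n" and x: "x \<in> topspace X" and g: "g \<in> cube_loops n Y (u x)"
  obtains h where "h \<in> cube_loops n X x" "cube_homotopic n Y (u x) (u \<circ> h) g"
proof -
  have "homotopy_classes n Y (u x) = homotopy_classes_map n Y u x ` homotopy_classes n X x"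
    using w n x by (auto simp: weak_homotopy_equivalence_def bij_betw_def)
  moreover have "{h. cube_homotopic n Y (u x) g h} \<in> homotopy_classes n Y (u x)"
    using g by (auto simp: homotopy_classes_eq)
  ultimately obtain c where c: "c \<in> homotopy_classes n X x" "{h. cube_homotopic n Y (u x) g h} = homotopy_classes_map n Y u x c"
    by auto
  have "g \<in> homotopy_classes_map n Y u x c" using c(2) cube_homotopic_refl[OF g] by auto
  then obtain h where h: "h \<in> c" "cube_homotopic n Y (u x) (u \<circ> h) g"
    by (auto simp: homotopy_classes_map_def)
  obtain k where "cube_homotopic n X x k h" using h(1) c(1) by (auto simp: homotopy_classes_eq)
  then show ?thesis
    by (rule that[OF cube_homotopic_loops(2) h(2)])
qed

lemma weak_homotopy_equivalence_inj:
  assumes w: "weak_homotopy_equivalence X Y u" and n: "1 \<le> n" and x: "x \<in> topspace X"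
    and g: "g \<in> cube_loops n X x" and h: "h \<in> cube_loops n X x" and ug: "cube_homotopic n Y (u x) (u \<circ> g) (u \<circ> h)"
  shows "cube_homotopic n X x g h"
proof -
  have u: "continuous_map X Y u" using w by (simp add: weak_homotopy_equivalence_def)
  have map: "homotopy_classes_map n Y u x {h. cube_homotopic n X x g h} = {h. cube_homotopic n Y (u x) (u \<circ> g) h}"
    if "g \<in> cube_loops n X x" for g
  proof (intro equalityI subsetI)
    fix k assume "k \<in> homotopy_classes_map n Y u x {h. cube_homotopic n X x g h}"
    then obtain h where "cube_homotopic n X x g h" "cube_homotopic n Y (u x) (u \<circ> h) k"
      by (auto simp: homotopy_classes_map_def)
    then show "k \<in> {h. cube_homotopic n Y (u x) (u \<circ> g) h}"
      using cube_homotopic_trans[OF cube_homotopic_compose[OF _ u]] by simp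
  next
    fix k assume "k \<in> {h. cube_homotopic n Y (u x) (u \<circ> g) h}"
    then show "k \<in> homotopy_classes_map n Y u x {h. cube_homotopic n X x g h}"
      using cube_homotopic_refl[OF that] by (auto simp: homotopy_classes_map_def)
  qed
  have "inj_on (homotopy_classes_map n Y u x) (homotopy_classes n X x)"
    using w n x by (auto simp: weak_homotopy_equivalence_def bij_betw_def)
  moreover have "{k. cube_homotopic n Y (u x) (u \<circ> g) k} = {k. cube_homotopic n Y (u x) (u \<circ> h) k}"
    by (intro Collect_cong iffI) (erule cube_homotopic_trans[OF cube_homotopic_sym[OF ug]], erule cube_homotopic_trans[OF ug])
  then have "homotopy_classes_map n Y u x {k. cube_homotopic n X x g k} = homotopy_classes_map n Y u x {k. cube_homotopic n X x h k}"
    using map g h by simp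
  ultimately have "{k. cube_homotopic n X x g k} = {k. cube_homotopic n X x h k}"
    by (rule inj_onD) (use g h in \<open>auto simp: homotopy_classes_eq\<close>)
  then show ?thesis using cube_homotopic_refl[OF h] by auto
qed

lemma weak_homotopy_equivalence_pi0_surj:
  assumes w: "weak_homotopy_equivalence X Y u" and y: "y \<in> topspace Y"
  obtains x where "x \<in> topspace X" "path_component_of Y (u x) y"
proof -
  have "path_components_of Y = (\<lambda>C. {y. \<exists>x\<in>C. path_component_of Y (u x) y}) ` path_components_of X"
    using w by (simp add: weak_homotopy_equivalence_def bij_betw_def)
  moreover have "path_component_of_set Y y \<in> path_components_of Y" using y by (simp add: path_component_in_path_components_of)
  ultimately obtain C where C: "C \<in> path_components_of X" "path_component_of_set Y y = {y. \<exists>x\<in>C. path_component_of Y (u x) y}"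
    by blast
  have "y \<in> path_component_of_set Y y" using y by (simp add: path_component_of_refl)
  then obtain x where "x \<in> C" "path_component_of Y (u x) y" using C(2) by blast
  then show ?thesis using that C(1) path_components_of_subset by blast
qed

lemma weak_homotopy_equivalence_pi0_inj:
  assumes w: "weak_homotopy_equivalence X Y u" and x: "x \<in> topspace X" "x' \<in> topspace X"
    and p: "path_component_of Y (u x) (u x')"
  shows "path_component_of X x x'"
proof -
  have u: "continuous_map X Y u" using w by (simp add: weak_homotopy_equivalence_def)
  let ?m = "\<lambda>C. {y. \<exists>x\<in>C. path_component_of Y (u x) y}"
  have map: "?m (path_component_of_set X x) = path_component_of_set Y (u x)" if "x \<in> topspace X" for x
  proof (intro equalityI subsetI)
    fix y assume "y \<in> ?m (path_component_of_set X x)"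
    then obtain z where "path_component_of X x z" "path_component_of Y (u z) y" by blast
    then show "y \<in> path_component_of_set Y (u x)"
      using path_component_of_trans[OF path_component_of_continuous_image[OF u]] by simp
  next
    fix y assume "y \<in> path_component_of_set Y (u x)"
    then show "y \<in> ?m (path_component_of_set X x)"
      using that path_component_of_refl[of X x] by (intro CollectI bexI[of _ x]) auto
  qed
  have "inj_on ?m (path_components_of X)" using w by (simp add: weak_homotopy_equivalence_def bij_betw_def)
  moreover have "path_component_of_set Y (u x) = path_component_of_set Y (u x')"
    using iffD1[OF path_component_of_equiv p] by simp
  then have "?m (path_component_of_set X x) = ?m (path_component_of_set X x')"
    using map x by simp
  ultimately have "path_component_of_set X x = path_component_of_set X x'"
    by (rule inj_onD) (use x in \<open>auto simp: path_component_in_path_components_of\<close>)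
  moreover have "x' \<in> path_component_of_set X x'" using x by (simp add: path_component_of_refl)
  ultimately show ?thesis by blast
qed

lemma unit_cube_0: "unit_cube 0 = {\<lambda>_. undefined}" "cube_boundary 0 = {}"
  by (auto simp: unit_cube_def cube_boundary_def)

lemma pathin_iff_cont_from: "pathin X g \<longleftrightarrow> cont_from unit_I X g"
  by (simp add: pathin_def)

lemma path_component_of_cube_0:
  assumes "path_component_of X x y"
  obtains H where "cont_from (unit_cube 0 \<times> unit_I) X H" "\<And>a. H (a, 0) = x" "\<And>a. H (a, 1) = y"
proof -
  obtain g where g: "cont_from unit_I X g" "g 0 = x" "g 1 = y"
    using assms by (auto simp: path_component_of_def pathin_iff_cont_from)
  show ?thesis
    by (rule that[of "\<lambda>z. g (snd z)"], rule cont_from_compose[OF _ _ g(1)]) 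
       (use g in \<open>auto intro!: continuous_intros\<close>)
qed

text \<open>Injectivity of \<open>u\<close>, on path components for \<open>n = 0\<close> and on
  homotopy classes otherwise. The contraction \<open>M\<close> is not claimed to lie over
  \<open>H\<close>; the discrepancy is absorbed later by surjectivity one dimension higher.\<close>

lemma weak_equivalence_homotopy_lift:
  assumes w: "weak_homotopy_equivalence X Y u" and x: "x \<in> topspace X"
    and a: "cont_from (unit_cube n) X a" "\<And>z. z \<in> cube_boundary n \<Longrightarrow> a z = x"
    and H: "cont_from (unit_cube n \<times> unit_I) Y H" "\<And>z. z \<in> unit_cube n \<Longrightarrow> H (z, 0) = u (a z)"
      "\<And>z. z \<in> unit_cube n \<Longrightarrow> H (z, 1) = u x" "\<And>z s. z \<in> cube_boundary n \<Longrightarrow> s \<in> unit_I \<Longrightarrow> H (z, s) = u x"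
  obtains M where "cont_from (unit_cube n \<times> unit_I) X M" "\<And>z. z \<in> unit_cube n \<Longrightarrow> M (z, 0) = a z"
      "\<And>z. z \<in> unit_cube n \<Longrightarrow> M (z, 1) = x" "\<And>z s. z \<in> cube_boundary n \<Longrightarrow> s \<in> unit_I \<Longrightarrow> M (z, s) = x"
proof (cases "n = 0")
  case True
  let ?o = "\<lambda>_::nat. undefined::real"
  have o: "?o \<in> unit_cube n" by (simp add: True unit_cube_0)
  have "cont_from unit_I Y (\<lambda>s. H (?o, s))"
    by (rule cont_from_compose[OF _ _ H(1)]) (use o in \<open>auto intro!: continuous_intros\<close>)
  then have "path_component_of Y (u (a ?o)) (u x)"
    unfolding path_component_of_def pathin_iff_cont_from using H o by (intro exI[of _ "\<lambda>s. H (?o, s)"]) auto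
  then have "path_component_of X (a ?o) x"
    by (rule weak_homotopy_equivalence_pi0_inj[OF w cont_from_in[OF a(1) o] x])
  then show ?thesis
  proof (rule path_component_of_cube_0)
    fix H assume H: "cont_from (unit_cube 0 \<times> unit_I) X H" "\<And>b. H (b, 0) = a ?o" "\<And>b. H (b, 1) = x"
    show ?thesis
      by (rule that[of H]) (use H True in \<open>auto simp: unit_cube_0\<close>)
  qed
next
  case False
  have u: "continuous_map X Y u" using w by (simp add: weak_homotopy_equivalence_def)
  have "cube_homotopic n X x a (\<lambda>_. x)"
  proof (rule weak_homotopy_equivalence_inj[OF w _ x])
    show "1 \<le> n" using False by simp
    show "a \<in> cube_loops n X x" "(\<lambda>_. x) \<in> cube_loops n X x" using a x by (auto simp: cube_loops_iff)
    show "cube_homotopic n Y (u x) (u \<circ> a) (u \<circ> (\<lambda>_. x))"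
      unfolding cube_homotopic_iff using H by (intro exI[of _ H]) auto
  qed
  then show ?thesis using that unfolding cube_homotopic_iff by auto
qed

text \<open>Straight-line contraction of the prism to the centre of its top face. This point lies in
  the union of sides and top, to which the prism retracts, so that union is contractible as
  well.\<close>

definition cube_segment :: "nat \<Rightarrow> ((nat \<Rightarrow> real) \<times> real) \<times> real \<Rightarrow> (nat \<Rightarrow> real) \<times> real" where
  "cube_segment n = (\<lambda>((x, s), t). (restrict (\<lambda>i. (1 - t) * x i + t / 2) {..<n}, (1 - t) * s + t))"

lemma cube_segment_0: "y \<in> unit_cube n \<times> unit_I \<Longrightarrow> cube_segment n (y, 0) = y"
  by (auto simp: cube_segment_def unit_cube_iff extensional_restrict)

lemma cube_segment_1: "cube_segment n (y, 1) = (restrict (\<lambda>_. 1/2) {..<n}, 1)"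
  by (cases y) (auto simp: cube_segment_def)

lemma cube_segment_in:
  assumes "y \<in> unit_cube n \<times> unit_I" "t \<in> unit_I"
  shows "cube_segment n (y, t) \<in> unit_cube n \<times> unit_I"
proof -
  have *: "0 \<le> (1 - t) * a + t * b" "(1 - t) * a + t * b \<le> 1" if "0 \<le> a" "a \<le> 1" "0 \<le> b" "b \<le> 1" for a b :: real
    using that assms(2) convex_bound_le[of a 1 b "1 - t" t] by auto
  show ?thesis using assms *(1)[of _ "1/2"] *(2)[of _ "1/2"] *(1)[of _ 1] *(2)[of _ 1]
    by (auto simp: cube_segment_def unit_cube_def PiE_def Pi_def)
qed

lemma continuous_on_cube_segment: "continuous_on ((unit_cube n \<times> unit_I) \<times> unit_I) (cube_segment n)"
  unfolding cube_segment_def split_def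
  by (intro continuous_on_Pair continuous_on_restrict_lessThan continuous_intros continuous_on_coordinate[of _ "\<lambda>z. fst (fst z)"]) auto

text \<open>Injectivity in dimension \<open>n\<close> and surjectivity in dimension
  \<open>n + 1\<close> together give compression for the cell of dimension \<open>n + 1\<close>. The
  sides and top \<open>?J\<close> are contractible, so the boundary data become constant there; what
  remains on the bottom is contracted by injectivity, which makes all boundary data constant; the
  map to \<open>Y\<close> is then a loop, and surjectivity lifts it.\<close>

lemma weak_homotopy_equivalence_compressible_cell:
  assumes w: "weak_homotopy_equivalence X Y u" 
    and f: "cont_from (cube_boundary n \<times> unit_I \<union> unit_cube n \<times> {0, 1}) X f"
    and g: "cont_from (unit_cube n \<times> unit_I) Y g"
    and eq: "\<And>a. a \<in> cube_boundary n \<times> unit_I \<union> unit_cube n \<times> {0, 1} \<Longrightarrow> u (f a) = g a"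
  shows "solves (unit_cube n \<times> unit_I) (cube_boundary n \<times> unit_I \<union> unit_cube n \<times> {0, 1}) X Y u f g"
proof -
  have u: "continuous_map X Y u" using w by (simp add: weak_homotopy_equivalence_def)
  let ?C = "unit_cube n" and ?b = "cube_boundary n"
  let ?S = "?C \<times> unit_I" and ?A = "?b \<times> unit_I \<union> ?C \<times> {0, 1}" and ?J = "?b \<times> unit_I \<union> ?C \<times> {1}"
  have bC: "?b \<subseteq> ?C" by (rule cube_boundary_subset)
  have AS: "?A \<subseteq> ?S" and JA: "?J \<subseteq> ?A" using bC by auto
  have cpS: "cell_pair ?S ?A"
    using cell_pair_homeo[OF cell_pair_cube homeomorphism_cube_Suc cube_boundary_Suc[symmetric]] .
  \<comment> \<open>Reversing the height turns the retraction onto bottom and sides into a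
    retraction \<open>\<rho>\<close> onto \<open>?J\<close>, the sides and the top.\<close>
  define flip where "flip y = (fst y, 1 - snd y)" for y :: "(nat \<Rightarrow> real) \<times> real"
  define \<rho> where "\<rho> y = flip (cube_push n (flip y, 0))" for y
  have flip_S: "flip y \<in> ?S" if "y \<in> ?S" for y using that by (auto simp: flip_def)
  have rho_J: "\<rho> y \<in> ?J" if "y \<in> ?S" for y
    using cube_push_0[OF flip_S[OF that]] by (auto simp: \<rho>_def flip_def cube_sides_def)
  have rho_id: "\<rho> y = y" if "y \<in> ?J" for y
  proof -
    have "flip y \<in> cube_sides n" using that by (auto simp: flip_def cube_sides_def)
    then show ?thesis by (simp add: \<rho>_def cube_push_sides) (simp add: flip_def)
  qed
  have rho_c: "continuous_on ?S \<rho>"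
  proof -
    have "continuous_on ?S (\<lambda>y. cube_push n (flip y, 0))"
    proof (rule continuous_on_compose2[OF continuous_on_cube_push])
      show "continuous_on ?S (\<lambda>y. (flip y, 0::real))" unfolding flip_def by (intro continuous_intros)
      show "(\<lambda>y. (flip y, 0)) ` ?S \<subseteq> ?S \<times> unit_I"
        using flip_S by (intro image_subsetI SigmaI) simp_all
    qed
    then show ?thesis unfolding \<rho>_def flip_def[of "cube_push n z" for z] by (intro continuous_intros)
  qed
  define top where "top = cube_segment n (undefined, 1)"
  have seg1: "cube_segment n (y, 1) = top" for y by (simp add: top_def cube_segment_1)
  have top: "top \<in> ?J"
    using cube_segment_1[of n undefined] by (auto simp: top_def unit_cube_def)
  define x where "x = f top"
  have x: "x \<in> topspace X" using cont_from_in[OF f] top JA by (auto simp: x_def)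
  have fJ: "cont_from ?J X f" using cont_from_subset[OF f JA] .
  have q_in: "cube_segment n z \<in> ?S" if "z \<in> ?S \<times> unit_I" for z
    using that cube_segment_in[of "fst z" n "snd z"] by (simp add: mem_Times_iff)
  \<comment> \<open>Contracting the prism to \<open>top\<close> and retracting to \<open>?J\<close>
    gives on \<open>?J\<close> a homotopy that starts at \<open>f\<close> and ends at the constant
    \<open>x\<close>.\<close>
  have q: "cont_from (?S \<times> unit_I) X (\<lambda>z. f (\<rho> (cube_segment n z)))"
  proof (rule cont_from_compose[OF _ _ fJ])
    show "continuous_on (?S \<times> unit_I) (\<lambda>z. \<rho> (cube_segment n z))"
      by (rule continuous_on_compose2[OF rho_c continuous_on_cube_segment]) (use q_in in blast)
  qed (use q_in rho_J in blast)
  let ?q = "\<lambda>z. f (\<rho> (cube_segment n z))"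
  have q0: "?q (y, 0) = f y" if "y \<in> ?J" for y
    using that JA AS by (subst cube_segment_0) (auto simp: rho_id)
  have q1: "?q (y, 1) = x" for y
    by (simp add: seg1 rho_id[OF top] x_def)
  have f0: "cont_from ?C X (\<lambda>y. f (y, 0))"
    by (rule cont_from_compose[OF _ _ f]) (auto intro!: continuous_intros)
  have h0: "cont_from (?b \<times> unit_I) X (\<lambda>z. ?q ((fst z, 0), snd z))"
    by (rule cont_from_compose[OF _ _ q])
       (use bC in \<open>auto intro!: continuous_on_Pair continuous_on_fst continuous_on_snd continuous_on_id continuous_on_const\<close>)
  \<comment> \<open>The homotopy on \<open>?J\<close> dictates the motion of the rim of the bottom
    face; homotopy extension spreads it over the face and leaves a map \<open>P (z, 1)\<close> that
    is constant on the rim.\<close>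
  obtain P where P: "cont_from (?C \<times> unit_I) X P" "\<And>y. y \<in> ?C \<Longrightarrow> P (y, 0) = f (y, 0)"
      "\<And>a s. a \<in> ?b \<Longrightarrow> s \<in> unit_I \<Longrightarrow> P (a, s) = ?q ((a, 0), s)"
    by (rule hep_extend[OF hep_cube f0 h0]) (use q0 in auto)
  define F where "F = (\<lambda>y. if snd (fst y) = 0 then P (fst (fst y), snd y) else ?q y)"
  have F: "cont_from (?A \<times> unit_I) X F"
    unfolding F_def
  proof (rule cell_boundary_glue[OF cell_pair_cube P(1)])
    show "cont_from (?J \<times> unit_I) X ?q" by (rule cont_from_subset[OF q]) (use bC in auto)
  qed (use P in auto)
  have F0: "F (a, 0) = f a" if "a \<in> ?A" for a
    using that P(2) q0[of a] bC by (auto simp: F_def)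
  have "solves ?S ?A X Y u (\<lambda>a. F (a, 0)) g"
  proof (rule solves_deform[OF cpS u F g])
    show "u (F (a, 0)) = g a" if "a \<in> ?A" for a using F0[OF that] eq[OF that] by simp
    fix g1 assume g1: "cont_from ?S Y g1" and ug1: "\<And>a. a \<in> ?A \<Longrightarrow> u (F (a, 1)) = g1 a"
    have Px: "P (z, 1) = x" if "z \<in> ?b" for z using P(3)[OF that, of 1] q1 by simp
    have F1: "F (a, 1) = (if snd a = 0 then P (fst a, 1) else x)" if "a \<in> ?A" for a
      by (simp add: F_def q1)
    \<comment> \<open>Read with the height as time, \<open>g1\<close> contracts the image of the
      bottom map to \<open>u x\<close>; by injectivity the bottom map itself is contractible
      relative to its rim.\<close>
    obtain M where M: "cont_from ?S X M" "\<And>z. z \<in> ?C \<Longrightarrow> M (z, 0) = P (z, 1)"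
      "\<And>z. z \<in> ?C \<Longrightarrow> M (z, 1) = x" "\<And>z s. z \<in> ?b \<Longrightarrow> s \<in> unit_I \<Longrightarrow> M (z, s) = x"
    proof (rule weak_equivalence_homotopy_lift[OF w x, of n "\<lambda>z. P (z, 1)" g1])
      show "cont_from ?C X (\<lambda>z. P (z, 1))" by (rule cont_from_slice[OF P(1)]) simp
      show "g1 (z, 0) = u (P (z, 1))" if "z \<in> ?C" for z using ug1[of "(z, 0)"] F1[of "(z, 0)"] that by simp
      show "g1 (z, 1) = u x" if "z \<in> ?C" for z using ug1[of "(z, 1)"] F1[of "(z, 1)"] that by simp
      show "g1 (z, s) = u x" if "z \<in> ?b" "s \<in> unit_I" for z s
        using ug1[of "(z, s)"] F1[of "(z, s)"] Px that by (cases "s = 0") auto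
    qed (use g1 Px in auto)
    \<comment> \<open>\<open>M\<close> extends the present boundary data over the whole prism, so
      contracting the prism to \<open>top\<close> deforms them to the constant
      \<open>x\<close>.\<close>
    let ?F = "\<lambda>z. M (cube_segment n z)"
    have cM: "cont_from (?S \<times> unit_I) X ?F"
      by (rule cont_from_compose[OF continuous_on_cube_segment q_in M(1)])
    have FM: "F (a, 1) = ?F (a, 0)" if "a \<in> ?A" for a
    proof -
      have "a \<in> ?S" using that AS by blast
      then have "?F (a, 0) = M a" by (simp add: cube_segment_0)
      also have "\<dots> = F (a, 1)" unfolding F1[OF that] using that M(2-4) Px bC by (cases a) auto
      finally show ?thesis by simp
    qed
    have "solves ?S ?A X Y u (\<lambda>a. ?F (a, 0)) g1"
    proof (rule solves_deform[OF cpS u _ g1])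
      show "cont_from (?A \<times> unit_I) X ?F" by (rule cont_from_subset[OF cM]) (use AS in blast)
      show "u (?F (a, 0)) = g1 a" if "a \<in> ?A" for a using ug1[OF that] FM[OF that] by simp
      fix g2 assume g2: "cont_from ?S Y g2" and ug2: "\<And>a. a \<in> ?A \<Longrightarrow> u (?F (a, 1)) = g2 a"
      have Fx: "?F (a, 1) = x" for a
        using M(3) bC top by (auto simp: top_def cube_segment_1 unit_cube_def)
      let ?p = "\<lambda>y. (fst y)(n := snd y)" and ?r = "\<lambda>x. (restrict x {..<n}, x n)"
      have hom: "homeomorphism ?S (unit_cube (Suc n)) ?p ?r" by (rule homeomorphism_cube_Suc)
      have rS: "?r y \<in> ?S" if "y \<in> unit_cube (Suc n)" for y
        using hom that unfolding homeomorphism_def by blast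
      have rA: "?r y \<in> ?A" if "y \<in> cube_boundary (Suc n)" for y
      proof -
        have "y \<in> unit_cube (Suc n)" using that cube_boundary_subset by blast
        moreover from this have "?p (?r y) = y" using hom unfolding homeomorphism_def by blast
        ultimately have "?r y \<in> {y \<in> ?S. ?p y \<in> cube_boundary (Suc n)}" using rS that by simp
        then show ?thesis unfolding cube_boundary_Suc .
      qed
      \<comment> \<open>Over constant boundary data \<open>g2\<close> is a loop on the cube of
        dimension \<open>Suc n\<close>; surjectivity lifts it up to a homotopy that is stationary on
        the boundary.\<close>
      have "cont_from (unit_cube (Suc n)) Y (\<lambda>y. g2 (?r y))"
        by (rule cont_from_compose[OF _ rS g2]) (use hom in \<open>simp add: homeomorphism_def\<close>)
      then have "(\<lambda>y. g2 (?r y)) \<in> cube_loops (Suc n) Y (u x)"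
        using ug2[OF rA] Fx by (simp add: cube_loops_iff)
      then obtain h where h: "h \<in> cube_loops (Suc n) X x" "cube_homotopic (Suc n) Y (u x) (u \<circ> h) (\<lambda>y. g2 (?r y))"
        using weak_homotopy_equivalence_surj[OF w _ x, of "Suc n" "\<lambda>y. g2 (?r y)"] by auto
      obtain H where H: "cont_from (unit_cube (Suc n) \<times> unit_I) Y H"
        "\<And>y. y \<in> unit_cube (Suc n) \<Longrightarrow> H (y, 0) = u (h y)" "\<And>y. y \<in> unit_cube (Suc n) \<Longrightarrow> H (y, 1) = g2 (?r y)"
        "\<And>a s. a \<in> cube_boundary (Suc n) \<Longrightarrow> s \<in> unit_I \<Longrightarrow> H (a, s) = u x"
        using h(2) unfolding cube_homotopic_iff by auto
      have "solves (unit_cube (Suc n)) (cube_boundary (Suc n)) X Y u (\<lambda>y. x) (\<lambda>y. g2 (?r y))"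
        unfolding solves_def using H h(1) ug2[OF rA] Fx
        by (intro exI[of _ h] exI[of _ H]) (simp add: cube_loops_iff)
      then have "solves ?S ?A X Y u (\<lambda>a. x) g2"
        by (rule solves_homeo[OF hom cube_boundary_Suc[symmetric] cube_boundary_subset])
      then show "solves ?S ?A X Y u (\<lambda>a. ?F (a, 1)) g2" by (simp add: Fx)
    qed
    then show "solves ?S ?A X Y u (\<lambda>a. F (a, 1)) g1"
      by (rule solves_cong) (use FM AS in auto)
  qed
  then show ?thesis by (rule solves_cong) (use F0 AS in auto)
qed

text \<open>Dimension 0 is surjectivity on path components. A cube of positive dimension is read as
  a prism, which reduces it to the previous lemma.\<close>

lemma weak_homotopy_equivalence_compressible:
  assumes w: "weak_homotopy_equivalence X Y u"
  shows "compressible X Y u"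
  unfolding compressible_def
proof (intro conjI allI impI)
  show "continuous_map X Y u" using w by (simp add: weak_homotopy_equivalence_def)
  fix n f g
  assume "cont_from (cube_boundary n) X f \<and> cont_from (unit_cube n) Y g \<and> (\<forall>a\<in>cube_boundary n. u (f a) = g a)"
  then have f: "cont_from (cube_boundary n) X f" and g: "cont_from (unit_cube n) Y g"
    and eq: "\<And>a. a \<in> cube_boundary n \<Longrightarrow> u (f a) = g a" by auto
  show "solves (unit_cube n) (cube_boundary n) X Y u f g"
  proof (cases n)
    case 0
    let ?o = "\<lambda>_::nat. undefined::real"
    have "g ?o \<in> topspace Y" using cont_from_in[OF g] by (simp add: 0 unit_cube_0)
    then obtain x where x: "x \<in> topspace X" "path_component_of Y (u x) (g ?o)"
      by (rule weak_homotopy_equivalence_pi0_surj[OF w])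
    obtain H where "cont_from (unit_cube 0 \<times> unit_I) Y H" "\<And>a. H (a, 0) = u x" "\<And>a. H (a, 1) = g ?o"
      using path_component_of_cube_0[OF x(2)] by blast
    then show ?thesis
      unfolding solves_def using x by (intro exI[of _ "\<lambda>_. x"] exI[of _ H]) (auto simp: 0 unit_cube_0)
  next
    case (Suc m)
    let ?p = "\<lambda>y. (fst y)(m := snd y)" and ?r = "\<lambda>x. (restrict x {..<m}, x m)"
    let ?A = "cube_boundary m \<times> unit_I \<union> unit_cube m \<times> {0, 1}"
    have hom: "homeomorphism (unit_cube m \<times> unit_I) (unit_cube n) ?p ?r"
      unfolding Suc by (rule homeomorphism_cube_Suc)
    have pS: "continuous_on (unit_cube m \<times> unit_I) ?p" "\<And>y. y \<in> unit_cube m \<times> unit_I \<Longrightarrow> ?p y \<in> unit_cube n"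
      and rp: "\<And>y. y \<in> unit_cube n \<Longrightarrow> ?p (?r y) = y" "\<And>y. y \<in> unit_cube n \<Longrightarrow> ?r y \<in> unit_cube m \<times> unit_I"
      using hom unfolding homeomorphism_def by blast+
    have A: "?A = {y \<in> unit_cube m \<times> unit_I. ?p y \<in> cube_boundary n}" unfolding Suc cube_boundary_Suc ..
    have "solves (unit_cube m \<times> unit_I) ?A X Y u (\<lambda>y. f (?p y)) (\<lambda>y. g (?p y))"
    proof (rule weak_homotopy_equivalence_compressible_cell[OF w])
      show "cont_from ?A X (\<lambda>y. f (?p y))"
        by (rule cont_from_compose[OF continuous_on_subset[OF pS(1)] _ f]) (auto simp only: A mem_Collect_eq)
      show "cont_from (unit_cube m \<times> unit_I) Y (\<lambda>y. g (?p y))"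
        by (rule cont_from_compose[OF pS g])
      show "u (f (?p a)) = g (?p a)" if "a \<in> ?A" for a
        by (rule eq) (use that in \<open>simp only: A mem_Collect_eq\<close>)
    qed
    note sol = this
    have hom': "homeomorphism (unit_cube n) (unit_cube m \<times> unit_I) ?r ?p" using hom by (simp add: homeomorphism_symD)
    have B: "cube_boundary n = {y \<in> unit_cube n. ?r y \<in> ?A}"
      using rp cube_boundary_subset[of n] unfolding A by auto
    have "?A \<subseteq> unit_cube m \<times> unit_I" unfolding A by blast
    then show ?thesis using solves_homeo[OF hom' B, of X Y u f g] sol by simp
  qed
qed

section \<open>Extending maps from the boundaries of cubes\<close>

text \<open>Weak contractibility without base points: dimension 0, with its empty boundary, provides
  a point, dimension 1 joins points by paths, and the higher dimensions fill spheres.\<close>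

definition cube_extension :: "'a topology \<Rightarrow> bool" where
  "cube_extension X \<longleftrightarrow> (\<forall>n T. cont_from (cube_boundary n) X T \<longrightarrow>
     (\<exists>G. cont_from (unit_cube n) X G \<and> (\<forall>a\<in>cube_boundary n. G a = T a)))"

lemma cube_extensionD:
  assumes "cube_extension X" "cont_from (cube_boundary n) X T"
  obtains G where "cont_from (unit_cube n) X G" "\<And>a. a \<in> cube_boundary n \<Longrightarrow> G a = T a"
  using assms unfolding cube_extension_def by blast

text \<open>\<open>a\<close> on the bottom, \<open>b\<close> on the top and \<open>x\<close> on the
  sides form a map on the boundary of the cube of the next dimension, whose extension is the
  homotopy.\<close>

lemma cube_extension_homotopy:
  assumes X: "cube_extension X" and a: "cont_from (unit_cube n) X a" and b: "cont_from (unit_cube n) X b"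
    and x: "\<And>z. z \<in> cube_boundary n \<Longrightarrow> a z = x" "\<And>z. z \<in> cube_boundary n \<Longrightarrow> b z = x"
  obtains H where "cont_from (unit_cube n \<times> unit_I) X H" "\<And>z. z \<in> unit_cube n \<Longrightarrow> H (z, 0) = a z"
    "\<And>z. z \<in> unit_cube n \<Longrightarrow> H (z, 1) = b z" "\<And>z s. z \<in> cube_boundary n \<Longrightarrow> s \<in> unit_I \<Longrightarrow> H (z, s) = x"
proof -
  let ?C = "unit_cube n" and ?b = "cube_boundary n"
  let ?S = "?C \<times> unit_I" and ?A = "?b \<times> unit_I \<union> ?C \<times> {0, 1}" and ?J = "?b \<times> unit_I \<union> ?C \<times> {1}"
  have bC: "?b \<subseteq> ?C" by (rule cube_boundary_subset)
  let ?T = "\<lambda>y. if snd y = 0 then a (fst y) else b (fst y)"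
  \<comment> \<open>\<open>cell_boundary_glue\<close> speaks of homotopies; it is applied to
    homotopies constant in time, and the slice at time 0 is taken.\<close>
  have "cont_from (?A \<times> unit_I) X (\<lambda>y. if snd (fst y) = 0 then a (fst (fst (fst y), snd y)) else b (fst (fst y)))"
  proof (rule cell_boundary_glue[OF cell_pair_cube, where p = "\<lambda>y. a (fst y)" and q = "\<lambda>y. b (fst (fst y))"])
    show "cont_from (?C \<times> unit_I) X (\<lambda>y. a (fst y))"
      by (rule cont_from_compose[OF _ _ a]) (auto intro!: continuous_on_fst continuous_on_id)
    show "cont_from (?J \<times> unit_I) X (\<lambda>y. b (fst (fst y)))"
      by (rule cont_from_compose[OF _ _ b]) (use bC in \<open>auto intro!: continuous_on_fst continuous_on_id\<close>)
  qed (use x in auto)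
  from cont_from_slice[OF this, of 0] have T: "cont_from ?A X ?T" by (simp cong: if_cong)
  have hom: "homeomorphism ?S (unit_cube (Suc n)) (\<lambda>y. (fst y)(n := snd y)) (\<lambda>x. (restrict x {..<n}, x n))"
    by (rule homeomorphism_cube_Suc)
  define p where "p = (\<lambda>y::(nat \<Rightarrow> real) \<times> real. (fst y)(n := snd y))"
  define q where "q = (\<lambda>x::nat \<Rightarrow> real. (restrict x {..<n}, x n))"
  have p: "continuous_on ?S p" "\<And>y. y \<in> ?S \<Longrightarrow> p y \<in> unit_cube (Suc n)" "\<And>y. y \<in> ?S \<Longrightarrow> q (p y) = y"
    and q: "continuous_on (unit_cube (Suc n)) q" "\<And>x. x \<in> unit_cube (Suc n) \<Longrightarrow> q x \<in> ?S" "\<And>x. x \<in> unit_cube (Suc n) \<Longrightarrow> p (q x) = x"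
    using hom unfolding homeomorphism_def p_def q_def by blast+
  have A: "?A = {y \<in> ?S. p y \<in> cube_boundary (Suc n)}" unfolding p_def cube_boundary_Suc ..
  have qA: "q y \<in> ?A" if "y \<in> cube_boundary (Suc n)" for y
  proof -
    have y: "y \<in> unit_cube (Suc n)" using that cube_boundary_subset by blast
    show ?thesis unfolding A mem_Collect_eq q(3)[OF y] using q(2)[OF y] that ..
  qed
  have "cont_from (cube_boundary (Suc n)) X (\<lambda>y. ?T (q y))"
    by (rule cont_from_compose[OF continuous_on_subset[OF q(1) cube_boundary_subset] qA T])
  from cube_extensionD[OF X this] obtain G where G: "cont_from (unit_cube (Suc n)) X G" "\<And>y. y \<in> cube_boundary (Suc n) \<Longrightarrow> G y = ?T (q y)"
    by blast
  have Gp: "G (p y) = ?T y" if "y \<in> ?A" for y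
  proof -
    have "y \<in> ?S" "p y \<in> cube_boundary (Suc n)" using that unfolding A by auto
    then show ?thesis using G(2)[of "p y"] p(3)[of y] by simp
  qed
  show ?thesis
  proof (rule that[of "\<lambda>y. G (p y)"])
    show "cont_from ?S X (\<lambda>y. G (p y))" by (rule cont_from_compose[OF p(1,2) G(1)])
    show "G (p (z, 0)) = a z" "G (p (z, 1)) = b z" if "z \<in> ?C" for z using that Gp[of "(z, 0)"] Gp[of "(z, 1)"] by auto
    show "G (p (z, s)) = x" if "z \<in> ?b" "s \<in> unit_I" for z s using that x Gp[of "(z, s)"] by auto
  qed
qed

lemma cube_extension_homotopy_classes:
  assumes X: "cube_extension X" and x: "x \<in> topspace X"
  shows "homotopy_classes n X x = {cube_loops n X x}"
    "g \<in> cube_loops n X x \<Longrightarrow> h \<in> cube_loops n X x \<Longrightarrow> cube_homotopic n X x g h"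
proof -
  show hom: "cube_homotopic n X x g h" if "g \<in> cube_loops n X x" "h \<in> cube_loops n X x" for g h
  proof -
    have gh: "cont_from (unit_cube n) X g" "cont_from (unit_cube n) X h"
      "\<And>z. z \<in> cube_boundary n \<Longrightarrow> g z = x" "\<And>z. z \<in> cube_boundary n \<Longrightarrow> h z = x"
      using that by (auto simp: cube_loops_iff)
    obtain H where "cont_from (unit_cube n \<times> unit_I) X H" "\<And>z. z \<in> unit_cube n \<Longrightarrow> H (z, 0) = g z"
      "\<And>z. z \<in> unit_cube n \<Longrightarrow> H (z, 1) = h z" "\<And>z s. z \<in> cube_boundary n \<Longrightarrow> s \<in> unit_I \<Longrightarrow> H (z, s) = x"
      by (rule cube_extension_homotopy[OF X gh]) auto
    then show ?thesis unfolding cube_homotopic_iff by (intro exI[of _ H]) auto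
  qed
  have "{h. cube_homotopic n X x g h} = cube_loops n X x" if "g \<in> cube_loops n X x" for g
    using hom[OF that] cube_homotopic_loops(2)[of n X x g] by (intro equalityI subsetI) auto
  moreover have "(\<lambda>_. x) \<in> cube_loops n X x" using x by (simp add: cube_loops_iff)
  ultimately show "homotopy_classes n X x = {cube_loops n X x}"
    unfolding homotopy_classes_eq by (intro equalityI subsetI) (force, blast)
qed

lemma cube_extension_discrete_unit: "cube_extension (discrete_topology {()})"
  unfolding cube_extension_def by (intro allI impI exI[of _ "\<lambda>_. ()"]) auto

lemma cube_extension_imp_weakly_contractible:
  assumes X: "cube_extension X"
  shows "weakly_contractible X"
  unfolding weakly_contractible_def weak_homotopy_equivalence_def
proof (intro conjI allI impI ballI)
  let ?D = "discrete_topology {()}" and ?u = "\<lambda>_. ()" and ?o = "\<lambda>_::nat. undefined::real"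
  show "continuous_map X ?D ?u" by simp
  \<comment> \<open>Every map on the empty boundary is continuous, so extension in dimension 0
    yields a point of \<open>X\<close>; an empty space would have no path component to match the one
    of the point.\<close>
  have "cont_from (cube_boundary 0) X (\<lambda>_. undefined)"
    by (simp add: unit_cube_0)
  then obtain G where "cont_from (unit_cube 0) X G"
    by (rule cube_extensionD[OF X])
  then have "G ?o \<in> topspace X" using cont_from_in unit_cube_0 by blast
  moreover have "path_connected_space X"
    unfolding path_connected_space_def
  proof (intro ballI)
    fix x y assume xy: "x \<in> topspace X" "y \<in> topspace X"
    obtain H where H: "cont_from (unit_cube 0 \<times> unit_I) X H" 
      "\<And>z. z \<in> unit_cube 0 \<Longrightarrow> H (z, 0) = x" "\<And>z. z \<in> unit_cube 0 \<Longrightarrow> H (z, 1) = y"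
      by (rule cube_extension_homotopy[OF X, of 0 "\<lambda>_. x" "\<lambda>_. y" x]) (use xy in \<open>auto simp: unit_cube_0\<close>)
    have "cont_from unit_I X (\<lambda>s. H (?o, s))"
      by (rule cont_from_compose[OF _ _ H(1)]) (auto simp: unit_cube_0 intro!: continuous_on_Pair continuous_on_id continuous_on_const)
    then show "\<exists>g. pathin X g \<and> g 0 = x \<and> g 1 = y"
      using H(2,3) by (intro exI[of _ "\<lambda>s. H (?o, s)"]) (simp add: pathin_def unit_cube_0)
  qed
  ultimately have "path_components_of X = {topspace X}"
    using path_components_of_eq_singleton[of X "topspace X"] by auto
  moreover have "path_components_of ?D = {{()}}"
    using path_components_of_eq_singleton[of ?D "{()}"] by (simp add: path_connected_space_def)
  moreover have "{y. \<exists>x\<in>topspace X. path_component_of ?D (?u x) y} = {()}"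
    using \<open>G ?o \<in> topspace X\<close> path_component_of_refl[of ?D "()"] by auto
  ultimately show "bij_betw (\<lambda>C. {y. \<exists>x\<in>C. path_component_of ?D (?u x) y}) (path_components_of X) (path_components_of ?D)"
    by (simp add: bij_betw_def)
  fix n :: nat and x assume "1 \<le> n" and x: "x \<in> topspace X"
  have D: "() \<in> topspace ?D" by simp
  have l: "g \<in> cube_loops n ?D ()" for g
  proof -
    have "g = (\<lambda>_. ())" by (simp add: fun_eq_iff)
    then show ?thesis by (simp add: cube_loops_iff)
  qed
  have "homotopy_classes_map n ?D ?u x (cube_loops n X x) = cube_loops n ?D ()"
  proof -
    have "(\<lambda>_. x) \<in> cube_loops n X x" using x by (simp add: cube_loops_iff)
    then show ?thesis
      unfolding homotopy_classes_map_def
      using cube_extension_homotopy_classes(2)[OF cube_extension_discrete_unit D l l] l by blast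
  qed
  then show "bij_betw (homotopy_classes_map n ?D ?u x) (homotopy_classes n X x) (homotopy_classes n ?D (?u x))"
    unfolding cube_extension_homotopy_classes(1)[OF X x] cube_extension_homotopy_classes(1)[OF cube_extension_discrete_unit D]
    by (simp add: bij_betw_def)
qed

lemma cube_extension_retract:
  assumes Y: "cube_extension Y" and a: "continuous_map X Y a" and b: "continuous_map Y X b"
    and ba: "\<And>x. x \<in> topspace X \<Longrightarrow> b (a x) = x"
  shows "cube_extension X"
  unfolding cube_extension_def
proof (intro allI impI)
  fix n T assume T: "cont_from (cube_boundary n) X T"
  then have "cont_from (cube_boundary n) Y (\<lambda>z. a (T z))"
    using continuous_map_compose[OF T a] by (simp add: o_def)
  from cube_extensionD[OF Y this] obtain G where G: "cont_from (unit_cube n) Y G" "\<And>z. z \<in> cube_boundary n \<Longrightarrow> G z = a (T z)"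
    by blast
  have "cont_from (unit_cube n) X (\<lambda>z. b (G z))"
    using continuous_map_compose[OF G(1) b] by (simp add: o_def)
  then show "\<exists>G. cont_from (unit_cube n) X G \<and> (\<forall>a\<in>cube_boundary n. G a = T a)"
    using G(2) ba cont_from_in[OF T] by (intro exI[of _ "\<lambda>z. b (G z)"]) simp
qed

text \<open>The null-homotopy contracts the image of a boundary map \<open>T\<close>, so that image
  extends over the cube in \<open>Y\<close>. Compression then lifts the extension to
  \<open>X\<close> with values \<open>T\<close> on the boundary.\<close>

lemma compressible_null_imp_cube_extension:
  assumes u: "compressible X Y u"
    and k: "continuous_map (prod_topology X (top_of_set unit_I)) Y k"
    and k0: "\<And>x. x \<in> topspace X \<Longrightarrow> k (x, 0) = u x" and k1: "\<And>x. x \<in> topspace X \<Longrightarrow> k (x, 1) = y"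
    and y: "y \<in> topspace Y"
  shows "cube_extension X"
  unfolding cube_extension_def
proof (intro allI impI)
  fix n T assume T: "cont_from (cube_boundary n) X T"
  have Tk: "cont_from (cube_boundary n \<times> unit_I) Y (\<lambda>z. k (T (fst z), snd z))"
  proof -
    have "continuous_map (prod_topology (top_of_set (cube_boundary n)) (top_of_set unit_I)) (prod_topology X (top_of_set unit_I)) (\<lambda>z. (T (fst z), snd z))"
      unfolding continuous_map_pairwise
      by (simp add: o_def del: prod_topology_subtopology_eu)
         (intro conjI continuous_map_compose[OF continuous_map_fst T, unfolded o_def] continuous_map_snd)
    from continuous_map_compose[OF this k] show ?thesis by (simp add: o_def)
  qed
  have Tin: "T a \<in> topspace X" if "a \<in> cube_boundary n" for a using cont_from_in[OF T that] .
  \<comment> \<open>Start from the constant \<open>y\<close> on the cube at time 1 and extend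
    \<open>k\<close> backwards; at time 0 this is a map on the cube that restricts to
    \<open>u\<close> of \<open>T\<close>.\<close>
  obtain G where G: "cont_from (unit_cube n \<times> unit_I) Y G"
    "\<And>a s. a \<in> cube_boundary n \<Longrightarrow> s \<in> unit_I \<Longrightarrow> G (a, s) = k (T a, s)"
    by (rule hep_extend_reverse[OF hep_cube _ Tk, of "\<lambda>_. y"]) (use y k1 Tin in auto)
  have "solves (unit_cube n) (cube_boundary n) X Y u T (\<lambda>x. G (x, 0))"
    using u T cont_from_slice[OF G(1), of 0] G(2) k0 Tin unfolding compressible_def by simp
  then show "\<exists>G. cont_from (unit_cube n) X G \<and> (\<forall>a\<in>cube_boundary n. G a = T a)"
    unfolding solves_def by blast
qed

section \<open>Maps out of geometric realisations\<close>

lemma cg_open_openin: "openin X U \<Longrightarrow> cg_open X U"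
  unfolding cg_open_def
  by (intro conjI allI impI openin_subset) (auto elim: openin_continuous_map_preimage)

lemma topspace_cg_topology [simp]: "topspace (cg_topology X) = topspace X"
proof -
  have "openin (cg_topology X) (topspace X)"
    unfolding openin_cg_topology_iff by (intro cg_open_openin) simp
  moreover have "U \<subseteq> topspace X" if "openin (cg_topology X) U" for U
    using that unfolding openin_cg_topology_iff cg_open_def by simp
  ultimately show ?thesis by (meson openin_subset openin_topspace subset_antisym)
qed

lemma topspace_cg_prod [simp]: "topspace (cg_prod X Y) = topspace X \<times> topspace Y"
  by (simp add: cg_prod_def)

lemma continuous_map_cg_id: "continuous_map (cg_topology X) X (\<lambda>x. x)"
  unfolding continuous_map_def
proof (intro conjI allI impI)
  fix U assume U: "openin X U"
  then have "{x \<in> topspace (cg_topology X). x \<in> U} = U" using openin_subset by fastforce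
  then show "openin (cg_topology X) {x \<in> topspace (cg_topology X). x \<in> U}"
    using cg_open_openin[OF U] by (simp add: openin_cg_topology_iff)
qed auto

lemma continuous_map_from_cg: "continuous_map X Y f \<Longrightarrow> continuous_map (cg_topology X) Y f"
  using continuous_map_compose[OF continuous_map_cg_id] by (auto simp: o_def)

text \<open>Compact Hausdorff sources of any type do not notice the finer topology, by
  \<open>openin_cg_topology\<close>. This makes cubes usable as sources of maps into nerves, fibres
  and realisations.\<close>

lemma continuous_map_into_cg:
  assumes K: "compact_space K" "Hausdorff_space K" and f: "continuous_map K X f"
  shows "continuous_map K (cg_topology X) f"
  unfolding continuous_map_def
proof (intro conjI allI impI)
  show "f \<in> topspace K \<rightarrow> topspace (cg_topology X)" using f by (simp add: continuous_map_def)
  fix U assume "openin (cg_topology X) U"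
  from openin_cg_topology[OF this K f] show "openin K {x \<in> topspace K. f x \<in> U}" .
qed

lemma continuous_map_cg_cg:
  assumes f: "continuous_map (cg_topology X) Y f"
  shows "continuous_map (cg_topology X) (cg_topology Y) f"
  unfolding continuous_map_def
proof (intro conjI allI impI)
  show "f \<in> topspace (cg_topology X) \<rightarrow> topspace (cg_topology Y)" using f by (simp add: continuous_map_def)
  fix U assume U: "openin (cg_topology Y) U"
  show "openin (cg_topology X) {x \<in> topspace (cg_topology X). f x \<in> U}"
    unfolding openin_cg_topology_iff cg_open_def
  proof (intro conjI allI impI)
    fix K :: "'a test_point topology" and g
    assume K: "compact_space K \<and> Hausdorff_space K \<and> continuous_map K X g"
    then have "continuous_map K Y (f \<circ> g)"
      by (intro continuous_map_compose[OF _ f] continuous_map_into_cg) auto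
    then have "openin K {z \<in> topspace K. (f \<circ> g) z \<in> U}" using K openin_cg_topology[OF U] by blast
    moreover have "g z \<in> topspace X" if "z \<in> topspace K" for z using K that by (auto simp: continuous_map_def)
    then have "{z \<in> topspace K. g z \<in> {x \<in> topspace (cg_topology X). f x \<in> U}} = {z \<in> topspace K. (f \<circ> g) z \<in> U}"
      by auto
    ultimately show "openin K {z \<in> topspace K. g z \<in> {x \<in> topspace (cg_topology X). f x \<in> U}}" by simp
  qed auto
qed

text \<open>The ordinary product of \<open>cg_topology X\<close> with a compact Hausdorff space is
  already compactly generated. Around a point of a k-open \<open>W\<close>, regularity provides a
  closed neighbourhood \<open>N\<close> in the compact factor inside the slice; the points over
  which the whole of \<open>N\<close> lies in \<open>W\<close> form a k-open set by a tube
  argument.\<close>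

lemma continuous_map_cg_prod_compact:
  fixes X :: "'a topology" and Z :: "'b topology"
  assumes Z: "compact_space Z" "Hausdorff_space Z"
  shows "continuous_map (prod_topology (cg_topology X) Z) (cg_topology (prod_topology X Z)) (\<lambda>y. y)"
  unfolding continuous_map_def
proof (intro conjI allI impI)
  fix W assume W: "openin (cg_topology (prod_topology X Z)) W"
  then have Wsub: "W \<subseteq> topspace X \<times> topspace Z" using openin_subset by fastforce
  have "\<exists>V U. openin (cg_topology X) V \<and> openin Z U \<and> x \<in> V \<and> z \<in> U \<and> V \<times> U \<subseteq> W" if xz: "(x, z) \<in> W" for x z
  proof -
    have x: "x \<in> topspace X" and z: "z \<in> topspace Z" using xz Wsub by auto
    have "continuous_map Z (prod_topology X Z) (\<lambda>z. (x, z))"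
      using x by (simp add: continuous_map_paired)
    from openin_cg_topology[OF W Z this] have "openin Z {z \<in> topspace Z. (x, z) \<in> W}" .
    moreover have "regular_space Z" using Z compact_Hausdorff_imp_regular_space by blast
    ultimately obtain U N where U: "openin Z U" "z \<in> U" "U \<subseteq> N" and N: "closedin Z N" "N \<subseteq> {z \<in> topspace Z. (x, z) \<in> W}"
      using z xz unfolding neighbourhood_base_of_closedin[symmetric] neighbourhood_base_of by (metis (no_types, lifting) mem_Collect_eq)
    let ?N = "subtopology Z N"
    have cN: "compact_space ?N" using Z N closedin_compact_space compact_space_subtopology by blast
    have hN: "Hausdorff_space ?N" using Z Hausdorff_space_subtopology by blast
    have NZ: "N \<subseteq> topspace Z" using N closedin_subset by blast
    define V where "V = {x \<in> topspace X. {x} \<times> N \<subseteq> W}"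
    have "cg_open X V"
      unfolding cg_open_def
    proof (intro conjI allI impI)
      show "V \<subseteq> topspace X" by (auto simp: V_def)
      fix K :: "'a test_point topology" and g
      assume K: "compact_space K \<and> Hausdorff_space K \<and> continuous_map K X g"
      let ?P = "prod_topology K ?N"
      have "continuous_map ?P X (\<lambda>y. g (fst y))"
        using continuous_map_compose[OF continuous_map_fst, of K X g ?N] K by (simp add: o_def)
      moreover have "continuous_map ?P Z snd"
        using continuous_map_into_fulltopology[OF continuous_map_snd] by blast
      ultimately have "continuous_map ?P (prod_topology X Z) (\<lambda>y. (g (fst y), snd y))"
        unfolding continuous_map_pairwise by (simp add: o_def)
      moreover have "compact_space ?P" "Hausdorff_space ?P"
        using K cN hN by (simp_all add: compact_space_prod_topology Hausdorff_space_prod_topology)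
      ultimately have "openin ?P {y \<in> topspace ?P. (g (fst y), snd y) \<in> W}"
        using openin_cg_topology[OF W] by blast
      then have "closedin ?P (topspace ?P - {y \<in> topspace ?P. (g (fst y), snd y) \<in> W})"
        by blast
      \<comment> \<open>The points of the test space over which some point of \<open>N\<close>
        misses \<open>W\<close> form the projection of a closed set, which is closed because
        \<open>N\<close> is compact.\<close>
      then have cl: "closedin K (fst ` (topspace ?P - {y \<in> topspace ?P. (g (fst y), snd y) \<in> W}))"
        using closed_map_fst[OF cN, of K] unfolding closed_map_def by blast
      have eq: "topspace K - fst ` (topspace ?P - {y \<in> topspace ?P. (g (fst y), snd y) \<in> W}) = {k \<in> topspace K. g k \<in> V}"
      proof -
        have "g k \<in> topspace X" if "k \<in> topspace K" for k using K that by (auto simp: continuous_map_def)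
        then show ?thesis using NZ by (force simp: V_def image_iff)
      qed
      show "openin K {k \<in> topspace K. g k \<in> V}"
        using openin_diff[OF openin_topspace cl] unfolding eq .
    qed
    then show ?thesis
      using U N x by (intro exI[of _ V] exI[of _ U]) (auto simp: openin_cg_topology_iff V_def)
  qed
  moreover have "{y \<in> topspace (prod_topology (cg_topology X) Z). y \<in> W} = W" using Wsub by auto
  ultimately show "openin (prod_topology (cg_topology X) Z) {y \<in> topspace (prod_topology (cg_topology X) Z). y \<in> W}"
    unfolding openin_prod_topology_alt by auto
qed auto

section \<open>Sums, quotients and the cells of a realisation\<close>

lemma continuous_map_sum_component: "continuous_map (X i) (sum_topology X UNIV) (\<lambda>x. (i, x))"
  unfolding continuous_map_def
proof (intro conjI allI impI)
  fix U assume U: "openin (sum_topology X UNIV) U"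
  then have "U \<subseteq> Sigma UNIV (topspace \<circ> X)" using openin_subset by fastforce
  then have "{x \<in> topspace (X i). (i, x) \<in> U} = {x. (i, x) \<in> U}" by auto
  then show "openin (X i) {x \<in> topspace (X i). (i, x) \<in> U}" using U by (simp add: openin_sum_topology)
qed auto

lemma continuous_map_sum_snd:
  "continuous_map (subtopology (sum_topology X UNIV) ({i} \<times> topspace (X i))) (X i) snd"
  unfolding continuous_map_def
proof (intro conjI allI impI)
  fix U assume U: "openin (X i) U"
  then have "openin (sum_topology X UNIV) ({i} \<times> U)"
  proof -
    have "{x. (j, x) \<in> {i} \<times> U} = (if j = i then U else {})" for j by auto
    then show ?thesis using U openin_subset[OF U] unfolding openin_sum_topology by auto
  qed
  moreover have "{x \<in> topspace (subtopology (sum_topology X UNIV) ({i} \<times> topspace (X i))). snd x \<in> U} = ({i} \<times> U) \<inter> ({i} \<times> topspace (X i))"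
    using openin_subset[OF U] by auto
  ultimately show "openin (subtopology (sum_topology X UNIV) ({i} \<times> topspace (X i)))
     {x \<in> topspace (subtopology (sum_topology X UNIV) ({i} \<times> topspace (X i))). snd x \<in> U}"
    by (auto simp: openin_subtopology)
qed auto

abbreviation simplices :: "(nat \<Rightarrow> 'x topology) \<Rightarrow> nat \<Rightarrow> ('x \<times> (nat \<Rightarrow> real)) topology" where
  "simplices X p \<equiv> cg_prod (X p) (simplex_topology p)"

definition simplex_cells :: "(nat \<Rightarrow> 'x topology) \<Rightarrow> (nat \<times> 'x \<times> (nat \<Rightarrow> real)) topology" where
  "simplex_cells X = sum_topology (\<lambda>p. simplices X p) UNIV"

definition cell_class :: "(nat \<Rightarrow> 'x topology) \<Rightarrow> (nat \<Rightarrow> nat \<Rightarrow> 'x \<Rightarrow> 'x) \<Rightarrow>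
    nat \<times> 'x \<times> (nat \<Rightarrow> real) \<Rightarrow> (nat \<times> 'x \<times> (nat \<Rightarrow> real)) set" where
  "cell_class X d a = {b. equivclp (face_glue X d) a b}"

lemma topspace_simplex_topology [simp]: "topspace (simplex_topology p) = standard_simplex p"
  by (simp add: simplex_topology_def)

lemma topspace_simplex_cells: 
  "(p, x, t) \<in> topspace (simplex_cells X) \<longleftrightarrow> x \<in> topspace (X p) \<and> t \<in> standard_simplex p"
  by (simp add: simplex_cells_def)

lemma quotient_map_cell_class: "quotient_map (simplex_cells X) (realisation X d) (cell_class X d)"
proof -
  have r: "realisation X d = quotient_topology (simplex_cells X) (cell_class X d)"
    by (simp add: realisation_def simplex_cells_def cell_class_def[abs_def])
  have "openin (realisation X d) (cell_class X d ` topspace (simplex_cells X))"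
    unfolding r openin_quotient_topology by (auto intro: openin_subopen[THEN iffD2])
  then have "topspace (realisation X d) = cell_class X d ` topspace (simplex_cells X)"
    using openin_quotient_topology[of "simplex_cells X" "cell_class X d"] unfolding r
    by (meson openin_subset openin_topspace subset_antisym)
  then show ?thesis
    unfolding quotient_map_def r openin_quotient_topology by auto
qed

lemma topspace_realisation: "topspace (realisation X d) = cell_class X d ` topspace (simplex_cells X)"
  using quotient_imp_surjective_map[OF quotient_map_cell_class] by blast

lemma cell_class_in: "x \<in> topspace (X p) \<Longrightarrow> t \<in> standard_simplex p \<Longrightarrow> cell_class X d (p, x, t) \<in> topspace (realisation X d)"
  unfolding topspace_realisation by (intro imageI) (simp add: topspace_simplex_cells)

lemma realisation_cases:
  assumes "z \<in> topspace (realisation X d)"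
  obtains p x t where "x \<in> topspace (X p)" "t \<in> standard_simplex p" "z = cell_class X d (p, x, t)"
proof -
  obtain a where a: "a \<in> topspace (simplex_cells X)" "z = cell_class X d a" using assms by (auto simp: topspace_realisation)
  obtain p x t where "a = (p, x, t)" by (cases a) auto
  then show ?thesis using that a topspace_simplex_cells by metis
qed

lemma cell_class_eq_iff: "cell_class X d a = cell_class X d b \<longleftrightarrow> equivclp (face_glue X d) a b"
proof
  assume "cell_class X d a = cell_class X d b"
  moreover have "b \<in> cell_class X d b" by (simp add: cell_class_def)
  ultimately have "b \<in> cell_class X d a" by simp
  then show "equivclp (face_glue X d) a b" by (simp add: cell_class_def)
next
  assume ab: "equivclp (face_glue X d) a b"
  show "cell_class X d a = cell_class X d b"
    unfolding cell_class_def
    by (intro Collect_cong iffI) (erule equivclp_trans[OF equivclp_sym[OF ab]], erule equivclp_trans[OF ab])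
qed

lemma cell_class_face:
  assumes "x \<in> topspace (X (Suc p))" "i \<le> Suc p" "t \<in> standard_simplex p"
  shows "cell_class X d (Suc p, x, simplical_face i t) = cell_class X d (p, d (Suc p) i x, t)"
  unfolding cell_class_eq_iff using assms
  by (intro r_into_equivclp) (auto simp: face_glue_def)

lemma continuous_map_cell_class: "continuous_map (simplices X p) (realisation X d) (\<lambda>y. cell_class X d (p, y))"
  using continuous_map_compose[OF continuous_map_sum_component[of "\<lambda>p. simplices X p"]
    quotient_imp_continuous_map[OF quotient_map_cell_class[unfolded simplex_cells_def]]]
  by (simp add: o_def)

lemma continuous_map_to_realisation:
  assumes K: "compact_space K" "Hausdorff_space K" and f: "continuous_map K (X p) f" and g: "continuous_map K (simplex_topology p) g"
  shows "continuous_map K (realisation X d) (\<lambda>k. cell_class X d (p, f k, g k))"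
proof -
  have "continuous_map K (simplices X p) (\<lambda>k. (f k, g k))"
    unfolding cg_prod_def by (intro continuous_map_into_cg K) (simp add: continuous_map_paired f g)
  from continuous_map_compose[OF this continuous_map_cell_class[of X p d]] show ?thesis by (simp add: o_def)
qed

lemma unit_I_compact_Hausdorff: "compact_space (top_of_set unit_I)" "Hausdorff_space (top_of_set unit_I)"
  by (simp_all add: compact_space_subtopology Hausdorff_space_subtopology)

text \<open>Simplices carry a compactly generated product, the homotopy parameter an ordinary one;
  \<open>continuous_map_cg_prod_compact\<close> reconciles the two for the interval.\<close>

lemma continuous_map_cell_homotopy:
  assumes f: "continuous_map (X p) (X' q) f"
    and g: "continuous_map (prod_topology (simplex_topology p) (top_of_set unit_I)) (simplex_topology q) g"
  shows "continuous_map (prod_topology (simplices X p) (top_of_set unit_I)) (realisation X' d')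
     (\<lambda>y. cell_class X' d' (q, f (fst (fst y)), g (snd (fst y), snd y)))"
proof -
  let ?P = "prod_topology (prod_topology (X p) (simplex_topology p)) (top_of_set unit_I)"
  have 1: "continuous_map ?P (X' q) (\<lambda>y. f (fst (fst y)))"
    using continuous_map_compose[OF continuous_map_compose[OF continuous_map_fst continuous_map_fst] f] by (simp add: o_def)
  have "continuous_map ?P (prod_topology (simplex_topology p) (top_of_set unit_I)) (\<lambda>y. (snd (fst y), snd y))"
    unfolding continuous_map_paired
    using continuous_map_compose[OF continuous_map_fst continuous_map_snd] continuous_map_snd by (auto simp: o_def)
  from continuous_map_compose[OF this g] have 2: "continuous_map ?P (simplex_topology q) (\<lambda>y. g (snd (fst y), snd y))"
    by (simp add: o_def)
  have "continuous_map ?P (prod_topology (X' q) (simplex_topology q)) (\<lambda>y. (f (fst (fst y)), g (snd (fst y), snd y)))"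
    using 1 2 by (simp add: continuous_map_paired)
  from continuous_map_compose[OF continuous_map_cg_prod_compact[OF unit_I_compact_Hausdorff] continuous_map_cg_cg[OF continuous_map_from_cg[OF this]]]
  have "continuous_map (prod_topology (simplices X p) (top_of_set unit_I)) (cg_prod (X' q) (simplex_topology q))
     (\<lambda>y. (f (fst (fst y)), g (snd (fst y), snd y)))"
    by (simp add: cg_prod_def o_def)
  from continuous_map_compose[OF this continuous_map_cell_class[of X' q d']] show ?thesis by (simp add: o_def)
qed

locale semi_simplicial =
  fixes X :: "nat \<Rightarrow> 'x topology" and d :: "nat \<Rightarrow> nat \<Rightarrow> 'x \<Rightarrow> 'x"
  assumes face_continuous: "i \<le> Suc p \<Longrightarrow> continuous_map (X (Suc p)) (X p) (d (Suc p) i)"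
    and face_face: "x \<in> topspace (X (Suc (Suc p))) \<Longrightarrow> i < j \<Longrightarrow> j \<le> Suc (Suc p) \<Longrightarrow>
      d (Suc p) i (d (Suc (Suc p)) j x) = d (Suc p) (j - 1) (d (Suc (Suc p)) i x)"
begin

lemma face_in: "x \<in> topspace (X (Suc p)) \<Longrightarrow> i \<le> Suc p \<Longrightarrow> d (Suc p) i x \<in> topspace (X p)"
  using face_continuous[of i p] by (auto simp: continuous_map_def)

text \<open>Along a zigzag of gluings the class in the realisation never changes, so only gluings
  inside \<open>V\<close> occur, and compatibility is asked only there.\<close>

lemma cell_class_invariant:
  assumes resp: "\<And>p x i t. x \<in> topspace (X (Suc p)) \<Longrightarrow> i \<le> Suc p \<Longrightarrow> t \<in> standard_simplex p \<Longrightarrow>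
      cell_class X d (p, d (Suc p) i x, t) \<in> V \<Longrightarrow> \<Phi> (Suc p, x, simplical_face i t) = \<Phi> (p, d (Suc p) i x, t)"
    and V: "cell_class X d a \<in> V" and eq: "cell_class X d a = cell_class X d b"
  shows "\<Phi> a = \<Phi> b"
proof -
  have step: "\<Phi> b = \<Phi> c" if "face_glue X d b c" "cell_class X d c \<in> V" for b c
    using that resp unfolding face_glue_def by auto
  have "equivclp (face_glue X d) a b" using eq by (simp add: cell_class_eq_iff)
  then have "cell_class X d b \<in> V \<and> \<Phi> a = \<Phi> b"
  proof (induction rule: equivclp_induct)
    case base then show ?case using V by simp
  next
    case (step b c)
    have "cell_class X d b = cell_class X d c"
      unfolding cell_class_eq_iff using step(2) by auto
    then show ?case using step \<open>\<And>c b. face_glue X d b c \<Longrightarrow> cell_class X d c \<in> V \<Longrightarrow> \<Phi> b = \<Phi> c\<close>[of b c]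
        \<open>\<And>c b. face_glue X d b c \<Longrightarrow> cell_class X d c \<in> V \<Longrightarrow> \<Phi> b = \<Phi> c\<close>[of c b] by auto
  qed
  then show ?thesis by simp
qed

text \<open>The tool behind all maps out of a realisation below. The formula \<open>\<Phi>\<close>
  may depend on the weights by cases, so its continuity is asked locally in the weights, and only
  over an open \<open>V\<close>. The interval is built in for the sake of deformations: a quotient
  map times a locally compact Hausdorff space is again a quotient map.\<close>

lemma realisation_descend:
  fixes \<Phi> :: "nat \<Rightarrow> 'x \<Rightarrow> (nat \<Rightarrow> real) \<Rightarrow> real \<Rightarrow> 'w"
  assumes V: "openin (realisation X d) V"
    and resp: "\<And>p x i t s. x \<in> topspace (X (Suc p)) \<Longrightarrow> i \<le> Suc p \<Longrightarrow> t \<in> standard_simplex p \<Longrightarrow>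
      cell_class X d (p, d (Suc p) i x, t) \<in> V \<Longrightarrow> s \<in> unit_I \<Longrightarrow> \<Phi> (Suc p) x (simplical_face i t) s = \<Phi> p (d (Suc p) i x) t s"
    and loc: "\<And>p x t. x \<in> topspace (X p) \<Longrightarrow> t \<in> standard_simplex p \<Longrightarrow> cell_class X d (p, x, t) \<in> V \<Longrightarrow>
      \<exists>U \<Psi>. openin (simplex_topology p) U \<and> t \<in> U \<and>
        continuous_map (prod_topology (simplices X p) (top_of_set unit_I)) W \<Psi> \<and>
        (\<forall>x t s. x \<in> topspace (X p) \<longrightarrow> t \<in> U \<longrightarrow> cell_class X d (p, x, t) \<in> V \<longrightarrow> s \<in> unit_I \<longrightarrow> \<Phi> p x t s = \<Psi> ((x, t), s))"
  obtains \<phi> where "continuous_map (prod_topology (subtopology (realisation X d) V) (top_of_set unit_I)) W \<phi>"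
    "\<And>p x t s. x \<in> topspace (X p) \<Longrightarrow> t \<in> standard_simplex p \<Longrightarrow> cell_class X d (p, x, t) \<in> V \<Longrightarrow> s \<in> unit_I \<Longrightarrow>
       \<phi> (cell_class X d (p, x, t), s) = \<Phi> p x t s"
proof -
  \<comment> \<open>The value at a point is computed from a chosen representative; invariance under
    gluing makes it independent of the choice.\<close>
  define rep where "rep z = (SOME a. a \<in> topspace (simplex_cells X) \<and> cell_class X d a = z)" for z
  define F where "F s a = \<Phi> (fst a) (fst (snd a)) (snd (snd a)) s" for s and a :: "nat \<times> 'x \<times> (nat \<Rightarrow> real)"
  define \<phi> where "\<phi> = (\<lambda>(z, s). F s (rep z))"
  have \<phi>: "\<phi> (cell_class X d a, s) = F s a" if "a \<in> topspace (simplex_cells X)" "cell_class X d a \<in> V" "s \<in> unit_I" for a s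
  proof -
    have "cell_class X d (rep (cell_class X d a)) = cell_class X d a"
      using someI[of "\<lambda>b. b \<in> topspace (simplex_cells X) \<and> cell_class X d b = cell_class X d a" a] that(1)
      by (simp add: rep_def)
    then have "F s a = F s (rep (cell_class X d a))"
      by (intro cell_class_invariant[of V "F s", OF _ that(2)]) (auto simp: F_def intro!: resp that(3))
    then show ?thesis by (simp add: \<phi>_def)
  qed
  let ?C = "simplex_cells X" and ?I = "top_of_set unit_I"
  define U where "U = {a \<in> topspace ?C. cell_class X d a \<in> V}"
  have Uo: "openin ?C U"
    unfolding U_def by (rule openin_continuous_map_preimage[OF quotient_imp_continuous_map[OF quotient_map_cell_class] V])
  \<comment> \<open>\<open>V\<close> is open, so the quotient map restricts to its preimage, and the
    product with the interval keeps it a quotient map.\<close>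
  have q: "quotient_map (prod_topology (subtopology ?C U) ?I) (prod_topology (subtopology (realisation X d) V) ?I)
      (\<lambda>(a, s). (cell_class X d a, s))"
    by (rule quotient_map_prod_left[OF _ _ quotient_map_restriction[OF quotient_map_cell_class]])
       (use V in \<open>auto simp: U_def Hausdorff_space_subtopology intro!: compact_imp_locally_compact_space unit_I_compact_Hausdorff\<close>)
  let ?P = "prod_topology (subtopology ?C U) ?I"
  define chart where "chart p U' \<Psi> \<longleftrightarrow> openin (simplex_topology p) U' \<and>
        continuous_map (prod_topology (simplices X p) ?I) W \<Psi> \<and>
        (\<forall>x t s. x \<in> topspace (X p) \<longrightarrow> t \<in> U' \<longrightarrow> cell_class X d (p, x, t) \<in> V \<longrightarrow> s \<in> unit_I \<longrightarrow> \<Phi> p x t s = \<Psi> ((x, t), s))"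
    for p U' and \<Psi> :: "('x \<times> (nat \<Rightarrow> real)) \<times> real \<Rightarrow> 'w"
  define T where "T p U' = (U \<inter> ({p} \<times> (topspace (X p) \<times> U'))) \<times> unit_I" for p U'
  have chart_eq: "\<Psi> (snd (fst y), snd y) = F (snd y) (fst y)" if ch: "chart p U' \<Psi>" and yT: "y \<in> T p U'" for p U' \<Psi> y
  proof -
    obtain x t s where y: "y = ((p, x, t), s)" "x \<in> topspace (X p)" "t \<in> U'" "(p, x, t) \<in> U" "s \<in> unit_I"
      using yT unfolding T_def by auto
    moreover have "cell_class X d (p, x, t) \<in> V" using y(4) unfolding U_def by simp
    ultimately have "\<Phi> p x t s = \<Psi> ((x, t), s)" using ch unfolding chart_def by blast
    then show ?thesis by (simp add: y(1) F_def)
  qed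
  \<comment> \<open>The charts live on open sets that cover the preimage of \<open>V\<close>, and
    they agree on overlaps because all of them compute \<open>\<Phi>\<close>.\<close>
  have cont: "continuous_map ?P W (\<lambda>y. F (snd y) (fst y))"
  proof (rule pasting_lemma[where I = "{(p, U', \<Psi>). chart p U' \<Psi>}"
      and T = "\<lambda>(p, U', \<Psi>). T p U'" and f = "\<lambda>(p, U', \<Psi>) y. \<Psi> (snd (fst y), snd y)"])
    fix i assume i0: "i \<in> {(p, U', \<Psi>). chart p U' \<Psi>}"
    obtain p U' \<Psi> where i: "i = (p, U', \<Psi>)" by (cases i) auto
    then have U': "openin (simplex_topology p) U'" 
      and \<Psi>: "continuous_map (prod_topology (simplices X p) ?I) W \<Psi>"
      using i0 by (simp_all add: chart_def)
    have o: "openin (simplices X p) (topspace (X p) \<times> U')"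
      unfolding cg_prod_def openin_cg_topology_iff
      by (intro cg_open_openin) (simp add: openin_prod_Times_iff U')
    have "openin ?C ({p} \<times> (topspace (X p) \<times> U'))"
    proof -
      have "{y. (j, y) \<in> {p} \<times> (topspace (X p) \<times> U')} = (if j = p then topspace (X p) \<times> U' else {})" for j by auto
      then show ?thesis using o openin_subset[OF o] unfolding simplex_cells_def openin_sum_topology by auto
    qed
    then have "openin (subtopology ?C U) (U \<inter> ({p} \<times> (topspace (X p) \<times> U')))"
      using Uo by (simp add: openin_open_subtopology openin_Int)
    then show "openin ?P (case i of (p, U', \<Psi>) \<Rightarrow> T p U')" by (simp add: i T_def openin_prod_Times_iff)
    have sub: "U' \<subseteq> standard_simplex p" using openin_subset[OF U'] by simp
    let ?Q = "U \<inter> ({p} \<times> (topspace (X p) \<times> U'))"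
    have "subtopology ?P (T p U') = prod_topology (subtopology ?C ?Q) ?I"
      by (simp add: T_def subtopology_Times subtopology_subtopology)
    moreover have "continuous_map (subtopology ?C ?Q) (simplices X p) snd"
      unfolding simplex_cells_def
      by (rule continuous_map_from_subtopology_mono[OF continuous_map_sum_snd]) (use sub in auto)
    then have "continuous_map (prod_topology (subtopology ?C ?Q) ?I) (prod_topology (simplices X p) ?I)
        (\<lambda>y. (snd (fst y), snd y))"
      unfolding continuous_map_paired
      using continuous_map_compose[OF continuous_map_fst] continuous_map_snd by (auto simp: o_def)
    from continuous_map_compose[OF this \<Psi>]
    have "continuous_map (prod_topology (subtopology ?C ?Q) ?I) W (\<lambda>y. \<Psi> (snd (fst y), snd y))"
      by (simp add: o_def)
    ultimately show "continuous_map (subtopology ?P (case i of (p, U', \<Psi>) \<Rightarrow> T p U')) W ((\<lambda>(p, U', \<Psi>) y. \<Psi> (snd (fst y), snd y)) i)"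
      by (simp add: i)
  next
    fix i j y assume ij: "i \<in> {(p, U', \<Psi>). chart p U' \<Psi>}" "j \<in> {(p, U', \<Psi>). chart p U' \<Psi>}"
      "y \<in> topspace ?P \<inter> (case i of (p, U', \<Psi>) \<Rightarrow> T p U') \<inter> (case j of (p, U', \<Psi>) \<Rightarrow> T p U')"
    obtain p U' \<Psi> where i: "i = (p, U', \<Psi>)" by (cases i) auto
    obtain p' U'' \<Psi>' where j: "j = (p', U'', \<Psi>')" by (cases j) auto
    have "\<Psi> (snd (fst y), snd y) = F (snd y) (fst y)" using ij i by (intro chart_eq) auto
    moreover have "\<Psi>' (snd (fst y), snd y) = F (snd y) (fst y)" using ij j by (intro chart_eq) auto
    ultimately show "(\<lambda>(p, U', \<Psi>) y. \<Psi> (snd (fst y), snd y)) i y = (\<lambda>(p, U', \<Psi>) y. \<Psi> (snd (fst y), snd y)) j y"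
      by (simp add: i j)
  next
    fix y assume yP: "y \<in> topspace ?P"
    obtain p x t s where y: "y = ((p, x, t), s)" by (metis prod.exhaust)
    then have xt: "x \<in> topspace (X p)" "t \<in> standard_simplex p" "cell_class X d (p, x, t) \<in> V" "s \<in> unit_I" "(p, x, t) \<in> U"
      using yP by (auto simp: U_def topspace_simplex_cells)
    obtain U' \<Psi> where c: "chart p U' \<Psi>" "t \<in> U'"
      using loc[OF xt(1-3)] unfolding chart_def by blast
    have yT: "y \<in> T p U'" using xt c(2) by (auto simp: y T_def)
    show "\<exists>j. j \<in> {(p, U', \<Psi>). chart p U' \<Psi>} \<and> y \<in> (case j of (p, U', \<Psi>) \<Rightarrow> T p U') \<and>
        F (snd y) (fst y) = (\<lambda>(p, U', \<Psi>) y. \<Psi> (snd (fst y), snd y)) j y"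
      by (rule exI[of _ "(p, U', \<Psi>)"]) (use c(1) yT chart_eq[OF c(1) yT] in simp)
  qed
  have "continuous_map ?P W (\<phi> \<circ> (\<lambda>(a, s). (cell_class X d a, s)))"
  proof (rule continuous_map_eq[OF cont])
    fix y assume "y \<in> topspace ?P"
    then have "fst y \<in> U" "snd y \<in> unit_I" by auto
    then show "F (snd y) (fst y) = (\<phi> \<circ> (\<lambda>(a, s). (cell_class X d a, s))) y"
      using \<phi>[of "fst y" "snd y"] unfolding U_def by (simp add: split_def)
  qed
  then have "continuous_map (prod_topology (subtopology (realisation X d) V) ?I) W \<phi>"
    by (rule continuous_compose_quotient_map[OF q])
  then show ?thesis
    by (rule that) (simp add: \<phi> topspace_simplex_cells F_def)
qed

end

section \<open>Faces spanned by the largest weights\<close>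

text \<open>\<open>keep_face d k A q x\<close> is the face of the \<open>q\<close>-simplex \<open>x\<close> obtained by forgetting the vertices
  \<open>j < k\<close> that are not in \<open>A\<close>, in decreasing order, so that the indices of the remaining candidates
  do not change.\<close>

primrec keep_face :: "(nat \<Rightarrow> nat \<Rightarrow> 'x \<Rightarrow> 'x) \<Rightarrow> nat \<Rightarrow> nat set \<Rightarrow> nat \<Rightarrow> 'x \<Rightarrow> 'x" where
  "keep_face d 0 A q x = x"
| "keep_face d (Suc k) A q x = (if k \<in> A then keep_face d k A q x else keep_face d k A (q - 1) (d q k x))"

text \<open>The coface map: the increasing injection of vertices that misses
  \<open>i\<close>.\<close>

definition skip :: "nat \<Rightarrow> nat \<Rightarrow> nat" where
  "skip i j = (if j < i then j else Suc j)"

lemma inj_skip: "inj (skip i)"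
  by (auto simp: inj_def skip_def split: if_splits)

lemma range_skip: "range (skip i) = - {i}"
proof -
  have "m \<in> range (skip i)" if "m \<noteq> i" for m
    by (cases "m < i") (use that in \<open>auto simp: skip_def image_iff intro: exI[of _ m] exI[of _ "m - 1"]\<close>)
  then show ?thesis by (auto simp: skip_def split: if_splits)
qed

lemma skip_image_simps:
  "i \<notin> skip i ` A" "j < i \<Longrightarrow> j \<in> skip i ` A \<longleftrightarrow> j \<in> A" "i \<le> j \<Longrightarrow> Suc j \<in> skip i ` A \<longleftrightarrow> j \<in> A"
  by (auto simp: skip_def image_iff split: if_splits)

lemma keep_face_cong: "(\<And>j. j < k \<Longrightarrow> j \<in> A \<longleftrightarrow> j \<in> B) \<Longrightarrow> keep_face d k A q x = keep_face d k B q x"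
  by (induction k arbitrary: q x) auto

lemma card_lessThan_Suc_Diff: 
  "card ({..<Suc k} - A) = (if k \<in> A then card ({..<k} - A) else Suc (card ({..<k} - A)))"
proof -
  have "{..<Suc k} - A = (if k \<in> A then {..<k} - A else insert k ({..<k} - A))" by (auto simp: less_Suc_eq)
  then show ?thesis by auto
qed

text \<open>The compatibility with gluing that lets \<open>keep_face\<close> descend. The image of
  \<open>A\<close> under \<open>skip i\<close> omits \<open>i\<close>, so forgetting its complement
  includes forgetting \<open>i\<close>; in the induction the face \<open>i\<close> is moved past the
  higher faces by the face identity. The carriers \<open>C\<close> are abstract so that the lemma
  serves simplices and weights alike.\<close>

lemma keep_face_skip:
  assumes cl: "\<And>p i x. x \<in> C (Suc p) \<Longrightarrow> i \<le> Suc p \<Longrightarrow> d (Suc p) i x \<in> C p"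
    and ff: "\<And>p i j x. x \<in> C (Suc (Suc p)) \<Longrightarrow> i < j \<Longrightarrow> j \<le> Suc (Suc p) \<Longrightarrow>
      d (Suc p) i (d (Suc (Suc p)) j x) = d (Suc p) (j - 1) (d (Suc (Suc p)) i x)"
  shows "x \<in> C (Suc q) \<Longrightarrow> i \<le> k \<Longrightarrow> k \<le> Suc q \<Longrightarrow> card ({..<k} - A) \<le> q \<Longrightarrow>
    keep_face d k A q (d (Suc q) i x) = keep_face d (Suc k) (skip i ` A) (Suc q) x"
proof (induction k arbitrary: q x)
  case 0
  then show ?case using skip_image_simps(1)[of 0 A] by simp
next
  case (Suc k)
  show ?case
  proof (cases "i = Suc k")
    case True
    have "keep_face d (Suc k) (skip i ` A) q y = keep_face d (Suc k) A q y" for y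
      by (rule keep_face_cong) (use True skip_image_simps(2)[of _ i A] in auto)
    then show ?thesis using skip_image_simps(1)[of i A] True by (simp del: keep_face.simps(2) add: keep_face.simps(2)[of d "Suc k"])
  next
    case False
    then have ik: "i \<le> k" using Suc.prems by simp
    show ?thesis
    proof (cases "k \<in> A")
      case True
      then show ?thesis
        using Suc.IH[OF Suc.prems(1) ik] Suc.prems skip_image_simps(3)[OF ik, of A]
        by (simp add: card_lessThan_Suc_Diff del: keep_face.simps(2) add: keep_face.simps(2)[of d k A] keep_face.simps(2)[of d "Suc k" "skip i ` A"])
    next
      case kA: False
      \<comment> \<open>The cardinality bound keeps \<open>q\<close> positive, so that the
        predecessor in \<open>keep_face\<close> is not truncated.\<close>
      then have c: "Suc (card ({..<k} - A)) \<le> q" using Suc.prems(4) by (simp add: card_lessThan_Suc_Diff)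
      then obtain q' where q: "q = Suc q'" by (cases q) auto
      have "keep_face d (Suc k) A q (d (Suc q) i x) = keep_face d k A q' (d (Suc q') k (d (Suc (Suc q')) i x))"
        using kA by (simp add: q)
      also have "d (Suc q') k (d (Suc (Suc q')) i x) = d (Suc q') i (d (Suc (Suc q')) (Suc k) x)"
        using ff[of x q' i "Suc k"] Suc.prems ik by (simp add: q)
      also have "keep_face d k A q' \<dots> = keep_face d (Suc k) (skip i ` A) (Suc q') (d (Suc (Suc q')) (Suc k) x)"
        by (rule Suc.IH) (use cl[of x "Suc q'" "Suc k"] Suc.prems ik c in \<open>auto simp: q\<close>)
      also have "\<dots> = keep_face d (Suc (Suc k)) (skip i ` A) (Suc q) x"
        using kA skip_image_simps(3)[OF ik, of A] by (simp add: q)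
      finally show ?thesis .
    qed
  qed
qed

text \<open>Undoes the insertion of a zero weight at \<open>k\<close>. It has the argument list of a
  face operator, so that \<open>keep_face\<close> applies to weights exactly as to
  simplices.\<close>

definition drop_coord :: "nat \<Rightarrow> nat \<Rightarrow> (nat \<Rightarrow> real) \<Rightarrow> nat \<Rightarrow> real" where
  "drop_coord q k t = (\<lambda>j. t (skip k j))"

lemma drop_coord_face: "drop_coord q k (simplical_face k t) = t"
  by (auto simp: drop_coord_def simplical_face_def skip_def)

lemma face_drop_coord: "t k = 0 \<Longrightarrow> simplical_face k (drop_coord q k t) = t"
  by (auto simp: drop_coord_def simplical_face_def skip_def fun_eq_iff)

lemma drop_coord_drop_coord: "i < j \<Longrightarrow> drop_coord q i (drop_coord r j t) = drop_coord q (j - 1) (drop_coord r i t)"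
  by (auto simp: drop_coord_def skip_def fun_eq_iff)

lemma keep_coord_face:
  assumes "i \<le> k" "k \<le> Suc q" "card ({..<k} - A) \<le> q"
  shows "keep_face drop_coord (Suc k) (skip i ` A) (Suc q) (simplical_face i t) = keep_face drop_coord k A q t"
  using keep_face_skip[of "\<lambda>_. UNIV" drop_coord "simplical_face i t" q i k A] assms
  by (simp add: drop_coord_drop_coord drop_coord_face)

lemma standard_simplexI:
  assumes "\<And>i. 0 \<le> t i" "\<And>i. p < i \<Longrightarrow> t i = 0" "(\<Sum>i\<le>p. t i) = 1"
  shows "t \<in> standard_simplex p"
proof -
  have "t i \<le> 1" for i
    using member_le_sum[of i "{..p}" t] assms by (cases "i \<le> p") auto
  then show ?thesis using assms by (auto simp: standard_simplex_def)
qed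

lemma standard_simplexD:
  assumes "t \<in> standard_simplex p"
  shows "0 \<le> t i" "p < i \<Longrightarrow> t i = 0" "(\<Sum>i\<le>p. t i) = 1"
  using assms by (auto simp: standard_simplex_def)

lemma sum_skip: 
  assumes "k \<le> Suc q"
  shows "(\<Sum>j\<le>Suc q. t j) = t k + (\<Sum>j\<le>q. (t (skip k j) :: real))"
proof -
  have "{..Suc q} = insert k (skip k ` {..q})"
  proof (intro equalityI subsetI)
    fix j assume j: "j \<in> {..Suc q}"
    show "j \<in> insert k (skip k ` {..q})"
    proof (cases "j = k")
      case False
      then obtain i where i: "j = skip k i" using range_skip[of k] by blast
      then have "i \<le> q" using j assms by (auto simp: skip_def split: if_splits)
      then show ?thesis using i by blast
    qed simp
  qed (use assms in \<open>auto simp: skip_def split: if_splits\<close>)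
  moreover have "k \<notin> skip k ` {..q}" by (rule skip_image_simps(1))
  moreover have "sum t (skip k ` {..q}) = (\<Sum>j\<le>q. t (skip k j))"
    by (subst sum.reindex) (auto intro: inj_on_subset[OF inj_skip])
  ultimately show ?thesis by simp
qed

lemma drop_coord_simplex:
  assumes t: "t \<in> standard_simplex (Suc q)" and k: "k \<le> Suc q" "t k = 0"
  shows "drop_coord r k t \<in> standard_simplex q"
proof (rule standard_simplexI)
  show "0 \<le> drop_coord r k t i" for i using standard_simplexD[OF t] by (simp add: drop_coord_def)
  show "drop_coord r k t i = 0" if "q < i" for i 
    using standard_simplexD(2)[OF t, of "Suc i"] that k by (simp add: drop_coord_def skip_def)
  show "(\<Sum>i\<le>q. drop_coord r k t i) = 1" using standard_simplexD(3)[OF t] sum_skip[OF k(1), of t] k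
    by (simp add: drop_coord_def)
qed

lemma continuous_map_coordinate: "continuous_map (simplex_topology p) euclideanreal (\<lambda>t. t i)"
  unfolding simplex_topology_def
  by (intro continuous_map_from_subtopology continuous_map_product_projection) simp

lemma continuous_map_to_simplex:
  assumes "\<And>i. continuous_map Z euclideanreal (\<lambda>z. f z i)" "\<And>z. z \<in> topspace Z \<Longrightarrow> f z \<in> standard_simplex p"
  shows "continuous_map Z (simplex_topology p) f"
  unfolding simplex_topology_def continuous_map_in_subtopology continuous_map_componentwise_UNIV using assms by auto

text \<open>\<open>b\<close> ranges over all naturals, also beyond the last vertex, where the
  weights of a simplex vanish. Hence the members of a top set have positive weight, and, up to
  renumbering, inserting a vertex of weight zero neither creates nor destroys a top set.\<close>

definition top_set :: "nat \<Rightarrow> (nat \<Rightarrow> real) \<Rightarrow> nat set \<Rightarrow> bool" where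
  "top_set m t A \<longleftrightarrow> finite A \<and> card A = Suc m \<and> (\<forall>a\<in>A. \<forall>b. b \<notin> A \<longrightarrow> t b < t a)"

lemma card_le_not_subset: "finite A \<Longrightarrow> finite B \<Longrightarrow> card B \<le> card A \<Longrightarrow> a \<in> B \<Longrightarrow> a \<notin> A \<Longrightarrow> \<exists>b. b \<in> A \<and> b \<notin> B"
  by (metis card_seteq subsetI)

text \<open>Otherwise counting finds in each set a member missing from the other, and each of their
  two weights would exceed the other.\<close>

lemma top_set_mono:
  assumes "top_set m t A" "top_set p t B" "p \<le> m"
  shows "B \<subseteq> A"
proof
  fix b assume b: "b \<in> B"
  show "b \<in> A"
  proof (rule ccontr)
    assume "b \<notin> A"
    moreover obtain a where "a \<in> A" "a \<notin> B"
      using card_le_not_subset[of A B b] b \<open>b \<notin> A\<close> assms by (auto simp: top_set_def)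
    ultimately show False using assms b unfolding top_set_def by (meson less_asym)
  qed
qed

lemma top_set_unique: "top_set m t A \<Longrightarrow> top_set m t B \<Longrightarrow> A = B"
  using top_set_mono[of m t A m B] top_set_mono[of m t B m A] by auto

lemma top_set_pos:
  assumes t: "t \<in> standard_simplex q" and A: "top_set m t A" "a \<in> A"
  shows "0 < t a"
proof -
  obtain b where "b \<notin> A" using A(1) infinite_UNIV_nat unfolding top_set_def by (metis ex_new_if_finite)
  then have "t b < t a" using A by (auto simp: top_set_def)
  then show ?thesis using standard_simplexD(1)[OF t, of b] by simp
qed

lemma top_set_subset: "t \<in> standard_simplex q \<Longrightarrow> top_set m t A \<Longrightarrow> A \<subseteq> {..q}"
  using top_set_pos standard_simplexD(2) by (fastforce simp: not_less[symmetric])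

lemma top_set_le:
  assumes "t \<in> standard_simplex q" "top_set m t A"
  shows "m \<le> q" "card ({..<Suc q} - A) = q - m"
proof -
  have A: "finite A" "card A = Suc m" "A \<subseteq> {..<Suc q}" using assms top_set_subset by (auto simp: top_set_def lessThan_Suc_atMost)
  then show "m \<le> q" using card_mono[OF _ A(3)] by simp
  show "card ({..<Suc q} - A) = q - m" using A by (subst card_Diff_subset) auto
qed

lemma simplical_face_skip: "simplical_face i t (skip i j) = t j" "simplical_face i t i = 0"
  by (auto simp: simplical_face_def skip_def)

lemma top_set_face:
  assumes t: "t \<in> standard_simplex q" and A: "top_set m t A"
  shows "top_set m (simplical_face i t) (skip i ` A)"
proof -
  have "card (skip i ` A) = card A" by (meson card_image inj_skip inj_on_subset subset_UNIV)
  moreover have "simplical_face i t b < simplical_face i t (skip i a)" if a: "a \<in> A" and b: "b \<notin> skip i ` A" for a b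
  proof (cases "b = i")
    case True
    then show ?thesis using top_set_pos[OF t A a] by (simp add: simplical_face_skip)
  next
    case False
    then obtain c where c: "b = skip i c" using range_skip[of i] by blast
    then have "c \<notin> A" using b by blast
    then show ?thesis using A a by (simp add: c simplical_face_skip top_set_def)
  qed
  ultimately show ?thesis using A by (auto simp: top_set_def)
qed

lemma top_set_face_iff:
  assumes t: "t \<in> standard_simplex q"
  shows "(\<exists>A. top_set m (simplical_face i t) A) \<longleftrightarrow> (\<exists>A. top_set m t A)"
proof
  assume "\<exists>A. top_set m (simplical_face i t) A"
  then obtain B where B: "top_set m (simplical_face i t) B" by blast
  have nn: "0 \<le> simplical_face i t b" for b using standard_simplexD(1)[OF t] by (auto simp: simplical_face_def)
  have "i \<notin> B"
  proof
    assume "i \<in> B"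
    moreover obtain b where "b \<notin> B" using B infinite_UNIV_nat unfolding top_set_def by (metis ex_new_if_finite)
    ultimately have "simplical_face i t b < 0" using B simplical_face_skip(2)[of i t] by (auto simp: top_set_def)
    then show False using nn[of b] by simp
  qed
  then have Bi: "B = skip i ` (skip i -` B)" using range_skip[of i] by (auto simp: image_iff)
  let ?A = "skip i -` B"
  have "card B = card ?A" by (subst Bi) (meson card_image inj_skip inj_on_subset subset_UNIV)
  moreover have "finite ?A" using B finite_vimageI[OF _ inj_skip] by (auto simp: top_set_def)
  moreover have "t b < t a" if "a \<in> ?A" "b \<notin> ?A" for a b
    using B that simplical_face_skip(1)[of i t] by (auto simp: top_set_def) metis
  ultimately have "top_set m t ?A" using B by (auto simp: top_set_def)
  then show "\<exists>A. top_set m t A" by blast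
qed (use top_set_face[OF t] in blast)

text \<open>The support of the weights is always a top set; this is why the stars cover.\<close>

lemma top_set_exists:
  assumes t: "t \<in> standard_simplex q"
  obtains m A where "top_set m t A"
proof -
  let ?A = "{i. t i \<noteq> 0}"
  have sub: "?A \<subseteq> {..q}" using standard_simplexD(2)[OF t] by (auto simp: not_less[symmetric])
  then have fin: "finite ?A" by (rule finite_subset) simp
  have "?A \<noteq> {}"
  proof
    assume "?A = {}"
    then have "t = (\<lambda>_. 0)" by auto
    then show False using standard_simplexD(3)[OF t] by simp
  qed
  then have c: "card ?A = Suc (card ?A - 1)" using fin by (metis Suc_pred' card_gt_0_iff)
  moreover have "t b < t a" if "a \<in> ?A" "b \<notin> ?A" for a b
    using that standard_simplexD(1)[OF t, of a] by auto
  ultimately have "top_set (card ?A - 1) t ?A" using fin by (auto simp: top_set_def)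
  then show ?thesis by (rule that)
qed

lemma openin_top_set: "openin (simplex_topology q) {t \<in> standard_simplex q. top_set m t A}"
proof (cases "finite A \<and> card A = Suc m \<and> A \<subseteq> {..q}")
  case True
  \<comment> \<open>Positivity on \<open>A\<close> stands for the comparison with the infinitely
    many vertices beyond \<open>q\<close>, which leaves finitely many open conditions.\<close>
  have "{t \<in> standard_simplex q. top_set m t A} =
      standard_simplex q \<inter> (\<Inter>a\<in>A. {t \<in> topspace (simplex_topology q). t a \<in> {0<..}}) \<inter>
      (\<Inter>(a, b)\<in>A \<times> ({..q} - A). {t \<in> topspace (simplex_topology q). t a - t b \<in> {0<..}})" (is "?l = ?r")
  proof (intro equalityI subsetI)
    fix t assume "t \<in> ?l" then show "t \<in> ?r" using top_set_pos[of t q m A] by (auto simp: top_set_def)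
  next
    fix t assume t: "t \<in> ?r"
    have "t b < t a" if "a \<in> A" "b \<notin> A" for a b
    proof (cases "b \<le> q")
      case True
      then show ?thesis using t that by auto
    next
      case False
      then have "t b = 0" using t standard_simplexD(2)[of t q b] by auto
      then show ?thesis using t that by auto
    qed
    then show "t \<in> ?l" using t True by (auto simp: top_set_def)
  qed
  moreover have "openin (simplex_topology q) ?r"
  proof -
    have "openin (simplex_topology q) {t \<in> topspace (simplex_topology q). t a \<in> {0<..}}" for a
      by (rule openin_continuous_map_preimage[OF continuous_map_coordinate]) auto
    moreover have "openin (simplex_topology q) {t \<in> topspace (simplex_topology q). t a - t b \<in> {0<..}}" for a b
      by (rule openin_continuous_map_preimage[of _ euclideanreal]) (auto intro!: continuous_map_diff continuous_map_coordinate)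
    ultimately show ?thesis
      using True openin_topspace[of "simplex_topology q"]
      by (intro openin_Int_Inter openin_Int) (auto intro!: openin_Int_Inter)
  qed
  ultimately show ?thesis by simp
next
  case False
  then have "{t \<in> standard_simplex q. top_set m t A} = {}" (is "?l = {}")
  proof (intro equals0I)
    fix t assume "t \<in> ?l"
    then have "A \<subseteq> {..q}" "top_set m t A" using top_set_subset by blast+
    then show False using False by (simp add: top_set_def)
  qed
  then show ?thesis by (simp only: openin_empty)
qed

text \<open>The weights outside \<open>A\<close> are scaled down and the lost mass is spread evenly over \<open>A\<close>, so that
  the order of the weights is preserved.\<close>

definition push :: "nat set \<Rightarrow> real \<Rightarrow> (nat \<Rightarrow> real) \<Rightarrow> nat \<Rightarrow> real" where
  "push A s t = (\<lambda>j. if j \<in> A then t j + s * (1 - (\<Sum>a\<in>A. t a)) / real (card A) else (1 - s) * t j)"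

lemma push_0: "push A 0 t = t"
  by (auto simp: push_def)

lemma sum_simplex_le: "t \<in> standard_simplex q \<Longrightarrow> A \<subseteq> {..q} \<Longrightarrow> (\<Sum>a\<in>A. t a) \<le> 1"
  using sum_mono2[of "{..q}" A t] standard_simplexD[of t q] by auto

lemma push_simplex:
  assumes t: "t \<in> standard_simplex q" and A: "A \<subseteq> {..q}" "A \<noteq> {}" and s: "s \<in> unit_I"
  shows "push A s t \<in> standard_simplex q"
proof (rule standard_simplexI)
  have fin: "finite A" using A finite_subset by blast
  have le: "(\<Sum>a\<in>A. t a) \<le> 1" using sum_simplex_le[OF t A(1)] .
  show "0 \<le> push A s t i" for i using standard_simplexD(1)[OF t, of i] s le by (auto simp: push_def)
  show "push A s t i = 0" if "q < i" for i using standard_simplexD(2)[OF t that] that A by (auto simp: push_def)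
  have "(\<Sum>i\<le>q. push A s t i) = (\<Sum>i\<in>A. push A s t i) + (\<Sum>i\<in>{..q} - A. push A s t i)"
    using A by (subst sum.subset_diff[of A "{..q}"]) auto
  also have "(\<Sum>i\<in>A. push A s t i) = (\<Sum>a\<in>A. t a) + s * (1 - (\<Sum>a\<in>A. t a))"
    using fin A(2) by (simp add: push_def sum.distrib)
  also have "(\<Sum>i\<in>{..q} - A. push A s t i) = (1 - s) * (\<Sum>i\<in>{..q} - A. t i)"
    by (simp add: push_def sum_distrib_left)
  also have "(\<Sum>i\<in>{..q} - A. t i) = 1 - (\<Sum>a\<in>A. t a)"
    using standard_simplexD(3)[OF t] A by (subst sum_diff) auto
  finally show "(\<Sum>i\<le>q. push A s t i) = 1" by (simp add: algebra_simps)
qed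

lemma push_face: "finite A \<Longrightarrow> push (skip i ` A) s (simplical_face i t) = simplical_face i (push A s t)"
proof
  fix j assume fin: "finite A"
  have inj: "inj_on (skip i) A" using inj_skip by (rule inj_on_subset) simp
  have s: "(\<Sum>a\<in>skip i ` A. simplical_face i t a) = (\<Sum>a\<in>A. t a)" "card (skip i ` A) = card A"
    by (simp_all add: sum.reindex[OF inj] card_image[OF inj] simplical_face_skip)
  show "push (skip i ` A) s (simplical_face i t) j = simplical_face i (push A s t) j"
  proof (cases "j = i")
    case True
    then show ?thesis using skip_image_simps(1)[of i A] by (simp add: push_def simplical_face_skip)
  next
    case False
    then obtain c where "j = skip i c" using range_skip[of i] by blast
    moreover have "skip i c \<in> skip i ` A \<longleftrightarrow> c \<in> A" using inj_skip by (auto simp: inj_def)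
    ultimately show ?thesis by (simp add: push_def simplical_face_skip s)
  qed
qed

text \<open>Weights in \<open>A\<close> rise by a common amount while the others do not rise, so the
  smaller top sets inside \<open>A\<close> survive. This is why a finite intersection of stars is
  deformed along the largest of its indices.\<close>

lemma top_set_push:
  assumes t: "t \<in> standard_simplex q" and A: "top_set m t A" and B: "top_set p t B" and pm: "p \<le> m" and s: "s \<in> unit_I"
  shows "top_set p (push A s t) B"
proof -
  have BA: "B \<subseteq> A" by (rule top_set_mono[OF A B pm])
  have le: "(\<Sum>a\<in>A. t a) \<le> 1" using sum_simplex_le[OF t top_set_subset[OF t A]] .
  have "push A s t b < push A s t a" if a: "a \<in> B" and b: "b \<notin> B" for a b
  proof -
    have ab: "t b < t a" using B a b by (auto simp: top_set_def)
    show ?thesis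
    proof (cases "b \<in> A")
      case True
      then show ?thesis using a BA ab by (auto simp: push_def)
    next
      case False
      have "(1 - s) * t b \<le> t b" using s standard_simplexD(1)[OF t, of b] by (simp add: mult_left_le_one_le)
      moreover have "0 \<le> s * (1 - (\<Sum>a\<in>A. t a)) / real (card A)" using s le by simp
      ultimately show ?thesis using False a BA ab by (auto simp: push_def)
    qed
  qed
  then show ?thesis using B by (auto simp: top_set_def)
qed

section \<open>Open stars in a realisation\<close>

lemma top_set_nonempty: "top_set m t A \<Longrightarrow> A \<noteq> {}"
  by (auto simp: top_set_def)

lemma continuous_map_push:
  assumes "A \<subseteq> {..q}" "A \<noteq> {}"
  shows "continuous_map (prod_topology (simplex_topology q) (top_of_set unit_I)) (simplex_topology q) (\<lambda>y. push A (snd y) (fst y))"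
proof (rule continuous_map_to_simplex)
  let ?P = "prod_topology (simplex_topology q) (top_of_set unit_I)"
  have c: "continuous_map ?P euclideanreal (\<lambda>y. fst y j)" for j
    using continuous_map_compose[OF continuous_map_fst continuous_map_coordinate] by (simp add: o_def)
  have s: "continuous_map ?P euclideanreal snd"
    by (rule continuous_map_into_fulltopology[OF continuous_map_snd])
  have "continuous_map ?P euclideanreal (\<lambda>y. snd y * (1 - (\<Sum>a\<in>A. fst y a)) / real (card A))"
    using assms by (intro continuous_map_real_divide continuous_map_real_mult continuous_map_diff s c continuous_map_sum continuous_map_const[THEN iffD2]) 
      (auto intro: finite_subset simp: card_eq_0_iff dest: finite_subset)
  then show "continuous_map ?P euclideanreal (\<lambda>y. push A (snd y) (fst y) i)" for i
    unfolding push_def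
    by (cases "i \<in> A") (simp_all add: continuous_map_add continuous_map_real_mult continuous_map_diff s c)
  show "push A (snd y) (fst y) \<in> standard_simplex q" if "y \<in> topspace ?P" for y
    using that by (intro push_simplex assms) auto
qed

text \<open>Forgetting vertices merely renumbers the weights, which gives continuity coordinate by
  coordinate.\<close>

lemma keep_coord_coordinate:
  "\<exists>j. \<forall>t. keep_face drop_coord k A q t i = t j"
proof (induction k arbitrary: q i)
  case (Suc k)
  then show ?case
  proof (cases "k \<in> A")
    case False
    obtain j where "\<forall>t. keep_face drop_coord k A (q - 1) t i = t j" using Suc by blast
    then have "keep_face drop_coord (Suc k) A q t i = drop_coord q k t j" for t using False by simp
    then have "\<forall>t. keep_face drop_coord (Suc k) A q t i = t (skip k j)" unfolding drop_coord_def[of q k] by blast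
    then show ?thesis by blast
  qed auto
qed auto

context semi_simplicial begin

lemma continuous_map_keep_face:
  "k \<le> Suc q \<Longrightarrow> card ({..<k} - A) \<le> q \<Longrightarrow>
    continuous_map (X q) (X (q - card ({..<k} - A))) (keep_face d k A q)"
proof (induction k arbitrary: q)
  case 0
  then show ?case using continuous_map_id[of "X q"] by (simp add: id_def)
next
  case (Suc k)
  show ?case
  proof (cases "k \<in> A")
    case False
    then obtain q' where q: "q = Suc q'" using Suc.prems(2) by (cases q) (auto simp: card_lessThan_Suc_Diff)
    have "continuous_map (X q') (X (q' - card ({..<k} - A))) (keep_face d k A q')"
      by (rule Suc.IH) (use Suc.prems q False in \<open>auto simp: card_lessThan_Suc_Diff\<close>)
    from continuous_map_compose[OF face_continuous[of k q'] this] show ?thesis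
      using False Suc.prems by (simp add: card_lessThan_Suc_Diff q o_def)
  qed (use Suc in \<open>auto simp: card_lessThan_Suc_Diff\<close>)
qed

text \<open>Each forgotten vertex has weight zero, so each step is one gluing relation and the point
  of the realisation stays the same.\<close>

lemma cell_class_keep_face:
  "x \<in> topspace (X q) \<Longrightarrow> t \<in> standard_simplex q \<Longrightarrow> k \<le> Suc q \<Longrightarrow> card ({..<k} - A) \<le> q \<Longrightarrow>
    (\<And>j. j < k \<Longrightarrow> j \<notin> A \<Longrightarrow> t j = 0) \<Longrightarrow>
    keep_face drop_coord k A q t \<in> standard_simplex (q - card ({..<k} - A)) \<and>
    cell_class X d (q, x, t) = cell_class X d (q - card ({..<k} - A), keep_face d k A q x, keep_face drop_coord k A q t)"
proof (induction k arbitrary: q x t)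
  case (Suc k)
  show ?case
  proof (cases "k \<in> A")
    case True
    then show ?thesis using Suc by (simp add: card_lessThan_Suc_Diff)
  next
    case False
    then obtain q' where q: "q = Suc q'" using Suc.prems(4) by (cases q) (auto simp: card_lessThan_Suc_Diff)
    have tk: "t k = 0" using Suc.prems(5) False by simp
    have dt: "drop_coord q k t \<in> standard_simplex q'"
      using drop_coord_simplex Suc.prems tk by (simp add: q)
    have "keep_face drop_coord k A q' (drop_coord q k t) \<in> standard_simplex (q' - card ({..<k} - A)) \<and>
      cell_class X d (q', d (Suc q') k x, drop_coord q k t) =
      cell_class X d (q' - card ({..<k} - A), keep_face d k A q' (d (Suc q') k x), keep_face drop_coord k A q' (drop_coord q k t))"
    proof (rule Suc.IH)
      show "drop_coord q k t j = 0" if "j < k" "j \<notin> A" for j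
        using Suc.prems(5)[of j] that by (simp add: drop_coord_def skip_def)
    qed (use Suc.prems False dt face_in[of x q' k] in \<open>auto simp: card_lessThan_Suc_Diff q\<close>)
    moreover have "cell_class X d (q, x, t) = cell_class X d (q', d (Suc q') k x, drop_coord q k t)"
      using cell_class_face[of x X q' k "drop_coord q k t" d] face_drop_coord[of t k q] tk Suc.prems dt by (simp add: q)
    ultimately show ?thesis using False by (simp add: card_lessThan_Suc_Diff q)
  qed
qed simp

declare keep_face.simps(2) [simp del]

text \<open>In the barycentric subdivision of a simplex, the open star of the barycentre of a face
  consists of the points whose weights on that face exceed all others. \<open>star m\<close> is the
  union of these open stars over the faces of dimension \<open>m\<close>.\<close>

definition star :: "nat \<Rightarrow> (nat \<times> 'x \<times> (nat \<Rightarrow> real)) set set" where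
  "star m = {z. \<exists>q x t A. x \<in> topspace (X q) \<and> t \<in> standard_simplex q \<and> z = cell_class X d (q, x, t) \<and> top_set m t A}"

lemma star_iff:
  assumes "x \<in> topspace (X q)" "t \<in> standard_simplex q"
  shows "cell_class X d (q, x, t) \<in> star m \<longleftrightarrow> (\<exists>A. top_set m t A)"
proof
  assume "cell_class X d (q, x, t) \<in> star m"
  then obtain q' x' t' A where *: "cell_class X d (q, x, t) = cell_class X d (q', x', t')" "top_set m t' A"
    unfolding star_def by blast
  have "(\<exists>A. top_set m (snd (snd (q, x, t))) A) = (\<exists>A. top_set m (snd (snd (q', x', t'))) A)"
    by (rule cell_class_invariant[of UNIV "\<lambda>a. \<exists>A. top_set m (snd (snd a)) A", OF _ _ *(1)])
       (simp_all add: top_set_face_iff)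
  then show "\<exists>A. top_set m t A" using *(2) by auto
qed (use assms in \<open>auto simp: star_def\<close>)

lemma star_subset: "star m \<subseteq> topspace (realisation X d)"
  by (auto simp: star_def cell_class_in)

lemma openin_star: "openin (realisation X d) (star m)"
proof -
  have "openin (simplex_cells X) {a \<in> topspace (simplex_cells X). cell_class X d a \<in> star m}"
    unfolding simplex_cells_def openin_sum_topology
  proof (intro conjI ballI)
    fix q :: nat
    have "{y. (q, y) \<in> {a \<in> topspace (sum_topology (\<lambda>p. simplices X p) UNIV). cell_class X d a \<in> star m}}
       = topspace (X q) \<times> (\<Union>A. {t \<in> standard_simplex q. top_set m t A})"
      using star_iff by auto
    moreover have "openin (cg_prod (X q) (simplex_topology q)) (topspace (X q) \<times> (\<Union>A. {t \<in> standard_simplex q. top_set m t A}))"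
      unfolding cg_prod_def openin_cg_topology_iff
      by (intro cg_open_openin) (auto simp: openin_prod_Times_iff intro!: openin_Union openin_top_set disjI2)
    ultimately show "openin (cg_prod (X q) (simplex_topology q)) {y. (q, y) \<in> {a \<in> topspace (sum_topology (\<lambda>p. simplices X p) UNIV). cell_class X d a \<in> star m}}"
      by simp
  qed auto
  then show ?thesis
    using quotient_map_cell_class[of X d] star_subset[of m] unfolding quotient_map_def by blast
qed

lemma star_cover:
  assumes "z \<in> topspace (realisation X d)"
  obtains m where "z \<in> star m"
proof -
  obtain q x t where z: "x \<in> topspace (X q)" "t \<in> standard_simplex q" "z = cell_class X d (q, x, t)"
    using realisation_cases[OF assms] by blast
  obtain m A where "top_set m t A" using top_set_exists[OF z(2)] by blast
  then show ?thesis using that[of m] unfolding z(3) star_iff[OF z(1,2)] by blast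
qed

lemma star_bound:
  assumes "z \<in> topspace (realisation X d)"
  obtains q where "\<And>m. z \<in> star m \<Longrightarrow> m \<le> q"
proof -
  obtain q x t where z: "x \<in> topspace (X q)" "t \<in> standard_simplex q" "z = cell_class X d (q, x, t)"
    using realisation_cases[OF assms] by blast
  show ?thesis
  proof (rule that)
    fix m assume "z \<in> star m"
    then show "m \<le> q" unfolding z(3) star_iff[OF z(1,2)] using top_set_le(1)[OF z(2)] by blast
  qed
qed

definition top_verts :: "nat \<Rightarrow> (nat \<Rightarrow> real) \<Rightarrow> nat set" where
  "top_verts m t = (THE A. top_set m t A)"

lemma top_verts_eq: "top_set m t A \<Longrightarrow> top_verts m t = A"
  unfolding top_verts_def by (rule the_equality) (auto dest: top_set_unique)

text \<open>The top set is locally constant in the weights, so on each chart \<open>push\<close> has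
  a fixed \<open>A\<close>; it commutes with inserting a vertex of weight zero and therefore
  descends.\<close>

lemma star_homotopy:
  obtains D where
    "continuous_map (prod_topology (subtopology (realisation X d) (star m)) (top_of_set unit_I)) (realisation X d) D"
    "\<And>q x t A s. x \<in> topspace (X q) \<Longrightarrow> t \<in> standard_simplex q \<Longrightarrow> top_set m t A \<Longrightarrow> s \<in> unit_I \<Longrightarrow>
       D (cell_class X d (q, x, t), s) = cell_class X d (q, x, push A s t)"
proof (rule realisation_descend[OF openin_star[of m], of "\<lambda>q x t s. cell_class X d (q, x, push (top_verts m t) s t)" "realisation X d"])
  fix p x i t s assume x: "x \<in> topspace (X (Suc p))" "i \<le> Suc p" "t \<in> standard_simplex p"
    and V: "cell_class X d (p, d (Suc p) i x, t) \<in> star m" and s: "s \<in> unit_I"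
  obtain A where A: "top_set m t A" using V star_iff[OF face_in[OF x(1,2)] x(3)] by blast
  then have "top_verts m (simplical_face i t) = skip i ` A" "top_verts m t = A"
    using top_verts_eq top_set_face[OF x(3)] by blast+
  moreover have "push A s t \<in> standard_simplex p"
    using A s top_set_subset[OF x(3) A] by (intro push_simplex x) (auto simp: top_set_def)
  ultimately show "cell_class X d (Suc p, x, push (top_verts m (simplical_face i t)) s (simplical_face i t)) =
      cell_class X d (p, d (Suc p) i x, push (top_verts m t) s t)"
    using A x by (simp add: push_face cell_class_face top_set_def)
next
  fix p x t assume x: "x \<in> topspace (X p)" "t \<in> standard_simplex p" "cell_class X d (p, x, t) \<in> star m"
  then obtain A where A: "top_set m t A" using star_iff by blast
  have "continuous_map (prod_topology (simplices X p) (top_of_set unit_I)) (realisation X d)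
     (\<lambda>y. cell_class X d (p, fst (fst y), push A (snd y) (snd (fst y))))"
    using continuous_map_cell_homotopy[where f = "\<lambda>x. x" and X = X and p = p and X' = X and q = p and d' = d, OF _ continuous_map_push[of A p]]
      top_set_nonempty[OF A] top_set_subset[OF x(2) A] continuous_map_id[of "X p"] by (simp add: id_def)
  then show "\<exists>U \<Psi>. openin (simplex_topology p) U \<and> t \<in> U \<and>
        continuous_map (prod_topology (simplices X p) (top_of_set unit_I)) (realisation X d) \<Psi> \<and>
        (\<forall>x t s. x \<in> topspace (X p) \<longrightarrow> t \<in> U \<longrightarrow> cell_class X d (p, x, t) \<in> star m \<longrightarrow> s \<in> unit_I \<longrightarrow>
           cell_class X d (p, x, push (top_verts m t) s t) = \<Psi> ((x, t), s))"
    using A x openin_top_set[of p m A] top_verts_eq[of m _ A]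
    by (intro exI[of _ "{t \<in> standard_simplex p. top_set m t A}"] exI conjI) auto
next
  fix D assume D: "continuous_map (prod_topology (subtopology (realisation X d) (star m)) (top_of_set unit_I)) (realisation X d) D"
    "\<And>p x t s. x \<in> topspace (X p) \<Longrightarrow> t \<in> standard_simplex p \<Longrightarrow> cell_class X d (p, x, t) \<in> star m \<Longrightarrow> s \<in> unit_I \<Longrightarrow>
       D (cell_class X d (p, x, t), s) = cell_class X d (p, x, push (top_verts m t) s t)"
  show thesis
  proof (rule that[OF D(1)])
    fix q x t A and s :: real assume x: "x \<in> topspace (X q)" "t \<in> standard_simplex q" and A: "top_set m t A" and s: "s \<in> unit_I"
    then have "cell_class X d (q, x, t) \<in> star m" using star_iff by blast
    from D(2)[OF x this s] show "D (cell_class X d (q, x, t), s) = cell_class X d (q, x, push A s t)"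
      by (simp add: top_verts_eq[OF A])
  qed
qed

text \<open>One component of the end of the deformation: the simplex spanned by the
  \<open>m + 1\<close> heaviest vertices. Its compatibility with gluing is
  \<open>keep_face_skip\<close>.\<close>

lemma star_face:
  obtains r where "continuous_map (subtopology (realisation X d) (star m)) (X m) r"
    "\<And>q x t A. x \<in> topspace (X q) \<Longrightarrow> t \<in> standard_simplex q \<Longrightarrow> top_set m t A \<Longrightarrow>
       r (cell_class X d (q, x, t)) = keep_face d (Suc q) A q x"
proof (rule realisation_descend[OF openin_star[of m], of "\<lambda>q x t s. keep_face d (Suc q) (top_verts m t) q x" "X m"])
  fix p x i t and s :: real assume x: "x \<in> topspace (X (Suc p))" "i \<le> Suc p" "t \<in> standard_simplex p"
    and V: "cell_class X d (p, d (Suc p) i x, t) \<in> star m"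
  obtain A where A: "top_set m t A" using V star_iff[OF face_in[OF x(1,2)] x(3)] by blast
  then have "top_verts m (simplical_face i t) = skip i ` A" "top_verts m t = A"
    using top_verts_eq top_set_face[OF x(3)] by blast+
  moreover have "keep_face d (Suc p) A p (d (Suc p) i x) = keep_face d (Suc (Suc p)) (skip i ` A) (Suc p) x"
    by (rule keep_face_skip[where C = "\<lambda>p. topspace (X p)"])
       (use face_in face_face x top_set_le[OF x(3) A] in auto)
  ultimately show "keep_face d (Suc (Suc p)) (top_verts m (simplical_face i t)) (Suc p) x = keep_face d (Suc p) (top_verts m t) p (d (Suc p) i x)"
    by simp
next
  fix p x t assume x: "x \<in> topspace (X p)" "t \<in> standard_simplex p" "cell_class X d (p, x, t) \<in> star m"
  then obtain A where A: "top_set m t A" using star_iff by blast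
  have c: "continuous_map (X p) (X m) (keep_face d (Suc p) A p)"
    using continuous_map_keep_face[of "Suc p" p A] top_set_le[OF x(2) A] by simp
  have "continuous_map (simplices X p) (X p) fst"
    unfolding cg_prod_def by (rule continuous_map_from_cg[OF continuous_map_fst])
  from continuous_map_compose[OF continuous_map_compose[OF continuous_map_fst this] c]
  have "continuous_map (prod_topology (simplices X p) (top_of_set unit_I)) (X m)
     (\<lambda>y. keep_face d (Suc p) A p (fst (fst y)))"
    by (simp only: o_def)
  then show "\<exists>U \<Psi>. openin (simplex_topology p) U \<and> t \<in> U \<and>
        continuous_map (prod_topology (simplices X p) (top_of_set unit_I)) (X m) \<Psi> \<and>
        (\<forall>x t s. x \<in> topspace (X p) \<longrightarrow> t \<in> U \<longrightarrow> cell_class X d (p, x, t) \<in> star m \<longrightarrow> s \<in> unit_I \<longrightarrow>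
           keep_face d (Suc p) (top_verts m t) p x = \<Psi> ((x, t), s))"
    using A x openin_top_set[of p m A] top_verts_eq[of m _ A]
    by (intro exI[of _ "{t \<in> standard_simplex p. top_set m t A}"] exI conjI) auto
next
  fix r assume r: "continuous_map (prod_topology (subtopology (realisation X d) (star m)) (top_of_set unit_I)) (X m) r"
    "\<And>p x t s. x \<in> topspace (X p) \<Longrightarrow> t \<in> standard_simplex p \<Longrightarrow> cell_class X d (p, x, t) \<in> star m \<Longrightarrow> s \<in> unit_I \<Longrightarrow>
       r (cell_class X d (p, x, t), s) = keep_face d (Suc p) (top_verts m t) p x"
  \<comment> \<open>The interval of \<open>realisation_descend\<close> is specialised to time 0,
    which gives a map on the star itself.\<close>
  have "continuous_map (subtopology (realisation X d) (star m)) (prod_topology (subtopology (realisation X d) (star m)) (top_of_set unit_I)) (\<lambda>z. (z, 0))"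
    using continuous_map_id by (simp add: continuous_map_paired id_def)
  from continuous_map_compose[OF this r(1)]
  have "continuous_map (subtopology (realisation X d) (star m)) (X m) (\<lambda>z. r (z, 0))" by (simp add: o_def)
  then show thesis
  proof (rule that)
    fix q x t A assume x: "x \<in> topspace (X q)" "t \<in> standard_simplex q" and A: "top_set m t A"
    then have "cell_class X d (q, x, t) \<in> star m" using star_iff by blast
    from r(2)[OF x this, of 0] show "r (cell_class X d (q, x, t), 0) = keep_face d (Suc q) A q x"
      by (simp add: top_verts_eq[OF A])
  qed
qed

lemma push_1_outside: "a \<notin> A \<Longrightarrow> push A 1 t a = 0"
  by (simp add: push_def)

text \<open>At time 1 all mass sits on the top set, so the other vertices can be forgotten: the end
  of the deformation factors through \<open>m\<close>-simplices with weights.\<close>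

lemma star_push_1:
  assumes x: "x \<in> topspace (X q)" "t \<in> standard_simplex q" and A: "top_set m t A"
  shows "keep_face drop_coord (Suc q) A q (push A 1 t) \<in> standard_simplex m"
    "cell_class X d (q, x, push A 1 t) = cell_class X d (m, keep_face d (Suc q) A q x, keep_face drop_coord (Suc q) A q (push A 1 t))"
proof -
  have "push A 1 t \<in> standard_simplex q"
    using A top_set_subset[OF x(2) A] by (intro push_simplex x) (auto simp: top_set_def)
  then have "keep_face drop_coord (Suc q) A q (push A 1 t) \<in> standard_simplex (q - card ({..<Suc q} - A)) \<and>
    cell_class X d (q, x, push A 1 t) = cell_class X d (q - card ({..<Suc q} - A), keep_face d (Suc q) A q x, keep_face drop_coord (Suc q) A q (push A 1 t))"
    by (rule cell_class_keep_face[OF x(1)]) (use top_set_le[OF x(2) A] push_1_outside in auto)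
  moreover have "q - card ({..<Suc q} - A) = m" using top_set_le[OF x(2) A] by simp
  ultimately show "keep_face drop_coord (Suc q) A q (push A 1 t) \<in> standard_simplex m"
    "cell_class X d (q, x, push A 1 t) = cell_class X d (m, keep_face d (Suc q) A q x, keep_face drop_coord (Suc q) A q (push A 1 t))"
    by simp_all
qed

text \<open>The companion of \<open>star_face\<close>: the weights on the heaviest vertices after
  they have received all the mass.\<close>

lemma star_weights:
  obtains w where "continuous_map (subtopology (realisation X d) (star m)) (simplex_topology m) w"
    "\<And>q x t A. x \<in> topspace (X q) \<Longrightarrow> t \<in> standard_simplex q \<Longrightarrow> top_set m t A \<Longrightarrow>
       w (cell_class X d (q, x, t)) = keep_face drop_coord (Suc q) A q (push A 1 t)"
proof (rule realisation_descend[OF openin_star[of m],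
      of "\<lambda>q x t s. keep_face drop_coord (Suc q) (top_verts m t) q (push (top_verts m t) 1 t)" "simplex_topology m"])
  fix p x i t and s :: real assume x: "x \<in> topspace (X (Suc p))" "i \<le> Suc p" "t \<in> standard_simplex p"
    and V: "cell_class X d (p, d (Suc p) i x, t) \<in> star m"
  obtain A where A: "top_set m t A" using V star_iff[OF face_in[OF x(1,2)] x(3)] by blast
  then have "top_verts m (simplical_face i t) = skip i ` A" "top_verts m t = A"
    using top_verts_eq top_set_face[OF x(3)] by blast+
  moreover have "keep_face drop_coord (Suc (Suc p)) (skip i ` A) (Suc p) (simplical_face i (push A 1 t)) = keep_face drop_coord (Suc p) A p (push A 1 t)"
    by (rule keep_coord_face) (use x top_set_le[OF x(3) A] in auto)
  ultimately show "keep_face drop_coord (Suc (Suc p)) (top_verts m (simplical_face i t)) (Suc p) (push (top_verts m (simplical_face i t)) 1 (simplical_face i t)) =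
      keep_face drop_coord (Suc p) (top_verts m t) p (push (top_verts m t) 1 t)"
    using A by (simp add: push_face top_set_def)
next
  fix p x t assume x: "x \<in> topspace (X p)" "t \<in> standard_simplex p" "cell_class X d (p, x, t) \<in> star m"
  then obtain A where A: "top_set m t A" using star_iff by blast
  let ?P = "prod_topology (simplices X p) (top_of_set unit_I)"
  let ?f = "\<lambda>y. keep_face drop_coord (Suc p) A p (push A 1 (snd (fst y)))"
  have 1: "continuous_map (simplices X p) (simplex_topology p) snd"
    unfolding cg_prod_def by (rule continuous_map_from_cg[OF continuous_map_snd])
  have 2: "continuous_map ?P (simplex_topology p) (\<lambda>y. snd (fst y))"
    using continuous_map_compose[OF continuous_map_fst 1] by (simp add: o_def)
  then have "continuous_map ?P (prod_topology (simplex_topology p) (top_of_set unit_I)) (\<lambda>y. (snd (fst y), 1))"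
    by (simp add: continuous_map_paired)
  from continuous_map_compose[OF this continuous_map_push[of A p]]
  have 3: "continuous_map ?P (simplex_topology p) (\<lambda>y. push A 1 (snd (fst y)))"
    using top_set_nonempty[OF A] top_set_subset[OF x(2) A] by (simp add: o_def)
  have "continuous_map ?P (simplex_topology m) ?f"
  proof (rule continuous_map_to_simplex)
    fix i
    obtain j where j: "\<And>t. keep_face drop_coord (Suc p) A p t i = t j" using keep_coord_coordinate by blast
    show "continuous_map ?P euclideanreal (\<lambda>y. ?f y i)"
      unfolding j using continuous_map_compose[OF 3 continuous_map_coordinate] by (simp add: o_def)
  next
    fix y assume y: "y \<in> topspace ?P"
    have B: "top_set m (push A 1 t) A" by (rule top_set_push[OF x(2) A A]) auto
    define t' where "t' = push A 1 (snd (fst y))"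
    have t': "t' \<in> standard_simplex p" unfolding t'_def
      using A y top_set_subset[OF x(2) A] by (intro push_simplex) (auto simp: top_set_def)
    have "keep_face drop_coord (Suc p) A p t' \<in> standard_simplex (p - card ({..<Suc p} - A))"
      using cell_class_keep_face[OF x(1) t', of "Suc p" A] top_set_le[OF x(2) A] push_1_outside[of _ A] by (simp add: t'_def)
    then show "?f y \<in> standard_simplex m"
      using top_set_le[OF x(2) A] by (simp add: t'_def)
  qed
  then show "\<exists>U \<Psi>. openin (simplex_topology p) U \<and> t \<in> U \<and>
        continuous_map ?P (simplex_topology m) \<Psi> \<and>
        (\<forall>x t s. x \<in> topspace (X p) \<longrightarrow> t \<in> U \<longrightarrow> cell_class X d (p, x, t) \<in> star m \<longrightarrow> s \<in> unit_I \<longrightarrow>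
           keep_face drop_coord (Suc p) (top_verts m t) p (push (top_verts m t) 1 t) = \<Psi> ((x, t), s))"
    using A x openin_top_set[of p m A] top_verts_eq[of m _ A]
    by (intro exI[of _ "{t \<in> standard_simplex p. top_set m t A}"] exI[of _ ?f] conjI) auto
next
  fix w assume w: "continuous_map (prod_topology (subtopology (realisation X d) (star m)) (top_of_set unit_I)) (simplex_topology m) w"
    "\<And>p x t s. x \<in> topspace (X p) \<Longrightarrow> t \<in> standard_simplex p \<Longrightarrow> cell_class X d (p, x, t) \<in> star m \<Longrightarrow> s \<in> unit_I \<Longrightarrow>
       w (cell_class X d (p, x, t), s) = keep_face drop_coord (Suc p) (top_verts m t) p (push (top_verts m t) 1 t)"
  have "continuous_map (subtopology (realisation X d) (star m)) (prod_topology (subtopology (realisation X d) (star m)) (top_of_set unit_I)) (\<lambda>z. (z, 0))"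
    using continuous_map_id by (simp add: continuous_map_paired id_def)
  from continuous_map_compose[OF this w(1)]
  have "continuous_map (subtopology (realisation X d) (star m)) (simplex_topology m) (\<lambda>z. w (z, 0))" by (simp add: o_def)
  then show thesis
  proof (rule that)
    fix q x t A assume x: "x \<in> topspace (X q)" "t \<in> standard_simplex q" and A: "top_set m t A"
    then have "cell_class X d (q, x, t) \<in> star m" using star_iff by blast
    from w(2)[OF x this, of 0] show "w (cell_class X d (q, x, t), 0) = keep_face drop_coord (Suc q) A q (push A 1 t)"
      by (simp add: top_verts_eq[OF A])
  qed
qed

end

section \<open>Semi-simplicial maps\<close>

locale semi_simplicial_map = dom: semi_simplicial X dX + cod: semi_simplicial Y dY
  for X :: "nat \<Rightarrow> 'x topology" and dX and Y :: "nat \<Rightarrow> 'y topology" and dY +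
  fixes u :: "nat \<Rightarrow> 'x \<Rightarrow> 'y"
  assumes map_continuous: "continuous_map (X p) (Y p) (u p)"
    and map_face: "x \<in> topspace (X (Suc p)) \<Longrightarrow> i \<le> Suc p \<Longrightarrow> u p (dX (Suc p) i x) = dY (Suc p) i (u (Suc p) x)"
begin

lemma map_in: "x \<in> topspace (X p) \<Longrightarrow> u p x \<in> topspace (Y p)"
  using map_continuous[of p] by (auto simp: continuous_map_def)

lemma keep_face_map:
  "x \<in> topspace (X q) \<Longrightarrow> k \<le> Suc q \<Longrightarrow> card ({..<k} - A) \<le> q \<Longrightarrow>
    u (q - card ({..<k} - A)) (keep_face dX k A q x) = keep_face dY k A q (u q x)"
proof (induction k arbitrary: q x)
  case (Suc k)
  show ?case
  proof (cases "k \<in> A")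
    case False
    then obtain q' where q: "q = Suc q'" using Suc.prems(3) by (cases q) (auto simp: card_lessThan_Suc_Diff)
    have "u (q' - card ({..<k} - A)) (keep_face dX k A q' (dX (Suc q') k x)) = keep_face dY k A q' (u q' (dX (Suc q') k x))"
      by (rule Suc.IH) (use Suc.prems False q dom.face_in[of x q' k] in \<open>auto simp: card_lessThan_Suc_Diff\<close>)
    moreover have "u q' (dX (Suc q') k x) = dY (Suc q') k (u (Suc q') x)"
      using Suc.prems q by (intro map_face) auto
    ultimately show ?thesis using False by (simp add: card_lessThan_Suc_Diff q keep_face.simps(2))
  qed (use Suc in \<open>auto simp: card_lessThan_Suc_Diff keep_face.simps(2)\<close>)
qed simp

lemma realisation_map_exists:
  "\<exists>U. continuous_map (realisation X dX) (realisation Y dY) U \<and>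
    (\<forall>q x t. x \<in> topspace (X q) \<longrightarrow> t \<in> standard_simplex q \<longrightarrow> U (cell_class X dX (q, x, t)) = cell_class Y dY (q, u q x, t))"
proof (rule dom.realisation_descend[OF openin_topspace, of "\<lambda>q x t s. cell_class Y dY (q, u q x, t)" "realisation Y dY"])
  fix p x i t and s :: real assume "x \<in> topspace (X (Suc p))" "i \<le> Suc p" "t \<in> standard_simplex p"
  then show "cell_class Y dY (Suc p, u (Suc p) x, simplical_face i t) = cell_class Y dY (p, u p (dX (Suc p) i x), t)"
    by (simp add: cell_class_face map_in map_face)
next
  fix p x t assume t: "t \<in> standard_simplex p"
  have "continuous_map (prod_topology (simplex_topology p) (top_of_set unit_I)) (simplex_topology p) fst"
    by (rule continuous_map_fst)
  from continuous_map_cell_homotopy[where X = X and X' = Y and d' = dY and q = p, OF map_continuous[of p] this]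
  show "\<exists>U \<Psi>. openin (simplex_topology p) U \<and> t \<in> U \<and>
     continuous_map (prod_topology (simplices X p) (top_of_set unit_I)) (realisation Y dY) \<Psi> \<and>
     (\<forall>x t s. x \<in> topspace (X p) \<longrightarrow> t \<in> U \<longrightarrow> cell_class X dX (p, x, t) \<in> topspace (realisation X dX) \<longrightarrow> s \<in> unit_I \<longrightarrow>
        cell_class Y dY (p, u p x, t) = \<Psi> ((x, t), s))"
    using t by (intro exI[of _ "standard_simplex p"] exI conjI) (use openin_topspace[of "simplex_topology p"] in auto)
next
  fix U assume U: "continuous_map (prod_topology (subtopology (realisation X dX) (topspace (realisation X dX))) (top_of_set unit_I)) (realisation Y dY) U"
    "\<And>p x t s. x \<in> topspace (X p) \<Longrightarrow> t \<in> standard_simplex p \<Longrightarrow> cell_class X dX (p, x, t) \<in> topspace (realisation X dX) \<Longrightarrow>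
       s \<in> unit_I \<Longrightarrow> U (cell_class X dX (p, x, t), s) = cell_class Y dY (p, u p x, t)"
  have "continuous_map (realisation X dX) (prod_topology (realisation X dX) (top_of_set unit_I)) (\<lambda>z. (z, 0))"
    using continuous_map_id[of "realisation X dX"] by (simp add: continuous_map_paired id_def)
  from continuous_map_compose[OF this U(1)[unfolded subtopology_topspace]]
  have "continuous_map (realisation X dX) (realisation Y dY) (\<lambda>z. U (z, 0))" by (simp add: o_def)
  moreover have "U (cell_class X dX (q, x, t), 0) = cell_class Y dY (q, u q x, t)"
    if "x \<in> topspace (X q)" "t \<in> standard_simplex q" for q x t
    using U(2)[OF that] cell_class_in[of x X q t dX] that by simp
  ultimately show "\<exists>U. continuous_map (realisation X dX) (realisation Y dY) U \<and>
    (\<forall>q x t. x \<in> topspace (X q) \<longrightarrow> t \<in> standard_simplex q \<longrightarrow> U (cell_class X dX (q, x, t)) = cell_class Y dY (q, u q x, t))"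
    by blast
qed

definition realisation_map where
  "realisation_map = (SOME U. continuous_map (realisation X dX) (realisation Y dY) U \<and>
    (\<forall>q x t. x \<in> topspace (X q) \<longrightarrow> t \<in> standard_simplex q \<longrightarrow> U (cell_class X dX (q, x, t)) = cell_class Y dY (q, u q x, t)))"

lemma continuous_map_realisation_map: "continuous_map (realisation X dX) (realisation Y dY) realisation_map"
  and realisation_map_cell: "x \<in> topspace (X q) \<Longrightarrow> t \<in> standard_simplex q \<Longrightarrow>
    realisation_map (cell_class X dX (q, x, t)) = cell_class Y dY (q, u q x, t)"
  using someI_ex[OF realisation_map_exists] unfolding realisation_map_def[symmetric] by blast+

text \<open>The map changes the simplex and leaves the weights alone, and membership in a star is a
  matter of weights.\<close>

lemma realisation_map_star:
  assumes "z \<in> topspace (realisation X dX)"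
  shows "realisation_map z \<in> cod.star m \<longleftrightarrow> z \<in> dom.star m"
proof -
  obtain q x t where z: "x \<in> topspace (X q)" "t \<in> standard_simplex q" "z = cell_class X dX (q, x, t)"
    using realisation_cases[OF assms] by blast
  show ?thesis unfolding z(3) realisation_map_cell[OF z(1,2)] dom.star_iff[OF z(1,2)] cod.star_iff[OF map_in[OF z(1)] z(2)] ..
qed

end

lemma cube_pair_compact_Hausdorff:
  "compact_space (top_of_set (unit_cube n \<times> unit_I))" "Hausdorff_space (top_of_set (S :: 'k::metric_space set))"
  "compact_space (top_of_set (unit_cube n))"
  using compact_unit_cube compact_Times[OF compact_unit_cube, of unit_I]
  by (simp_all add: compact_space_subtopology Hausdorff_space_subtopology)

context semi_simplicial begin

lemma in_starE:
  assumes "z \<in> star m"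
  obtains q x t A where "x \<in> topspace (X q)" "t \<in> standard_simplex q" "z = cell_class X d (q, x, t)" "top_set m t A"
  using assms unfolding star_def by blast

lemma star_push_in:
  assumes x: "x \<in> topspace (X q)" "t \<in> standard_simplex q" and A: "top_set m t A"
    and p: "cell_class X d (q, x, t) \<in> star p" "p \<le> m" and s: "s \<in> unit_I"
  shows "cell_class X d (q, x, push A s t) \<in> star p"
proof -
  have "push A s t \<in> standard_simplex q"
    using top_set_nonempty[OF A] top_set_subset[OF x(2) A] s by (intro push_simplex x) auto
  moreover obtain B where "top_set p t B" using p star_iff[OF x] by blast
  then have "top_set p (push A s t) B" by (rule top_set_push[OF x(2) A _ p(2) s])
  ultimately show ?thesis using star_iff[OF x(1)] by blast
qed

end

context semi_simplicial_map begin

text \<open>The deformations of both intersections are compatible with the map, so by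
  \<open>solves_homotopy\<close> it suffices to solve the deformed square. There the data are
  \<open>m\<close>-simplices with weights: the square of simplices is compressed at level
  \<open>m\<close>, while the weights coming from \<open>g\<close> are kept.\<close>

lemma star_compressible:
  assumes lev: "\<And>p. compressible (X p) (Y p) (u p)" and S: "finite S" "S \<noteq> {}"
  shows "compressible (subtopology (realisation X dX) (\<Inter>p\<in>S. dom.star p)) (subtopology (realisation Y dY) (\<Inter>p\<in>S. cod.star p)) realisation_map"
proof -
  \<comment> \<open>The largest index: pushing along its top set preserves all smaller top sets,
    hence the whole intersection.\<close>
  define m where "m = Max S"
  have mS: "m \<in> S" "\<And>p. p \<in> S \<Longrightarrow> p \<le> m" using S by (auto simp: m_def)
  let ?RX = "realisation X dX" and ?RY = "realisation Y dY"
  let ?U = "\<Inter>p\<in>S. dom.star p" and ?V = "\<Inter>p\<in>S. cod.star p"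
  have Um: "z \<in> dom.star m" if "z \<in> ?U" for z using that mS by blast
  have Vm: "z \<in> cod.star m" if "z \<in> ?V" for z using that mS by blast
  have UX: "z \<in> topspace ?RX" if "z \<in> ?U" for z using Um[OF that] dom.star_subset by blast
  have subU: "?U \<subseteq> dom.star m" and subV: "?V \<subseteq> cod.star m" using mS by blast+
  have topU: "topspace (subtopology ?RX ?U) = ?U" and topV: "topspace (subtopology ?RY ?V) = ?V"
    using subU subV dom.star_subset[of m] cod.star_subset[of m] by auto
  obtain D where D: "continuous_map (prod_topology (subtopology ?RX (dom.star m)) (top_of_set unit_I)) ?RX D"
    "\<And>q x t A s. x \<in> topspace (X q) \<Longrightarrow> t \<in> standard_simplex q \<Longrightarrow> top_set m t A \<Longrightarrow> s \<in> unit_I \<Longrightarrow>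
       D (cell_class X dX (q, x, t), s) = cell_class X dX (q, x, push A s t)"
    by (rule dom.star_homotopy[of m]) (rule that)
  obtain E where E: "continuous_map (prod_topology (subtopology ?RY (cod.star m)) (top_of_set unit_I)) ?RY E"
    "\<And>q x t A s. x \<in> topspace (Y q) \<Longrightarrow> t \<in> standard_simplex q \<Longrightarrow> top_set m t A \<Longrightarrow> s \<in> unit_I \<Longrightarrow>
       E (cell_class Y dY (q, x, t), s) = cell_class Y dY (q, x, push A s t)"
    by (rule cod.star_homotopy[of m]) (rule that)
  obtain r where r: "continuous_map (subtopology ?RX (dom.star m)) (X m) r"
    "\<And>q x t A. x \<in> topspace (X q) \<Longrightarrow> t \<in> standard_simplex q \<Longrightarrow> top_set m t A \<Longrightarrow>
       r (cell_class X dX (q, x, t)) = keep_face dX (Suc q) A q x"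
    by (rule dom.star_face[of m]) (rule that)
  obtain r' where r': "continuous_map (subtopology ?RY (cod.star m)) (Y m) r'"
    "\<And>q x t A. x \<in> topspace (Y q) \<Longrightarrow> t \<in> standard_simplex q \<Longrightarrow> top_set m t A \<Longrightarrow>
       r' (cell_class Y dY (q, x, t)) = keep_face dY (Suc q) A q x"
    by (rule cod.star_face[of m]) (rule that)
  \<comment> \<open>The map preserves weights, so \<open>w\<close> applied to the image of a point
    of the source gives the weights upstairs too.\<close>
  obtain w where w: "continuous_map (subtopology ?RY (cod.star m)) (simplex_topology m) w"
    "\<And>q x t A. x \<in> topspace (Y q) \<Longrightarrow> t \<in> standard_simplex q \<Longrightarrow> top_set m t A \<Longrightarrow>
       w (cell_class Y dY (q, x, t)) = keep_face drop_coord (Suc q) A q (push A 1 t)"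
    by (rule cod.star_weights[of m]) (rule that)

  have D0: "D (z, 0) = z" if z: "z \<in> dom.star m" for z
    using z by (rule dom.in_starE) (simp add: D(2) push_0)
  have E0: "E (z, 0) = z" if z: "z \<in> cod.star m" for z
    using z by (rule cod.in_starE) (simp add: E(2) push_0)
  have DE: "realisation_map (D (z, s)) = E (realisation_map z, s)" if z: "z \<in> dom.star m" and s: "s \<in> unit_I" for z s
  proof -
    obtain q x t A where zz: "x \<in> topspace (X q)" "t \<in> standard_simplex q" "z = cell_class X dX (q, x, t)" "top_set m t A"
      using z by (rule dom.in_starE)
    have "push A s t \<in> standard_simplex q"
      using top_set_nonempty[OF zz(4)] top_set_subset[OF zz(2,4)] s by (intro push_simplex zz) auto
    then show ?thesis
      unfolding zz(3) D(2)[OF zz(1,2,4) s] realisation_map_cell[OF zz(1,2)] E(2)[OF map_in[OF zz(1)] zz(2,4) s]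
      by (rule realisation_map_cell[OF zz(1)])
  qed
  have DU: "D (z, s) \<in> ?U" if z: "z \<in> ?U" and s: "s \<in> unit_I" for z s
  proof -
    obtain q x t A where zz: "x \<in> topspace (X q)" "t \<in> standard_simplex q" "z = cell_class X dX (q, x, t)" "top_set m t A"
      using Um[OF z] by (rule dom.in_starE)
    show ?thesis
    proof
      fix p assume p: "p \<in> S"
      then show "D (z, s) \<in> dom.star p"
        unfolding zz(3) D(2)[OF zz(1,2,4) s] using z mS(2)[OF p] by (intro dom.star_push_in[OF zz(1,2,4) _ _ s]) (auto simp: zz(3))
    qed
  qed
  have EV: "E (z, s) \<in> ?V" if z: "z \<in> ?V" and s: "s \<in> unit_I" for z s
  proof -
    obtain q x t A where zz: "x \<in> topspace (Y q)" "t \<in> standard_simplex q" "z = cell_class Y dY (q, x, t)" "top_set m t A"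
      using Vm[OF z] by (rule cod.in_starE)
    show ?thesis
    proof
      fix p assume p: "p \<in> S"
      then show "E (z, s) \<in> cod.star p"
        unfolding zz(3) E(2)[OF zz(1,2,4) s] using z mS(2)[OF p] by (intro cod.star_push_in[OF zz(1,2,4) _ _ s]) (auto simp: zz(3))
    qed
  qed
  have E1: "w z \<in> standard_simplex m" "r' z \<in> topspace (Y m)" "E (z, 1) = cell_class Y dY (m, r' z, w z)" if z: "z \<in> cod.star m" for z
  proof -
    obtain q x t A where zz: "x \<in> topspace (Y q)" "t \<in> standard_simplex q" "z = cell_class Y dY (q, x, t)" "top_set m t A"
      using z by (rule cod.in_starE)
    show "w z \<in> standard_simplex m" "E (z, 1) = cell_class Y dY (m, r' z, w z)"
      unfolding zz(3) w(2)[OF zz(1,2,4)] r'(2)[OF zz(1,2,4)] using cod.star_push_1[OF zz(1,2,4)] E(2)[OF zz(1,2,4), of 1] by simp_all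
    show "r' z \<in> topspace (Y m)" using r'(1) z cod.star_subset by (auto simp: continuous_map_def)
  qed
  have D1: "D (z, 1) = cell_class X dX (m, r z, w (realisation_map z))" "u m (r z) = r' (realisation_map z)" "r z \<in> topspace (X m)" if z: "z \<in> dom.star m" for z
  proof -
    obtain q x t A where zz: "x \<in> topspace (X q)" "t \<in> standard_simplex q" "z = cell_class X dX (q, x, t)" "top_set m t A"
      using z by (rule dom.in_starE)
    note q = top_set_le[OF zz(2,4)]
    show "D (z, 1) = cell_class X dX (m, r z, w (realisation_map z))"
      unfolding zz(3) realisation_map_cell[OF zz(1,2)] w(2)[OF map_in[OF zz(1)] zz(2,4)] r(2)[OF zz(1,2,4)]
      using dom.star_push_1[OF zz(1,2,4)] D(2)[OF zz(1,2,4), of 1] by simp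
    show "u m (r z) = r' (realisation_map z)"
      unfolding zz(3) realisation_map_cell[OF zz(1,2)] r'(2)[OF map_in[OF zz(1)] zz(2,4)] r(2)[OF zz(1,2,4)]
      using keep_face_map[OF zz(1), of "Suc q" A] q by simp
    show "r z \<in> topspace (X m)" using r(1) z dom.star_subset by (auto simp: continuous_map_def)
  qed
  show ?thesis
    unfolding compressible_def
  proof (intro conjI allI impI)
    show uc: "continuous_map (subtopology ?RX ?U) (subtopology ?RY ?V) realisation_map"
      unfolding continuous_map_in_subtopology
      using continuous_map_from_subtopology[OF continuous_map_realisation_map] realisation_map_star UX by (auto simp: topU)
    fix n f g
    let ?C = "unit_cube n" and ?b = "cube_boundary n"
    assume asm: "cont_from ?b (subtopology ?RX ?U) f \<and> cont_from ?C (subtopology ?RY ?V) g \<and> (\<forall>a\<in>?b. realisation_map (f a) = g a)"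
    then have f: "cont_from ?b (subtopology ?RX ?U) f" and g: "cont_from ?C (subtopology ?RY ?V) g"
      and fg: "\<And>a. a \<in> ?b \<Longrightarrow> realisation_map (f a) = g a" by auto
    have bC: "?b \<subseteq> ?C" by (rule cube_boundary_subset)
    have fU: "f a \<in> ?U" if "a \<in> ?b" for a using cont_from_in[OF f that] topU by simp
    have gV: "g a \<in> ?V" if "a \<in> ?C" for a using cont_from_in[OF g that] topV by simp
    have fm: "cont_from ?b (subtopology ?RX (dom.star m)) f"
      using f fU Um by (auto simp: continuous_map_in_subtopology)
    have gm: "cont_from ?C (subtopology ?RY (cod.star m)) g"
      using g gV Vm by (auto simp: continuous_map_in_subtopology)
    have hcomp: "cont_from (A \<times> unit_I) R (\<lambda>y. P (k (fst y), snd y))"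
      if k: "cont_from A Q k" and P: "continuous_map (prod_topology Q (top_of_set unit_I)) R P"
      for A :: "(nat \<Rightarrow> real) set" and Q :: "'q topology" and R :: "'r topology" and k P
    proof -
      have "continuous_map (prod_topology (top_of_set A) (top_of_set unit_I)) (prod_topology Q (top_of_set unit_I)) (\<lambda>y. (k (fst y), snd y))"
        unfolding continuous_map_paired
        using continuous_map_compose[OF continuous_map_fst k, of "top_of_set unit_I", unfolded o_def]
          continuous_map_snd[of "top_of_set A" "top_of_set unit_I"] by (intro conjI)
      from continuous_map_compose[OF this P] show ?thesis by (simp add: o_def)
    qed
    have F: "cont_from (?b \<times> unit_I) (subtopology ?RX ?U) (\<lambda>y. D (f (fst y), snd y))"
      unfolding continuous_map_in_subtopology using hcomp[OF fm D(1)] fU DU by auto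
    have G: "cont_from (?C \<times> unit_I) (subtopology ?RY ?V) (\<lambda>y. E (g (fst y), snd y))"
      unfolding continuous_map_in_subtopology using hcomp[OF gm E(1)] gV EV by auto
    have "solves ?C ?b (subtopology ?RX ?U) (subtopology ?RY ?V) realisation_map (\<lambda>a. D (f (fst (a, 1::real)), snd (a, 1))) (\<lambda>x. E (g (fst (x, 1::real)), snd (x, 1)))"
    proof -
      have rf: "cont_from ?b (X m) (\<lambda>a. r (f a))" using continuous_map_compose[OF fm r(1)] by (simp add: o_def)
      have rg: "cont_from ?C (Y m) (\<lambda>a. r' (g a))" using continuous_map_compose[OF gm r'(1)] by (simp add: o_def)
      have wg: "cont_from ?C (simplex_topology m) (\<lambda>a. w (g a))" using continuous_map_compose[OF gm w(1)] by (simp add: o_def)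
      have "u m (r (f a)) = r' (g a)" if "a \<in> ?b" for a using D1(2)[OF Um[OF fU[OF that]]] fg[OF that] by simp
      then have "solves ?C ?b (X m) (Y m) (u m) (\<lambda>a. r (f a)) (\<lambda>a. r' (g a))"
        using lev[of m] rf rg unfolding compressible_def by blast
      then obtain L H where L: "cont_from ?C (X m) L" "\<And>a. a \<in> ?b \<Longrightarrow> L a = r (f a)"
        and H: "cont_from (?C \<times> unit_I) (Y m) H" "\<And>x. x \<in> ?C \<Longrightarrow> H (x, 0) = u m (L x)" "\<And>x. x \<in> ?C \<Longrightarrow> H (x, 1) = r' (g x)"
          "\<And>a s. a \<in> ?b \<Longrightarrow> s \<in> unit_I \<Longrightarrow> H (a, s) = r' (g a)"
        unfolding solves_def by auto
      have Lin: "L x \<in> topspace (X m)" if "x \<in> ?C" for x using cont_from_in[OF L(1) that] .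
      have Hin: "H y \<in> topspace (Y m)" if "y \<in> ?C \<times> unit_I" for y using cont_from_in[OF H(1) that] .
      have win: "w (g x) \<in> standard_simplex m" if "x \<in> ?C" for x using E1(1)[OF Vm[OF gV[OF that]]] .
      \<comment> \<open>The new lift stays in all stars of \<open>S\<close> because its weights are
        those of the deformed point of \<open>g\<close>, which lies in the intersection.\<close>
      have wtop: "\<exists>A. top_set p (w (g x)) A" if x: "x \<in> ?C" and p: "p \<in> S" for x p
      proof -
        have gx: "g x \<in> cod.star m" using Vm[OF gV[OF x]] .
        have "E (g x, 1) \<in> cod.star p" using EV[OF gV[OF x], of 1] p by auto
        then show ?thesis unfolding E1(3)[OF gx] using cod.star_iff[OF E1(2)[OF gx] E1(1)[OF gx]] by blast
      qed
      let ?L = "\<lambda>x. cell_class X dX (m, L x, w (g x))" and ?H = "\<lambda>y. cell_class Y dY (m, H y, w (g (fst y)))"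
      have "cont_from ?C ?RX ?L"
        by (rule continuous_map_to_realisation[where X = X, OF cube_pair_compact_Hausdorff(3,2) L(1) wg])
      moreover have "?L x \<in> ?U" if "x \<in> ?C" for x
        using dom.star_iff[OF Lin[OF that] win[OF that]] wtop[OF that] by blast
      ultimately have L': "cont_from ?C (subtopology ?RX ?U) ?L" by (auto simp: continuous_map_in_subtopology)
      have "cont_from (?C \<times> unit_I) (simplex_topology m) (\<lambda>y. w (g (fst y)))"
        by (rule cont_from_compose[OF _ _ wg]) (auto intro!: continuous_on_fst continuous_on_id)
      then have "cont_from (?C \<times> unit_I) ?RY ?H"
        by (rule continuous_map_to_realisation[where X = Y, OF cube_pair_compact_Hausdorff(1,2) H(1)])
      moreover have "?H y \<in> ?V" if "y \<in> ?C \<times> unit_I" for y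
      proof -
        have "fst y \<in> ?C" using that by auto
        then show ?thesis using cod.star_iff[OF Hin[OF that] win] wtop by blast
      qed
      ultimately have H': "cont_from (?C \<times> unit_I) (subtopology ?RY ?V) ?H" by (auto simp: continuous_map_in_subtopology)
      show ?thesis
        unfolding solves_def
      proof (intro exI[of _ ?L] exI[of _ ?H] conjI ballI L' H')
        show "?L a = D (f (fst (a, 1::real)), snd (a, 1))" if "a \<in> ?b" for a
          using D1(1)[OF Um[OF fU[OF that]]] L(2)[OF that] fg[OF that] by simp
        show "?H (x, 0) = realisation_map (?L x)" if "x \<in> ?C" for x
          using realisation_map_cell[OF Lin[OF that] win[OF that]] H(2)[OF that] by simp
        show "?H (x, 1) = E (g (fst (x, 1::real)), snd (x, 1))" if "x \<in> ?C" for x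
          using E1(3)[OF Vm[OF gV[OF that]]] H(3)[OF that] by simp
        show "?H (a, s) = E (g (fst (a, 1::real)), snd (a, 1))" if "a \<in> ?b" "s \<in> unit_I" for a s
          using E1(3)[OF Vm[OF gV], of a] H(4)[OF that] that(1) bC by auto
      qed
    qed
    then have "solves ?C ?b (subtopology ?RX ?U) (subtopology ?RY ?V) realisation_map (\<lambda>a. D (f (fst (a, 0::real)), snd (a, 0))) (\<lambda>x. E (g (fst (x, 0::real)), snd (x, 0)))"
      by (rule solves_homotopy[OF cell_pair_cube uc F G, rotated]) (use DE[OF Um[OF fU]] fg in simp)
    then show "solves ?C ?b (subtopology ?RX ?U) (subtopology ?RY ?V) realisation_map f g"
      by (rule solves_cong) (use D0[OF Um[OF fU]] E0[OF Vm[OF gV]] bC in auto)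
  qed
qed

end

section \<open>Subdivided cubes\<close>

text \<open>The factor 2 is the sum of the geometric weights in the metric of the function
  space.\<close>

lemma dist_fun_le:
  fixes x y :: "nat \<Rightarrow> real"
  assumes "\<And>i. dist (x i) (y i) \<le> e"
  shows "dist x y \<le> 2 * e"
proof -
  have e: "0 \<le> e" using assms[of 0] zero_le_dist[of "x 0" "y 0"] by linarith
  have s: "summable (\<lambda>n. (1/2::real) ^ n)" by (rule summable_geometric) simp
  have le: "(1/2) ^ n * min (dist (x (from_nat n)) (y (from_nat n))) 1 \<le> (1/2) ^ n * e" for n
    using assms[of "from_nat n"] by (intro mult_left_mono) auto
  have "summable (\<lambda>n. (1/2) ^ n * min (dist (x (from_nat n)) (y (from_nat n))) 1)"
    by (rule summable_comparison_test'[OF s, of 0]) (auto simp: abs_mult mult_left_le)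
  then have "dist x y \<le> suminf (\<lambda>n. (1/2) ^ n * e)"
    unfolding dist_fun_def by (intro suminf_le le summable_mult2 s)
  also have "\<dots> = 2 * e" using suminf_geometric[of "1/2::real"] suminf_mult2[OF s, of e] by simp
  finally show ?thesis .
qed

text \<open>Cells of the subdivision of \<open>unit_cube n\<close> into small cubes of side \<open>1/N\<close>: in each coordinate
  the code \<open>2 k\<close> stands for the point \<open>k/N\<close> and \<open>2 k + 1\<close> for the interval from \<open>k/N\<close> to \<open>(k + 1)/N\<close>.\<close>

definition code_lo :: "nat \<Rightarrow> nat \<Rightarrow> real" where "code_lo N k = real (k div 2) / real N"
definition code_hi :: "nat \<Rightarrow> nat \<Rightarrow> real" where "code_hi N k = real (Suc k div 2) / real N"

definition grid_codes :: "nat \<Rightarrow> nat \<Rightarrow> (nat \<Rightarrow> nat) set" where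
  "grid_codes N n = (\<Pi>\<^sub>E i\<in>{..<n}. {0..2 * N})"

definition grid_cell :: "nat \<Rightarrow> nat \<Rightarrow> (nat \<Rightarrow> nat) \<Rightarrow> (nat \<Rightarrow> real) set" where
  "grid_cell N n a = {x \<in> unit_cube n. \<forall>i<n. code_lo N (a i) \<le> x i \<and> x i \<le> code_hi N (a i)}"

text \<open>The relative boundary: a coordinate with even code is a single point and contributes no
  end points.\<close>

definition grid_boundary :: "nat \<Rightarrow> nat \<Rightarrow> (nat \<Rightarrow> nat) \<Rightarrow> (nat \<Rightarrow> real) set" where
  "grid_boundary N n a = {x \<in> grid_cell N n a. \<exists>i<n. odd (a i) \<and> (x i = code_lo N (a i) \<or> x i = code_hi N (a i))}"

text \<open>An interval has odd code, and its lower and upper end points have the codes just below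
  and just above it.\<close>

definition grid_face :: "nat \<Rightarrow> (nat \<Rightarrow> nat) \<Rightarrow> (nat \<Rightarrow> nat) \<Rightarrow> bool" where
  "grid_face n b a \<longleftrightarrow> (\<forall>i<n. b i = a i \<or> odd (a i) \<and> (Suc (b i) = a i \<or> b i = Suc (a i)))"

definition coord_code :: "nat \<Rightarrow> real \<Rightarrow> nat" where
  "coord_code N x = (if real (nat \<lfloor>x * real N\<rfloor>) = x * real N then 2 * nat \<lfloor>x * real N\<rfloor> else 2 * nat \<lfloor>x * real N\<rfloor> + 1)"

text \<open>The carrier of \<open>x\<close>: the cell with \<open>x\<close> in its relative
  interior, a face of every cell that contains \<open>x\<close>.\<close>

definition grid_carrier :: "nat \<Rightarrow> nat \<Rightarrow> (nat \<Rightarrow> real) \<Rightarrow> nat \<Rightarrow> nat" where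
  "grid_carrier N n x = restrict (\<lambda>i. coord_code N (x i)) {..<n}"

definition grid_dim :: "nat \<Rightarrow> (nat \<Rightarrow> nat) \<Rightarrow> nat" where
  "grid_dim n a = card {i. i < n \<and> odd (a i)}"

section \<open>Faces, carriers and boundaries of grid cells\<close>

lemma code_even: "even k \<Longrightarrow> code_lo N k = code_hi N k"
  by (auto simp: code_lo_def code_hi_def elim!: evenE)

lemma code_odd: "odd k \<Longrightarrow> 0 < N \<Longrightarrow> code_hi N k = code_lo N k + 1 / real N"
  by (auto simp: code_lo_def code_hi_def add_divide_distrib elim!: oddE)

lemma code_diff: "0 < N \<Longrightarrow> code_hi N k - code_lo N k \<le> 1 / real N"
  using code_even[of k N] code_odd[of k N] by (cases "even k") auto

lemma coord_code_bound:
  assumes N: "0 < N" and x: "0 \<le> x" "x \<le> 1"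
  shows "coord_code N x \<le> 2 * N"
proof -
  have xN: "x * real N \<le> real N" "0 \<le> x * real N" using x N by (auto simp: mult_le_cancel_right1)
  then have le: "nat \<lfloor>x * real N\<rfloor> \<le> N" by linarith
  show ?thesis
  proof (cases "real (nat \<lfloor>x * real N\<rfloor>) = x * real N")
    case False
    \<comment> \<open>Only the end point 1 has floor \<open>N\<close>, and it is a grid point with
      the even code \<open>2 * N\<close>.\<close>
    then have "nat \<lfloor>x * real N\<rfloor> \<noteq> N" using xN by linarith
    then show ?thesis using le False by (simp add: coord_code_def)
  qed (use le in \<open>simp add: coord_code_def\<close>)
qed

lemma coord_code_cell:
  assumes N: "0 < N" and x: "0 \<le> x"
  shows "code_lo N (coord_code N x) \<le> x" "x \<le> code_hi N (coord_code N x)"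
    "odd (coord_code N x) \<Longrightarrow> code_lo N (coord_code N x) < x \<and> x < code_hi N (coord_code N x)"
proof -
  define k where "k = nat \<lfloor>x * real N\<rfloor>"
  have "0 \<le> x * real N" using x by simp
  then have k: "real k \<le> x * real N" "x * real N < real k + 1" unfolding k_def by linarith+
  have kx: "real k / real N \<le> x" "x < (1 + real k) / real N" using k N by (simp_all add: field_simps)
  have c: "coord_code N x = (if real k = x * real N then 2 * k else 2 * k + 1)" by (simp add: coord_code_def k_def)
  have e: "real k = x * real N \<longleftrightarrow> real k / real N = x" using N by (auto simp: field_simps)
  show "code_lo N (coord_code N x) \<le> x" using kx x by (simp add: c code_lo_def)
  show "x \<le> code_hi N (coord_code N x)" using kx e by (auto simp: c code_hi_def less_imp_le)
  show "code_lo N (coord_code N x) < x \<and> x < code_hi N (coord_code N x)" if "odd (coord_code N x)"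
    using that kx e by (auto simp: c code_lo_def code_hi_def add.commute split: if_splits)
qed

lemma coord_code_face:
  assumes N: "0 < N" and x: "0 \<le> x" and b: "code_lo N b \<le> x" "x \<le> code_hi N b"
  shows "coord_code N x = b \<or> odd b \<and> (Suc (coord_code N x) = b \<or> coord_code N x = Suc b)"
proof -
  define k where "k = nat \<lfloor>x * real N\<rfloor>"
  define j where "j = b div 2"
  have "0 \<le> x * real N" using x by simp
  then have k: "real k \<le> x * real N" "x * real N < real k + 1" unfolding k_def by linarith+
  have c: "coord_code N x = (if real k = x * real N then 2 * k else 2 * k + 1)" by (simp add: coord_code_def k_def)
  show ?thesis
  proof (cases "even b")
    case True
    then have bj: "b = 2 * j" by (simp add: j_def)
    then have "x = real j / real N" using b by (simp add: code_lo_def code_hi_def)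
    then have "x * real N = real j" using N by simp
    then have "k = j" using k by linarith
    then show ?thesis using bj c \<open>x * real N = real j\<close> by simp
  next
    case False
    then have bj: "b = 2 * j + 1" by (auto simp: j_def)
    then have "real j \<le> x * real N" "x * real N \<le> real j + 1" using b N by (auto simp: code_lo_def code_hi_def field_simps)
    then consider "k = j" | "k = Suc j" "x * real N = real k" using k by linarith
    then show ?thesis using bj c by cases auto
  qed
qed

lemma grid_carrier_simp: "i < n \<Longrightarrow> grid_carrier N n x i = coord_code N (x i)"
  by (simp add: grid_carrier_def)

lemma unit_cube_coord: "x \<in> unit_cube n \<Longrightarrow> i < n \<Longrightarrow> 0 \<le> x i \<and> x i \<le> 1"
  by (auto simp: unit_cube_def PiE_def Pi_def)

lemma grid_carrier_codes: "0 < N \<Longrightarrow> x \<in> unit_cube n \<Longrightarrow> grid_carrier N n x \<in> grid_codes N n"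
  using coord_code_bound[of N] unit_cube_coord[of x n] by (auto simp: grid_codes_def grid_carrier_def)

lemma grid_carrier_cell: "0 < N \<Longrightarrow> x \<in> unit_cube n \<Longrightarrow> x \<in> grid_cell N n (grid_carrier N n x)"
  using coord_code_cell(1,2)[of N] unit_cube_coord[of x n] by (simp add: grid_cell_def grid_carrier_simp)

lemma grid_carrier_face: "0 < N \<Longrightarrow> x \<in> grid_cell N n b \<Longrightarrow> grid_face n (grid_carrier N n x) b"
  using coord_code_face[of N] unit_cube_coord[of x n] by (simp add: grid_cell_def grid_face_def grid_carrier_simp)

lemma grid_faceD:
  "grid_face n b a \<Longrightarrow> i < n \<Longrightarrow> b i = a i \<or> odd (a i) \<and> (Suc (b i) = a i \<or> b i = Suc (a i))"
  unfolding grid_face_def by blast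

lemma grid_face_cell:
  assumes N: "0 < N" and f: "grid_face n b a"
  shows "grid_cell N n b \<subseteq> grid_cell N n a"
proof -
  have "code_lo N (a i) \<le> code_lo N (b i) \<and> code_hi N (b i) \<le> code_hi N (a i)" if "i < n" for i
  proof -
    consider "b i = a i" | "odd (a i)" "Suc (b i) = a i" | "odd (a i)" "b i = Suc (a i)"
      using grid_faceD[OF f \<open>i < n\<close>] by blast
    then show ?thesis
    proof cases
      case 2
      then have "even (b i)" by (metis even_Suc)
      then have "a i div 2 = b i div 2" "Suc (b i) div 2 = b i div 2" using 2(2) by auto
      moreover have "Suc (a i) div 2 = Suc (b i div 2)" using 2 \<open>even (b i)\<close> by (auto elim!: evenE)
      ultimately show ?thesis using N by (simp add: code_lo_def code_hi_def divide_right_mono)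
    next
      case 3
      then have "a i div 2 \<le> b i div 2" "Suc (b i) div 2 = Suc (a i) div 2" by (auto elim!: oddE)
      then show ?thesis using N by (simp add: code_lo_def code_hi_def divide_right_mono)
    qed simp
  qed
  then show ?thesis unfolding grid_cell_def by (auto dest: order_trans)
qed

text \<open>The neighbours of an odd code are even, so every interval direction of a face is one of
  the cell, and a proper face has lost at least one.\<close>

lemma grid_face_dim:
  assumes f: "grid_face n b a"
  shows "grid_dim n b \<le> grid_dim n a"
    "grid_dim n b = grid_dim n a \<Longrightarrow> a \<in> grid_codes N n \<Longrightarrow> b \<in> grid_codes N n \<Longrightarrow> b = a"
proof -
  have *: "b i = a i" if "i < n" "odd (b i)" for i
  proof -
    have "Suc (b i) \<noteq> a i \<and> b i \<noteq> Suc (a i)" if "odd (a i)" using that \<open>odd (b i)\<close> by (metis even_Suc)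
    then show ?thesis using grid_faceD[OF f that(1)] by blast
  qed
  then have sub: "{i. i < n \<and> odd (b i)} \<subseteq> {i. i < n \<and> odd (a i)}" by auto
  then show "grid_dim n b \<le> grid_dim n a" unfolding grid_dim_def by (intro card_mono) auto
  assume "grid_dim n b = grid_dim n a" and ab: "a \<in> grid_codes N n" "b \<in> grid_codes N n"
  then have "{i. i < n \<and> odd (b i)} = {i. i < n \<and> odd (a i)}"
    unfolding grid_dim_def using sub by (intro card_subset_eq) auto
  then have "b i = a i" if "i < n" for i using * f that unfolding grid_face_def by blast
  then show "b = a" using ab unfolding grid_codes_def by (intro PiE_ext[of _ "{..<n}" "\<lambda>_. {0..2 * N}"]) auto
qed

lemma grid_carrier_interior:
  assumes N: "0 < N" and a: "a \<in> grid_codes N n" and x: "x \<in> grid_cell N n a" "x \<notin> grid_boundary N n a"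
  shows "grid_carrier N n x = a"
proof -
  have xc: "x \<in> unit_cube n" using x by (simp add: grid_cell_def)
  have "grid_carrier N n x i = a i" if i: "i < n" for i
  proof (rule ccontr)
    assume ne: "grid_carrier N n x i \<noteq> a i"
    then have o: "odd (a i)" and c: "Suc (coord_code N (x i)) = a i \<or> coord_code N (x i) = Suc (a i)"
      using grid_carrier_face[OF N x(1)] i by (auto simp: grid_face_def grid_carrier_simp)
    have e: "even (coord_code N (x i))" using o c by (metis even_Suc)
    note cc = coord_code_cell[OF N, of "x i"]
    have xi: "x i = code_lo N (coord_code N (x i))" "x i = code_hi N (coord_code N (x i))"
      using cc(1,2) code_even[OF e, of N] unit_cube_coord[OF xc i] by auto
    from c have "x i = code_lo N (a i) \<or> x i = code_hi N (a i)"
    proof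
      assume "Suc (coord_code N (x i)) = a i"
      then have "coord_code N (x i) div 2 = a i div 2" using e by (metis even_Suc_div_two)
      then show ?thesis using xi(1) by (simp add: code_lo_def)
    next
      assume "coord_code N (x i) = Suc (a i)"
      then show ?thesis using xi(1) by (simp add: code_lo_def code_hi_def)
    qed
    then show False using x i o by (auto simp: grid_boundary_def)
  qed
  then show ?thesis using a grid_carrier_codes[OF N xc] unfolding grid_codes_def
    by (intro PiE_ext[of _ "{..<n}" "\<lambda>_. {0..2 * N}"]) auto
qed

lemma grid_carrier_boundary:
  assumes N: "0 < N" and x: "x \<in> grid_boundary N n a"
  shows "grid_carrier N n x \<noteq> a"
proof
  assume eq: "grid_carrier N n x = a"
  obtain i where i: "i < n" "odd (a i)" "x i = code_lo N (a i) \<or> x i = code_hi N (a i)" and xc: "x \<in> unit_cube n"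
    using x by (auto simp: grid_boundary_def grid_cell_def)
  have "coord_code N (x i) = a i" using eq i by (metis grid_carrier_simp)
  then show False using coord_code_cell(3)[OF N, of "x i"] unit_cube_coord[OF xc i(1)] i by auto
qed

text \<open>If no coordinate of the cell is frozen at 0 or 1, the cell touches the boundary of the
  cube only with end points of its intervals.\<close>

lemma grid_boundary_of_cube_boundary:
  assumes N: "0 < N" and a: "a \<in> grid_codes N n" and int: "\<And>i. i < n \<Longrightarrow> a i \<noteq> 0 \<and> a i \<noteq> 2 * N"
    and x: "x \<in> grid_cell N n a" "x \<in> cube_boundary n"
  shows "x \<in> grid_boundary N n a"
proof -
  obtain i where i: "i < n" "x i = 0 \<or> x i = 1" using x by (auto simp: cube_boundary_def)
  have b: "code_lo N (a i) \<le> x i" "x i \<le> code_hi N (a i)" using x i by (auto simp: grid_cell_def)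
  have aN: "a i \<noteq> 0" "a i < 2 * N" using int[OF i(1)] a i(1) by (auto simp: grid_codes_def PiE_def Pi_def le_less)
  have hi: "0 < code_hi N (a i)" "code_hi N (a i) \<le> 1" using aN N by (auto simp: code_hi_def)
  have lo: "0 \<le> code_lo N (a i)" "code_lo N (a i) < 1" using aN N by (auto simp: code_lo_def)
  have "odd (a i)"
  proof
    assume "even (a i)"
    then show False using code_even[of "a i" N] b hi lo i(2) by auto
  qed
  moreover have "x i = code_lo N (a i) \<or> x i = code_hi N (a i)" using i(2) b hi lo by auto
  ultimately show ?thesis using x i by (auto simp: grid_boundary_def)
qed

lemma grid_cell_in_cube_boundary:
  assumes N: "0 < N" and i: "i < n" "a i = 0 \<or> a i = 2 * N"
  shows "grid_cell N n a \<subseteq> cube_boundary n"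
proof
  fix x assume x: "x \<in> grid_cell N n a"
  then have "code_lo N (a i) \<le> x i" "x i \<le> code_hi N (a i)" using i by (auto simp: grid_cell_def)
  then have "x i = 0 \<or> x i = 1" using i(2) N by (auto simp: code_lo_def code_hi_def)
  then show "x \<in> cube_boundary n" using x i(1) by (auto simp: cube_boundary_def grid_cell_def topspace_cube)
qed

lemma closed_grid_cell: "closedin (top_of_set (unit_cube n)) (grid_cell N n a)"
proof -
  have "grid_cell N n a = unit_cube n \<inter> (\<Inter>i\<in>{..<n}. {x \<in> topspace (top_of_set (unit_cube n)). x i \<in> {code_lo N (a i)..code_hi N (a i)}})"
    by (auto simp: grid_cell_def)
  moreover have "closedin (top_of_set (unit_cube n)) (unit_cube n \<inter> (\<Inter>i\<in>{..<n}. {x \<in> topspace (top_of_set (unit_cube n)). x i \<in> {code_lo N (a i)..code_hi N (a i)}}))"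
  proof (cases "n = 0")
    case True then show ?thesis using closedin_topspace[of "top_of_set (unit_cube n)"] by simp
  next
    case False
    have "closedin (top_of_set (unit_cube n)) {x \<in> topspace (top_of_set (unit_cube n)). x i \<in> {code_lo N (a i)..code_hi N (a i)}}" for i
      by (rule closedin_continuous_map_preimage[of _ euclideanreal])
         (auto intro: continuous_on_subset[OF continuous_on_product_coordinates])
    then show ?thesis using False closedin_topspace[of "top_of_set (unit_cube n)"] by (intro closedin_Int closedin_INT) auto
  qed
  ultimately show ?thesis by simp
qed

lemma grid_cell_nonempty:
  assumes N: "0 < N" and a: "a \<in> grid_codes N n"
  shows "restrict (\<lambda>i. code_lo N (a i)) {..<n} \<in> grid_cell N n a"
proof -
  have "code_lo N (a i) \<le> code_hi N (a i)" for i by (simp add: code_lo_def code_hi_def divide_right_mono div_le_mono)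
  moreover have "code_lo N (a i) \<le> 1" if "i < n" for i
    using a that N by (auto simp: grid_codes_def PiE_def Pi_def code_lo_def)
  moreover have "0 \<le> code_lo N (a i)" for i by (simp add: code_lo_def)
  ultimately show ?thesis by (auto simp: grid_cell_def unit_cube_def)
qed

lemma grid_cell_small:
  assumes N: "0 < N" and x: "x \<in> grid_cell N n a" "y \<in> grid_cell N n a"
  shows "dist x y \<le> 2 / real N"
proof -
  have "dist (x i) (y i) \<le> 1 / real N" for i
  proof (cases "i < n")
    case True
    then have "code_lo N (a i) \<le> x i" "x i \<le> code_hi N (a i)" "code_lo N (a i) \<le> y i" "y i \<le> code_hi N (a i)"
      using x by (auto simp: grid_cell_def)
    then show ?thesis using code_diff[OF N, of "a i"] unfolding dist_real_def by linarith
  next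
    case False
    then have "x i = undefined" "y i = undefined" using x by (auto simp: grid_cell_def unit_cube_def PiE_def extensional_def)
    then show ?thesis by simp
  qed
  then show ?thesis using dist_fun_le[of x y "1 / real N"] by simp
qed

text \<open>The interval directions are enumerated by \<open>e\<close> and rescaled by
  \<open>N\<close>; the remaining coordinates are constant.\<close>

lemma grid_cell_homeomorphism:
  assumes N: "0 < N" and a: "a \<in> grid_codes N n"
  obtains p q where "homeomorphism (grid_cell N n a) (unit_cube (grid_dim n a)) p q"
    "grid_boundary N n a = {x \<in> grid_cell N n a. p x \<in> cube_boundary (grid_dim n a)}"
proof -
  let ?A = "{i. i < n \<and> odd (a i)}" and ?d = "grid_dim n a"
  have fin: "finite ?A" by simp
  obtain e where e: "bij_betw e {..<?d} ?A"
    using ex_bij_betw_nat_finite[OF fin] by (auto simp: grid_dim_def atLeast0LessThan)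
  define e' where "e' = inv_into {..<?d} e"
  have e': "e' (e j) = j" if "j < ?d" for j using e that by (auto simp: e'_def bij_betw_def inv_into_f_f)
  have ee': "e (e' i) = i" "e' i < ?d" if "i < n" "odd (a i)" for i
    using e that f_inv_into_f[of i e "{..<?d}"] inv_into_into[of i e "{..<?d}"] by (auto simp: e'_def bij_betw_def)
  have eA: "e j < n" "odd (a (e j))" if "j < ?d" for j using bij_betwE[OF e] that by auto
  define p where "p x = restrict (\<lambda>j. real N * (x (e j) - code_lo N (a (e j)))) {..<?d}" for x :: "nat \<Rightarrow> real"
  define q where "q y = restrict (\<lambda>i. if odd (a i) then code_lo N (a i) + y (e' i) / real N else code_lo N (a i)) {..<n}" for y :: "nat \<Rightarrow> real"
  have ai: "a i \<le> 2 * N" if "i < n" for i using a that by (auto simp: grid_codes_def PiE_def Pi_def)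
  have lo: "0 \<le> code_lo N k" "k \<le> 2 * N \<Longrightarrow> code_hi N k \<le> 1" "code_lo N k \<le> code_hi N k" for k
    using N by (auto simp: code_lo_def code_hi_def divide_right_mono div_le_mono)
  have coords: "code_lo N (a i) \<le> x i" "x i \<le> code_hi N (a i)" if "x \<in> grid_cell N n a" "i < n" for x i
    using that by (auto simp: grid_cell_def)
  have pin: "p x \<in> unit_cube ?d" if x: "x \<in> grid_cell N n a" for x
  proof -
    have "real N * (x (e j) - code_lo N (a (e j))) \<in> {0..1}" if j: "j < ?d" for j
      using coords[OF x eA(1)[OF j]] code_odd[OF eA(2)[OF j] N] N by (auto simp: field_simps)
    then show ?thesis by (auto simp: p_def unit_cube_def)
  qed
  have qin: "q y \<in> grid_cell N n a" if y: "y \<in> unit_cube ?d" for y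
  proof -
    have "code_lo N (a i) \<le> q y i \<and> q y i \<le> code_hi N (a i)" if i: "i < n" for i
    proof (cases "odd (a i)")
      case True
      have "0 \<le> y (e' i)" "y (e' i) \<le> 1" using unit_cube_coord[OF y ee'(2)[OF i True]] by auto
      then show ?thesis using True i N code_odd[OF True N] by (auto simp: q_def divide_right_mono)
    next
      case False
      then show ?thesis using i code_even[of "a i" N] by (simp add: q_def)
    qed
    then have "code_lo N (a i) \<le> q y i" "q y i \<le> code_hi N (a i)" "0 \<le> q y i" "q y i \<le> 1" if "i < n" for i
      using that lo(1)[of "a i"] lo(2)[OF ai[OF that]] by (meson order_trans)+
    then show ?thesis by (auto simp: grid_cell_def unit_cube_def q_def)
  qed
  have qp: "q (p x) = x" if x: "x \<in> grid_cell N n a" for x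
  proof (rule unit_cube_ext[of _ n])
    show "q (p x) \<in> unit_cube n" "x \<in> unit_cube n" using qin[OF pin[OF x]] x by (auto simp: grid_cell_def)
    show "q (p x) i = x i" if i: "i < n" for i
    proof (cases "odd (a i)")
      case True
      then show ?thesis using i ee'[OF i True] N by (simp add: q_def p_def)
    next
      case False
      then show ?thesis using i coords[OF x i] code_even[of "a i" N] by (simp add: q_def)
    qed
  qed
  have pq: "p (q y) = y" if y: "y \<in> unit_cube ?d" for y
  proof (rule unit_cube_ext[OF pin[OF qin[OF y]] y])
    fix j assume j: "j < ?d"
    then show "p (q y) j = y j" using eA[OF j] e'[OF j] N by (simp add: p_def q_def)
  qed
  have pc: "continuous_on (grid_cell N n a) p"
    unfolding p_def
    by (rule continuous_on_restrict_lessThan)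
       (intro continuous_on_mult continuous_on_diff continuous_on_const continuous_on_subset[OF continuous_on_product_coordinates], simp)
  have qc: "continuous_on (unit_cube ?d) q"
    unfolding q_def
  proof (rule continuous_on_restrict_lessThan)
    fix i
    have "continuous_on (unit_cube ?d) (\<lambda>x. x (e' i))"
      by (rule continuous_on_subset[OF continuous_on_product_coordinates]) simp
    then show "continuous_on (unit_cube ?d) (\<lambda>y. if odd (a i) then code_lo N (a i) + y (e' i) / real N else code_lo N (a i))"
      by (cases "odd (a i)") (use N in \<open>auto intro!: continuous_on_add continuous_on_divide continuous_on_const\<close>)
  qed
  have "homeomorphism (grid_cell N n a) (unit_cube ?d) p q"
    by (rule homeomorphismI[OF pc qc]) (use pin qin qp pq in auto)
  moreover have "grid_boundary N n a = {x \<in> grid_cell N n a. p x \<in> cube_boundary ?d}"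
  proof -
    have "p x \<in> cube_boundary ?d \<longleftrightarrow> (\<exists>i<n. odd (a i) \<and> (x i = code_lo N (a i) \<or> x i = code_hi N (a i)))"
      if x: "x \<in> grid_cell N n a" for x
    proof -
      have "p x j = 0 \<or> p x j = 1 \<longleftrightarrow> x (e j) = code_lo N (a (e j)) \<or> x (e j) = code_hi N (a (e j))" if j: "j < ?d" for j
      proof -
        have px: "p x j = real N * (x (e j) - code_lo N (a (e j)))" using j by (simp add: p_def)
        have iff: "real N * (z - l) = 0 \<longleftrightarrow> z = l" "real N * (z - l) = 1 \<longleftrightarrow> z = l + 1 / real N" for z l
          using N by (auto simp: field_simps)
        show ?thesis unfolding px code_odd[OF eA(2)[OF j] N] iff ..
      qed
      then have "p x \<in> cube_boundary ?d \<longleftrightarrow> (\<exists>j<?d. x (e j) = code_lo N (a (e j)) \<or> x (e j) = code_hi N (a (e j)))"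
        using pin[OF x] by (auto simp: cube_boundary_def topspace_cube)
      also have "\<dots> \<longleftrightarrow> (\<exists>i<n. odd (a i) \<and> (x i = code_lo N (a i) \<or> x i = code_hi N (a i)))"
      proof
        assume "\<exists>j<?d. x (e j) = code_lo N (a (e j)) \<or> x (e j) = code_hi N (a (e j))"
        then obtain j where "j < ?d" "x (e j) = code_lo N (a (e j)) \<or> x (e j) = code_hi N (a (e j))" by blast
        then show "\<exists>i<n. odd (a i) \<and> (x i = code_lo N (a i) \<or> x i = code_hi N (a i))"
          using eA by (intro exI[of _ "e j"]) simp
      next
        assume "\<exists>i<n. odd (a i) \<and> (x i = code_lo N (a i) \<or> x i = code_hi N (a i))"
        then obtain i where "i < n" "odd (a i)" "x i = code_lo N (a i) \<or> x i = code_hi N (a i)" by blast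
        then show "\<exists>j<?d. x (e j) = code_lo N (a (e j)) \<or> x (e j) = code_hi N (a (e j))"
          using ee' by (intro exI[of _ "e' i"]) simp
      qed
      finally show ?thesis .
    qed
    then show ?thesis by (auto simp: grid_boundary_def)
  qed
  ultimately show ?thesis by (rule that)
qed

section \<open>Compressibility of realisations\<close>

lemma compressible_homeo:
  assumes u: "compressible X Y u" and hom: "homeomorphism S (unit_cube d) p q" and B: "B = {y \<in> S. p y \<in> cube_boundary d}"
    and f: "cont_from B X f" and g: "cont_from S Y g" and fg: "\<And>b. b \<in> B \<Longrightarrow> u (f b) = g b"
  shows "solves S B X Y u f g"
proof (rule solves_homeo[OF hom B cube_boundary_subset])
  have q: "continuous_on (unit_cube d) q" "\<And>y. y \<in> unit_cube d \<Longrightarrow> q y \<in> S" "\<And>y. y \<in> unit_cube d \<Longrightarrow> p (q y) = y"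
    using hom unfolding homeomorphism_def by blast+
  have qB: "q y \<in> B" if "y \<in> cube_boundary d" for y
    using that q(2,3)[of y] cube_boundary_subset[of d] B by auto
  have "cont_from (cube_boundary d) X (\<lambda>x. f (q x))"
    by (rule cont_from_compose[OF continuous_on_subset[OF q(1) cube_boundary_subset] qB f])
  moreover have "cont_from (unit_cube d) Y (\<lambda>x. g (q x))"
    by (rule cont_from_compose[OF q(1,2) g])
  ultimately show "solves (unit_cube d) (cube_boundary d) X Y u (\<lambda>x. f (q x)) (\<lambda>x. g (q x))"
    using u fg[OF qB] unfolding compressible_def by blast
qed

text \<open>A Lebesgue number for the pulled-back cover, with cells of diameter at most
  \<open>2 / N\<close>.\<close>

lemma grid_subordinate:
  assumes g: "cont_from (unit_cube n) Y g" and V: "\<And>p. openin Y (V p)" and cover: "\<And>y. y \<in> topspace Y \<Longrightarrow> \<exists>p. y \<in> V p"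
  obtains N where "0 < N" "\<And>a. a \<in> grid_codes N n \<Longrightarrow> \<exists>p. \<forall>x\<in>grid_cell N n a. g x \<in> V p"
proof -
  have "\<exists>U. open U \<and> {x \<in> unit_cube n. g x \<in> V p} = unit_cube n \<inter> U" for p
  proof -
    have "openin (top_of_set (unit_cube n)) {x \<in> topspace (top_of_set (unit_cube n)). g x \<in> V p}"
      by (rule openin_continuous_map_preimage[OF g V])
    then show ?thesis by (simp add: openin_open)
  qed
  then obtain U where U: "\<And>p. open (U p)" "\<And>p. {x \<in> unit_cube n. g x \<in> V p} = unit_cube n \<inter> U p" by metis
  have "unit_cube n \<subseteq> \<Union>(range U)"
  proof
    fix x assume x: "x \<in> unit_cube n"
    then obtain p where "g x \<in> V p" using cover cont_from_in[OF g x] by blast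
    then show "x \<in> \<Union>(range U)" using U(2)[of p] x by blast
  qed
  then obtain \<delta> where \<delta>: "0 < \<delta>" "\<And>T. T \<subseteq> unit_cube n \<Longrightarrow> diameter T < \<delta> \<Longrightarrow> \<exists>B\<in>range U. T \<subseteq> B"
    using Lebesgue_number_lemma[OF compact_unit_cube[of n], of "range U"] U(1) by blast
  obtain N where N: "0 < N" "2 / real N < \<delta>"
  proof -
    obtain M where "inverse (real (Suc M)) < \<delta> / 2" using reals_Archimedean[of "\<delta> / 2"] \<delta>(1) by auto
    then have "2 / real (Suc M) < \<delta>" by (simp add: field_simps)
    then show ?thesis using that[of "Suc M"] by blast
  qed
  show ?thesis
  proof (rule that[OF N(1)])
    fix a assume "a \<in> grid_codes N n"
    have sub: "grid_cell N n a \<subseteq> unit_cube n" by (auto simp: grid_cell_def)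
    have "diameter (grid_cell N n a) \<le> 2 / real N"
      unfolding diameter_def using grid_cell_small[OF N(1)] by (auto intro!: cSUP_least)
    then have "diameter (grid_cell N n a) < \<delta>" using N(2) by simp
    then obtain p where "grid_cell N n a \<subseteq> U p" using \<delta>(2)[OF sub] by blast
    then show "\<exists>p. \<forall>x\<in>grid_cell N n a. g x \<in> V p" using U(2)[of p] sub by blast
  qed
qed

text \<open>The solution is built cell by cell, faces before the cells they bound. For a cell
  \<open>a\<close>, \<open>sel a\<close> collects every \<open>p\<close> for which \<open>g\<close>
  maps the whole cell into \<open>V p\<close>; it is nonempty by smallness and finite by
  boundedness. Faces select at least as many indices, so the homotopy already built on the boundary
  stays in the intersection over \<open>sel a\<close>, and the cell can be solved there.\<close>

lemma local_compressible:
  assumes u: "continuous_map X Y u" and V: "\<And>p. openin Y (V p)" and cover: "\<And>y. y \<in> topspace Y \<Longrightarrow> \<exists>p. y \<in> V p"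
    and bounded: "\<And>y. y \<in> topspace Y \<Longrightarrow> \<exists>q::nat. \<forall>p. y \<in> V p \<longrightarrow> p \<le> q"
    and W: "\<And>p x. x \<in> topspace X \<Longrightarrow> x \<in> W p \<longleftrightarrow> u x \<in> V p"
    and loc: "\<And>S. finite S \<Longrightarrow> S \<noteq> {} \<Longrightarrow> compressible (subtopology X (\<Inter>p\<in>S. W p)) (subtopology Y (\<Inter>p\<in>S. V p)) u"
  shows "compressible X Y u"
  unfolding compressible_def
proof (intro conjI allI impI u)
  fix n f g
  let ?C = "unit_cube n" and ?b = "cube_boundary n"
  assume "cont_from ?b X f \<and> cont_from ?C Y g \<and> (\<forall>a\<in>?b. u (f a) = g a)"
  then have f: "cont_from ?b X f" and g: "cont_from ?C Y g" and fg: "\<And>a. a \<in> ?b \<Longrightarrow> u (f a) = g a" by auto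
  obtain N where N: "0 < N" and small: "\<And>a. a \<in> grid_codes N n \<Longrightarrow> \<exists>p. \<forall>x\<in>grid_cell N n a. g x \<in> V p"
    using grid_subordinate[OF g V cover] by blast
  define cell where "cell = grid_cell N n"
  define bd where "bd = grid_boundary N n"
  define car where "car = grid_carrier N n"
  define sel where "sel a = {p. \<forall>y\<in>cell a. g y \<in> V p}" for a
  define K where "K \<Sigma> = ?b \<union> \<Union>(cell ` \<Sigma>)" for \<Sigma>
  \<comment> \<open>The last clause is the invariant that drives the induction: over
    \<open>x\<close> the homotopy respects every index selected by the carrier of \<open>x\<close>.
    The carrier is the smallest cell at \<open>x\<close>, so the indices of every other cell
    containing \<open>x\<close> are covered as well.\<close>
  define good where "good \<Sigma> \<longleftrightarrow> (\<exists>L H. cont_from (K \<Sigma>) X L \<and> cont_from (K \<Sigma> \<times> unit_I) Y H \<and>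
     (\<forall>a\<in>?b. L a = f a) \<and> (\<forall>a\<in>?b. \<forall>s\<in>unit_I. H (a, s) = g a) \<and> (\<forall>x\<in>K \<Sigma>. H (x, 0) = u (L x) \<and> H (x, 1) = g x) \<and>
     (\<forall>x\<in>K \<Sigma>. \<forall>s\<in>unit_I. \<forall>p\<in>sel (car x). H (x, s) \<in> V p))" for \<Sigma>
  define closed where "closed \<Sigma> \<longleftrightarrow> \<Sigma> \<subseteq> grid_codes N n \<and> (\<forall>a\<in>\<Sigma>. \<forall>b\<in>grid_codes N n. grid_face n b a \<longrightarrow> b \<in> \<Sigma>)" for \<Sigma>
  have bC: "?b \<subseteq> ?C" by (rule cube_boundary_subset)
  have cellC: "cell a \<subseteq> ?C" for a by (auto simp: cell_def grid_cell_def)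
  have bdcell: "bd a \<subseteq> cell a" for a by (auto simp: bd_def cell_def grid_boundary_def)
  have KC: "K \<Sigma> \<subseteq> ?C" for \<Sigma> using bC cellC by (auto simp: K_def)
  have carcell: "x \<in> cell (car x)" if "x \<in> ?C" for x
    using grid_carrier_cell[OF N that] by (simp add: cell_def car_def)
  have finc: "finite (grid_codes N n)" by (simp add: grid_codes_def finite_PiE)
  have sel_mono: "sel a \<subseteq> sel (car x)" if "x \<in> cell a" for a x
  proof -
    have "grid_face n (car x) a" using grid_carrier_face[OF N] that by (simp add: cell_def car_def)
    then have "cell (car x) \<subseteq> cell a" using grid_face_cell[OF N] by (simp add: cell_def)
    then show ?thesis by (auto simp: sel_def)
  qed
  have selg: "g x \<in> V p" if "p \<in> sel (car x)" "x \<in> ?C" for p x using that carcell by (auto simp: sel_def)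
  have closedK: "closedin (top_of_set ?C) (K \<Sigma>)" if "finite \<Sigma>" for \<Sigma>
    unfolding K_def using that by (intro closedin_Un closed_cube_boundary closedin_Union) (auto simp: cell_def closed_grid_cell)
  have step: "good (insert a \<Sigma>)" if good: "good \<Sigma>" and \<Sigma>: "closed \<Sigma>" "closed (insert a \<Sigma>)" and a: "a \<notin> \<Sigma>" for a \<Sigma>
  proof (cases "\<exists>i<n. a i = 0 \<or> a i = 2 * N")
    case True
    \<comment> \<open>Such a cell lies in the boundary of the cube, where the data are
      given.\<close>
    then have "cell a \<subseteq> ?b" using grid_cell_in_cube_boundary[OF N] by (auto simp: cell_def)
    then have "K (insert a \<Sigma>) = K \<Sigma>" by (auto simp: K_def)
    then show ?thesis using good by (simp add: good_def)
  next
    case False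
    have ac: "a \<in> grid_codes N n" using \<Sigma> by (simp add: closed_def)
    have fin: "finite \<Sigma>" using \<Sigma>(1) finc finite_subset by (auto simp: closed_def)
    obtain L H where L: "cont_from (K \<Sigma>) X L" "\<And>x. x \<in> ?b \<Longrightarrow> L x = f x" and H: "cont_from (K \<Sigma> \<times> unit_I) Y H"
      "\<And>x s. x \<in> ?b \<Longrightarrow> s \<in> unit_I \<Longrightarrow> H (x, s) = g x" "\<And>x. x \<in> K \<Sigma> \<Longrightarrow> H (x, 0) = u (L x)" "\<And>x. x \<in> K \<Sigma> \<Longrightarrow> H (x, 1) = g x"
      "\<And>x s p. x \<in> K \<Sigma> \<Longrightarrow> s \<in> unit_I \<Longrightarrow> p \<in> sel (car x) \<Longrightarrow> H (x, s) \<in> V p"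
      using good unfolding good_def by auto
    have KK: "K (insert a \<Sigma>) = K \<Sigma> \<union> cell a" by (auto simp: K_def)
    \<comment> \<open>A boundary point of \<open>a\<close> has a proper face of \<open>a\<close> as
      its carrier, and that face has been treated before.\<close>
    have bdK: "bd a \<subseteq> K \<Sigma>"
    proof
      fix x assume x: "x \<in> bd a"
      then have xc: "x \<in> cell a" "x \<in> ?C" using bdcell cellC by blast+
      have "grid_face n (car x) a" using grid_carrier_face[OF N] xc by (simp add: cell_def car_def)
      moreover have "car x \<in> grid_codes N n" using grid_carrier_codes[OF N xc(2)] by (simp add: car_def)
      ultimately have "car x \<in> insert a \<Sigma>" using \<Sigma>(2) by (simp add: closed_def)
      moreover have "car x \<noteq> a" using grid_carrier_boundary[OF N] x by (simp add: car_def bd_def)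
      ultimately show "x \<in> K \<Sigma>" using carcell[OF xc(2)] by (auto simp: K_def)
    qed
    \<comment> \<open>Conversely, a point of \<open>a\<close> already treated lies on its boundary,
      so the old and the new maps overlap on \<open>bd a\<close> only.\<close>
    have Kbd: "x \<in> bd a" if xa: "x \<in> cell a" and xK: "x \<in> K \<Sigma>" for x
    proof (cases "x \<in> ?b")
      case True
      then show ?thesis using grid_boundary_of_cube_boundary[OF N ac _ xa[unfolded cell_def]] \<open>\<not> (\<exists>i<n. a i = 0 \<or> a i = 2 * N)\<close>
        by (auto simp: bd_def)
    next
      case False
      then obtain b where b: "b \<in> \<Sigma>" "x \<in> cell b" using xK by (auto simp: K_def)
      show ?thesis
      proof (rule ccontr)
        assume "x \<notin> bd a"
        then have "car x = a" using grid_carrier_interior[OF N ac] xa by (simp add: cell_def bd_def car_def)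
        then have "grid_face n a b" using grid_carrier_face[OF N b(2)[unfolded cell_def]] by (simp add: car_def)
        then show False using \<Sigma>(1) b(1) ac a by (simp add: closed_def)
      qed
    qed
    let ?S = "sel a" 
    have "?S \<noteq> {}" using small[OF ac] by (auto simp: sel_def cell_def)
    moreover have "finite ?S"
    proof -
      obtain x where x: "x \<in> cell a" using grid_cell_nonempty[OF N ac] by (auto simp: cell_def)
      then obtain q where "\<forall>p. g x \<in> V p \<longrightarrow> p \<le> q" using bounded[OF cont_from_in[OF g]] cellC by blast
      then have "?S \<subseteq> {..q}" using x by (auto simp: sel_def)
      then show ?thesis by (rule finite_subset) simp
    qed
    ultimately have comp: "compressible (subtopology X (\<Inter>p\<in>?S. W p)) (subtopology Y (\<Inter>p\<in>?S. V p)) u"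
      by (intro loc)
    let ?X = "subtopology X (\<Inter>p\<in>?S. W p)" and ?Y = "subtopology Y (\<Inter>p\<in>?S. V p)"
    obtain p q where hom: "homeomorphism (cell a) (unit_cube (grid_dim n a)) p q" and B: "bd a = {x \<in> cell a. p x \<in> cube_boundary (grid_dim n a)}"
      using grid_cell_homeomorphism[OF N ac] unfolding cell_def bd_def by blast
    have cp: "cell_pair (cell a) (bd a)" by (rule cell_pair_homeo[OF cell_pair_cube hom B])
    have HV: "H (x, s) \<in> (\<Inter>p\<in>?S. V p)" if "x \<in> bd a" "s \<in> unit_I" for x s
    proof
      fix p assume "p \<in> ?S"
      then have "p \<in> sel (car x)" using sel_mono[of x a] that(1) bdcell by blast
      then show "H (x, s) \<in> V p" using H(5)[of x s p] that bdK by blast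
    qed
    have "cont_from (bd a) X L" by (rule cont_from_subset[OF L(1) bdK])
    \<comment> \<open>\<open>u (L x)\<close> is the homotopy at time 0, which lies in every
      \<open>V p\<close> selected by the cell.\<close>
    moreover have "L x \<in> (\<Inter>p\<in>?S. W p)" if "x \<in> bd a" for x
    proof -
      have xK: "x \<in> K \<Sigma>" using that bdK by blast
      have "u (L x) \<in> (\<Inter>p\<in>?S. V p)" using HV[OF that, of 0] H(3)[OF xK] by simp
      then show ?thesis using W[OF cont_from_in[OF L(1) xK]] by simp
    qed
    ultimately have L1: "cont_from (bd a) ?X L" by (auto simp: continuous_map_in_subtopology)
    have "cont_from (bd a \<times> unit_I) Y H" by (rule cont_from_subset[OF H(1)]) (use bdK in auto)
    then have H1: "cont_from (bd a \<times> unit_I) ?Y H" using HV by (auto simp: continuous_map_in_subtopology)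
    have g1: "cont_from (cell a) ?Y g"
      using cont_from_subset[OF g cellC[of a]] by (auto simp: continuous_map_in_subtopology sel_def)
    have uc: "continuous_map ?X ?Y u" using comp by (simp add: compressible_def)
    obtain L' H' where L': "cont_from (cell a) ?X L'" "\<And>x. x \<in> bd a \<Longrightarrow> L' x = L x"
      and H': "cont_from (cell a \<times> unit_I) ?Y H'" "\<And>x. x \<in> cell a \<Longrightarrow> H' (x, 0) = u (L' x)" "\<And>x. x \<in> cell a \<Longrightarrow> H' (x, 1) = g x"
        "\<And>x s. x \<in> bd a \<Longrightarrow> s \<in> unit_I \<Longrightarrow> H' (x, s) = H (x, s)"
    proof (rule solves_relative[OF cp uc L1 H1 g1])
      show "H (x, 0) = u (L x)" "H (x, 1) = g x" if "x \<in> bd a" for x using H(3,4) that bdK by blast+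
      show "solves (cell a) (bd a) ?X ?Y u L g'" if "cont_from (cell a) ?Y g'" "\<And>x. x \<in> bd a \<Longrightarrow> u (L x) = g' x" for g'
        by (rule compressible_homeo[OF comp hom B L1 that])
    qed blast
    have clK: "closedin (top_of_set (K (insert a \<Sigma>))) (K \<Sigma>)"
      by (rule closedin_top_of_set_subset[OF closedK[OF fin] _ KC]) (auto simp: KK)
    have clc: "closedin (top_of_set (K (insert a \<Sigma>))) (cell a)"
      by (rule closedin_top_of_set_subset[OF _ _ KC]) (auto simp: KK cell_def closed_grid_cell)
    let ?L = "\<lambda>x. if x \<in> K \<Sigma> then L x else L' x"
    let ?H = "\<lambda>y. if y \<in> K \<Sigma> \<times> unit_I then H y else H' y"
    have "cont_from (K (insert a \<Sigma>)) X ?L"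
    proof (rule cont_from_glue[OF clK clc _ L(1)])
      show "cont_from (cell a) X L'" using L'(1) by (simp add: continuous_map_in_subtopology)
    qed (use KK Kbd L'(2) in auto)
    moreover have "cont_from (K (insert a \<Sigma>) \<times> unit_I) Y ?H"
    proof (rule cont_from_glue[OF closedin_Times_top_of_set[OF clK] closedin_Times_top_of_set[OF clc] _ H(1)])
      show "cont_from (cell a \<times> unit_I) Y H'" using H'(1) by (simp add: continuous_map_in_subtopology)
    qed (use KK Kbd H'(4) in auto)
    \<comment> \<open>A new point has carrier \<open>a\<close>, and \<open>H'\<close> was built
      inside the intersection over exactly these indices.\<close>
    moreover have "?H (x, s) \<in> V p" if x: "x \<in> K (insert a \<Sigma>)" and s: "s \<in> unit_I" and p: "p \<in> sel (car x)" for x s p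
    proof (cases "x \<in> K \<Sigma>")
      case True
      then show ?thesis using H(5)[OF True s p] s by simp
    next
      case False
      then have xa: "x \<in> cell a" "x \<notin> bd a" using x KK bdK by auto
      then have "car x = a" using grid_carrier_interior[OF N ac] by (simp add: cell_def bd_def car_def)
      then have pS: "p \<in> ?S" using p by simp
      have "H' (x, s) \<in> topspace ?Y" using cont_from_in[OF H'(1), of "(x, s)"] xa(1) s by blast
      then show ?thesis using False pS by simp
    qed
    moreover have "x \<in> K \<Sigma>" if "x \<in> ?b" for x using that by (simp add: K_def)
    ultimately show ?thesis
      unfolding good_def
      using L(2) H(2-4) H'(2,3) by (intro exI[of _ ?L] exI[of _ ?H]) (auto simp: KK)
  qed
  have "good \<Sigma>" if "closed \<Sigma>" for \<Sigma>
    using that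
  proof (induction "card \<Sigma>" arbitrary: \<Sigma>)
    case 0
    then have "\<Sigma> = {}" using finc finite_subset[of \<Sigma>] by (auto simp: closed_def)
    then have K: "K \<Sigma> = ?b" by (simp add: K_def)
    have "cont_from (?b \<times> unit_I) Y (\<lambda>y. g (fst y))"
      by (rule cont_from_compose[OF _ _ g]) (use bC in \<open>auto intro!: continuous_on_fst continuous_on_id\<close>)
    then show ?case
      unfolding good_def K using f fg selg bC by (intro exI[of _ f] exI[of _ "\<lambda>y. g (fst y)"]) auto
  next
    case (Suc k)
    have fin: "finite \<Sigma>" and "\<Sigma> \<noteq> {}" using Suc by (auto intro: card_ge_0_finite)
    \<comment> \<open>Removing a cell of maximal dimension leaves a set closed under faces, since
      such a cell is not a proper face of another one in the set.\<close>
    then obtain a where a: "a \<in> \<Sigma>" and max: "\<And>b. b \<in> \<Sigma> \<Longrightarrow> grid_dim n b \<le> grid_dim n a"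
      using Max_in[of "grid_dim n ` \<Sigma>"] Max_ge[of "grid_dim n ` \<Sigma>"] by (smt (verit, best) finite_imageI image_iff image_is_empty)
    have cl: "closed (\<Sigma> - {a})"
      unfolding closed_def
    proof (intro conjI ballI impI)
      show "\<Sigma> - {a} \<subseteq> grid_codes N n" using Suc.prems by (auto simp: closed_def)
      fix c b assume c: "c \<in> \<Sigma> - {a}" and b: "b \<in> grid_codes N n" "grid_face n b c"
      have cc: "c \<in> grid_codes N n" using c Suc.prems by (auto simp: closed_def)
      have "b \<noteq> a"
      proof
        assume "b = a"
        then have "grid_dim n b = grid_dim n c" using grid_face_dim(1)[OF b(2)] max[of c] c by simp
        then have "b = c" by (rule grid_face_dim(2)[OF b(2) _ cc b(1)])
        then show False using \<open>b = a\<close> c by simp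
      qed
      then show "b \<in> \<Sigma> - {a}" using c b Suc.prems by (auto simp: closed_def)
    qed
    moreover have "k = card (\<Sigma> - {a})" using Suc.hyps(2) a fin by simp
    ultimately have "good (\<Sigma> - {a})" by (intro Suc.hyps(1))
    then have "good (insert a (\<Sigma> - {a}))" by (rule step[OF _ cl]) (use a Suc.prems in \<open>auto simp: insert_absorb\<close>)
    then show ?case using a by (simp add: insert_absorb)
  qed
  then have "good (grid_codes N n)" by (simp add: closed_def)
  moreover have "K (grid_codes N n) = ?C"
  proof
    show "?C \<subseteq> K (grid_codes N n)"
      using carcell grid_carrier_codes[OF N, of _ n, folded car_def] unfolding K_def by blast
  qed (rule KC)
  ultimately show "solves ?C ?b X Y u f g"
    unfolding good_def solves_def by auto
qed

section \<open>Weights on the join of a simplex with a new last vertex of weight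
  \<open>s\<close>\<close>

definition cone_coord :: "nat \<Rightarrow> real \<Rightarrow> (nat \<Rightarrow> real) \<Rightarrow> nat \<Rightarrow> real" where
  "cone_coord p s t = (\<lambda>j. if j = Suc p then s else (1 - s) * t j)"

lemma cone_coord_simplex:
  assumes t: "t \<in> standard_simplex p" and s: "s \<in> unit_I"
  shows "cone_coord p s t \<in> standard_simplex (Suc p)"
proof (rule standard_simplexI)
  show "0 \<le> cone_coord p s t i" for i using standard_simplexD(1)[OF t, of i] s by (simp add: cone_coord_def)
  show "cone_coord p s t i = 0" if "Suc p < i" for i using standard_simplexD(2)[OF t, of i] that by (simp add: cone_coord_def)
  have "(\<Sum>i\<le>p. cone_coord p s t i) = (\<Sum>i\<le>p. (1 - s) * t i)" by (rule sum.cong) (auto simp: cone_coord_def)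
  also have "\<dots> = 1 - s" using standard_simplexD(3)[OF t] by (simp flip: sum_distrib_left)
  finally show "(\<Sum>i\<le>Suc p. cone_coord p s t i) = 1" by (simp add: cone_coord_def)
qed

lemma cone_coord_face:
  "i \<le> Suc p \<Longrightarrow> cone_coord (Suc p) s (simplical_face i t) = simplical_face i (cone_coord p s t)"
  by (auto simp: cone_coord_def simplical_face_def fun_eq_iff)

lemma cone_coord_0: "t \<in> standard_simplex p \<Longrightarrow> cone_coord p 0 t = simplical_face (Suc p) t"
  using standard_simplexD(2)[of t p] by (auto simp: cone_coord_def simplical_face_def fun_eq_iff)

lemma continuous_map_cone_coord:
  "continuous_map (prod_topology (simplex_topology p) (top_of_set unit_I)) (simplex_topology (Suc p)) (\<lambda>y. cone_coord p (snd y) (fst y))"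
proof (rule continuous_map_to_simplex)
  let ?P = "prod_topology (simplex_topology p) (top_of_set unit_I)"
  have c: "continuous_map ?P euclideanreal (\<lambda>y. fst y j)" for j
    using continuous_map_compose[OF continuous_map_fst continuous_map_coordinate] by (simp add: o_def)
  have s: "continuous_map ?P euclideanreal snd"
    by (rule continuous_map_into_fulltopology[OF continuous_map_snd])
  show "continuous_map ?P euclideanreal (\<lambda>y. cone_coord p (snd y) (fst y) i)" for i
    unfolding cone_coord_def
    by (cases "i = Suc p") (simp_all add: continuous_map_real_mult continuous_map_diff s c)
  show "cone_coord p (snd y) (fst y) \<in> standard_simplex (Suc p)" if "y \<in> topspace ?P" for y
    using that by (intro cone_coord_simplex) auto
qed

context semi_simplicial_map begin

lemma compressible_realisation_map:
  assumes lev: "\<And>p. compressible (X p) (Y p) (u p)"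
  shows "compressible (realisation X dX) (realisation Y dY) realisation_map"
proof (rule local_compressible[OF continuous_map_realisation_map cod.openin_star])
  show "\<exists>p. y \<in> cod.star p" if "y \<in> topspace (realisation Y dY)" for y using cod.star_cover[OF that] by blast
  show "\<exists>q. \<forall>p. y \<in> cod.star p \<longrightarrow> p \<le> q" if "y \<in> topspace (realisation Y dY)" for y using cod.star_bound[OF that] by blast
  show "x \<in> dom.star p \<longleftrightarrow> realisation_map x \<in> cod.star p" if "x \<in> topspace (realisation X dX)" for p x
    using realisation_map_star[OF that] by simp
qed (rule star_compressible[OF lev])

text \<open>\<open>k\<close> joins a simplex of \<open>X\<close> to a new last vertex, whose vertex of \<open>Y\<close> is always \<open>v\<close>; so
  \<open>realisation_map\<close> extends over the cone of the realisation of \<open>X\<close>.\<close>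

lemma cone_cube_extension:
  assumes lev: "\<And>p. compressible (X p) (Y p) (u p)"
    and k: "\<And>p. continuous_map (X p) (Y (Suc p)) (k p)"
    and k_last: "\<And>p x. x \<in> topspace (X p) \<Longrightarrow> dY (Suc p) (Suc p) (k p x) = u p x"
    and k_face: "\<And>p i x. x \<in> topspace (X (Suc p)) \<Longrightarrow> i \<le> Suc p \<Longrightarrow> dY (Suc (Suc p)) i (k (Suc p) x) = k p (dX (Suc p) i x)"
    and k_0: "\<And>x. x \<in> topspace (X 0) \<Longrightarrow> dY (Suc 0) 0 (k 0 x) = v"
    and v: "v \<in> topspace (Y 0)"
  shows "cube_extension (realisation X dX)"
proof -
  let ?e = "\<lambda>i j. if j = i then 1 else 0 :: real"
  let ?v = "cell_class Y dY (0, v, ?e 0)"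
  have kin: "k p x \<in> topspace (Y (Suc p))" if "x \<in> topspace (X p)" for p x
    using k[of p] that by (auto simp: continuous_map_def)
  \<comment> \<open>Dropping initial vertices one at a time by face 0 identifies the last vertex of
    every \<open>k p x\<close> with \<open>v\<close>.\<close>
  have top: "cell_class Y dY (Suc p, k p x, ?e (Suc p)) = ?v" if "x \<in> topspace (X p)" for p x
    using that
  proof (induction p arbitrary: x)
    case 0
    have "?e (Suc 0) = simplical_face 0 (?e 0)" by (auto simp: simplical_face_def fun_eq_iff)
    then show ?case using cell_class_face[where X = Y, OF kin[OF 0], of 0 "?e 0" dY] k_0[OF 0] by simp
  next
    case (Suc p)
    have "?e (Suc (Suc p)) = simplical_face 0 (?e (Suc p))" by (auto simp: simplical_face_def fun_eq_iff)
    then show ?case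
      using cell_class_face[where X = Y, OF kin[OF Suc.prems], of 0 "?e (Suc p)" dY] k_face[OF Suc.prems, of 0] Suc.IH[OF dom.face_in[OF Suc.prems, of 0]]
      by simp
  qed
  obtain \<kappa> where \<kappa>: "continuous_map (prod_topology (subtopology (realisation X dX) (topspace (realisation X dX))) (top_of_set unit_I)) (realisation Y dY) \<kappa>"
    "\<And>p x t s. x \<in> topspace (X p) \<Longrightarrow> t \<in> standard_simplex p \<Longrightarrow> cell_class X dX (p, x, t) \<in> topspace (realisation X dX) \<Longrightarrow>
       s \<in> unit_I \<Longrightarrow> \<kappa> (cell_class X dX (p, x, t), s) = cell_class Y dY (Suc p, k p x, cone_coord p s t)"
  proof (rule dom.realisation_descend[OF openin_topspace, of "\<lambda>p x t s. cell_class Y dY (Suc p, k p x, cone_coord p s t)" "realisation Y dY"])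
    fix p x i t and s :: real assume x: "x \<in> topspace (X (Suc p))" "i \<le> Suc p" "t \<in> standard_simplex p" and s: "s \<in> unit_I"
    then show "cell_class Y dY (Suc (Suc p), k (Suc p) x, cone_coord (Suc p) s (simplical_face i t)) = cell_class Y dY (Suc p, k p (dX (Suc p) i x), cone_coord p s t)"
      using cell_class_face[where X = Y, OF kin[OF x(1)], of i "cone_coord p s t" dY] cone_coord_simplex[OF x(3) s] by (simp add: cone_coord_face k_face)
  next
    fix p x t assume t: "t \<in> standard_simplex p"
    from continuous_map_cell_homotopy[where X = X and X' = Y and d' = dY and q = "Suc p", OF k[of p] continuous_map_cone_coord]
    show "\<exists>U \<Psi>. openin (simplex_topology p) U \<and> t \<in> U \<and>
       continuous_map (prod_topology (simplices X p) (top_of_set unit_I)) (realisation Y dY) \<Psi> \<and>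
       (\<forall>x t s. x \<in> topspace (X p) \<longrightarrow> t \<in> U \<longrightarrow> cell_class X dX (p, x, t) \<in> topspace (realisation X dX) \<longrightarrow> s \<in> unit_I \<longrightarrow>
          cell_class Y dY (Suc p, k p x, cone_coord p s t) = \<Psi> ((x, t), s))"
      using t by (intro exI[of _ "standard_simplex p"] exI conjI) (use openin_topspace[of "simplex_topology p"] in auto)
  qed blast
  show ?thesis
  proof (rule compressible_null_imp_cube_extension[OF compressible_realisation_map[OF lev]])
    show "continuous_map (prod_topology (realisation X dX) (top_of_set unit_I)) (realisation Y dY) \<kappa>"
      using \<kappa>(1) by (simp add: subtopology_topspace)
    show "?v \<in> topspace (realisation Y dY)" by (rule cell_class_in[where X = Y, OF v]) simp
    fix z assume zX: "z \<in> topspace (realisation X dX)"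
    then obtain p x t where z: "x \<in> topspace (X p)" "t \<in> standard_simplex p" "z = cell_class X dX (p, x, t)"
      by (rule realisation_cases)
    have \<kappa>z: "\<kappa> (z, s) = cell_class Y dY (Suc p, k p x, cone_coord p s t)" if "s \<in> unit_I" for s
      using \<kappa>(2)[OF z(1,2) _ that] zX by (simp add: z(3))
    \<comment> \<open>At time 0 the new vertex has weight zero, so it can be forgotten, and the last
      face of \<open>k p x\<close> is \<open>u p x\<close>.\<close>
    show "\<kappa> (z, 0) = realisation_map z"
      using \<kappa>z[of 0] cell_class_face[where X = Y, OF kin[OF z(1)], of "Suc p" t dY] z k_last[OF z(1)] by (simp add: cone_coord_0 realisation_map_cell)
    have "cone_coord p 1 t = ?e (Suc p)" by (auto simp: cone_coord_def fun_eq_iff)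
    then show "\<kappa> (z, 1) = ?v" using \<kappa>z[of 1] top[OF z(1)] by simp
  qed
qed

end

section \<open>Nerves\<close>

lemma topspace_cg_subspace [simp]: "topspace (cg_subspace X S) = topspace X \<inter> S"
  by (simp add: cg_subspace_def)

text \<open>By \<open>continuous_map_cg_cg\<close> the identity is continuous from the once refined
  to the twice refined topology.\<close>

lemma cg_space_cg_topology: "cg_space (cg_topology X)"
proof -
  have "openin (cg_topology (cg_topology X)) U \<longleftrightarrow> openin (cg_topology X) U" for U
  proof
    assume "openin (cg_topology (cg_topology X)) U"
    moreover have "continuous_map (cg_topology X) (cg_topology (cg_topology X)) (\<lambda>x. x)"
      by (rule continuous_map_cg_cg) (use continuous_map_id in \<open>simp add: id_def\<close>)
    ultimately have "openin (cg_topology X) {x \<in> topspace (cg_topology X). x \<in> U}"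
      by (rule openin_continuous_map_preimage[rotated])
    moreover have "{x \<in> topspace (cg_topology X). x \<in> U} = U"
      using openin_subset[OF \<open>openin (cg_topology (cg_topology X)) U\<close>] by auto
    ultimately show "openin (cg_topology X) U" by simp
  next
    assume "openin (cg_topology X) U"
    then show "openin (cg_topology (cg_topology X)) U"
      unfolding openin_cg_topology_iff[of "cg_topology X"] by (rule cg_open_openin)
  qed
  then show ?thesis unfolding cg_space_def by (simp add: topology_eq)
qed

lemma cg_space_cg_subspace: "cg_space (cg_subspace X S)"
  by (simp add: cg_subspace_def cg_space_cg_topology)

lemma cg_space_compact_Hausdorff:
  assumes "compact_space K" "Hausdorff_space K"
  shows "cg_space K"
proof -
  have "openin K U" if U: "openin (cg_topology K) U" for U
  proof -
    have "openin K {x \<in> topspace K. x \<in> U}"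
      using openin_cg_topology[OF U assms continuous_map_id] by simp
    moreover have "{x \<in> topspace K. x \<in> U} = U" using openin_subset[OF U] by auto
    ultimately show ?thesis by simp
  qed
  moreover have "openin (cg_topology K) U" if "openin K U" for U
    using cg_open_openin[OF that] by (simp add: openin_cg_topology_iff)
  ultimately show ?thesis unfolding cg_space_def topology_eq by (intro allI iffI)
qed

lemma continuous_map_cg_space:
  assumes Z: "cg_space Z" and f: "continuous_map Z X f"
  shows "continuous_map Z (cg_topology X) f"
  using continuous_map_cg_cg[of Z X f] f Z by (simp add: cg_space_def)

lemma continuous_map_cg_subspace:
  assumes "cg_space Z" "continuous_map Z X f" "\<And>z. z \<in> topspace Z \<Longrightarrow> f z \<in> S"
  shows "continuous_map Z (cg_subspace X S) f"
  unfolding cg_subspace_def using assms by (intro continuous_map_cg_space) (auto simp: continuous_map_in_subtopology)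

lemma continuous_map_from_cg_subspace: "continuous_map X Y f \<Longrightarrow> continuous_map (cg_subspace X S) Y f"
  unfolding cg_subspace_def by (intro continuous_map_from_cg continuous_map_from_subtopology)

lemma topspace_nerve:
  "x \<in> topspace (nerve C p) \<longleftrightarrow> fst x \<in> (\<Pi>\<^sub>E i\<in>{..p}. topspace (Obj C)) \<and> snd x \<in> (\<Pi>\<^sub>E i\<in>{..<p}. topspace (Mor C)) \<and>
     (\<forall>i<p. src C (snd x i) = fst x i \<and> tgt C (snd x i) = fst x (Suc i))"
  by (cases x) (auto simp: nerve_def)

lemma nerve_objD: "x \<in> topspace (nerve C p) \<Longrightarrow> i \<le> p \<Longrightarrow> fst x i \<in> topspace (Obj C)"
  and nerve_morD: "x \<in> topspace (nerve C p) \<Longrightarrow> i < p \<Longrightarrow> snd x i \<in> topspace (Mor C)"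
  and nerve_srcD: "x \<in> topspace (nerve C p) \<Longrightarrow> i < p \<Longrightarrow> src C (snd x i) = fst x i"
  and nerve_tgtD: "x \<in> topspace (nerve C p) \<Longrightarrow> i < p \<Longrightarrow> tgt C (snd x i) = fst x (Suc i)"
  by (auto simp: topspace_nerve PiE_def Pi_def)

lemma nerve_eqI:
  assumes "x \<in> topspace (nerve C p)" "y \<in> topspace (nerve C p)"
    "\<And>i. i \<le> p \<Longrightarrow> fst x i = fst y i" "\<And>i. i < p \<Longrightarrow> snd x i = snd y i"
  shows "x = y"
proof (rule prod_eqI)
  show "fst x = fst y" using assms(1,2) by (intro PiE_ext[of _ "{..p}" "\<lambda>_. topspace (Obj C)"]) (auto simp: topspace_nerve assms(3))
  show "snd x = snd y" using assms(1,2) by (intro PiE_ext[of _ "{..<p}" "\<lambda>_. topspace (Mor C)"]) (auto simp: topspace_nerve assms(4))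
qed

text \<open>A compactly generated source does not notice the refinement of the topology of the fibre
  product, so continuity may be checked on each object and each morphism separately.\<close>

lemma continuous_map_to_nerve:
  assumes Z: "cg_space Z" and ob: "\<And>i. i \<le> p \<Longrightarrow> continuous_map Z (Obj C) (\<lambda>z. fst (F z) i)"
    and mor: "\<And>i. i < p \<Longrightarrow> continuous_map Z (Mor C) (\<lambda>z. snd (F z) i)"
    and F: "\<And>z. z \<in> topspace Z \<Longrightarrow> F z \<in> topspace (nerve C p)"
  shows "continuous_map Z (nerve C p) F"
  unfolding nerve_def
proof (rule continuous_map_cg_subspace[OF Z])
  have "continuous_map Z (product_topology (\<lambda>_. Obj C) {..p}) (\<lambda>z. fst (F z))"
    unfolding continuous_map_componentwise using ob F by (auto simp: topspace_nerve PiE_def)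
  moreover have "continuous_map Z (product_topology (\<lambda>_. Mor C) {..<p}) (\<lambda>z. snd (F z))"
    unfolding continuous_map_componentwise using mor F by (auto simp: topspace_nerve PiE_def)
  ultimately show "continuous_map Z (prod_topology (product_topology (\<lambda>_. Obj C) {..p}) (product_topology (\<lambda>_. Mor C) {..<p})) F"
    unfolding continuous_map_pairwise by (simp add: o_def)
  show "F z \<in> {(c, f). \<forall>i<p. src C (f i) = c i \<and> tgt C (f i) = c (Suc i)}" if "z \<in> topspace Z" for z
    using F[OF that] by (simp add: topspace_nerve split_def)
qed

lemma cg_space_nerve: "cg_space (nerve C p)"
  by (simp add: nerve_def cg_space_cg_subspace)

lemma continuous_map_nerve_obj: "i \<le> p \<Longrightarrow> continuous_map (nerve C p) (Obj C) (\<lambda>x. fst x i)"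
  unfolding nerve_def
  using continuous_map_compose[OF continuous_map_fst continuous_map_product_projection[of i "{..p}" "\<lambda>_. Obj C"]]
  by (intro continuous_map_from_cg_subspace) (simp add: o_def)

lemma continuous_map_nerve_mor: "i < p \<Longrightarrow> continuous_map (nerve C p) (Mor C) (\<lambda>x. snd x i)"
  unfolding nerve_def
  using continuous_map_compose[OF continuous_map_snd continuous_map_product_projection[of i "{..<p}" "\<lambda>_. Mor C"]]
  by (intro continuous_map_from_cg_subspace) (simp add: o_def)

lemma nerve_face_fst: "j \<le> q \<Longrightarrow> fst (nerve_face C (Suc q) i x) j = (if j < i then fst x j else fst x (Suc j))"
  by (simp add: nerve_face_def split_def)

lemma nerve_face_snd: "j < q \<Longrightarrow> snd (nerve_face C (Suc q) i x) j =
    (if Suc j < i then snd x j else if Suc j = i then cmp C (snd x (Suc j)) (snd x j) else snd x (Suc j))"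
  by (simp add: nerve_face_def split_def)

lemma nerve_face_extensional:
  "fst (nerve_face C (Suc q) i x) \<in> extensional {..q}" "snd (nerve_face C (Suc q) i x) \<in> extensional {..<q}"
  by (auto simp: nerve_face_def split_def)

locale nonunital_category =
  fixes C :: "('o, 'm) top_cat"
  assumes cat: "nonunital_top_cat C"
begin

lemma src_continuous: "continuous_map (Mor C) (Obj C) (src C)" and tgt_continuous: "continuous_map (Mor C) (Obj C) (tgt C)"
  using cat by (auto simp: nonunital_top_cat_def)

lemma src_cmp: "f \<in> topspace (Mor C) \<Longrightarrow> g \<in> topspace (Mor C) \<Longrightarrow> tgt C f = src C g \<Longrightarrow> src C (cmp C g f) = src C f"
  and tgt_cmp: "f \<in> topspace (Mor C) \<Longrightarrow> g \<in> topspace (Mor C) \<Longrightarrow> tgt C f = src C g \<Longrightarrow> tgt C (cmp C g f) = tgt C g"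
  and cmp_assoc: "f \<in> topspace (Mor C) \<Longrightarrow> g \<in> topspace (Mor C) \<Longrightarrow> h \<in> topspace (Mor C) \<Longrightarrow> tgt C f = src C g \<Longrightarrow>
    tgt C g = src C h \<Longrightarrow> cmp C h (cmp C g f) = cmp C (cmp C h g) f"
  using cat unfolding nonunital_top_cat_def by blast+

lemma continuous_map_cmp:
  assumes Z: "cg_space Z" and f: "continuous_map Z (Mor C) f" and g: "continuous_map Z (Mor C) g"
    and fg: "\<And>z. z \<in> topspace Z \<Longrightarrow> tgt C (f z) = src C (g z)"
  shows "continuous_map Z (Mor C) (\<lambda>z. cmp C (g z) (f z))"
proof -
  have "continuous_map Z (cg_prod (Mor C) (Mor C)) (\<lambda>z. (f z, g z))"
    unfolding cg_prod_def by (intro continuous_map_cg_space Z) (simp add: continuous_map_paired f g)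
  then have "continuous_map Z (cg_subspace (cg_prod (Mor C) (Mor C)) {(f, g). tgt C f = src C g}) (\<lambda>z. (f z, g z))"
    by (rule continuous_map_cg_subspace[OF Z]) (simp add: fg)
  moreover have "continuous_map (cg_subspace (cg_prod (Mor C) (Mor C)) {(f, g). tgt C f = src C g}) (Mor C) (\<lambda>(f, g). cmp C g f)"
    using cat by (simp add: nonunital_top_cat_def)
  ultimately have "continuous_map Z (Mor C) ((\<lambda>(f, g). cmp C g f) \<circ> (\<lambda>z. (f z, g z)))"
    by (rule continuous_map_compose)
  then show ?thesis by (simp add: o_def)
qed

lemma cmp_in:
  assumes fg: "f \<in> topspace (Mor C)" "g \<in> topspace (Mor C)" "tgt C f = src C g"
  shows "cmp C g f \<in> topspace (Mor C)"
proof -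
  have "continuous_map (cg_subspace (cg_prod (Mor C) (Mor C)) {(f, g). tgt C f = src C g}) (Mor C) (\<lambda>(f, g). cmp C g f)"
    using cat by (simp add: nonunital_top_cat_def)
  moreover have "(f, g) \<in> topspace (cg_subspace (cg_prod (Mor C) (Mor C)) {(f, g). tgt C f = src C g})" using fg by simp
  ultimately have "(\<lambda>(f, g). cmp C g f) (f, g) \<in> topspace (Mor C)" unfolding continuous_map_def by blast
  then show ?thesis by simp
qed

lemma nerve_face_in:
  assumes x: "x \<in> topspace (nerve C (Suc q))" and i: "i \<le> Suc q"
  shows "nerve_face C (Suc q) i x \<in> topspace (nerve C q)"
proof -
  note D = nerve_objD[OF x] nerve_morD[OF x] nerve_srcD[OF x] nerve_tgtD[OF x]
  let ?y = "nerve_face C (Suc q) i x"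
  have ob: "fst ?y j \<in> topspace (Obj C)" if "j \<le> q" for j using that D(1) by (simp add: nerve_face_fst)
  have mor: "snd ?y j \<in> topspace (Mor C)" if "j < q" for j using that D by (simp add: nerve_face_snd cmp_in)
  have "src C (snd ?y j) = fst ?y j \<and> tgt C (snd ?y j) = fst ?y (Suc j)" if "j < q" for j
    using that D by (auto simp: nerve_face_fst nerve_face_snd src_cmp tgt_cmp)
  then show ?thesis
    unfolding topspace_nerve using ob mor nerve_face_extensional[of C q i x] by (auto simp: PiE_def)
qed

lemma continuous_map_nerve_face:
  assumes i: "i \<le> Suc q"
  shows "continuous_map (nerve C (Suc q)) (nerve C q) (nerve_face C (Suc q) i)"
proof (rule continuous_map_to_nerve[OF cg_space_nerve])
  show "continuous_map (nerve C (Suc q)) (Obj C) (\<lambda>x. fst (nerve_face C (Suc q) i x) j)" if "j \<le> q" for j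
    using that continuous_map_nerve_obj[of j "Suc q" C] continuous_map_nerve_obj[of "Suc j" "Suc q" C]
    by (cases "j < i") (simp_all add: nerve_face_fst)
  show "continuous_map (nerve C (Suc q)) (Mor C) (\<lambda>x. snd (nerve_face C (Suc q) i x) j)" if j: "j < q" for j
  proof -
    note c = continuous_map_nerve_mor[of j "Suc q" C] continuous_map_nerve_mor[of "Suc j" "Suc q" C]
    have "continuous_map (nerve C (Suc q)) (Mor C) (\<lambda>x. cmp C (snd x (Suc j)) (snd x j))"
      using j by (intro continuous_map_cmp[OF cg_space_nerve] c) (auto simp: nerve_srcD nerve_tgtD)
    then show ?thesis using j c
      by (cases "Suc j < i"; cases "Suc j = i") (simp_all add: nerve_face_snd)
  qed
qed (rule nerve_face_in[OF _ i])

lemma nerve_face_face: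
  assumes x: "x \<in> topspace (nerve C (Suc (Suc q)))" and ij: "i < j" "j \<le> Suc (Suc q)"
  shows "nerve_face C (Suc q) i (nerve_face C (Suc (Suc q)) j x) = nerve_face C (Suc q) (j - 1) (nerve_face C (Suc (Suc q)) i x)"
proof (rule nerve_eqI)
  show "nerve_face C (Suc q) i (nerve_face C (Suc (Suc q)) j x) \<in> topspace (nerve C q)"
    "nerve_face C (Suc q) (j - 1) (nerve_face C (Suc (Suc q)) i x) \<in> topspace (nerve C q)"
    using x ij by (intro nerve_face_in; simp)+
  show "fst (nerve_face C (Suc q) i (nerve_face C (Suc (Suc q)) j x)) k = fst (nerve_face C (Suc q) (j - 1) (nerve_face C (Suc (Suc q)) i x)) k"
    if "k \<le> q" for k
    using that ij by (auto simp: nerve_face_fst)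
  show "snd (nerve_face C (Suc q) i (nerve_face C (Suc (Suc q)) j x)) k = snd (nerve_face C (Suc q) (j - 1) (nerve_face C (Suc (Suc q)) i x)) k"
    if k: "k < q" for k
  proof -
    note D = nerve_morD[OF x] nerve_srcD[OF x] nerve_tgtD[OF x]
    have assoc: "cmp C (snd x (Suc (Suc k))) (cmp C (snd x (Suc k)) (snd x k)) = cmp C (cmp C (snd x (Suc (Suc k))) (snd x (Suc k))) (snd x k)"
      using k D by (intro cmp_assoc) auto
    \<comment> \<open>Only the second case, \<open>Suc k = i\<close> with \<open>j = Suc i\<close>,
      meets two consecutive compositions in both bracketings and calls for associativity.\<close>
    consider "Suc k < i" | "Suc k = i" "j = Suc i" | "Suc k = i" "Suc i < j" | "i < Suc k" "Suc (Suc k) < j" | "i < Suc k" "Suc (Suc k) = j" | "i < Suc k" "j < Suc (Suc k)"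
      using ij by linarith
    then show ?thesis using k ij assoc by cases (auto simp: nerve_face_snd)
  qed
qed

end

section \<open>Over- and under-nerves, and appending a morphism\<close>

lemma over_nerve_iff: "x \<in> topspace (over_nerve C c p) \<longleftrightarrow> x \<in> topspace (nerve C (Suc p)) \<and> fst x (Suc p) = c"
  by (auto simp: over_nerve_def)

lemma under_nerve_iff: "x \<in> topspace (under_nerve C c p) \<longleftrightarrow> x \<in> topspace (nerve C (Suc p)) \<and> fst x 0 = c"
  by (auto simp: under_nerve_def)

lemma cg_space_over_under: "cg_space (over_nerve C c p)" "cg_space (under_nerve C c p)"
  by (simp_all add: over_nerve_def under_nerve_def cg_space_cg_subspace)

lemma continuous_map_from_over_under:
  "continuous_map (nerve C (Suc p)) Y f \<Longrightarrow> continuous_map (over_nerve C c p) Y f"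
  "continuous_map (nerve C (Suc p)) Y f \<Longrightarrow> continuous_map (under_nerve C c p) Y f"
  by (simp_all add: over_nerve_def under_nerve_def continuous_map_from_cg_subspace)

lemma continuous_map_to_over:
  assumes "cg_space Z" "continuous_map Z (nerve C (Suc p)) f" "\<And>z. z \<in> topspace Z \<Longrightarrow> fst (f z) (Suc p) = c"
  shows "continuous_map Z (over_nerve C c p) f"
  unfolding over_nerve_def using assms by (intro continuous_map_cg_subspace) auto

lemma continuous_map_to_under:
  assumes "cg_space Z" "continuous_map Z (nerve C (Suc p)) f" "\<And>z. z \<in> topspace Z \<Longrightarrow> fst (f z) 0 = c"
  shows "continuous_map Z (under_nerve C c p) f"
  unfolding under_nerve_def using assms by (intro continuous_map_cg_subspace) auto

text \<open>The objects are the sources of the morphisms, except the last one, which is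
  \<open>c\<close>.\<close>

lemma over_nerve_eqI:
  assumes x: "x \<in> topspace (over_nerve C c p)" and y: "y \<in> topspace (over_nerve C c p)"
    and eq: "\<And>i. i < Suc p \<Longrightarrow> snd x i = snd y i"
  shows "x = y"
proof (rule nerve_eqI[of _ C "Suc p"])
  show xy: "x \<in> topspace (nerve C (Suc p))" "y \<in> topspace (nerve C (Suc p))" using x y by (auto simp: over_nerve_iff)
  show "fst x i = fst y i" if "i \<le> Suc p" for i
  proof (cases "i = Suc p")
    case True then show ?thesis using x y by (simp add: over_nerve_iff)
  next
    case False
    then have i: "i < Suc p" using that by simp
    show ?thesis using nerve_srcD[OF xy(1) i] nerve_srcD[OF xy(2) i] eq[OF i] by simp
  qed
qed (rule eq)

definition append_mor :: "('o, 'm) top_cat \<Rightarrow> 'm \<Rightarrow> nat \<Rightarrow> (nat \<Rightarrow> 'o) \<times> (nat \<Rightarrow> 'm) \<Rightarrow> (nat \<Rightarrow> 'o) \<times> (nat \<Rightarrow> 'm)" where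
  "append_mor C m p x = (\<lambda>j\<in>{..Suc (Suc p)}. if j = Suc (Suc p) then tgt C m else fst x j,
     \<lambda>j\<in>{..<Suc (Suc p)}. if j = Suc p then m else snd x j)"

text \<open>Composing the last morphism with \<open>m\<close>, written as an inner face of the
  simplex with \<open>m\<close> appended. Continuity and compatibility with faces are thereby
  inherited, and the condition on the last face in the cone construction holds by
  definition.\<close>

definition post_mor :: "('o, 'm) top_cat \<Rightarrow> 'm \<Rightarrow> nat \<Rightarrow> (nat \<Rightarrow> 'o) \<times> (nat \<Rightarrow> 'm) \<Rightarrow> (nat \<Rightarrow> 'o) \<times> (nat \<Rightarrow> 'm)" where
  "post_mor C m p x = nerve_face C (Suc (Suc p)) (Suc p) (append_mor C m p x)"

lemma post_mor_snd:
  "j < p \<Longrightarrow> snd (post_mor C m p x) j = snd x j" "snd (post_mor C m p x) p = cmp C m (snd x p)"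
  by (simp_all add: post_mor_def nerve_face_snd append_mor_def)

context nonunital_category begin

lemma over_nerve_semi_simplicial: "semi_simplicial (over_nerve C c) (\<lambda>p i. nerve_face C (Suc p) i)"
proof
  fix p i :: nat assume i: "i \<le> Suc p"
  show "continuous_map (over_nerve C c (Suc p)) (over_nerve C c p) (nerve_face C (Suc (Suc p)) i)"
    using i by (intro continuous_map_to_over cg_space_over_under continuous_map_from_over_under continuous_map_nerve_face)
      (auto simp: nerve_face_fst over_nerve_iff)
next
  fix x and p i j :: nat assume "x \<in> topspace (over_nerve C c (Suc (Suc p)))" "i < j" "j \<le> Suc (Suc p)"
  then show "nerve_face C (Suc (Suc p)) i (nerve_face C (Suc (Suc (Suc p))) j x) = nerve_face C (Suc (Suc p)) (j - 1) (nerve_face C (Suc (Suc (Suc p))) i x)"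
    by (intro nerve_face_face) (auto simp: over_nerve_iff)
qed

text \<open>Vertex 0 of the chain is the fixed object, hence the shift of all face indices by
  one.\<close>

lemma under_nerve_semi_simplicial: "semi_simplicial (under_nerve C c) (\<lambda>p i. nerve_face C (Suc p) (Suc i))"
proof
  fix p i :: nat assume i: "i \<le> Suc p"
  show "continuous_map (under_nerve C c (Suc p)) (under_nerve C c p) (nerve_face C (Suc (Suc p)) (Suc i))"
    using i by (intro continuous_map_to_under cg_space_over_under continuous_map_from_over_under continuous_map_nerve_face)
      (auto simp: nerve_face_fst under_nerve_iff)
next
  fix x and p i j :: nat assume "x \<in> topspace (under_nerve C c (Suc (Suc p)))" "i < j" "j \<le> Suc (Suc p)"
  then show "nerve_face C (Suc (Suc p)) (Suc i) (nerve_face C (Suc (Suc (Suc p))) (Suc j) x) =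
      nerve_face C (Suc (Suc p)) (Suc (j - 1)) (nerve_face C (Suc (Suc (Suc p))) (Suc i) x)"
    using nerve_face_face[of x "Suc p" "Suc i" "Suc j"] by (auto simp: under_nerve_iff)
qed

lemma append_mor_in:
  assumes m: "m \<in> topspace (Mor C)" and x: "x \<in> topspace (over_nerve C (src C m) p)"
  shows "append_mor C m p x \<in> topspace (over_nerve C (tgt C m) (Suc p))"
proof -
  have xn: "x \<in> topspace (nerve C (Suc p))" and xc: "fst x (Suc p) = src C m" using x by (auto simp: over_nerve_iff)
  note D = nerve_objD[OF xn] nerve_morD[OF xn] nerve_srcD[OF xn] nerve_tgtD[OF xn]
  have "tgt C m \<in> topspace (Obj C)" "src C m \<in> topspace (Obj C)"
    using tgt_continuous src_continuous m by (auto simp: continuous_map_def)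
  then show ?thesis
    unfolding over_nerve_iff topspace_nerve using D xc m by (auto simp: append_mor_def less_Suc_eq PiE_def Pi_def le_Suc_eq)
qed

lemma continuous_map_append_mor:
  assumes m: "m \<in> topspace (Mor C)"
  shows "continuous_map (over_nerve C (src C m) p) (over_nerve C (tgt C m) (Suc p)) (append_mor C m p)"
proof (intro continuous_map_to_over cg_space_over_under continuous_map_to_nerve)
  have tm: "tgt C m \<in> topspace (Obj C)" using tgt_continuous m by (auto simp: continuous_map_def)
  show "continuous_map (over_nerve C (src C m) p) (Obj C) (\<lambda>z. fst (append_mor C m p z) i)" if "i \<le> Suc (Suc p)" for i
    using that tm continuous_map_nerve_obj[of i "Suc p" C]
    by (cases "i = Suc (Suc p)") (simp_all add: append_mor_def continuous_map_from_over_under)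
  show "continuous_map (over_nerve C (src C m) p) (Mor C) (\<lambda>z. snd (append_mor C m p z) i)" if "i < Suc (Suc p)" for i
    using that m continuous_map_nerve_mor[of i "Suc p" C]
    by (cases "i = Suc p") (simp_all add: append_mor_def continuous_map_from_over_under)
qed (use append_mor_in[OF m] in \<open>auto simp: over_nerve_iff\<close>)

lemma append_mor_face:
  assumes m: "m \<in> topspace (Mor C)" and x: "x \<in> topspace (over_nerve C (src C m) (Suc p))" and i: "i \<le> Suc p"
  shows "nerve_face C (Suc (Suc (Suc p))) i (append_mor C m (Suc p) x) = append_mor C m p (nerve_face C (Suc (Suc p)) i x)"
proof (rule over_nerve_eqI)
  interpret S: semi_simplicial "over_nerve C (src C m)" "\<lambda>p i. nerve_face C (Suc p) i" by (rule over_nerve_semi_simplicial)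
  interpret T: semi_simplicial "over_nerve C (tgt C m)" "\<lambda>p i. nerve_face C (Suc p) i" by (rule over_nerve_semi_simplicial)
  show "nerve_face C (Suc (Suc (Suc p))) i (append_mor C m (Suc p) x) \<in> topspace (over_nerve C (tgt C m) (Suc p))"
    using T.face_in[OF append_mor_in[OF m x]] i by simp
  show "append_mor C m p (nerve_face C (Suc (Suc p)) i x) \<in> topspace (over_nerve C (tgt C m) (Suc p))"
    using append_mor_in[OF m S.face_in[OF x i]] .
  show "snd (nerve_face C (Suc (Suc (Suc p))) i (append_mor C m (Suc p) x)) j = snd (append_mor C m p (nerve_face C (Suc (Suc p)) i x)) j"
    if "j < Suc (Suc p)" for j
    using that i by (auto simp: nerve_face_snd append_mor_def)
qed

lemma post_mor_map:
  assumes m: "m \<in> topspace (Mor C)"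
  shows "semi_simplicial_map (over_nerve C (src C m)) (\<lambda>p i. nerve_face C (Suc p) i) (over_nerve C (tgt C m)) (\<lambda>p i. nerve_face C (Suc p) i) (post_mor C m)"
proof -
  interpret S: semi_simplicial "over_nerve C (src C m)" "\<lambda>p i. nerve_face C (Suc p) i" by (rule over_nerve_semi_simplicial)
  interpret T: semi_simplicial "over_nerve C (tgt C m)" "\<lambda>p i. nerve_face C (Suc p) i" by (rule over_nerve_semi_simplicial)
  show ?thesis
  proof
    fix p
    have "continuous_map (over_nerve C (src C m) p) (over_nerve C (tgt C m) p) (nerve_face C (Suc (Suc p)) (Suc p) \<circ> append_mor C m p)"
      by (rule continuous_map_compose[OF continuous_map_append_mor[OF m] T.face_continuous]) simp
    then show "continuous_map (over_nerve C (src C m) p) (over_nerve C (tgt C m) p) (post_mor C m p)"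
      by (simp add: post_mor_def[abs_def] o_def)
    fix x i assume x: "x \<in> topspace (over_nerve C (src C m) (Suc p))" and i: "i \<le> Suc p"
    have "nerve_face C (Suc (Suc p)) i (nerve_face C (Suc (Suc (Suc p))) (Suc (Suc p)) (append_mor C m (Suc p) x)) =
        nerve_face C (Suc (Suc p)) (Suc p) (nerve_face C (Suc (Suc (Suc p))) i (append_mor C m (Suc p) x))"
      using T.face_face[OF append_mor_in[OF m x], of i "Suc (Suc p)"] i by simp
    then show "post_mor C m p (nerve_face C (Suc (Suc p)) i x) = nerve_face C (Suc (Suc p)) i (post_mor C m (Suc p) x)"
      by (simp add: post_mor_def append_mor_face[OF m x i])
  qed
qed

end

section \<open>Lifting chains of morphisms\<close>

lemma cg_space_cube: "cg_space (top_of_set (unit_cube n))" "cg_space (top_of_set (unit_cube n \<times> unit_I))"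
  using cube_pair_compact_Hausdorff by (auto intro!: cg_space_compact_Hausdorff)

context nonunital_category begin

lemma src_in: "f \<in> topspace (Mor C) \<Longrightarrow> src C f \<in> topspace (Obj C)" and tgt_in: "f \<in> topspace (Mor C) \<Longrightarrow> tgt C f \<in> topspace (Obj C)"
  using src_continuous tgt_continuous by (auto simp: continuous_map_def)

text \<open>The homotopy \<open>K\<close> of the last morphism moves its source. This motion is the
  prescribed target for the morphism before it and is lifted through the fibration
  \<open>tgt C\<close>; the construction continues down to the first morphism. The boundary of the
  cube has to stay fixed, so lifting is used in its relative form.\<close>

lemma chain_lift:
  assumes fib: "serre_fibration (Mor C) (Obj C) (tgt C)"
    and g: "\<And>j. j < p \<Longrightarrow> cont_from (unit_cube n) (Mor C) (g j)"
    and g_chain: "\<And>j z. j < p \<Longrightarrow> z \<in> unit_cube n \<Longrightarrow> tgt C (g j z) = src C (g (Suc j) z)"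
    and K: "cont_from (unit_cube n \<times> unit_I) (Mor C) K" "\<And>z. z \<in> unit_cube n \<Longrightarrow> K (z, 1) = g p z"
      "\<And>a s. a \<in> cube_boundary n \<Longrightarrow> s \<in> unit_I \<Longrightarrow> K (a, s) = g p a"
  obtains M where "\<And>j. j \<le> p \<Longrightarrow> cont_from (unit_cube n \<times> unit_I) (Mor C) (M j)" "M p = K"
    "\<And>j z. j \<le> p \<Longrightarrow> z \<in> unit_cube n \<Longrightarrow> M j (z, 1) = g j z"
    "\<And>j a s. j \<le> p \<Longrightarrow> a \<in> cube_boundary n \<Longrightarrow> s \<in> unit_I \<Longrightarrow> M j (a, s) = g j a"
    "\<And>j y. j < p \<Longrightarrow> y \<in> unit_cube n \<times> unit_I \<Longrightarrow> tgt C (M j y) = src C (M (Suc j) y)"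
proof -
  let ?C = "unit_cube n" and ?b = "cube_boundary n"
  have bC: "?b \<subseteq> ?C" by (rule cube_boundary_subset)
  have "\<exists>M. (\<forall>j. p - k \<le> j \<and> j \<le> p \<longrightarrow> cont_from (?C \<times> unit_I) (Mor C) (M j) \<and>
      (\<forall>z\<in>?C. M j (z, 1) = g j z) \<and> (\<forall>a\<in>?b. \<forall>s\<in>unit_I. M j (a, s) = g j a)) \<and> M p = K \<and>
      (\<forall>j. p - k \<le> j \<and> j < p \<longrightarrow> (\<forall>y\<in>?C \<times> unit_I. tgt C (M j y) = src C (M (Suc j) y)))"
    if "k \<le> p" for k
    using that
  proof (induction k)
    case 0
    then show ?case using K by (intro exI[of _ "\<lambda>_. K"]) auto
  next
    case (Suc k)
    then obtain M where M0: "(\<forall>j. p - k \<le> j \<and> j \<le> p \<longrightarrow> cont_from (?C \<times> unit_I) (Mor C) (M j) \<and>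
      (\<forall>z\<in>?C. M j (z, 1) = g j z) \<and> (\<forall>a\<in>?b. \<forall>s\<in>unit_I. M j (a, s) = g j a)) \<and> M p = K \<and>
      (\<forall>j. p - k \<le> j \<and> j < p \<longrightarrow> (\<forall>y\<in>?C \<times> unit_I. tgt C (M j y) = src C (M (Suc j) y)))"
      by auto
    have M: "\<And>j. p - k \<le> j \<Longrightarrow> j \<le> p \<Longrightarrow> cont_from (?C \<times> unit_I) (Mor C) (M j)"
      "\<And>j z. p - k \<le> j \<Longrightarrow> j \<le> p \<Longrightarrow> z \<in> ?C \<Longrightarrow> M j (z, 1) = g j z"
      "\<And>j a s. p - k \<le> j \<Longrightarrow> j \<le> p \<Longrightarrow> a \<in> ?b \<Longrightarrow> s \<in> unit_I \<Longrightarrow> M j (a, s) = g j a"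
      "M p = K" "\<And>j y. p - k \<le> j \<Longrightarrow> j < p \<Longrightarrow> y \<in> ?C \<times> unit_I \<Longrightarrow> tgt C (M j y) = src C (M (Suc j) y)"
      using M0 by blast+
    define r where "r = p - Suc k"
    have r: "r < p" "Suc r = p - k" "p - k \<le> p" using Suc.prems by (auto simp: r_def)
    note Mr = M(1)[of "p - k", OF order_refl r(3)] M(2)[of "p - k", OF order_refl r(3)] M(3)[of "p - k", OF order_refl r(3)]
    have "cont_from (?C \<times> unit_I) (Obj C) (\<lambda>y. src C (M (p - k) y))"
      using continuous_map_compose[OF Mr(1) src_continuous] by (simp add: o_def)
    \<comment> \<open>The data are given at time 1, while \<open>serre_relative_lift\<close> starts
      at time 0, so time is reversed here and back again in \<open>?M\<close>.\<close>
    then have h: "cont_from (?C \<times> unit_I) (Obj C) (\<lambda>y. src C (M (p - k) (fst y, 1 - snd y)))"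
      by (rule cont_from_reverse_time)
    have e: "cont_from (cube_sides n) (Mor C) (\<lambda>y. g r (fst y))"
      by (rule cont_from_compose[OF _ _ g[OF r(1)]])
         (use bC in \<open>auto simp: cube_sides_def intro!: continuous_on_fst continuous_on_id\<close>)
    have eh: "tgt C (g r (fst y)) = src C (M (p - k) (fst y, 1 - snd y))" if "y \<in> cube_sides n" for y
    proof -
      have "fst y \<in> ?C" using that bC by (auto simp: cube_sides_def)
      moreover have "M (p - k) (fst y, 1 - snd y) = g (p - k) (fst y)"
        using that Mr(2)[of "fst y"] Mr(3)[of "fst y" "1 - snd y"] by (auto simp: cube_sides_def)
      ultimately show ?thesis using g_chain[OF r(1)] r(2) by simp
    qed
    obtain H where H: "cont_from (?C \<times> unit_I) (Mor C) H"
      "\<And>y. y \<in> ?C \<times> unit_I \<Longrightarrow> tgt C (H y) = src C (M (p - k) (fst y, 1 - snd y))" "\<And>y. y \<in> cube_sides n \<Longrightarrow> H y = g r (fst y)"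
      by (rule serre_relative_lift[OF fib h e eh]) auto
    let ?M = "M(r := (\<lambda>y. H (fst y, 1 - snd y)))"
    have cH: "cont_from (?C \<times> unit_I) (Mor C) (\<lambda>y. H (fst y, 1 - snd y))" by (rule cont_from_reverse_time[OF H(1)])
    have H1: "H (z, 0) = g r z" if "z \<in> ?C" for z using H(3)[of "(z, 0)"] that by (simp add: cube_sides_def)
    have Hb: "H (a, s) = g r a" if "a \<in> ?b" "s \<in> unit_I" for a s using H(3)[of "(a, s)"] that by (simp add: cube_sides_def)
    have Ht: "tgt C (H (fst y, 1 - snd y)) = src C (M (Suc r) y)" if "y \<in> ?C \<times> unit_I" for y
      using H(2)[of "(fst y, 1 - snd y)"] that r(2) by auto
    show ?case
    proof (intro exI[of _ ?M] conjI allI impI ballI)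
      fix j assume j: "p - Suc k \<le> j \<and> j \<le> p"
      then have jr: "j = r \<or> p - k \<le> j" using r by auto
      show "cont_from (?C \<times> unit_I) (Mor C) (?M j)" using jr j cH M(1) by (cases "j = r") auto
      show "?M j (z, 1) = g j z" if "z \<in> ?C" for z using jr j H1[OF that] M(2)[OF _ _ that] by (cases "j = r") auto
      show "?M j (a, s) = g j a" if "a \<in> ?b" "s \<in> unit_I" for a s
        using jr j Hb[of a "1 - s"] M(3)[OF _ _ that] that by (cases "j = r") auto
    next
      show "?M p = K" using r(1) M(4) by simp
      fix j y assume j: "p - Suc k \<le> j \<and> j < p" and y: "y \<in> ?C \<times> unit_I"
      then have jr: "j = r \<or> p - k \<le> j" using r by auto
      show "tgt C (?M j y) = src C (?M (Suc j) y)"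
      proof (cases "j = r")
        case True
        then show ?thesis using Ht[OF y] by simp
      next
        case False
        then have pj: "p - k \<le> j" "Suc j \<noteq> r" using jr r by auto
        then show ?thesis using False M(5)[OF pj(1) _ y] j by simp
      qed
    qed
  qed
  from this[of p] obtain M where M0: "(\<forall>j. j \<le> p \<longrightarrow> cont_from (?C \<times> unit_I) (Mor C) (M j) \<and>
      (\<forall>z\<in>?C. M j (z, 1) = g j z) \<and> (\<forall>a\<in>?b. \<forall>s\<in>unit_I. M j (a, s) = g j a)) \<and> M p = K \<and>
      (\<forall>j. j < p \<longrightarrow> (\<forall>y\<in>?C \<times> unit_I. tgt C (M j y) = src C (M (Suc j) y)))"
    by auto
  have "\<And>j. j \<le> p \<Longrightarrow> cont_from (?C \<times> unit_I) (Mor C) (M j)" "M p = K"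
    "\<And>j z. j \<le> p \<Longrightarrow> z \<in> ?C \<Longrightarrow> M j (z, 1) = g j z"
    "\<And>j a s. j \<le> p \<Longrightarrow> a \<in> ?b \<Longrightarrow> s \<in> unit_I \<Longrightarrow> M j (a, s) = g j a"
    "\<And>j y. j < p \<Longrightarrow> y \<in> ?C \<times> unit_I \<Longrightarrow> tgt C (M j y) = src C (M (Suc j) y)"
    using M0 by blast+
  then show ?thesis by (rule that)
qed

definition chain :: "'o \<Rightarrow> nat \<Rightarrow> (nat \<Rightarrow> 'm) \<Rightarrow> (nat \<Rightarrow> 'o) \<times> (nat \<Rightarrow> 'm)" where
  "chain c p f = (\<lambda>j\<in>{..Suc p}. if j = Suc p then c else src C (f j), \<lambda>j\<in>{..<Suc p}. f j)"

lemma chain_in: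
  assumes "\<And>j. j \<le> p \<Longrightarrow> f j \<in> topspace (Mor C)" "\<And>j. j < p \<Longrightarrow> tgt C (f j) = src C (f (Suc j))" "tgt C (f p) = c"
  shows "chain c p f \<in> topspace (over_nerve C c p)"
proof -
  have "c \<in> topspace (Obj C)" using tgt_in[OF assms(1)[of p]] assms(3) by simp
  then show ?thesis
    unfolding over_nerve_iff topspace_nerve using assms src_in by (auto simp: chain_def less_Suc_eq PiE_def Pi_def le_Suc_eq)
qed

lemma chain_snd: "j \<le> p \<Longrightarrow> snd (chain c p f) j = f j"
  by (simp add: chain_def)

lemma continuous_map_chain:
  assumes Z: "cg_space Z" and f: "\<And>j. j \<le> p \<Longrightarrow> continuous_map Z (Mor C) (f j)"
    and ch: "\<And>j z. j < p \<Longrightarrow> z \<in> topspace Z \<Longrightarrow> tgt C (f j z) = src C (f (Suc j) z)" "\<And>z. z \<in> topspace Z \<Longrightarrow> tgt C (f p z) = c"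
  shows "continuous_map Z (over_nerve C c p) (\<lambda>z. chain c p (\<lambda>j. f j z))"
proof (cases "topspace Z = {}")
  case True
  then show ?thesis by (simp add: continuous_map_def)
next
  case False
  have fin: "f j z \<in> topspace (Mor C)" if "j \<le> p" "z \<in> topspace Z" for j z
    using f[OF that(1)] that(2) by (auto simp: continuous_map_def)
  have cin: "chain c p (\<lambda>j. f j z) \<in> topspace (over_nerve C c p)" if "z \<in> topspace Z" for z
    by (rule chain_in) (use fin ch that in auto)
  obtain z0 where "z0 \<in> topspace Z" using False by blast
  then have c: "c \<in> topspace (Obj C)" using tgt_in[OF fin[of p z0]] ch(2)[of z0] by simp
  show ?thesis
  proof (intro continuous_map_to_over Z continuous_map_to_nerve)
    show "continuous_map Z (Obj C) (\<lambda>z. fst (chain c p (\<lambda>j. f j z)) i)" if "i \<le> Suc p" for i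
      using that c continuous_map_compose[OF f src_continuous, of i]
      by (cases "i = Suc p") (simp_all add: chain_def o_def)
    show "continuous_map Z (Mor C) (\<lambda>z. snd (chain c p (\<lambda>j. f j z)) i)" if "i < Suc p" for i
      using that f[of i] by (simp add: chain_def)
  qed (use cin in \<open>auto simp: over_nerve_iff\<close>)
qed

text \<open>The weak equivalence \<open>w\<close> compresses the last morphism inside the fibres of
  the target map, and \<open>chain_lift\<close> drags the earlier morphisms along. At time 0 these
  end at the source of \<open>m\<close> composed with the lift, which is the source of the lift
  itself, so together they form a chain upstairs.\<close>

lemma over_nerve_compressible:
  assumes fib: "right_fibrant C" and m: "m \<in> topspace (Mor C)"
    and w: "weak_homotopy_equivalence (tgt_fibre C (src C m)) (tgt_fibre C (tgt C m)) (\<lambda>f. cmp C m f)"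
  shows "compressible (over_nerve C (src C m) p) (over_nerve C (tgt C m) p) (post_mor C m p)"
proof -
  interpret P: semi_simplicial_map "over_nerve C (src C m)" "\<lambda>p i. nerve_face C (Suc p) i" "over_nerve C (tgt C m)" "\<lambda>p i. nerve_face C (Suc p) i" "post_mor C m"
    by (rule post_mor_map[OF m])
  show ?thesis
    unfolding compressible_def
  proof (intro conjI allI impI P.map_continuous)
    fix n f g
    let ?C = "unit_cube n" and ?b = "cube_boundary n"
    let ?X = "over_nerve C (src C m) p" and ?Y = "over_nerve C (tgt C m) p"
    assume "cont_from ?b ?X f \<and> cont_from ?C ?Y g \<and> (\<forall>a\<in>?b. post_mor C m p (f a) = g a)"
    then have f: "cont_from ?b ?X f" and g: "cont_from ?C ?Y g" and fg: "\<And>a. a \<in> ?b \<Longrightarrow> post_mor C m p (f a) = g a" by auto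
    have bC: "?b \<subseteq> ?C" by (rule cube_boundary_subset)
    have fX: "f a \<in> topspace ?X" if "a \<in> ?b" for a using cont_from_in[OF f that] .
    have gY: "g z \<in> topspace ?Y" if "z \<in> ?C" for z using cont_from_in[OF g that] .
    have fN: "f a \<in> topspace (nerve C (Suc p))" "fst (f a) (Suc p) = src C m" if "a \<in> ?b" for a using fX[OF that] by (auto simp: over_nerve_iff)
    have gN: "g z \<in> topspace (nerve C (Suc p))" "fst (g z) (Suc p) = tgt C m" if "z \<in> ?C" for z using gY[OF that] by (auto simp: over_nerve_iff)
    have gj: "cont_from ?C (Mor C) (\<lambda>z. snd (g z) j)" if "j \<le> p" for j
      using continuous_map_compose[OF g continuous_map_from_over_under(1)[OF continuous_map_nerve_mor]] that by (simp add: o_def)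
    have fj: "cont_from ?b (Mor C) (\<lambda>z. snd (f z) p)"
      using continuous_map_compose[OF f continuous_map_from_over_under(1)[OF continuous_map_nerve_mor, of p]] by (simp add: o_def)
    \<comment> \<open>Fibres carry the compactly generated subspace topology, but on a compact
      source continuity into \<open>Mor C\<close> suffices.\<close>
    have into_fibre: "cont_from A (tgt_fibre C c) k" if "compact A" "cont_from A (Mor C) k" "\<And>z. z \<in> A \<Longrightarrow> tgt C (k z) = c" for A :: "(nat \<Rightarrow> real) set" and c k
      unfolding tgt_fibre_def
      by (intro continuous_map_cg_subspace cg_space_compact_Hausdorff) (use that in \<open>auto simp: compact_space_subtopology Hausdorff_space_subtopology\<close>)
    have "closedin (top_of_set ?C) ?b" by (rule closed_cube_boundary)
    then have cb: "compact ?b" using compact_unit_cube closedin_compact by blast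
    have f0: "cont_from ?b (tgt_fibre C (src C m)) (\<lambda>a. snd (f a) p)"
      by (rule into_fibre[OF cb fj]) (use nerve_tgtD[OF fN(1), of _ p] fN(2) in auto)
    have g0: "cont_from ?C (tgt_fibre C (tgt C m)) (\<lambda>a. snd (g a) p)"
      by (rule into_fibre[OF compact_unit_cube gj]) (use nerve_tgtD[OF gN(1), of _ p] gN(2) in auto)
    have "cmp C m (snd (f a) p) = snd (g a) p" if "a \<in> ?b" for a
      using post_mor_snd(2)[of C m p "f a"] fg[OF that] by simp
    then have "solves ?C ?b (tgt_fibre C (src C m)) (tgt_fibre C (tgt C m)) (\<lambda>f. cmp C m f) (\<lambda>a. snd (f a) p) (\<lambda>a. snd (g a) p)"
      using weak_homotopy_equivalence_compressible[OF w] f0 g0 unfolding compressible_def by blast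
    then obtain L K where L: "cont_from ?C (tgt_fibre C (src C m)) L" "\<And>a. a \<in> ?b \<Longrightarrow> L a = snd (f a) p"
      and K: "cont_from (?C \<times> unit_I) (tgt_fibre C (tgt C m)) K" "\<And>z. z \<in> ?C \<Longrightarrow> K (z, 0) = cmp C m (L z)" "\<And>z. z \<in> ?C \<Longrightarrow> K (z, 1) = snd (g z) p"
        "\<And>a s. a \<in> ?b \<Longrightarrow> s \<in> unit_I \<Longrightarrow> K (a, s) = snd (g a) p"
      unfolding solves_def by auto
    have fibre_id: "continuous_map (tgt_fibre C c) (Mor C) (\<lambda>x. x)" for c
      unfolding tgt_fibre_def using continuous_map_id[of "Mor C"] by (intro continuous_map_from_cg_subspace) (simp add: id_def)
    have LM: "cont_from ?C (Mor C) L" and KM: "cont_from (?C \<times> unit_I) (Mor C) K"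
      using continuous_map_compose[OF L(1) fibre_id] continuous_map_compose[OF K(1) fibre_id] by (auto simp: o_def)
    have Lt: "L z \<in> topspace (Mor C)" "tgt C (L z) = src C m" if "z \<in> ?C" for z
      using cont_from_in[OF L(1) that] by (auto simp: tgt_fibre_def)
    have Kt: "tgt C (K y) = tgt C m" if "y \<in> ?C \<times> unit_I" for y
      using cont_from_in[OF K(1) that] by (auto simp: tgt_fibre_def)
    obtain M where M: "\<And>j. j \<le> p \<Longrightarrow> cont_from (?C \<times> unit_I) (Mor C) (M j)" "M p = K"
      "\<And>j z. j \<le> p \<Longrightarrow> z \<in> ?C \<Longrightarrow> M j (z, 1) = snd (g z) j"
      "\<And>j a s. j \<le> p \<Longrightarrow> a \<in> ?b \<Longrightarrow> s \<in> unit_I \<Longrightarrow> M j (a, s) = snd (g a) j"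
      "\<And>j y. j < p \<Longrightarrow> y \<in> ?C \<times> unit_I \<Longrightarrow> tgt C (M j y) = src C (M (Suc j) y)"
    proof (rule chain_lift[where p = p and n = n and g = "\<lambda>j z. snd (g z) j" and K = K])
      show "serre_fibration (Mor C) (Obj C) (tgt C)" using fib by (simp add: right_fibrant_def)
      show "cont_from ?C (Mor C) (\<lambda>z. snd (g z) j)" if "j < p" for j using gj that by simp
      show "tgt C (snd (g z) j) = src C (snd (g z) (Suc j))" if "j < p" "z \<in> ?C" for j z
        using nerve_tgtD[OF gN(1)[OF that(2)], of j] nerve_srcD[OF gN(1)[OF that(2)], of "Suc j"] that(1) by simp
    qed (use KM K in auto)
    \<comment> \<open>The chain upstairs: the compressed morphism \<open>L\<close> in the last
      place, the lifted morphisms at time 0 before it.\<close>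
    define N where "N j z = (if j = p then L z else M j (z, 0))" for j z
    have Nc: "cont_from ?C (Mor C) (N j)" if "j \<le> p" for j
      unfolding N_def using that LM cont_from_slice[OF M(1)[OF that], of 0] by (cases "j = p") auto
    have srcK: "src C (K (z, 0)) = src C (L z)" if "z \<in> ?C" for z
      using K(2)[OF that] src_cmp[OF Lt(1)[OF that] m Lt(2)[OF that]] by simp
    have Nt: "tgt C (N j z) = src C (N (Suc j) z)" if "j < p" "z \<in> ?C" for j z
      using M(5)[OF that(1), of "(z, 0)"] that M(2) srcK[OF that(2)] by (cases "Suc j = p") (auto simp: N_def)
    let ?L = "\<lambda>z. chain (src C m) p (\<lambda>j. N j z)" and ?H = "\<lambda>y. chain (tgt C m) p (\<lambda>j. M j y)"
    have L': "cont_from ?C ?X ?L"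
      by (rule continuous_map_chain[OF cg_space_cube(1) Nc]) (use Nt Lt in \<open>auto simp: N_def\<close>)
    have H': "cont_from (?C \<times> unit_I) ?Y ?H"
    proof (rule continuous_map_chain[OF cg_space_cube(2) M(1)])
      show "tgt C (M j z) = src C (M (Suc j) z)" if "j < p" "z \<in> topspace (top_of_set (?C \<times> unit_I))" for j z
        by (rule M(5)) (use that in simp_all)
      show "tgt C (M p z) = tgt C m" if "z \<in> topspace (top_of_set (?C \<times> unit_I))" for z
        unfolding M(2) by (rule Kt) (use that in simp)
    qed
    show "solves ?C ?b ?X ?Y (post_mor C m p) f g"
      unfolding solves_def
    proof (intro exI[of _ ?L] exI[of _ ?H] conjI ballI L' H')
      show "?L a = f a" if a: "a \<in> ?b" for a
      proof (rule over_nerve_eqI[OF _ fX[OF a]])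
        show "?L a \<in> topspace ?X" using cont_from_in[OF L'] a bC by blast
        show "snd (?L a) i = snd (f a) i" if "i < Suc p" for i
          using that L(2)[OF a] M(4)[of i a 0] a post_mor_snd(1)[of i p C m "f a"] fg[OF a]
          by (cases "i = p") (auto simp: chain_snd N_def)
      qed
      show "?H (z, 0) = post_mor C m p (?L z)" if z: "z \<in> ?C" for z
      proof (rule over_nerve_eqI)
        show "?H (z, 0) \<in> topspace ?Y" using cont_from_in[OF H'] z by auto
        show "post_mor C m p (?L z) \<in> topspace ?Y" using P.map_in[OF cont_from_in[OF L' z]] .
        show "snd (?H (z, 0)) i = snd (post_mor C m p (?L z)) i" if "i < Suc p" for i
          using that K(2)[OF z] M(2) by (cases "i = p") (auto simp: chain_snd N_def post_mor_snd)
      qed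
      show "?H (z, 1) = g z" if z: "z \<in> ?C" for z
      proof (rule over_nerve_eqI[OF _ gY[OF z]])
        show "?H (z, 1) \<in> topspace ?Y" using cont_from_in[OF H'] z by auto
        show "snd (?H (z, 1)) i = snd (g z) i" if "i < Suc p" for i
          using that M(3)[of i z] z by (simp add: chain_snd)
      qed
      show "?H (a, s) = g a" if a: "a \<in> ?b" and s: "s \<in> unit_I" for a s
      proof (rule over_nerve_eqI)
        show "?H (a, s) \<in> topspace ?Y" using cont_from_in[OF H'] a s bC by auto
        show "g a \<in> topspace ?Y" using gY a bC by blast
        show "snd (?H (a, s)) i = snd (g a) i" if "i < Suc p" for i
          using that M(4)[of i a s] a s by (simp add: chain_snd)
      qed
    qed
  qed
qed

text \<open>The cone point is the unit \<open>m\<close> itself, seen as an object over its target: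
  appending \<open>m\<close> to a chain over its source adds this object as last vertex.\<close>

lemma over_cube_extension:
  assumes fib: "right_fibrant C" and unit: "weak_left_units C" and c: "c \<in> topspace (Obj C)"
  shows "cube_extension (B_over C c)"
proof -
  obtain m where m: "m \<in> topspace (Mor C)" "src C m = c"
    and w: "weak_homotopy_equivalence (tgt_fibre C c) (tgt_fibre C (tgt C m)) (\<lambda>f. cmp C m f)"
    using unit c unfolding weak_left_units_def by blast
  interpret P: semi_simplicial_map "over_nerve C (src C m)" "\<lambda>p i. nerve_face C (Suc p) i" "over_nerve C (tgt C m)" "\<lambda>p i. nerve_face C (Suc p) i" "post_mor C m"
    by (rule post_mor_map[OF m(1)])
  have "cube_extension (realisation (over_nerve C (src C m)) (\<lambda>p i. nerve_face C (Suc p) i))"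
  proof (rule P.cone_cube_extension[where k = "append_mor C m" and v = "chain (tgt C m) 0 (\<lambda>_. m)"])
    show "compressible (over_nerve C (src C m) p) (over_nerve C (tgt C m) p) (post_mor C m p)" for p
      by (rule over_nerve_compressible[OF fib m(1)]) (use w m in simp)
    show "continuous_map (over_nerve C (src C m) p) (over_nerve C (tgt C m) (Suc p)) (append_mor C m p)" for p
      by (rule continuous_map_append_mor[OF m(1)])
    show v: "chain (tgt C m) 0 (\<lambda>_. m) \<in> topspace (over_nerve C (tgt C m) 0)"
      by (rule chain_in) (use m in auto)
    show "nerve_face C (Suc (Suc 0)) 0 (append_mor C m 0 x) = chain (tgt C m) 0 (\<lambda>_. m)"
      if x: "x \<in> topspace (over_nerve C (src C m) 0)" for x
    proof (rule over_nerve_eqI[OF _ v])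
      show "nerve_face C (Suc (Suc 0)) 0 (append_mor C m 0 x) \<in> topspace (over_nerve C (tgt C m) 0)"
        using P.cod.face_in[OF append_mor_in[OF m(1) x], of 0] by simp
    qed (auto simp: nerve_face_snd append_mor_def chain_snd)
  qed (use append_mor_face[OF m(1)] in \<open>simp_all add: post_mor_def\<close>)
  then show ?thesis using m(2) by (simp add: B_over_def)
qed

lemma weak_left_imp_soft_left:
  assumes "weak_left_units C" "right_fibrant C"
  shows "soft_left_units C"
  unfolding soft_left_units_def
  by (intro ballI cube_extension_imp_weakly_contractible over_cube_extension assms)

end

section \<open>Duality: the opposite category and reversed simplices\<close>

definition op_cat :: "('o, 'm) top_cat \<Rightarrow> ('o, 'm) top_cat" where
  "op_cat C = \<lparr>Obj = Obj C, Mor = Mor C, src = tgt C, tgt = src C, cmp = (\<lambda>g f. cmp C f g)\<rparr>"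

lemma op_cat_simps [simp]: "Obj (op_cat C) = Obj C" "Mor (op_cat C) = Mor C" "src (op_cat C) = tgt C" "tgt (op_cat C) = src C"
  "cmp (op_cat C) g f = cmp C f g"
  by (simp_all add: op_cat_def)

lemma op_cat_units_fibrant:
  "weak_right_units C \<Longrightarrow> weak_left_units (op_cat C)" "left_fibrant C \<Longrightarrow> right_fibrant (op_cat C)"
  by (simp_all add: weak_right_units_def weak_left_units_def tgt_fibre_def src_fibre_def left_fibrant_def right_fibrant_def)

lemma op_cat_nonunital:
  assumes "nonunital_top_cat C" shows "nonunital_top_cat (op_cat C)"
proof -
  interpret nonunital_category C by standard (rule assms)
  let ?Z = "cg_subspace (cg_prod (Mor C) (Mor C)) {(f, g). src C f = tgt C g}"
  have "continuous_map ?Z (Mor C) (\<lambda>z. cmp C (fst z) (snd z))"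
  proof (rule continuous_map_cmp[OF cg_space_cg_subspace])
    show "continuous_map ?Z (Mor C) snd" "continuous_map ?Z (Mor C) fst"
      by (intro continuous_map_from_cg_subspace, simp add: cg_prod_def continuous_map_from_cg continuous_map_fst continuous_map_snd)+
  qed auto
  then show ?thesis
    unfolding nonunital_top_cat_def
    using assms src_cmp tgt_cmp cmp_assoc by (auto simp: nonunital_top_cat_def split_def)
qed

definition reverse_chain :: "nat \<Rightarrow> (nat \<Rightarrow> 'o) \<times> (nat \<Rightarrow> 'm) \<Rightarrow> (nat \<Rightarrow> 'o) \<times> (nat \<Rightarrow> 'm)" where
  "reverse_chain p x = (\<lambda>j\<in>{..Suc p}. fst x (Suc p - j), \<lambda>j\<in>{..<Suc p}. snd x (p - j))"

lemma reverse_chain_in: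
  assumes x: "x \<in> topspace (nerve C (Suc p))"
  shows "reverse_chain p x \<in> topspace (nerve (op_cat C) (Suc p))"
proof -
  note D = nerve_objD[OF x] nerve_morD[OF x] nerve_srcD[OF x] nerve_tgtD[OF x]
  have "tgt C (snd x (p - i)) = fst x (Suc p - i)" "src C (snd x (p - i)) = fst x (Suc p - Suc i)" if "i < Suc p" for i
    using that D(3)[of "p - i"] D(4)[of "p - i"] by (simp_all add: Suc_diff_le)
  then show ?thesis
    unfolding topspace_nerve using D by (auto simp: reverse_chain_def PiE_def Pi_def)
qed

lemma continuous_map_reverse_chain: "continuous_map (nerve C (Suc p)) (nerve (op_cat C) (Suc p)) (reverse_chain p)"
proof (rule continuous_map_to_nerve[OF cg_space_nerve])
  show "continuous_map (nerve C (Suc p)) (Obj (op_cat C)) (\<lambda>z. fst (reverse_chain p z) i)" if "i \<le> Suc p" for i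
    using that continuous_map_nerve_obj[of "Suc p - i" "Suc p" C] by (simp add: reverse_chain_def)
  show "continuous_map (nerve C (Suc p)) (Mor (op_cat C)) (\<lambda>z. snd (reverse_chain p z) i)" if "i < Suc p" for i
    using that continuous_map_nerve_mor[of "p - i" "Suc p" C] by (simp add: reverse_chain_def)
qed (rule reverse_chain_in)

lemma reverse_chain_involution:
  assumes x: "x \<in> topspace (nerve C (Suc p))"
  shows "reverse_chain p (reverse_chain p x) = x"
proof (rule nerve_eqI[OF _ x])
  have "op_cat (op_cat C) = C" by (simp add: op_cat_def)
  then show "reverse_chain p (reverse_chain p x) \<in> topspace (nerve C (Suc p))"
    using reverse_chain_in[OF reverse_chain_in[OF x]] by simp
qed (auto simp: reverse_chain_def)

text \<open>In a chain with vertices from 0 to \<open>Suc (Suc p)\<close>, reversal sends vertex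
  \<open>Suc i\<close> to vertex \<open>Suc p - i\<close>.\<close>

lemma reverse_chain_face:
  assumes cat: "nonunital_top_cat C" and x: "x \<in> topspace (nerve C (Suc (Suc p)))" and i: "i \<le> Suc p"
  shows "reverse_chain p (nerve_face C (Suc (Suc p)) (Suc i) x) = nerve_face (op_cat C) (Suc (Suc p)) (Suc p - i) (reverse_chain (Suc p) x)"
proof (rule nerve_eqI)
  interpret nonunital_category C by standard (rule cat)
  interpret op: nonunital_category "op_cat C" by standard (rule op_cat_nonunital[OF cat])
  show "reverse_chain p (nerve_face C (Suc (Suc p)) (Suc i) x) \<in> topspace (nerve (op_cat C) (Suc p))"
    using i by (intro reverse_chain_in nerve_face_in x) simp
  show "nerve_face (op_cat C) (Suc (Suc p)) (Suc p - i) (reverse_chain (Suc p) x) \<in> topspace (nerve (op_cat C) (Suc p))"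
    by (intro op.nerve_face_in reverse_chain_in x) simp
  show "fst (reverse_chain p (nerve_face C (Suc (Suc p)) (Suc i) x)) j = fst (nerve_face (op_cat C) (Suc (Suc p)) (Suc p - i) (reverse_chain (Suc p) x)) j"
    if "j \<le> Suc p" for j
    using that i by (auto simp: nerve_face_fst reverse_chain_def Suc_diff_le)
  show "snd (reverse_chain p (nerve_face C (Suc (Suc p)) (Suc i) x)) j = snd (nerve_face (op_cat C) (Suc (Suc p)) (Suc p - i) (reverse_chain (Suc p) x)) j"
    if j: "j < Suc p" for j
  proof -
    consider "Suc j < Suc p - i" | "Suc j = Suc p - i" | "Suc p - i < Suc j" by linarith
    then show ?thesis
    proof cases
      case 1
      then have "i < p - j" "j < p" by auto
      then show ?thesis using 1 j i by (simp add: nerve_face_snd reverse_chain_def Suc_diff_le)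
    next
      case 2
      then have "p - j = i" using j i by auto
      then show ?thesis using 2 j i by (simp add: nerve_face_snd reverse_chain_def Suc_diff_le)
    next
      case 3
      then have "p - j < i" using j i by auto
      then show ?thesis using 3 j i by (simp add: nerve_face_snd reverse_chain_def Suc_diff_le)
    qed
  qed
qed

definition reverse_coord :: "nat \<Rightarrow> (nat \<Rightarrow> real) \<Rightarrow> nat \<Rightarrow> real" where
  "reverse_coord p t = (\<lambda>j. if j \<le> p then t (p - j) else 0)"

lemma reverse_coord_simplex:
  assumes "t \<in> standard_simplex p" shows "reverse_coord p t \<in> standard_simplex p"
proof (rule standard_simplexI)
  have "(\<Sum>i\<le>p. reverse_coord p t i) = (\<Sum>i\<le>p. t (p - i))" by (rule sum.cong) (auto simp: reverse_coord_def)
  also have "\<dots> = (\<Sum>i\<le>p. t i)" by (rule sum.reindex_bij_witness[of _ "\<lambda>i. p - i" "\<lambda>i. p - i"]) auto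
  finally show "(\<Sum>i\<le>p. reverse_coord p t i) = 1" using standard_simplexD(3)[OF assms] by simp
qed (use standard_simplexD[OF assms] in \<open>auto simp: reverse_coord_def\<close>)

lemma reverse_coord_involution: "t \<in> standard_simplex p \<Longrightarrow> reverse_coord p (reverse_coord p t) = t"
  using standard_simplexD(2)[of t p] by (auto simp: reverse_coord_def fun_eq_iff)

lemma reverse_coord_face:
  assumes "t \<in> standard_simplex p" "i \<le> Suc p"
  shows "reverse_coord (Suc p) (simplical_face i t) = simplical_face (Suc p - i) (reverse_coord p t)"
proof
  fix j
  consider "j < Suc p - i" | "j = Suc p - i" | "Suc p - i < j" "j \<le> Suc p" | "Suc p < j" by linarith
  then show "reverse_coord (Suc p) (simplical_face i t) j = simplical_face (Suc p - i) (reverse_coord p t) j"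
    using assms(2)
  proof cases
    case 1
    then have "\<not> Suc p - j < i" "Suc p - j \<noteq> i" "Suc p - j - 1 = p - j" "j \<le> p" using assms(2) by auto
    then show ?thesis using 1 by (simp add: reverse_coord_def simplical_face_def)
  next
    case 2
    then have "Suc p - j = i" using assms(2) by auto
    then show ?thesis using 2 by (simp add: reverse_coord_def simplical_face_def)
  next
    case 3
    then have "Suc p - j < i" "p - (j - 1) = Suc p - j" "j - 1 \<le> p" by auto
    then show ?thesis using 3 by (simp add: reverse_coord_def simplical_face_def)
  next
    case 4
    then show ?thesis by (simp add: reverse_coord_def simplical_face_def)
  qed
qed

lemma continuous_map_reverse_coord:
  "continuous_map (prod_topology (simplex_topology p) (top_of_set unit_I)) (simplex_topology p) (\<lambda>y. reverse_coord p (fst y))"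
proof (rule continuous_map_to_simplex)
  fix i
  have "continuous_map (prod_topology (simplex_topology p) (top_of_set unit_I)) euclideanreal (\<lambda>y. fst y (p - i))"
    using continuous_map_compose[OF continuous_map_fst continuous_map_coordinate] by (simp add: o_def)
  then show "continuous_map (prod_topology (simplex_topology p) (top_of_set unit_I)) euclideanreal (\<lambda>y. reverse_coord p (fst y) i)"
    by (cases "i \<le> p") (simp_all add: reverse_coord_def)
qed (use reverse_coord_simplex in auto)

text \<open>Reversal turns the face \<open>i\<close> into the face \<open>Suc p - i\<close>, so it
  is not a semi-simplicial map; it acts on realisations once the weights are reversed too.\<close>

lemma reversal_realisation_map:
  assumes X: "semi_simplicial X dX" and Y: "semi_simplicial Y dY"
    and r: "\<And>p. continuous_map (X p) (Y p) (r p)"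
    and rf: "\<And>p i x. x \<in> topspace (X (Suc p)) \<Longrightarrow> i \<le> Suc p \<Longrightarrow> r p (dX (Suc p) i x) = dY (Suc p) (Suc p - i) (r (Suc p) x)"
  obtains R where "continuous_map (realisation X dX) (realisation Y dY) R"
    "\<And>p x t. x \<in> topspace (X p) \<Longrightarrow> t \<in> standard_simplex p \<Longrightarrow> R (cell_class X dX (p, x, t)) = cell_class Y dY (p, r p x, reverse_coord p t)"
proof -
  interpret X: semi_simplicial X dX by (rule X)
  have rin: "r p x \<in> topspace (Y p)" if "x \<in> topspace (X p)" for p x using r[of p] that by (auto simp: continuous_map_def)
  obtain R where R: "continuous_map (prod_topology (subtopology (realisation X dX) (topspace (realisation X dX))) (top_of_set unit_I)) (realisation Y dY) R"
    "\<And>p x t s. x \<in> topspace (X p) \<Longrightarrow> t \<in> standard_simplex p \<Longrightarrow> cell_class X dX (p, x, t) \<in> topspace (realisation X dX) \<Longrightarrow>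
       s \<in> unit_I \<Longrightarrow> R (cell_class X dX (p, x, t), s) = cell_class Y dY (p, r p x, reverse_coord p t)"
  proof (rule X.realisation_descend[OF openin_topspace, of "\<lambda>p x t s. cell_class Y dY (p, r p x, reverse_coord p t)" "realisation Y dY"])
    fix p x i t and s :: real assume x: "x \<in> topspace (X (Suc p))" "i \<le> Suc p" "t \<in> standard_simplex p"
    then show "cell_class Y dY (Suc p, r (Suc p) x, reverse_coord (Suc p) (simplical_face i t)) = cell_class Y dY (p, r p (dX (Suc p) i x), reverse_coord p t)"
      using cell_class_face[where X = Y, OF rin[OF x(1)], of "Suc p - i" "reverse_coord p t" dY] reverse_coord_simplex[OF x(3)] by (simp add: reverse_coord_face rf)
  next
    fix p x t assume t: "t \<in> standard_simplex p"
    from continuous_map_cell_homotopy[where X = X and X' = Y and d' = dY and q = p, OF r[of p] continuous_map_reverse_coord]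
    show "\<exists>U \<Psi>. openin (simplex_topology p) U \<and> t \<in> U \<and>
       continuous_map (prod_topology (simplices X p) (top_of_set unit_I)) (realisation Y dY) \<Psi> \<and>
       (\<forall>x t s. x \<in> topspace (X p) \<longrightarrow> t \<in> U \<longrightarrow> cell_class X dX (p, x, t) \<in> topspace (realisation X dX) \<longrightarrow> s \<in> unit_I \<longrightarrow>
          cell_class Y dY (p, r p x, reverse_coord p t) = \<Psi> ((x, t), s))"
      using t by (intro exI[of _ "standard_simplex p"] exI conjI) (use openin_topspace[of "simplex_topology p"] in auto)
  qed blast
  have "continuous_map (realisation X dX) (prod_topology (realisation X dX) (top_of_set unit_I)) (\<lambda>z. (z, 0))"
    using continuous_map_id[of "realisation X dX"] by (simp add: continuous_map_paired id_def)
  from continuous_map_compose[OF this R(1)[unfolded subtopology_topspace]]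
  have "continuous_map (realisation X dX) (realisation Y dY) (\<lambda>z. R (z, 0))" by (simp add: o_def)
  then show ?thesis
  proof (rule that)
    fix p x t assume "x \<in> topspace (X p)" "t \<in> standard_simplex p"
    then show "R (cell_class X dX (p, x, t), 0) = cell_class Y dY (p, r p x, reverse_coord p t)"
      using R(2)[of x p t 0] cell_class_in[of x X p t dX] by simp
  qed
qed

text \<open>Reversal in both directions exhibits the realisation for \<open>C\<close> as a retract
  of the one for the opposite category, and extending maps from boundaries passes to
  retracts.\<close>

lemma B_under_cube_extension:
  assumes cat: "nonunital_top_cat C" and ext: "cube_extension (B_over (op_cat C) c)"
  shows "cube_extension (B_under C c)"
proof -
  interpret nonunital_category C by standard (rule cat)
  interpret op: nonunital_category "op_cat C" by standard (rule op_cat_nonunital[OF cat])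
  have opop: "op_cat (op_cat C) = C" by (simp add: op_cat_def)
  let ?X = "under_nerve C c" and ?Y = "over_nerve (op_cat C) c"
  let ?dX = "\<lambda>p i. nerve_face C (Suc p) (Suc i)" and ?dY = "\<lambda>p i. nerve_face (op_cat C) (Suc p) i"
  have r: "continuous_map (?X p) (?Y p) (reverse_chain p)" for p
    by (intro continuous_map_to_over cg_space_over_under continuous_map_from_over_under continuous_map_reverse_chain)
       (auto simp: reverse_chain_def under_nerve_iff)
  have r': "continuous_map (?Y p) (?X p) (reverse_chain p)" for p
    using continuous_map_reverse_chain[of "op_cat C" p, unfolded opop]
    by (intro continuous_map_to_under cg_space_over_under continuous_map_from_over_under)
       (auto simp: reverse_chain_def over_nerve_iff)
  have rf: "reverse_chain p (?dX (Suc p) i x) = ?dY (Suc p) (Suc p - i) (reverse_chain (Suc p) x)"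
    if "x \<in> topspace (?X (Suc p))" "i \<le> Suc p" for p i x
    using reverse_chain_face[OF cat _ that(2)] that(1) by (simp add: under_nerve_iff)
  \<comment> \<open>Reversal is an involution, so this is \<open>rf\<close> at the reversed simplex,
    with reversal applied to both sides.\<close>
  have rf': "reverse_chain p (?dY (Suc p) i y) = ?dX (Suc p) (Suc p - i) (reverse_chain (Suc p) y)"
    if y: "y \<in> topspace (?Y (Suc p))" and i: "i \<le> Suc p" for p i y
  proof -
    have yn: "y \<in> topspace (nerve (op_cat C) (Suc (Suc p)))" using y by (simp add: over_nerve_iff)
    have xX: "reverse_chain (Suc p) y \<in> topspace (?X (Suc p))" using r'[of "Suc p"] y by (auto simp: continuous_map_def)
    have eq: "reverse_chain p (?dX (Suc p) (Suc p - i) (reverse_chain (Suc p) y)) = ?dY (Suc p) i y"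
      using rf[OF xX, of "Suc p - i"] i reverse_chain_involution[OF yn] by simp
    have "?dX (Suc p) (Suc p - i) (reverse_chain (Suc p) y) \<in> topspace (nerve C (Suc p))"
      using xX by (intro nerve_face_in) (auto simp: under_nerve_iff)
    from reverse_chain_involution[OF this] show ?thesis unfolding eq .
  qed
  obtain R where R: "continuous_map (realisation ?X ?dX) (realisation ?Y ?dY) R"
    "\<And>p x t. x \<in> topspace (?X p) \<Longrightarrow> t \<in> standard_simplex p \<Longrightarrow> R (cell_class ?X ?dX (p, x, t)) = cell_class ?Y ?dY (p, reverse_chain p x, reverse_coord p t)"
  proof (rule reversal_realisation_map[where X = ?X and dX = ?dX and Y = ?Y and dY = ?dY and r = reverse_chain,
        OF under_nerve_semi_simplicial op.over_nerve_semi_simplicial r])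
    show "reverse_chain p (?dX (Suc p) i x) = ?dY (Suc p) (Suc p - i) (reverse_chain (Suc p) x)"
      if "x \<in> topspace (?X (Suc p))" "i \<le> Suc p" for p i x by (rule rf[OF that])
  qed (rule that)
  obtain R' where R': "continuous_map (realisation ?Y ?dY) (realisation ?X ?dX) R'"
    "\<And>p x t. x \<in> topspace (?Y p) \<Longrightarrow> t \<in> standard_simplex p \<Longrightarrow> R' (cell_class ?Y ?dY (p, x, t)) = cell_class ?X ?dX (p, reverse_chain p x, reverse_coord p t)"
  proof (rule reversal_realisation_map[where X = ?Y and dX = ?dY and Y = ?X and dY = ?dX and r = reverse_chain,
        OF op.over_nerve_semi_simplicial under_nerve_semi_simplicial r'])
    show "reverse_chain p (?dY (Suc p) i y) = ?dX (Suc p) (Suc p - i) (reverse_chain (Suc p) y)"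
      if "y \<in> topspace (?Y (Suc p))" "i \<le> Suc p" for p i y by (rule rf'[OF that])
  qed (rule that)
  have "R' (R z) = z" if z: "z \<in> topspace (realisation ?X ?dX)" for z
  proof -
    obtain p x t where zz: "x \<in> topspace (?X p)" "t \<in> standard_simplex p" "z = cell_class ?X ?dX (p, x, t)"
      using realisation_cases[OF z] by blast
    have "reverse_chain p x \<in> topspace (?Y p)" using r[of p] zz(1) by (auto simp: continuous_map_def)
    moreover have "reverse_chain p (reverse_chain p x) = x"
      using zz(1) by (intro reverse_chain_involution) (auto simp: under_nerve_iff)
    ultimately show ?thesis
      using R(2)[OF zz(1,2)] R'(2)[of "reverse_chain p x" p "reverse_coord p t"] reverse_coord_simplex[OF zz(2)] reverse_coord_involution[OF zz(2)]
      by (simp add: zz(3))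
  qed
  then show ?thesis
    unfolding B_under_def by (rule cube_extension_retract[OF ext[unfolded B_over_def] R(1) R'(1)])
qed

theorem lemma3p13:
  fixes C :: "('o, 'm) top_cat"
  assumes "nonunital_top_cat C"
  shows "(weak_left_units C \<and> right_fibrant C \<longrightarrow> soft_left_units C) \<and>
         (weak_right_units C \<and> left_fibrant C \<longrightarrow> soft_right_units C)"
proof (intro conjI impI; elim conjE)
  interpret nonunital_category C by standard (rule assms)
  interpret op: nonunital_category "op_cat C" by standard (rule op_cat_nonunital[OF assms])
  show "soft_left_units C" if "weak_left_units C" "right_fibrant C"
    by (rule weak_left_imp_soft_left[OF that])
  show "soft_right_units C" if "weak_right_units C" "left_fibrant C"
    unfolding soft_right_units_def
  proof
    fix c assume c: "c \<in> topspace (Obj C)"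
    have "cube_extension (B_over (op_cat C) c)"
      by (rule op.over_cube_extension[OF op_cat_units_fibrant(2,1)]) (use that c in simp_all)
    then show "weakly_contractible (B_under C c)"
      by (intro cube_extension_imp_weakly_contractible B_under_cube_extension assms)
  qed
qed

end
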